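(* Let $\mu>0$, $T>0$, $\nu>0$ and $\alpha>1/2$. Suppose that $\phi\in L_2(-\mu,0,V^{1+\alpha})$, $u_0\in V^\alpha$ and $f\in V^{\alpha-1}$. Then there exists a unique weak solution $u^\mu$ on $[-\mu,T]$ (in the sense defined in the context) of the 3D Navier-Stokes equations with constant delay $\mu$ with data $(\phi,u_0)$ and forcing $f$. Furthermore, $u^\mu|_{[0,T]}\in C([0,T],V^\alpha)$ and, if $0\le\gamma\le 1/2$ and $s\ge 1$, also $u^\mu|_{[0,T]}\in L_\infty(0,T,V^\alpha)\cap C^\gamma([0,T],V^{-s})$ and $\frac{du^\mu}{dt}\in L_2(0,T,V^{\alpha-1})$.
   Context: Function spaces. Fix $L>0$ and let $\mathbb{T}^3_L$ be the three-dimensional torus of side length $L$. For $s\in\mathbb{R}$, $V^s$ is the space of real $L$-periodic divergence-free vector fields (distributions) $u=\sum_{\zeta}e^{i(x,\zeta)}\hat u(\zeta)$, $\zeta\in\frac{2\pi}{L}\mathbb{Z}^3$, with $\hat u(0)=0$, $\hat u(-\zeta)=\overline{\hat u(\zeta)}$, and finite norm $\|u\|_s=\big(L^3\sum_{\zeta\neq0}|\zeta|^{2s}|\hat u(\zeta)|^2\big)^{1/2}$. $(\cdot,\cdot)$ is the scalar product of $V^0$ (the $L_2$ scalar product). The Stokes operator is $A=-\Delta$, so $\|u\|_s=\|A^{s/2}u\|_0$. $V^{-s}$ is the dual of $V^s$, and $\langle\cdot,\cdot\rangle$ denotes the duality pairing between $V^s$ and $V^{-s}$ (extending $(\cdot,\cdot)$)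 for any $s$. Nonlinearity. $b(u,v,w)=\sum_{i,j=1}^3\int_{\mathbb{T}^3_L}u_j\frac{\partial v_i}{\partial x_j}w_i\,dx$, extended by continuity from trigonometric polynomials to $V^{s_1}\times V^{s_2+1}\times V^{s_3}$ whenever either $s_i+s_j\ge0$ for $i\ne j$ and $s_1+s_2+s_3>3/2$, or $s_i+s_j>0$ for $i\neq j$ and $s_1+s_2+s_3\ge3/2$. $B:V^{s_1}\times V^{s_2+1}\to V^{-s_3}$ is defined by $\langle B(u,v),w\rangle=b(u,v,w)$. Weak solution of the delay equation. The equation is $u'(t)+\nu Au(t)+B(u(t-\mu),u(t))=f$ for $t\ge0$, with $u(t)=\phi(t)$ for $t\in[-\mu,0)$ and $u(0)=u_0$. A weak solution on $[-\mu,T]$ is a function $u^\mu\in L_2(-\mu,T,V^{1+\alpha})$ with $u^\mu(0)=u_0$, $u^\mu(t)=\phi(t)$ for (almost all) $t\in[-\mu,0)$, such that for every $v\in V^{\alpha+1}$ and every test function $\varphi\in C_0^\infty([0,T])$ (smooth, compactly supported in $(0,T)$), $$-\int_0^T\langle u^\mu(r),v\rangle\varphi'(r)\,dr+\nu\int_0^T\langle A^{1/2}u^\mu(r),A^{1/2}v\rangle\varphi(r)\,dr+\int_0^T\langle B(u^\mu(r-\mu),u^\mu(r)),v\rangle\varphi(r)\,dr=\int_0^T\langle f,v\rangle\varphi(r)\,dr.$$ The condition $u^\mu(0)=u_0$ refers to the time-continuous representative on $[0,T]$. $C^\gamma$ denotes Hölder continuous functions ($C^0=C$), and $\frac{d}{dt}$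 is the distributional derivative. *)

theory Defs
  imports "HOL-Analysis.Analysis"
begin

text \<open>
  An \<open>L\<close>-periodic vector field (or distribution) is represented by the family of its Fourier
  coefficients \<open>u k\<close>, where \<open>k :: int ^ 3\<close> stands for the frequency \<open>\<zeta> = (2 \<pi> / L) k\<close>.
\<close>

type_synonym coeffs = "int ^ 3 \<Rightarrow> complex ^ 3"

definition freq :: "real \<Rightarrow> int ^ 3 \<Rightarrow> real ^ 3" where
  "freq L k = (\<chi> i. 2 * pi / L * of_int (k $ i))"


section \<open>The scale of spaces \<open>V\<^sup>s\<close>\<close>

text \<open>
  The second conjunct says that the field is real, the third one (divided by the imaginary unit,
  each coefficient of the divergence) that it is divergence-free.
\<close>

definition Vspace :: "real \<Rightarrow> real \<Rightarrow> coeffs set" where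
  "Vspace L s = {u. u 0 = 0 \<and>
     (\<forall>k. u (- k) = (\<chi> i. cnj (u k $ i))) \<and>
     (\<forall>k. (\<Sum>i\<in>UNIV. complex_of_real (freq L k $ i) * u k $ i) = 0) \<and>
     (\<lambda>k. norm (freq L k) powr (2 * s) * (norm (u k))\<^sup>2) summable_on (- {0})}"

text \<open>
  \<open>Vnorm L s u\<close> is meaningful for \<open>u \<in> Vspace L s\<close> only: a divergent \<open>infsum\<close> is 0.
\<close>

definition Vnorm :: "real \<Rightarrow> real \<Rightarrow> coeffs \<Rightarrow> real" where
  "Vnorm L s u =
     sqrt (L ^ 3 * (\<Sum>\<^sub>\<infinity>k\<in>- {0}. norm (freq L k) powr (2 * s) * (norm (u k))\<^sup>2))"

definition Vdist :: "real \<Rightarrow> real \<Rightarrow> coeffs \<Rightarrow> coeffs \<Rightarrow> real" where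
  "Vdist L s u v = Vnorm L s (\<lambda>k. u k - v k)"

text \<open>
  The \<open>L\<^sub>2\<close> scalar product in terms of Fourier coefficients, that is, the scalar product belonging
  to the norm \<open>Vnorm L 0\<close>. The series converges absolutely for \<open>u \<in> Vspace L s\<close> and
  \<open>v \<in> Vspace L (- s)\<close>, so that the same formula is the duality pairing.
\<close>

definition pairing :: "real \<Rightarrow> coeffs \<Rightarrow> coeffs \<Rightarrow> real" where
  "pairing L u v = L ^ 3 * (\<Sum>\<^sub>\<infinity>k. Re (\<Sum>i\<in>UNIV. u k $ i * cnj (v k $ i)))"

text \<open>The power \<open>A\<^sup>r\<close> of the Stokes operator \<open>A = - \<Delta>\<close>, whose symbol is \<open>\<bar>\<zeta>\<bar>\<^sup>2\<close>.\<close>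

definition stokes_pow :: "real \<Rightarrow> real \<Rightarrow> coeffs \<Rightarrow> coeffs" where
  "stokes_pow L r u = (\<lambda>k. (norm (freq L k) powr (2 * r)) *\<^sub>R u k)"


section \<open>The nonlinearity\<close>

definition trig_polys :: "real \<Rightarrow> coeffs set" where
  "trig_polys L = {u \<in> Vspace L 0. finite {k. u k \<noteq> 0}}"

text \<open>
  The vector field of a trigonometric polynomial. The sums are real for \<open>u \<in> trig_polys L\<close>;
  \<open>Re\<close> only changes the type.
\<close>

definition field_of :: "real \<Rightarrow> coeffs \<Rightarrow> real ^ 3 \<Rightarrow> real ^ 3" where
  "field_of L u x =
     (\<chi> i. Re (\<Sum>k | u k \<noteq> 0. exp (\<i> * complex_of_real (x \<bullet> freq L k)) * u k $ i))"

definition partial_deriv :: "3 \<Rightarrow> (real ^ 3 \<Rightarrow> real) \<Rightarrow> real ^ 3 \<Rightarrow> real" where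
  "partial_deriv j g x = frechet_derivative g (at x) (axis j 1)"

definition b_trig :: "real \<Rightarrow> coeffs \<Rightarrow> coeffs \<Rightarrow> coeffs \<Rightarrow> real" where
  "b_trig L u v w =
     (\<Sum>i\<in>UNIV. \<Sum>j\<in>UNIV. LINT x|lebesgue_on (cbox 0 (\<chi> i. L)).
        field_of L u x $ j * partial_deriv j (\<lambda>y. field_of L v y $ i) x * field_of L w x $ i)"

text \<open>
  The extension by continuity of \<open>b_trig\<close> to \<open>V\<^bsup>s1\<^esup> \<times> V\<^bsup>s2+1\<^esup> \<times> V\<^bsup>s3\<^esup>\<close>. It exists if the pairwise sums
  of the exponents are nonnegative and \<open>s1 + s2 + s3 > 3/2\<close> (or if the pairwise sums are positive
  and \<open>s1 + s2 + s3 \<ge> 3/2\<close>).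
\<close>

definition b_form ::
    "real \<Rightarrow> real \<Rightarrow> real \<Rightarrow> real \<Rightarrow> coeffs \<Rightarrow> coeffs \<Rightarrow> coeffs \<Rightarrow> real" where
  "b_form L s1 s2 s3 u v w = (THE c. \<forall>p q r.
     (\<forall>n. p n \<in> trig_polys L \<and> q n \<in> trig_polys L \<and> r n \<in> trig_polys L) \<and>
     (\<lambda>n. Vdist L s1 (p n) u) \<longlonglongrightarrow> 0 \<and>
     (\<lambda>n. Vdist L (s2 + 1) (q n) v) \<longlonglongrightarrow> 0 \<and>
     (\<lambda>n. Vdist L s3 (r n) w) \<longlonglongrightarrow> 0 \<longrightarrow>
     (\<lambda>n::nat. b_trig L (p n) (q n) (r n)) \<longlonglongrightarrow> c)"

definition B_op :: "real \<Rightarrow> real \<Rightarrow> real \<Rightarrow> real \<Rightarrow> coeffs \<Rightarrow> coeffs \<Rightarrow> coeffs" where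
  "B_op L s1 s2 s3 u v = (THE z. z \<in> Vspace L (- s3) \<and>
     (\<forall>w\<in>Vspace L s3. pairing L z w = b_form L s1 s2 s3 u v w))"


section \<open>Functions of time with values in \<open>V\<^sup>s\<close>\<close>

text \<open>
  Strong (Bochner) measurability. Values on null sets are irrelevant; in particular \<open>u t\<close> has to
  belong to \<open>Vspace L s\<close> for almost all \<open>t\<close> only.
\<close>

definition strongly_measurable :: "real \<Rightarrow> real \<Rightarrow> real \<Rightarrow> real \<Rightarrow> (real \<Rightarrow> coeffs) \<Rightarrow> bool" where
  "strongly_measurable L s a b u \<longleftrightarrow>
     (\<exists>g :: nat \<Rightarrow> real \<Rightarrow> coeffs.
        (\<forall>n. simple_function (lebesgue_on {a..b}) (g n) \<and> g n ` {a..b} \<subseteq> Vspace L s) \<and>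
        (AE t in lebesgue_on {a..b}.
           u t \<in> Vspace L s \<and> (\<lambda>n. Vdist L s (g n t) (u t)) \<longlonglongrightarrow> 0))"

definition L2_V :: "real \<Rightarrow> real \<Rightarrow> real \<Rightarrow> real \<Rightarrow> (real \<Rightarrow> coeffs) set" where
  "L2_V L s a b = {u. strongly_measurable L s a b u \<and>
     integrable (lebesgue_on {a..b}) (\<lambda>t. (Vnorm L s (u t))\<^sup>2)}"

definition Linf_V :: "real \<Rightarrow> real \<Rightarrow> real \<Rightarrow> real \<Rightarrow> (real \<Rightarrow> coeffs) set" where
  "Linf_V L s a b = {u. strongly_measurable L s a b u \<and>
     (\<exists>C. AE t in lebesgue_on {a..b}. Vnorm L s (u t) \<le> C)}"

definition C_V :: "real \<Rightarrow> real \<Rightarrow> real \<Rightarrow> real \<Rightarrow> (real \<Rightarrow> coeffs) set" where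
  "C_V L s a b = {u. (\<forall>t\<in>{a..b}. u t \<in> Vspace L s) \<and>
     (\<forall>t\<in>{a..b}. ((\<lambda>r. Vdist L s (u r) (u t)) \<longlongrightarrow> 0) (at t within {a..b}))}"

text \<open>
  For \<open>\<gamma> = 0\<close> the Hoelder bound is implied by continuity on a compact interval, so that
  \<open>Hoelder_V 0 L s a b = C_V L s a b\<close>.
\<close>

definition Hoelder_V :: "real \<Rightarrow> real \<Rightarrow> real \<Rightarrow> real \<Rightarrow> real \<Rightarrow> (real \<Rightarrow> coeffs) set" where
  "Hoelder_V \<gamma> L s a b = {u \<in> C_V L s a b.
     \<exists>C. \<forall>t\<in>{a..b}. \<forall>r\<in>{a..b}. Vdist L s (u t) (u r) \<le> C * \<bar>t - r\<bar> powr \<gamma>}"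

text \<open>The support is a closed subset of a bounded interval, hence compact.\<close>

definition test_functions :: "real \<Rightarrow> (real \<Rightarrow> real) set" where
  "test_functions T = {\<psi>. (\<forall>n x. ((deriv ^^ n) \<psi>) differentiable (at x)) \<and>
     closure {x. \<psi> x \<noteq> 0} \<subseteq> {0<..<T}}"

text \<open>
  \<open>g\<close> is the distributional derivative of \<open>u\<close> on \<open>(0, T)\<close>, as a distribution with values in \<open>V\<^sup>s\<close>;
  the \<open>V\<^sup>s\<close>-valued identity \<open>- \<integral> u \<psi>' = \<integral> g \<psi>\<close> is tested with the elements of the dual \<open>V\<^bsup>-s\<^esup>\<close>.
\<close>

definition has_distr_deriv ::
    "real \<Rightarrow> real \<Rightarrow> real \<Rightarrow> (real \<Rightarrow> coeffs) \<Rightarrow> (real \<Rightarrow> coeffs) \<Rightarrow> bool" where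
  "has_distr_deriv L s T u g \<longleftrightarrow>
     (\<forall>v\<in>Vspace L (- s). \<forall>\<psi>\<in>test_functions T.
        - (LINT r|lebesgue_on {0..T}. pairing L (u r) v * deriv \<psi> r) =
        (LINT r|lebesgue_on {0..T}. pairing L (g r) v * \<psi> r))"


section \<open>Weak solutions of the delay equation\<close>

text \<open>
  The initial condition is imposed on the time-continuous representative \<open>u'\<close> of \<open>u\<close> on \<open>[0, T]\<close>;
  continuity is only required in some space of the scale. All three
  arguments of \<open>b\<close> are in \<open>V\<^bsup>1+\<alpha>\<^esup>\<close>, whence the exponents \<open>1 + \<alpha>\<close>, \<open>\<alpha>\<close>, \<open>1 + \<alpha>\<close> of \<open>B_op\<close>.
\<close>

definition weak_solution ::
    "real \<Rightarrow> real \<Rightarrow> real \<Rightarrow> real \<Rightarrow> real \<Rightarrow> (real \<Rightarrow> coeffs) \<Rightarrow> coeffs \<Rightarrow> coeffs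
      \<Rightarrow> (real \<Rightarrow> coeffs) \<Rightarrow> bool" where
  "weak_solution L \<nu> \<alpha> \<mu> T \<phi> u0 f u \<longleftrightarrow>
     u \<in> L2_V L (1 + \<alpha>) (- \<mu>) T \<and>
     (\<exists>u' \<sigma>. u' \<in> C_V L \<sigma> 0 T \<and> (AE t in lebesgue_on {0..T}. u' t = u t) \<and> u' 0 = u0) \<and>
     (AE t in lebesgue_on {- \<mu>..<0}. u t = \<phi> t) \<and>
     (\<forall>v\<in>Vspace L (\<alpha> + 1). \<forall>\<psi>\<in>test_functions T.
        - (LINT r|lebesgue_on {0..T}. pairing L (u r) v * deriv \<psi> r)
        + \<nu> * (LINT r|lebesgue_on {0..T}.
                 pairing L (stokes_pow L (1/2) (u r)) (stokes_pow L (1/2) v) * \<psi> r)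
        + (LINT r|lebesgue_on {0..T}.
             pairing L (B_op L (1 + \<alpha>) \<alpha> (1 + \<alpha>) (u (r - \<mu>)) (u r)) v * \<psi> r)
        = (LINT r|lebesgue_on {0..T}. pairing L f v * \<psi> r))"

end

(*
  In Fourier space the bilinear term satisfies |B(u,v)|_(s-1) <= C |u|_(1+a) |v|_s for 0 <= s <= 1+a,
  by Young's inequality on the frequency lattice, since 1+a > 3/2. On [0,mu] the delayed argument
  is known, so the equation is linear with a given drift w in L_2(V^(1+a)); the energy inequality
  makes the Duhamel map a contraction in the norm weighted by exp(-K int |w|^2), and the solution
  is the drift on the next interval of length mu.
  For uniqueness, the weak formulation tested against single Fourier modes gives, by du Bois-Reymond,
  an integral equation for each mode; the difference of two solutions with the same drift lies in V^a
  by a weighted Cauchy-Schwarz estimate, so it is killed by the same contraction, delay interval by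
  delay interval.
*)
theory Submission
  imports Defs "HOL-Analysis.Analysis"
begin

section \<open>Sums over the frequency lattice\<close>

text \<open>Norms enter as squared sums \<open>Esq\<close> in the extended nonnegative reals, of
  representatives whose modes are Borel in time. Exchanging time, modes and limits is then Tonelli,
  Fatou or dominated convergence, and an estimate can be stated before any norm is known to be
  finite. The derivative lost by B is the one that the Stokes operator returns: the energy
  inequality turns a force in L_2(V^(\<alpha>-1)) into a bound in V^\<alpha> uniform in time. At s =
  \<alpha> the drift costs the integral of |w|^2 |d|_\<alpha>^2, which the exponential weight makes
  small. The obstacle lies in uniqueness. The difference d of two weak solutions is only known to be
  in L_2(V^(1+\<alpha>)), whereas controlling B(w,d) in L_2(V^(\<alpha>-1)) already asks for the
  supremum of |d|_\<alpha>. The estimate at s = 1+\<alpha> breaks the circle: it puts B(w,d) into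
  V^\<alpha>, merely integrable in time, and the weight 1 + |w|^2 splits it into two square
  integrable factors. This makes the supremum finite, and the contraction then makes it 0.\<close>

lemma summable_on_iff_integrable:
  fixes g :: "'a \<Rightarrow> real"
  shows "g summable_on A \<longleftrightarrow> integrable (count_space A) g"
  by (metis Infinite_Set_Sum.abs_summable_on_def abs_summable_equivalent
      summable_on_iff_abs_summable_on_real)

text \<open>The conventions agree: a divergent series and the integral of a non-integrable function
  are both 0. So \<open>Vnorm\<close> and \<open>pairing\<close> turn into integrals over the
  counting measure without side conditions.\<close>

lemma infsum_eq_integral:
  fixes g :: "'a \<Rightarrow> real"
  shows "infsum g A = (LINT k|count_space A. g k)"
proof (cases "g summable_on A")
  case True
  then have "Infinite_Set_Sum.abs_summable_on g A"
    by (simp add: Infinite_Set_Sum.abs_summable_on_def summable_on_iff_integrable)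
  then show ?thesis
    by (metis infsetsum_def infsetsum_infsum)
next
  case False
  then show ?thesis
    by (metis infsum_not_exists not_integrable_integral_eq summable_on_iff_integrable)
qed

text \<open>Over a countable index set, joint measurability is measurability of every section. This
  is why time-dependent fields are controlled below through their single modes.\<close>

lemma measurable_pair_count_space:
  fixes f :: "'i::countable \<Rightarrow> 'a \<Rightarrow> 'b"
  assumes "\<And>k. f k \<in> measurable M N"
  shows "(\<lambda>(t, k). f k t) \<in> measurable (M \<Otimes>\<^sub>M count_space UNIV) N"
proof -
  have "(\<lambda>(k, t). f k t) \<in> measurable (count_space UNIV \<Otimes>\<^sub>M M) N"
    using assms by (intro measurable_pair_measure_countable1) auto
  then show ?thesis
    by (auto dest: measurable_pair_swap simp: case_prod_beta')
qed

lemma measurable_nn_sum [measurable (raw)]: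
  fixes f :: "'i::countable \<Rightarrow> 'a \<Rightarrow> ennreal"
  assumes "\<And>k. f k \<in> borel_measurable M"
  shows "(\<lambda>t. \<integral>\<^sup>+k. f k t \<partial>count_space UNIV) \<in> borel_measurable M"
proof -
  interpret sigma_finite_measure "count_space (UNIV :: 'i set)"
    by (rule sigma_finite_measure_count_space)
  show ?thesis
    by (rule borel_measurable_nn_integral[OF measurable_pair_count_space]) (rule assms)
qed

lemma nn_sum_swap:
  fixes f :: "'i::countable \<Rightarrow> 'a \<Rightarrow> ennreal"
  assumes "\<And>k. f k \<in> borel_measurable M"
  shows "(\<integral>\<^sup>+t. \<integral>\<^sup>+k. f k t \<partial>count_space UNIV \<partial>M) = (\<integral>\<^sup>+k. \<integral>\<^sup>+t. f k t \<partial>M \<partial>count_space UNIV)"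
  using nn_integral_count_space_nn_integral[of UNIV f M] assms by auto

text \<open>Young's inequality for the convolution of l_1 with l_2. Splitting f into two square
  roots, the Cauchy-Schwarz inequality leaves a sum of f times squares of g; after summing over m
  first, translation invariance of the counting measure removes the shift.\<close>

lemma young_convolution:
  fixes f g :: "'a::{countable, ab_group_add} \<Rightarrow> real"
  assumes f: "\<And>k. f k \<ge> 0" and g: "\<And>k. g k \<ge> 0"
  shows "(\<integral>\<^sup>+m. (\<integral>\<^sup>+k. ennreal (f k * g (m - k)) \<partial>count_space UNIV)\<^sup>2 \<partial>count_space UNIV)
    \<le> (\<integral>\<^sup>+k. ennreal (f k) \<partial>count_space UNIV)\<^sup>2 * (\<integral>\<^sup>+k. ennreal ((g k)\<^sup>2) \<partial>count_space UNIV)"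
proof -
  let ?C = "count_space (UNIV :: 'a set)"
  let ?F = "\<integral>\<^sup>+k. ennreal (f k) \<partial>?C"
  have shift: "(\<integral>\<^sup>+m. ennreal ((g (m - k))\<^sup>2) \<partial>?C) = (\<integral>\<^sup>+k. ennreal ((g k)\<^sup>2) \<partial>?C)" for k
    by (rule nn_integral_bij_count_space[where f = "\<lambda>k. ennreal ((g k)\<^sup>2)" and g = "\<lambda>m. m - k"])
      (rule bij_betwI[where g = "\<lambda>m. m + k"], auto)
  have CS: "(\<integral>\<^sup>+k. ennreal (f k * g (m - k)) \<partial>?C)\<^sup>2 \<le> ?F * (\<integral>\<^sup>+k. ennreal (f k * (g (m - k))\<^sup>2) \<partial>?C)" for m
  proof -
    have "(\<integral>\<^sup>+k. ennreal (sqrt (f k)) * ennreal (sqrt (f k) * g (m - k)) \<partial>?C)\<^sup>2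
        \<le> (\<integral>\<^sup>+k. (ennreal (sqrt (f k)))\<^sup>2 \<partial>?C) * (\<integral>\<^sup>+k. (ennreal (sqrt (f k) * g (m - k)))\<^sup>2 \<partial>?C)"
      by (rule Cauchy_Schwarz_nn_integral) auto
    moreover have "ennreal (sqrt (f k)) * ennreal (sqrt (f k) * g (m - k)) = ennreal (f k * g (m - k))" for k
      using f g by (simp flip: ennreal_mult mult.assoc)
    moreover have "(ennreal (sqrt (f k)))\<^sup>2 = ennreal (f k)"
      "(ennreal (sqrt (f k) * g (m - k)))\<^sup>2 = ennreal (f k * (g (m - k))\<^sup>2)" for k
      using f g by (simp_all add: ennreal_power power_mult_distrib)
    ultimately show ?thesis by simp
  qed
  have "(\<integral>\<^sup>+m. (\<integral>\<^sup>+k. ennreal (f k * g (m - k)) \<partial>?C)\<^sup>2 \<partial>?C)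
      \<le> (\<integral>\<^sup>+m. ?F * (\<integral>\<^sup>+k. ennreal (f k * (g (m - k))\<^sup>2) \<partial>?C) \<partial>?C)"
    by (intro nn_integral_mono CS)
  also have "\<dots> = ?F * (\<integral>\<^sup>+m. \<integral>\<^sup>+k. ennreal (f k * (g (m - k))\<^sup>2) \<partial>?C \<partial>?C)"
    by (rule nn_integral_cmult) simp
  also have "\<dots> = ?F * (\<integral>\<^sup>+k. \<integral>\<^sup>+m. ennreal (f k * (g (m - k))\<^sup>2) \<partial>?C \<partial>?C)"
    by (subst nn_sum_swap) auto
  also have "\<dots> = ?F * (\<integral>\<^sup>+k. ennreal (f k) * (\<integral>\<^sup>+k. ennreal ((g k)\<^sup>2) \<partial>?C) \<partial>?C)"
    using f by (simp add: ennreal_mult nn_integral_cmult shift)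
  also have "\<dots> = ?F\<^sup>2 * (\<integral>\<^sup>+k. ennreal ((g k)\<^sup>2) \<partial>?C)"
    by (simp add: nn_integral_multc power2_eq_square mult.assoc)
  finally show ?thesis .
qed

section \<open>Frequencies and their powers as weights\<close>

lemma freq_simps [simp]:
  "freq L 0 = 0" "freq L (- k) = - freq L k" "freq L (k + l) = freq L k + freq L l"
  "freq L (k - l) = freq L k - freq L l"
  by (simp_all add: freq_def vec_eq_iff algebra_simps)

lemma freq_ge_component:
  assumes "L > 0"
  shows "norm (freq L k) \<ge> 2 * pi / L * \<bar>real_of_int (k $ i)\<bar>"
proof -
  have "2 * pi / L * \<bar>real_of_int (k $ i)\<bar> = \<bar>freq L k $ i\<bar>"
    using assms by (simp add: freq_def abs_mult)
  then show ?thesis using component_le_norm_cart[of "freq L k" i] by simp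
qed

lemma freq_ge:
  assumes "L > 0" "k \<noteq> 0"
  shows "norm (freq L k) \<ge> 2 * pi / L"
proof -
  obtain i where "k $ i \<noteq> 0" using assms by (auto simp: vec_eq_iff)
  then have "\<bar>real_of_int (k $ i)\<bar> \<ge> 1" by simp
  then have "2 * pi / L * 1 \<le> 2 * pi / L * \<bar>real_of_int (k $ i)\<bar>"
    using assms by (intro mult_left_mono) auto
  then show ?thesis using freq_ge_component[OF assms(1), of k i] by simp
qed

lemma freq_norm_pos:
  assumes "L > 0" "k \<noteq> 0"
  shows "norm (freq L k) > 0"
proof -
  have "2 * pi / L > 0" using assms by simp
  then show ?thesis using freq_ge[OF assms] by linarith
qed

lemma freq_eq_0_iff: "L > 0 \<Longrightarrow> freq L k = 0 \<longleftrightarrow> k = 0"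
  using freq_norm_pos[of L k] by auto

text \<open>The symbol of A^(s/2). Since 0 powr s is 0 for every s, the weight vanishes at frequency
  0 even for s \<le> 0; the mean mode thus drops out of all sums, and the exponents still add in
  products.\<close>

definition wt :: "real \<Rightarrow> real \<Rightarrow> int ^ 3 \<Rightarrow> real" where
  "wt L s k = norm (freq L k) powr s"

lemma wt_nonneg [simp]: "wt L s k \<ge> 0"
  by (simp add: wt_def)

lemma wt_0 [simp]: "wt L s 0 = 0"
  by (simp add: wt_def)

lemma wt_minus [simp]: "wt L s (- k) = wt L s k"
  by (simp add: wt_def)

lemma wt_pos: "L > 0 \<Longrightarrow> k \<noteq> 0 \<Longrightarrow> wt L s k > 0"
  using freq_norm_pos[of L k] by (simp add: wt_def)

lemma wt_mult: "wt L s k * wt L t k = wt L (s + t) k"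
  by (simp add: wt_def powr_add)

lemma wt_sq: "(wt L s k)\<^sup>2 = wt L (2 * s) k"
  by (simp add: power2_eq_square wt_mult)

lemma wt_1 [simp]: "wt L 1 k = norm (freq L k)"
  by (simp add: wt_def)

lemma wt_zero_exp: "L > 0 \<Longrightarrow> k \<noteq> 0 \<Longrightarrow> wt L 0 k = 1"
  using freq_norm_pos[of L k] by (simp add: wt_def)

text \<open>The constant of the embedding of V^t into V^s for s \<le> t: the quotient of the two
  weights, evaluated at the smallest nonzero frequency modulus 2 \<pi> / L, where it is
  largest.\<close>

definition wt_const :: "real \<Rightarrow> real \<Rightarrow> real \<Rightarrow> real" where
  "wt_const L s t = (L / (2 * pi)) powr (t - s)"

lemma wt_mono:
  assumes "L > 0" "s \<le> t"
  shows "wt L s k \<le> wt_const L s t * wt L t k"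
proof (cases "k = 0")
  case False
  have "wt L s k = wt L (s - t) k * wt L t k" by (simp add: wt_mult)
  also have "wt L (s - t) k \<le> (2 * pi / L) powr (s - t)"
    unfolding wt_def using assms freq_ge[OF assms(1) False] by (intro powr_mono2') auto
  also have "(2 * pi / L) powr (s - t) = wt_const L s t"
    using assms unfolding wt_const_def
    by (metis (no_types, lifting) inverse_divide inverse_powr minus_diff_eq powr_minus)
  finally show ?thesis by (simp add: mult_right_mono)
qed simp

text \<open>The maximum with 1 matters at n = 0: there a plain power would have the value 0 and
  could not bound the factor of a frequency with a vanishing component.\<close>

lemma powr_int_summable:
  assumes "p > 1"
  shows "integrable (count_space UNIV) (\<lambda>n::int. (max 1 \<bar>real_of_int n\<bar>) powr (- p))" (is "integrable _ ?h")
proof -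
  have "summable (\<lambda>n. real n powr (- p))"
    using assms by (simp add: summable_real_powr_iff)
  then have s: "summable (\<lambda>n. real (Suc n) powr (- p))"
    by (subst summable_Suc_iff) 
  have pos: "(\<lambda>n::nat. ?h (int n)) summable_on UNIV"
  proof (rule summable_nonneg_imp_summable_on)
    have "(\<lambda>n. ?h (int (Suc n))) = (\<lambda>n. real (Suc n) powr (- p))" by (auto simp: max_def)
    then show "summable (\<lambda>n::nat. ?h (int n))" using s summable_Suc_iff[of "\<lambda>n. ?h (int n)"] by simp
  qed simp
  have U: "UNIV = range int \<union> range (\<lambda>n. - int n)"
    using int_cases2 by blast
  have "?h summable_on range int"
    using pos by (subst summable_on_reindex) (auto simp: inj_def o_def)
  moreover have "?h summable_on range (\<lambda>n. - int n)"
    using pos by (subst summable_on_reindex) (auto simp: inj_def o_def)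
  ultimately have "?h summable_on UNIV"
    unfolding U by (rule summable_on_union)
  then show ?thesis by (simp add: summable_on_iff_integrable)
qed

text \<open>The modulus of a frequency dominates each of its three components, so |\<zeta>|^(-2b) is
  at most a constant times a product of three one-dimensional powers with exponent 2b/3. The
  condition on b says that this exponent exceeds 1.\<close>

lemma wt_summable:
  assumes L: "L > 0" and b: "2 * b > 3"
  shows "(\<integral>\<^sup>+k. ennreal ((wt L (- b) k)\<^sup>2) \<partial>count_space UNIV) < \<infinity>"
proof -
  define p where "p = 2 * b / 3"
  define h where "h = (\<lambda>n::int. (max 1 \<bar>real_of_int n\<bar>) powr (- p))"
  have p: "p > 1" using b by (simp add: p_def)
  have "Infinite_Set_Sum.abs_summable_on (\<lambda>g. \<Prod>i\<in>UNIV. h (g i)) (PiE (UNIV :: 3 set) (\<lambda>_. UNIV))"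
    using powr_int_summable[OF p]
    by (intro abs_summable_on_prod_PiE) (auto simp: h_def Infinite_Set_Sum.abs_summable_on_def)
  then have i1: "integrable (count_space UNIV) (\<lambda>g :: 3 \<Rightarrow> int. \<Prod>i\<in>UNIV. h (g i))"
    by (simp add: Infinite_Set_Sum.abs_summable_on_def)
  have "bij (vec_nth :: int ^ 3 \<Rightarrow> _)"
    by (rule bij_betwI[where g = vec_lambda]) auto
  from integrable_bij_count_space[OF this, of "\<lambda>g. \<Prod>i\<in>UNIV. h (g i)"] i1
  have i2: "integrable (count_space UNIV) (\<lambda>k :: int ^ 3. \<Prod>i\<in>UNIV. h (k $ i))"
    by simp
  have le: "(wt L (- b) k)\<^sup>2 \<le> (2 * pi / L) powr (- (2 * b)) * (\<Prod>i\<in>UNIV. h (k $ i))" for k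
  proof (cases "k = 0")
    case True
    then show ?thesis by (auto intro!: mult_nonneg_nonneg prod_nonneg simp: h_def)
  next
    case False
    define x where "x = norm (freq L k) / (2 * pi / L)"
    have x1: "x \<ge> 1" using freq_ge[OF L False] L by (simp add: x_def field_simps)
    have xi: "x \<ge> \<bar>real_of_int (k $ i)\<bar>" for i
      using freq_ge_component[OF L, of k i] L by (simp add: x_def field_simps)
    have "x powr (- p) \<le> h (k $ i)" for i
      unfolding h_def using p x1 xi[of i] by (intro powr_mono2') auto
    then have "(\<Prod>i\<in>(UNIV :: 3 set). x powr (- p)) \<le> (\<Prod>i\<in>UNIV. h (k $ i))"
      by (intro prod_mono) auto
    then have "(x powr (- p)) ^ 3 \<le> (\<Prod>i\<in>UNIV. h (k $ i))" by simp
    moreover have "(x powr (- p)) ^ 3 = x powr (- (2 * b))"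
      using x1 by (simp add: p_def power3_eq_cube flip: powr_add)
    ultimately have "(2 * pi / L) powr (- (2 * b)) * x powr (- (2 * b))
        \<le> (2 * pi / L) powr (- (2 * b)) * (\<Prod>i\<in>UNIV. h (k $ i))"
      by (intro mult_left_mono) auto
    moreover have "(2 * pi / L) powr (- (2 * b)) * x powr (- (2 * b)) = (2 * pi / L * x) powr (- (2 * b))"
      using L x1 by (subst powr_mult) auto
    moreover have "2 * pi / L * x = norm (freq L k)" using L by (simp add: x_def)
    ultimately show ?thesis by (simp add: wt_sq) (simp add: wt_def)
  qed
  have "(\<integral>\<^sup>+k. ennreal ((wt L (- b) k)\<^sup>2) \<partial>count_space UNIV)
      \<le> (\<integral>\<^sup>+k. ennreal ((2 * pi / L) powr (- (2 * b)) * (\<Prod>i\<in>UNIV. h (k $ i))) \<partial>count_space (UNIV :: (int ^ 3) set))"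
    by (intro nn_integral_mono ennreal_leI le)
  also have "\<dots> < \<infinity>"
    using i2
    by (auto simp: integrable_iff_bounded abs_mult prod_nonneg h_def abs_of_nonneg ennreal_mult
        nn_integral_cmult ennreal_mult_less_top)
  finally show ?thesis .
qed

section \<open>Sobolev norms as sums in the extended nonnegative reals\<close>

text \<open>The squared norm of V^s without the volume factor \<open>L ^ 3\<close>. It has the value
  infinity for fields outside the space, where \<open>Vnorm\<close> would be 0, so inequalities
  between values of \<open>Esq\<close> also carry the information about membership.\<close>

definition Esq :: "real \<Rightarrow> real \<Rightarrow> coeffs \<Rightarrow> ennreal" where
  "Esq L s u = (\<integral>\<^sup>+k. ennreal ((wt L s k * norm (u k))\<^sup>2) \<partial>count_space UNIV)"

text \<open>Membership in \<open>Vspace\<close> is split: these algebraic constraints can be kept at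
  every time by a choice of representative, whereas finiteness of a norm is available for almost
  every time only.\<close>

definition solen :: "real \<Rightarrow> coeffs \<Rightarrow> bool" where
  "solen L u \<longleftrightarrow> u 0 = 0 \<and> (\<forall>k. u (- k) = (\<chi> i. cnj (u k $ i))) \<and>
     (\<forall>k. (\<Sum>i\<in>UNIV. complex_of_real (freq L k $ i) * u k $ i) = 0)"

lemma Esq_integral:
  "integrable (count_space UNIV) (\<lambda>k. (wt L s k * norm (u k))\<^sup>2) \<longleftrightarrow> Esq L s u < \<infinity>"
  "(LINT k|count_space UNIV. (wt L s k * norm (u k))\<^sup>2) = enn2real (Esq L s u)"
  by (simp_all add: integrable_iff_bounded Esq_def abs_mult power2_abs integral_eq_nn_integral)

lemma weight_eq:
  "norm (freq L k) powr (2 * s) * (norm (u k))\<^sup>2 = (wt L s k * norm (u k))\<^sup>2"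
  by (simp add: power_mult_distrib wt_sq) (simp add: wt_def)

lemma Vspace_iff: "u \<in> Vspace L s \<longleftrightarrow> solen L u \<and> Esq L s u < \<infinity>"
proof -
  have "(\<lambda>k. norm (freq L k) powr (2 * s) * (norm (u k))\<^sup>2) summable_on (- {0})
      \<longleftrightarrow> (\<lambda>k. (wt L s k * norm (u k))\<^sup>2) summable_on UNIV"
    by (rule summable_on_cong_neutral) (auto simp: weight_eq)
  then show ?thesis
    unfolding Vspace_def solen_def by (simp add: summable_on_iff_integrable Esq_integral)
qed

lemma Vnorm_eq: "Vnorm L s u = sqrt (L ^ 3 * enn2real (Esq L s u))"
proof -
  have "(\<Sum>\<^sub>\<infinity>k\<in>- {0}. norm (freq L k) powr (2 * s) * (norm (u k))\<^sup>2)
      = (\<Sum>\<^sub>\<infinity>k. (wt L s k * norm (u k))\<^sup>2)"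
    by (rule infsum_cong_neutral) (auto simp: weight_eq)
  then show ?thesis
    unfolding Vnorm_def by (simp add: infsum_eq_integral Esq_integral)
qed

lemma pairing_eq: "pairing L u v = L ^ 3 * (LINT k|count_space UNIV. u k \<bullet> v k)"
proof -
  have "Re (\<Sum>i\<in>UNIV. u k $ i * cnj (v k $ i)) = u k \<bullet> v k" for k
    by (simp add: inner_vec_def inner_complex_def)
  then show ?thesis by (simp add: pairing_def infsum_eq_integral)
qed

lemma Esq_measurable [measurable (raw)]:
  assumes "\<And>k. (\<lambda>t. u t k) \<in> borel_measurable M"
  shows "(\<lambda>t. Esq L s (u t)) \<in> borel_measurable M"
  unfolding Esq_def using assms by (intro measurable_nn_sum) measurable

lemma Esq_cong_norm: "(\<And>k. norm (u k) = norm (v k)) \<Longrightarrow> Esq L s u = Esq L s v"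
  by (simp add: Esq_def)

lemma Esq_zero [simp]: "Esq L s (\<lambda>k. 0) = 0"
  by (simp add: Esq_def)

text \<open>The factor 2 is the price for working with squares: it replaces the triangle inequality
  throughout.\<close>

lemma Esq_add: "Esq L s (\<lambda>k. u k + v k) \<le> 2 * Esq L s u + 2 * Esq L s v"
proof -
  have *: "(wt L s k * norm (u k + v k))\<^sup>2 \<le> 2 * (wt L s k * norm (u k))\<^sup>2 + 2 * (wt L s k * norm (v k))\<^sup>2" for k
  proof -
    have "(wt L s k * norm (u k + v k))\<^sup>2 \<le> (wt L s k * norm (u k) + wt L s k * norm (v k))\<^sup>2"
      by (intro power_mono) (auto simp flip: distrib_left intro!: mult_left_mono norm_triangle_ineq)
    also have "\<dots> \<le> 2 * (wt L s k * norm (u k))\<^sup>2 + 2 * (wt L s k * norm (v k))\<^sup>2"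
      using sum_squares_bound[of "wt L s k * norm (u k)" "wt L s k * norm (v k)"]
      by (simp add: power2_sum)
    finally show ?thesis .
  qed
  have "Esq L s (\<lambda>k. u k + v k) \<le> (\<integral>\<^sup>+k. 2 * ennreal ((wt L s k * norm (u k))\<^sup>2) + 2 * ennreal ((wt L s k * norm (v k))\<^sup>2) \<partial>count_space UNIV)"
    unfolding Esq_def
  proof (intro nn_integral_mono)
    fix k
    show "ennreal ((wt L s k * norm (u k + v k))\<^sup>2) \<le> 2 * ennreal ((wt L s k * norm (u k))\<^sup>2) + 2 * ennreal ((wt L s k * norm (v k))\<^sup>2)"
      using ennreal_leI[OF *[of k]] by (simp add: ennreal_plus ennreal_mult)
  qed
  also have "\<dots> = 2 * Esq L s u + 2 * Esq L s v"
    unfolding Esq_def by (simp add: nn_integral_add nn_integral_cmult)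
  finally show ?thesis .
qed

lemma Esq_diff: "Esq L s (\<lambda>k. u k - v k) \<le> 2 * Esq L s u + 2 * Esq L s v"
  using Esq_add[of L s u "\<lambda>k. - v k"] Esq_cong_norm[of "\<lambda>k. - v k" v] by simp

lemma Esq_commute: "Esq L s (\<lambda>k. u k - v k) = Esq L s (\<lambda>k. v k - u k)"
  by (rule Esq_cong_norm) (rule norm_minus_commute)

lemma Esq_scaleR: "Esq L s (\<lambda>k. c *\<^sub>R u k) = ennreal (c\<^sup>2) * Esq L s u"
  unfolding Esq_def
  by (subst nn_integral_cmult[symmetric]) (simp_all add: power_mult_distrib ac_simps flip: ennreal_mult)

lemma Esq_mono_exp:
  assumes "L > 0" "s \<le> t"
  shows "Esq L s u \<le> ennreal ((wt_const L s t)\<^sup>2) * Esq L t u"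
  unfolding Esq_def
proof (subst nn_integral_cmult[symmetric], simp, intro nn_integral_mono)
  fix k
  have "(wt L s k * norm (u k))\<^sup>2 \<le> (wt_const L s t * wt L t k * norm (u k))\<^sup>2"
    by (intro power_mono mult_right_mono wt_mono assms) auto
  then show "ennreal ((wt L s k * norm (u k))\<^sup>2) \<le> ennreal ((wt_const L s t)\<^sup>2) * ennreal ((wt L t k * norm (u k))\<^sup>2)"
    by (simp add: power_mult_distrib ac_simps flip: ennreal_mult)
qed

lemma Esq_finite_mono: "L > 0 \<Longrightarrow> s \<le> t \<Longrightarrow> Esq L t u < \<infinity> \<Longrightarrow> Esq L s u < \<infinity>"
  using Esq_mono_exp[of L s t u] by (simp add: le_less_trans ennreal_mult_less_top)

lemma Vspace_mono: "L > 0 \<Longrightarrow> s \<le> t \<Longrightarrow> u \<in> Vspace L t \<Longrightarrow> u \<in> Vspace L s"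
  by (auto simp: Vspace_iff dest: Esq_finite_mono)

lemma Esq_mode: "ennreal ((wt L s k * norm (u k))\<^sup>2) \<le> Esq L s u"
  unfolding Esq_def
  by (rule nn_integral_ge_point[where p = "\<lambda>k. ennreal ((wt L s k * norm (u k))\<^sup>2)"]) simp

lemma Esq_eq_0_iff:
  assumes "L > 0" "u 0 = 0"
  shows "Esq L s u = 0 \<longleftrightarrow> u = (\<lambda>k. 0)"
proof
  assume *: "Esq L s u = 0"
  show "u = (\<lambda>k. 0)"
  proof
    fix k
    show "u k = 0"
    proof (cases "k = 0")
      case False
      have "ennreal ((wt L s k * norm (u k))\<^sup>2) = 0" using Esq_mode[of L s k u] * by simp
      then show ?thesis using wt_pos[OF assms(1) False, of s] by (simp add: ennreal_eq_0_iff)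
    qed (use assms in simp)
  qed
qed simp

text \<open>The duality of V^s and V^(-s). The two opposite weights multiply to 1 at every frequency
  except 0, where both vanish; the condition on \<open>u 0\<close> closes this gap.\<close>

lemma sum_norm_mult_sq_le:
  assumes "L > 0" "u 0 = 0"
  shows "(\<integral>\<^sup>+k. ennreal (norm (u k) * norm (v k)) \<partial>count_space UNIV)\<^sup>2 \<le> Esq L s u * Esq L (- s) v"
proof -
  have "ennreal (norm (u k) * norm (v k)) = ennreal (wt L s k * norm (u k)) * ennreal (wt L (- s) k * norm (v k))" for k
  proof (cases "k = 0")
    case False
    have "wt L s k * wt L (- s) k = 1" using assms False by (simp add: wt_mult wt_zero_exp)
    then have "norm (u k) * norm (v k) = (wt L s k * norm (u k)) * (wt L (- s) k * norm (v k))"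
      by (metis (no_types, opaque_lifting) mult.assoc mult.commute mult_1)
    then show ?thesis by (simp flip: ennreal_mult)
  qed (use assms in simp)
  then show ?thesis
    using Cauchy_Schwarz_nn_integral[of "\<lambda>k. ennreal (wt L s k * norm (u k))" "count_space UNIV" "\<lambda>k. ennreal (wt L (- s) k * norm (v k))"]
    by (simp add: Esq_def ennreal_power)
qed

lemma sum_norm_mult_finite:
  assumes "L > 0" "u 0 = 0" "Esq L s u < \<infinity>" "Esq L (- s) v < \<infinity>"
  shows "(\<integral>\<^sup>+k. ennreal (norm (u k) * norm (v k)) \<partial>count_space UNIV) < \<infinity>"
proof -
  have "Esq L s u * Esq L (- s) v < \<infinity>"
    using assms(3,4) by (simp add: ennreal_mult_less_top)
  then have "(\<integral>\<^sup>+k. ennreal (norm (u k) * norm (v k)) \<partial>count_space UNIV)\<^sup>2 < \<infinity>"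
    by (rule le_less_trans[OF sum_norm_mult_sq_le[where u = u and s = s, OF assms(1,2)]])
  then show ?thesis
    by (cases "\<integral>\<^sup>+k. ennreal (norm (u k) * norm (v k)) \<partial>count_space UNIV") auto
qed

lemma integrable_pairing:
  assumes "L > 0" "u 0 = 0" "Esq L s u < \<infinity>" "Esq L (- s) v < \<infinity>"
  shows "integrable (count_space UNIV) (\<lambda>k. u k \<bullet> v k)"
proof (rule integrableI_bounded)
  have "(\<integral>\<^sup>+k. ennreal (norm (u k \<bullet> v k)) \<partial>count_space UNIV) \<le> (\<integral>\<^sup>+k. ennreal (norm (u k) * norm (v k)) \<partial>count_space UNIV)"
    by (intro nn_integral_mono ennreal_leI) (simp add: Cauchy_Schwarz_ineq2)
  then show "(\<integral>\<^sup>+k. ennreal (norm (u k \<bullet> v k)) \<partial>count_space UNIV) < \<infinity>"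
    using sum_norm_mult_finite[OF assms] by (rule le_less_trans)
qed simp

lemma pairing_sq_le:
  assumes "L > 0" "u 0 = 0"
  shows "ennreal ((pairing L u v)\<^sup>2) \<le> ennreal ((L ^ 3)\<^sup>2) * (Esq L s u * Esq L (- s) v)"
proof -
  have "ennreal \<bar>LINT k|count_space UNIV. u k \<bullet> v k\<bar> \<le> (\<integral>\<^sup>+k. ennreal (norm (u k) * norm (v k)) \<partial>count_space UNIV)"
  proof (cases "integrable (count_space UNIV) (\<lambda>k. u k \<bullet> v k)")
    case True
    then have "ennreal \<bar>LINT k|count_space UNIV. u k \<bullet> v k\<bar> \<le> (\<integral>\<^sup>+k. ennreal (norm (u k \<bullet> v k)) \<partial>count_space UNIV)"
      using integral_norm_bound_ennreal by fastforce
    also have "\<dots> \<le> (\<integral>\<^sup>+k. ennreal (norm (u k) * norm (v k)) \<partial>count_space UNIV)"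
      by (intro nn_integral_mono ennreal_leI) (simp add: Cauchy_Schwarz_ineq2)
    finally show ?thesis .
  qed (simp add: not_integrable_integral_eq)
  then have "(ennreal \<bar>LINT k|count_space UNIV. u k \<bullet> v k\<bar>)\<^sup>2 \<le> (\<integral>\<^sup>+k. ennreal (norm (u k) * norm (v k)) \<partial>count_space UNIV)\<^sup>2"
    by (intro power_mono) auto
  also have "\<dots> \<le> Esq L s u * Esq L (- s) v"
    by (rule sum_norm_mult_sq_le) fact+
  finally have "ennreal ((LINT k|count_space UNIV. u k \<bullet> v k)\<^sup>2) \<le> Esq L s u * Esq L (- s) v"
    by (simp add: ennreal_power)
  then have "ennreal ((L ^ 3)\<^sup>2) * ennreal ((LINT k|count_space UNIV. u k \<bullet> v k)\<^sup>2) \<le> ennreal ((L ^ 3)\<^sup>2) * (Esq L s u * Esq L (- s) v)"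
    by (intro mult_left_mono) auto
  then show ?thesis by (simp add: pairing_eq power_mult_distrib flip: ennreal_mult)
qed


section \<open>The nonlinearity in Fourier space\<close>

text \<open>Bilinear rather than Hermitian. At \<open>z = freq L k\<close> it is the Fourier
  coefficient of the divergence up to the imaginary unit.\<close>

definition zdot :: "real ^ 3 \<Rightarrow> complex ^ 3 \<Rightarrow> complex" where
  "zdot z a = (\<Sum>i\<in>UNIV. complex_of_real (z $ i) * a $ i)"

definition cvec :: "real ^ 3 \<Rightarrow> complex ^ 3" where
  "cvec z = (\<chi> i. complex_of_real (z $ i))"

definition cj :: "complex ^ 3 \<Rightarrow> complex ^ 3" where
  "cj a = (\<chi> i. cnj (a $ i))"

text \<open>The orthogonal projection onto the kernel of \<open>zdot z\<close>, that is, the symbol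
  of the Leray projection. At z = 0 it is the identity, because the subtracted multiple of
  \<open>cvec z\<close> is then 0.\<close>

definition leray :: "real ^ 3 \<Rightarrow> complex ^ 3 \<Rightarrow> complex ^ 3" where
  "leray z a = a - (zdot z a / complex_of_real ((norm z)\<^sup>2)) *s cvec z"

lemma norm_vec_sq: "(norm (a :: 'a::real_normed_vector ^ 'n))\<^sup>2 = (\<Sum>i\<in>UNIV. (norm (a $ i))\<^sup>2)"
  by (simp add: norm_vec_def L2_set_def sum_nonneg)

lemma norm_smult: "norm (c *s (a :: complex ^ 3)) = norm c * norm a"
  by (rule power2_eq_imp_eq)
    (simp_all add: norm_vec_sq power_mult_distrib norm_mult sum_distrib_left)

lemma norm_cvec [simp]: "norm (cvec z) = norm z"
  by (rule power2_eq_imp_eq) (simp_all add: norm_vec_sq cvec_def)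

lemma norm_cj [simp]: "norm (cj a) = norm a"
  by (rule power2_eq_imp_eq) (simp_all add: norm_vec_sq cj_def)

lemma cj_simps [simp]: "cj (cj a) = a" "cj (a + b) = cj a + cj b" "cj (- a) = - cj a"
  "cj (a - b) = cj a - cj b" "cj (c *s a) = cnj c *s cj a" "cj (r *\<^sub>R a) = r *\<^sub>R cj a" "cj 0 = 0"
  "cj (cvec z) = cvec z"
  by (simp_all add: cj_def vec_eq_iff cvec_def)

lemma bounded_linear_cj: "bounded_linear cj"
  by (rule bounded_linear_intro[where K = 1]) auto

lemma norm_zdot: "norm (zdot z a) \<le> norm z * norm a"
proof -
  have "norm (zdot z a) \<le> (\<Sum>i\<in>UNIV. norm (z $ i) * norm (a $ i))"
    unfolding zdot_def by (rule order_trans[OF norm_sum]) (simp add: norm_mult)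
  also have "\<dots> \<le> norm z * norm a"
    unfolding norm_vec_def using L2_set_mult_ineq[of "\<lambda>i. norm (z $ i)" "\<lambda>i. norm (a $ i)" UNIV] by simp
  finally show ?thesis .
qed

lemma zdot_simps [simp]: "zdot z (a + b) = zdot z a + zdot z b" "zdot z (a - b) = zdot z a - zdot z b"
  "zdot z (- a) = - zdot z a" "zdot (- z) a = - zdot z a" "zdot (y - z) a = zdot y a - zdot z a"
  "zdot z (c *s a) = c * zdot z a" "zdot z (r *\<^sub>R a) = r *\<^sub>R zdot z a"
  "zdot z (cj a) = cnj (zdot z a)" "zdot 0 a = 0" "zdot z 0 = 0"
  by (simp_all add: zdot_def cj_def sum.distrib sum_subtractf sum_negf algebra_simps sum_distrib_left
      scaleR_sum_right)

lemma zdot_cvec: "zdot z (cvec z) = complex_of_real ((norm z)\<^sup>2)"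
  unfolding norm_vec_sq by (simp add: zdot_def cvec_def power2_eq_square)

lemma zdot_leray [simp]: "zdot z (leray z a) = 0"
  by (cases "z = 0") (simp_all add: leray_def zdot_cvec)

text \<open>The triangle inequality is used in place of orthogonality. The resulting 2 enters the
  constant \<open>Bconst\<close>.\<close>

lemma norm_leray: "norm (leray z a) \<le> 2 * norm a"
proof -
  have "norm ((zdot z a / complex_of_real ((norm z)\<^sup>2)) *s cvec z) \<le> norm a"
  proof (cases "z = 0")
    case False
    then have "norm ((zdot z a / complex_of_real ((norm z)\<^sup>2)) *s cvec z) = norm (zdot z a) / norm z"
      unfolding norm_smult norm_divide norm_of_real by (simp add: power2_eq_square)
    also have "\<dots> \<le> norm a" using norm_zdot[of z a] False by (simp add: field_simps)
    finally show ?thesis .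
  next
    case True
    then show ?thesis unfolding norm_smult by simp
  qed
  then show ?thesis
    unfolding leray_def using norm_triangle_ineq4[of a "(zdot z a / complex_of_real ((norm z)\<^sup>2)) *s cvec z"]
    by linarith
qed

lemma leray_simps [simp]: "leray z 0 = 0" "leray (- z) a = leray z a"
  "leray z (a + b) = leray z a + leray z b" "leray z (a - b) = leray z a - leray z b"
  "leray z (- a) = - leray z a" "leray z (cj a) = cj (leray z a)"
proof -
  show "leray z (cj a) = cj (leray z a)" by (simp add: leray_def)
qed (simp_all add: leray_def cvec_def vec_eq_iff add_divide_distrib diff_divide_distrib algebra_simps)

lemma inner_cvec_smult: "(c *s a) \<bullet> b = Re (c * (\<Sum>i\<in>UNIV. a $ i * cnj (b $ i)))"
  by (simp add: inner_vec_def inner_complex_def sum_distrib_left algebra_simps sum.distrib sum_subtractf)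

text \<open>The projection subtracts a multiple of z, and w is orthogonal to z: divergence-free test
  fields do not see the pressure.\<close>

lemma leray_inner:
  assumes "zdot z w = 0"
  shows "(c *s leray z a) \<bullet> w = (c *s a) \<bullet> w"
proof -
  have "(\<Sum>i\<in>UNIV. cvec z $ i * cnj (w $ i)) = cnj (zdot z w)"
    by (simp add: cvec_def zdot_def)
  then have *: "(\<Sum>i\<in>UNIV. cvec z $ i * cnj (w $ i)) = 0" using assms by simp
  have "(\<Sum>i\<in>UNIV. leray z a $ i * cnj (w $ i)) = (\<Sum>i\<in>UNIV. a $ i * cnj (w $ i))
      - (zdot z a / complex_of_real ((norm z)\<^sup>2)) * (\<Sum>i\<in>UNIV. cvec z $ i * cnj (w $ i))"
    unfolding leray_def by (simp add: algebra_simps sum_subtractf sum_distrib_left)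
  then show ?thesis using * by (simp add: inner_cvec_smult)
qed

lemma solen_iff: "solen L u \<longleftrightarrow> u 0 = 0 \<and> (\<forall>k. u (- k) = cj (u k)) \<and> (\<forall>k. zdot (freq L k) (u k) = 0)"
  by (simp add: solen_def cj_def zdot_def)

lemma solenD: assumes "solen L u"
  shows "u 0 = 0" "u (- k) = cj (u k)" "zdot (freq L k) (u k) = 0"
  using assms by (auto simp: solen_iff)

lemma solen_zero [simp]: "solen L (\<lambda>k. 0)"
  by (simp add: solen_iff)

lemma solen_diff: "solen L u \<Longrightarrow> solen L v \<Longrightarrow> solen L (\<lambda>k. u k - v k)"
  by (simp add: solen_iff)

lemma solen_scaleR: "solen L u \<Longrightarrow> (\<And>k. c (- k) = c k) \<Longrightarrow> solen L (\<lambda>k. c k *\<^sub>R u k)"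
  by (simp add: solen_iff)

definition Bsum :: "real \<Rightarrow> coeffs \<Rightarrow> coeffs \<Rightarrow> coeffs" where
  "Bsum L u v m = (LINT k|count_space UNIV. zdot (freq L m) (u k) *s v (m - k))"

text \<open>
  The coefficients of the Leray projection of \<open>(u \<cdot> \<nabla>) v\<close>. Since \<open>u\<close> is divergence-free, the
  derivative can be moved to the outside: it costs the factor \<open>\<bar>\<zeta>\<^sub>m\<bar>\<close> only.
\<close>

definition Bc :: "real \<Rightarrow> coeffs \<Rightarrow> coeffs \<Rightarrow> coeffs" where
  "Bc L u v m = \<i> *s leray (freq L m) (Bsum L u v m)"

lemma Bc_0 [simp]: "Bc L u v 0 = 0"
  by (simp add: Bc_def Bsum_def)

text \<open>The sign comes from the frequency factor under k to -k. It is compensated by the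
  imaginary unit in \<open>Bc\<close>, whose conjugate also changes sign, so that \<open>Bc\<close>
  is again the family of coefficients of a real field.\<close>

lemma Bsum_minus:
  assumes "solen L u" "solen L v"
  shows "Bsum L u v (- m) = - cj (Bsum L u v m)"
proof -
  let ?C = "count_space (UNIV :: (int ^ 3) set)"
  define g where "g = (\<lambda>k. zdot (freq L m) (u k) *s v (m - k))"
  have "Bsum L u v (- m) = (LINT k|?C. zdot (freq L (- m)) (u (- k)) *s v (- m - (- k)))"
    unfolding Bsum_def
    by (rule integral_bij_count_space[symmetric, of uminus UNIV UNIV])
      (rule bij_betwI[where g = uminus], auto)
  also have "\<dots> = (LINT k|?C. - cj (g k))"
  proof (rule Bochner_Integration.integral_cong[OF refl])
    fix k
    have "v (- m - (- k)) = cj (v (m - k))"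
      using solenD(2)[OF assms(2), of "m - k"] by simp
    then show "zdot (freq L (- m)) (u (- k)) *s v (- m - (- k)) = - cj (g k)"
      unfolding g_def solenD(2)[OF assms(1), of k] by (simp only: freq_simps zdot_simps cj_simps) (simp add: vec_eq_iff)
  qed
  also have "\<dots> = - cj (LINT k|?C. g k)"
  proof (cases "integrable ?C g")
    case True
    then show ?thesis by (simp add: integral_bounded_linear[OF bounded_linear_cj])
  next
    case False
    moreover have "\<not> integrable ?C (\<lambda>k. cj (g k))"
      using False integrable_bounded_linear[OF bounded_linear_cj, of ?C "\<lambda>k. cj (g k)"] by auto
    ultimately show ?thesis by (simp add: not_integrable_integral_eq)
  qed
  finally show ?thesis by (simp add: Bsum_def g_def)
qed

lemma solen_Bc:
  assumes "solen L u" "solen L v"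
  shows "solen L (Bc L u v)"
proof -
  have "Bc L u v (- k) = cj (Bc L u v k)" for k
    unfolding Bc_def Bsum_minus[OF assms] by (simp add: vec_eq_iff)
  moreover have "zdot (freq L k) (Bc L u v k) = 0" for k
    by (simp add: Bc_def)
  ultimately show ?thesis by (simp add: solen_iff)
qed

lemma norm_Bc_le:
  "ennreal (norm (Bc L u v m)) \<le> ennreal (2 * norm (freq L m)) *
     (\<integral>\<^sup>+k. ennreal (norm (u k) * norm (v (m - k))) \<partial>count_space UNIV)"
proof -
  let ?C = "count_space (UNIV :: (int ^ 3) set)"
  let ?S = "\<integral>\<^sup>+k. ennreal (norm (u k) * norm (v (m - k))) \<partial>?C"
  have "ennreal (norm (Bsum L u v m)) \<le> ennreal (norm (freq L m)) * ?S"
  proof (cases "integrable ?C (\<lambda>k. zdot (freq L m) (u k) *s v (m - k))")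
    case True
    then have "ennreal (norm (Bsum L u v m)) \<le> (\<integral>\<^sup>+k. ennreal (norm (zdot (freq L m) (u k) *s v (m - k))) \<partial>?C)"
      unfolding Bsum_def using integral_norm_bound_ennreal by blast
    also have "\<dots> \<le> (\<integral>\<^sup>+k. ennreal (norm (freq L m)) * ennreal (norm (u k) * norm (v (m - k))) \<partial>?C)"
    proof (intro nn_integral_mono)
      fix k
      have "norm (zdot (freq L m) (u k) *s v (m - k)) \<le> norm (freq L m) * norm (u k) * norm (v (m - k))"
        using norm_zdot by (simp add: norm_smult mult_right_mono)
      then show "ennreal (norm (zdot (freq L m) (u k) *s v (m - k)))
          \<le> ennreal (norm (freq L m)) * ennreal (norm (u k) * norm (v (m - k)))"
        by (simp add: mult.assoc flip: ennreal_mult)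
    qed
    also have "\<dots> = ennreal (norm (freq L m)) * ?S" by (rule nn_integral_cmult) simp
    finally show ?thesis .
  qed (simp add: Bsum_def not_integrable_integral_eq)
  then have "ennreal 2 * ennreal (norm (Bsum L u v m)) \<le> ennreal 2 * (ennreal (norm (freq L m)) * ?S)"
    by (rule mult_left_mono) simp
  moreover have "ennreal (norm (Bc L u v m)) \<le> ennreal (2 * norm (Bsum L u v m))"
    using norm_leray by (intro ennreal_leI) (simp add: Bc_def norm_smult)
  ultimately show ?thesis by (simp add: ennreal_mult mult.assoc)
qed

text \<open>Used with the moduli x, y, z of the frequencies k, m - k and m. After z^s is split into
  x^s and y^s, the point is x^(s-b) y^(-s) \<le> x^(-b) + y^(-b): the smaller of x and y takes the
  whole power -b, by s \<ge> 0 if it is x and by s \<le> b if it is y. One factor of each product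
  then carries the square summable weight of exponent -b.\<close>

lemma weight_product_bound:
  fixes x y z s b :: real
  assumes "0 \<le> s" "s \<le> b" "x > 0" "y > 0" "0 \<le> z" "z \<le> x + y"
  shows "z powr s \<le> 2 powr (s + 1) * (x powr (- b) + y powr (- b)) * (x powr b * y powr s)"
proof -
  have a: "z powr s \<le> 2 powr s * (x powr s + y powr s)"
  proof -
    have "z powr s \<le> (2 * max x y) powr s" using assms by (intro powr_mono2) auto
    also have "\<dots> = 2 powr s * max x y powr s" using assms by (simp add: powr_mult)
    also have "max x y powr s \<le> x powr s + y powr s" by (auto simp: max_def)
    finally show ?thesis by simp
  qed
  have e: "x powr (- b) * x powr b = 1" "y powr (- s) * y powr s = 1" "x powr (s - b) * x powr b = x powr s"
    using assms by (simp_all flip: powr_add)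
  have "x powr (s - b) * y powr (- s) \<le> x powr (- b) + y powr (- b)"
  proof (cases "x \<le> y")
    case True
    then have "x powr (s - b) * y powr (- s) \<le> x powr (s - b) * x powr (- s)"
      using assms by (intro mult_left_mono powr_mono2') auto
    also have "\<dots> = x powr (- b)" by (simp flip: powr_add)
    finally show ?thesis by (simp add: add_increasing2)
  next
    case False
    then have "x powr (s - b) * y powr (- s) \<le> y powr (s - b) * y powr (- s)"
      using assms by (intro mult_right_mono powr_mono2') auto
    also have "\<dots> = y powr (- b)" by (simp flip: powr_add)
    finally show ?thesis by (simp add: add_increasing)
  qed
  then have "x powr (s - b) * y powr (- s) * (x powr b * y powr s) \<le> (x powr (- b) + y powr (- b)) * (x powr b * y powr s)"
    by (rule mult_right_mono) simp
  moreover have "x powr (s - b) * y powr (- s) * (x powr b * y powr s) = x powr s"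
  proof -
    have "x powr (s - b) * y powr (- s) * (x powr b * y powr s) = (x powr (s - b) * x powr b) * (y powr (- s) * y powr s)"
      by (simp only: ac_simps)
    then show ?thesis using e by simp
  qed
  moreover have "y powr s \<le> (x powr (- b) + y powr (- b)) * (x powr b * y powr s)"
  proof -
    have "(x powr (- b) + y powr (- b)) * (x powr b * y powr s)
      = (x powr (- b) * x powr b) * y powr s + y powr (- b) * (x powr b * y powr s)"
      by (simp add: algebra_simps)
    then show ?thesis using e by simp
  qed
  ultimately have "x powr s + y powr s \<le> 2 * ((x powr (- b) + y powr (- b)) * (x powr b * y powr s))"
    by linarith
  then have "2 powr s * (x powr s + y powr s) \<le> 2 powr s * (2 * ((x powr (- b) + y powr (- b)) * (x powr b * y powr s)))"
    by (rule mult_left_mono) simp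
  also have "\<dots> = 2 powr (s + 1) * (x powr (- b) + y powr (- b)) * (x powr b * y powr s)"
    unfolding powr_add by (simp only: mult.assoc) simp
  finally show ?thesis using a by linarith
qed

text \<open>The 16 is 4 * 2 * 2: the square of the 2 in \<open>norm_Bc_le\<close>, a 2 from squaring
  a sum of two terms, and a 2 because both terms have the same bound.\<close>

definition Bconst :: "real \<Rightarrow> real \<Rightarrow> real \<Rightarrow> ennreal" where
  "Bconst L b s = ennreal (16 * (2 powr (s + 1))\<^sup>2) * (\<integral>\<^sup>+k. ennreal ((wt L (- b) k)\<^sup>2) \<partial>count_space UNIV)"

lemma Bconst_finite: "L > 0 \<Longrightarrow> 2 * b > 3 \<Longrightarrow> Bconst L b s < \<infinity>"
  using wt_summable[of L b] by (simp add: Bconst_def ennreal_mult_less_top)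

text \<open>By \<open>weight_product_bound\<close> each weighted coefficient is at most a sum of two
  convolutions, in which one factor carries the additional weight of exponent -b. This factor is in
  l_1 by the Cauchy-Schwarz inequality and the other one is in l_2, so Young's inequality applies to
  both. The estimate is used at three values of s: 1 to identify \<open>B_op\<close>, \<alpha> for
  the contraction, and 1 + \<alpha> for uniqueness.\<close>

lemma Bc_bound:
  assumes L: "L > 0" and s: "0 \<le> s" "s \<le> b" and u0: "u 0 = 0" and v0: "v 0 = 0"
  shows "Esq L (s - 1) (Bc L u v) \<le> Bconst L b s * (Esq L b u * Esq L s v)"
proof -
  let ?C = "count_space (UNIV :: (int ^ 3) set)"
  define W where "W = (\<integral>\<^sup>+k. ennreal ((wt L (- b) k)\<^sup>2) \<partial>?C)"
  define c where "c = 2 * 2 powr (s + 1)"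
  define U where "U k = wt L b k * norm (u k)" for k
  define V where "V k = wt L s k * norm (v k)" for k
  define A where "A m = (\<integral>\<^sup>+k. ennreal ((wt L (- b) k * U k) * V (m - k)) \<partial>?C)" for m
  define D where "D m = (\<integral>\<^sup>+k. ennreal ((wt L (- b) k * V k) * U (m - k)) \<partial>?C)" for m
  have c: "c \<ge> 0" by (simp add: c_def)
  have nn: "U k \<ge> 0" "V k \<ge> 0" for k by (simp_all add: U_def V_def)
  have l1: "(\<integral>\<^sup>+k. ennreal (wt L (- b) k * X k) \<partial>?C)\<^sup>2 \<le> W * (\<integral>\<^sup>+k. ennreal ((X k)\<^sup>2) \<partial>?C)"
    if "\<And>k. X k \<ge> 0" for X
    using Cauchy_Schwarz_nn_integral[of "\<lambda>k. ennreal (wt L (- b) k)" ?C "\<lambda>k. ennreal (X k)"] that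
    by (simp add: W_def ennreal_power ennreal_mult)
  have EU: "(\<integral>\<^sup>+k. ennreal ((U k)\<^sup>2) \<partial>?C) = Esq L b u" and EV: "(\<integral>\<^sup>+k. ennreal ((V k)\<^sup>2) \<partial>?C) = Esq L s v"
    by (simp_all add: U_def V_def Esq_def)
  have A: "(\<integral>\<^sup>+m. (A m)\<^sup>2 \<partial>?C) \<le> W * (Esq L b u * Esq L s v)"
  proof -
    have "(\<integral>\<^sup>+m. (A m)\<^sup>2 \<partial>?C) \<le> (\<integral>\<^sup>+k. ennreal (wt L (- b) k * U k) \<partial>?C)\<^sup>2 * Esq L s v"
      unfolding A_def EV[symmetric] by (rule young_convolution) (simp_all add: nn)
    also have "\<dots> \<le> (W * Esq L b u) * Esq L s v"
      using l1[of U] nn EU by (intro mult_right_mono) auto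
    finally show ?thesis by (simp add: mult.assoc)
  qed
  have D: "(\<integral>\<^sup>+m. (D m)\<^sup>2 \<partial>?C) \<le> W * (Esq L b u * Esq L s v)"
  proof -
    have "(\<integral>\<^sup>+m. (D m)\<^sup>2 \<partial>?C) \<le> (\<integral>\<^sup>+k. ennreal (wt L (- b) k * V k) \<partial>?C)\<^sup>2 * Esq L b u"
      unfolding D_def EU[symmetric] by (rule young_convolution) (simp_all add: nn)
    also have "\<dots> \<le> (W * Esq L s v) * Esq L b u"
      using l1[of V] nn EV by (intro mult_right_mono) auto
    finally show ?thesis by (simp add: ac_simps)
  qed
  \<comment> \<open>The weight bound asks for nonzero frequencies. If k or m - k is 0, the
    coefficient there vanishes and the left side is 0.\<close>
  have pt: "wt L s m * (norm (u k) * norm (v (m - k)))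
      \<le> 2 powr (s + 1) * ((wt L (- b) k * U k) * V (m - k) + (wt L (- b) (m - k) * V (m - k)) * U k)" for k m
  proof (cases "k = 0 \<or> m - k = 0")
    case True
    then show ?thesis using u0 v0 nn by (auto intro!: mult_nonneg_nonneg add_nonneg_nonneg)
  next
    case False
    have "norm (freq L m) \<le> norm (freq L k) + norm (freq L (m - k))"
      using norm_triangle_ineq[of "freq L k" "freq L (m - k)"] by simp
    then have "wt L s m \<le> 2 powr (s + 1) * (wt L (- b) k + wt L (- b) (m - k)) * (wt L b k * wt L s (m - k))"
      unfolding wt_def using s False freq_norm_pos[OF L, of k] freq_norm_pos[OF L, of "m - k"]
      by (intro weight_product_bound) auto
    then have "wt L s m * (norm (u k) * norm (v (m - k)))
        \<le> 2 powr (s + 1) * (wt L (- b) k + wt L (- b) (m - k)) * (wt L b k * wt L s (m - k)) * (norm (u k) * norm (v (m - k)))"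
      by (rule mult_right_mono) simp
    then show ?thesis by (simp add: U_def V_def algebra_simps)
  qed
  \<comment> \<open>The reflection of the summation index at m moves the additional weight to the
    index k, which is the form of a convolution required by
    \<open>young_convolution\<close>.\<close>
  have refl: "(\<integral>\<^sup>+k. ennreal ((wt L (- b) (m - k) * V (m - k)) * U k) \<partial>?C) = D m" for m
  proof -
    have "(\<integral>\<^sup>+k. ennreal ((wt L (- b) (m - k) * V (m - k)) * U (m - (m - k))) \<partial>?C) = D m"
      unfolding D_def
      by (rule nn_integral_bij_count_space[where f = "\<lambda>k. ennreal ((wt L (- b) k * V k) * U (m - k))" and g = "\<lambda>k. m - k"])
        (rule bij_betwI[where g = "\<lambda>k. m - k"], auto)
    then show ?thesis by simp
  qed
  have mode: "ennreal (wt L (s - 1) m * norm (Bc L u v m)) \<le> ennreal c * (A m + D m)" for m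
  proof -
    have "ennreal (wt L (s - 1) m * norm (Bc L u v m))
        \<le> ennreal (wt L (s - 1) m) * (ennreal (2 * norm (freq L m)) *
          (\<integral>\<^sup>+k. ennreal (norm (u k) * norm (v (m - k))) \<partial>?C))"
      using norm_Bc_le[of L u v m] by (simp add: ennreal_mult mult_left_mono)
    also have "\<dots> = ennreal (2 * wt L s m) * (\<integral>\<^sup>+k. ennreal (norm (u k) * norm (v (m - k))) \<partial>?C)"
    proof -
      have "wt L (s - 1) m * norm (freq L m) = wt L s m" using wt_mult[of L "s - 1" m 1] by simp
      then have "wt L (s - 1) m * (2 * norm (freq L m)) = 2 * wt L s m" by simp
      then have "ennreal (wt L (s - 1) m) * ennreal (2 * norm (freq L m)) = ennreal (2 * wt L s m)"
        by (subst ennreal_mult[symmetric]) auto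
      then show ?thesis unfolding mult.assoc[symmetric] by (rule arg_cong)
    qed
    also have "\<dots> = ennreal 2 * (\<integral>\<^sup>+k. ennreal (wt L s m * (norm (u k) * norm (v (m - k)))) \<partial>?C)"
      by (subst (1 2) ennreal_mult) (simp_all add: nn_integral_cmult mult.assoc)
    also have "\<dots> \<le> ennreal 2 * (\<integral>\<^sup>+k. ennreal (2 powr (s + 1) * ((wt L (- b) k * U k) * V (m - k) + (wt L (- b) (m - k) * V (m - k)) * U k)) \<partial>?C)"
      by (intro mult_left_mono nn_integral_mono ennreal_leI pt) simp
    also have "\<dots> = ennreal 2 * (ennreal (2 powr (s + 1)) * (A m + D m))"
    proof -
      have "(\<integral>\<^sup>+k. ennreal (2 powr (s + 1) * ((wt L (- b) k * U k) * V (m - k) + (wt L (- b) (m - k) * V (m - k)) * U k)) \<partial>?C)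
          = (\<integral>\<^sup>+k. ennreal (2 powr (s + 1)) * (ennreal ((wt L (- b) k * U k) * V (m - k)) + ennreal ((wt L (- b) (m - k) * V (m - k)) * U k)) \<partial>?C)"
      proof (rule nn_integral_cong)
        fix k
        have "0 \<le> (wt L (- b) k * U k) * V (m - k)" "0 \<le> (wt L (- b) (m - k) * V (m - k)) * U k"
          by (simp_all add: nn)
        then show "ennreal (2 powr (s + 1) * ((wt L (- b) k * U k) * V (m - k) + (wt L (- b) (m - k) * V (m - k)) * U k))
            = ennreal (2 powr (s + 1)) * (ennreal ((wt L (- b) k * U k) * V (m - k)) + ennreal ((wt L (- b) (m - k) * V (m - k)) * U k))"
          by (subst ennreal_plus[symmetric]) (simp_all add: ennreal_mult)
      qed
      also have "\<dots> = ennreal (2 powr (s + 1)) * (A m + D m)"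
        unfolding refl[symmetric] A_def by (simp add: nn_integral_cmult nn_integral_add)
      finally show ?thesis by simp
    qed
    also have "\<dots> = ennreal c * (A m + D m)"
    proof -
      have "ennreal c = ennreal 2 * ennreal (2 powr (s + 1))"
        unfolding c_def by (rule ennreal_mult) auto
      then show ?thesis by (simp only: mult.assoc)
    qed
    finally show ?thesis .
  qed
  have "Esq L (s - 1) (Bc L u v) \<le> (\<integral>\<^sup>+m. ennreal (2 * c\<^sup>2) * ((A m)\<^sup>2 + (D m)\<^sup>2) \<partial>?C)"
    unfolding Esq_def
  proof (intro nn_integral_mono)
    fix m
    have sq: "(x + y)\<^sup>2 \<le> 2 * (x\<^sup>2 + y\<^sup>2)" for x y :: ennreal
    proof (cases x; cases y)
      fix a b :: real
      assume ab: "x = ennreal a" "a \<ge> 0" "y = ennreal b" "b \<ge> 0"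
      have "(a + b)\<^sup>2 \<le> 2 * (a\<^sup>2 + b\<^sup>2)" using sum_squares_bound[of a b] by (simp add: power2_sum)
      then have "ennreal ((a + b)\<^sup>2) \<le> ennreal (2 * (a\<^sup>2 + b\<^sup>2))" by (rule ennreal_leI)
      moreover have "ennreal (2 * (a\<^sup>2 + b\<^sup>2)) = 2 * (x\<^sup>2 + y\<^sup>2)"
        using ab by (subst ennreal_mult) (auto simp: ennreal_power)
      moreover have "ennreal ((a + b)\<^sup>2) = (x + y)\<^sup>2"
        using ab by (simp add: ennreal_power[symmetric])
      ultimately show ?thesis by simp
    qed (auto simp: power2_eq_square ennreal_mult_eq_top_iff ennreal_mult_top)
    have "ennreal ((wt L (s - 1) m * norm (Bc L u v m))\<^sup>2) = (ennreal (wt L (s - 1) m * norm (Bc L u v m)))\<^sup>2"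
      by (simp add: ennreal_power)
    also have "\<dots> \<le> (ennreal c * (A m + D m))\<^sup>2"
      by (intro power_mono mode) simp
    also have "\<dots> = (ennreal c)\<^sup>2 * (A m + D m)\<^sup>2" by (rule power_mult_distrib)
    also have "\<dots> \<le> (ennreal c)\<^sup>2 * (2 * ((A m)\<^sup>2 + (D m)\<^sup>2))"
      by (intro mult_left_mono sq) simp
    also have "\<dots> = ennreal (2 * c\<^sup>2) * ((A m)\<^sup>2 + (D m)\<^sup>2)"
    proof -
      have "ennreal (2 * c\<^sup>2) = 2 * (ennreal c)\<^sup>2"
        using c by (subst ennreal_mult) (simp_all add: ennreal_power)
      then show ?thesis by (simp only: mult.assoc mult.left_commute)
    qed
    finally show "ennreal ((wt L (s - 1) m * norm (Bc L u v m))\<^sup>2) \<le> ennreal (2 * c\<^sup>2) * ((A m)\<^sup>2 + (D m)\<^sup>2)" .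
  qed
  also have "\<dots> = ennreal (2 * c\<^sup>2) * ((\<integral>\<^sup>+m. (A m)\<^sup>2 \<partial>?C) + (\<integral>\<^sup>+m. (D m)\<^sup>2 \<partial>?C))"
    by (simp add: nn_integral_cmult nn_integral_add)
  also have "\<dots> \<le> ennreal (2 * c\<^sup>2) * (W * (Esq L b u * Esq L s v) + W * (Esq L b u * Esq L s v))"
    by (intro mult_left_mono add_mono A D) simp
  also have "\<dots> = (ennreal (2 * c\<^sup>2) * 2) * W * (Esq L b u * Esq L s v)"
    by (simp add: mult_2[symmetric] ac_simps)
  also have "ennreal (2 * c\<^sup>2) * 2 = ennreal (16 * (2 powr (s + 1))\<^sup>2)"
  proof -
    have "ennreal (2 * c\<^sup>2) * 2 = ennreal (2 * c\<^sup>2 * 2)" by (subst ennreal_mult) auto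
    also have "2 * c\<^sup>2 * 2 = 16 * (2 powr (s + 1))\<^sup>2" by (simp add: c_def power_mult_distrib)
    finally show ?thesis .
  qed
  finally show ?thesis unfolding Bconst_def W_def .
qed

lemma Esq_0_eq:
  assumes "L > 0" "u 0 = 0"
  shows "Esq L 0 u = (\<integral>\<^sup>+k. ennreal ((norm (u k))\<^sup>2) \<partial>count_space UNIV)"
  unfolding Esq_def
proof (rule nn_integral_cong)
  fix k
  show "ennreal ((wt L 0 k * norm (u k))\<^sup>2) = ennreal ((norm (u k))\<^sup>2)"
    using assms wt_zero_exp[of L k] by (cases "k = 0") auto
qed

text \<open>A crude bound, additive instead of multiplicative. It makes \<open>Bsum\<close> converge
  absolutely for fields in V^0, and a sum of squares stays integrable in time if both fields are
  only square integrable in time.\<close>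

lemma convolution_le:
  assumes L: "L > 0" and u: "u 0 = 0" and v: "v 0 = 0"
  shows "(\<integral>\<^sup>+k. ennreal (norm (u k) * norm (v (m - k))) \<partial>count_space UNIV) \<le> Esq L 0 u + Esq L 0 v"
proof -
  let ?C = "count_space (UNIV :: (int ^ 3) set)"
  have "(\<integral>\<^sup>+k. ennreal (norm (u k) * norm (v (m - k))) \<partial>?C) \<le> (\<integral>\<^sup>+k. ennreal ((norm (u k))\<^sup>2) + ennreal ((norm (v (m - k)))\<^sup>2) \<partial>?C)"
  proof (intro nn_integral_mono)
    fix k
    have "norm (u k) * norm (v (m - k)) \<le> (norm (u k))\<^sup>2 + (norm (v (m - k)))\<^sup>2"
      using sum_squares_bound[of "norm (u k)" "norm (v (m - k))"] mult_nonneg_nonneg[OF norm_ge_zero[of "u k"] norm_ge_zero[of "v (m - k)"]]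
      by linarith
    then show "ennreal (norm (u k) * norm (v (m - k))) \<le> ennreal ((norm (u k))\<^sup>2) + ennreal ((norm (v (m - k)))\<^sup>2)"
      by (simp add: ennreal_leI flip: ennreal_plus)
  qed
  also have "\<dots> = (\<integral>\<^sup>+k. ennreal ((norm (u k))\<^sup>2) \<partial>?C) + (\<integral>\<^sup>+k. ennreal ((norm (v (m - k)))\<^sup>2) \<partial>?C)"
    by (rule nn_integral_add) auto
  also have "(\<integral>\<^sup>+k. ennreal ((norm (v (m - k)))\<^sup>2) \<partial>?C) = (\<integral>\<^sup>+k. ennreal ((norm (v k))\<^sup>2) \<partial>?C)"
    by (rule nn_integral_bij_count_space[where f = "\<lambda>k. ennreal ((norm (v k))\<^sup>2)" and g = "\<lambda>k. m - k"])
      (rule bij_betwI[where g = "\<lambda>k. m - k"], auto)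
  finally show ?thesis by (simp only: Esq_0_eq[of L u, OF L u] Esq_0_eq[of L v, OF L v])
qed

lemma Bc_mode_le:
  assumes L: "L > 0" and u: "u 0 = 0" and v: "v 0 = 0"
  shows "ennreal (norm (Bc L u v m)) \<le> ennreal (2 * norm (freq L m)) * (Esq L 0 u + Esq L 0 v)"
  by (rule order_trans[OF norm_Bc_le mult_left_mono[OF convolution_le[of L u v, OF L u v]]]) simp

lemma integrable_Bsum:
  assumes "L > 0" "u 0 = 0" "v 0 = 0" "Esq L 0 u < \<infinity>" "Esq L 0 v < \<infinity>"
  shows "integrable (count_space UNIV) (\<lambda>k. zdot (freq L m) (u k) *s v (m - k))"
proof (rule integrableI_bounded)
  have "(\<integral>\<^sup>+k. ennreal (norm (zdot (freq L m) (u k) *s v (m - k))) \<partial>count_space UNIV)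
      \<le> (\<integral>\<^sup>+k. ennreal (norm (freq L m)) * ennreal (norm (u k) * norm (v (m - k))) \<partial>count_space UNIV)"
  proof (intro nn_integral_mono)
    fix k
    have "norm (zdot (freq L m) (u k) *s v (m - k)) \<le> norm (freq L m) * norm (u k) * norm (v (m - k))"
      using norm_zdot by (simp add: norm_smult mult_right_mono)
    then show "ennreal (norm (zdot (freq L m) (u k) *s v (m - k)))
        \<le> ennreal (norm (freq L m)) * ennreal (norm (u k) * norm (v (m - k)))"
      by (simp add: mult.assoc flip: ennreal_mult)
  qed
  also have "\<dots> < \<infinity>"
    using convolution_le[of L u v m] assms
    by (auto simp: nn_integral_cmult ennreal_mult_less_top intro: le_less_trans[where y = "Esq L 0 u + Esq L 0 v"])
  finally show "(\<integral>\<^sup>+k. ennreal (norm (zdot (freq L m) (u k) *s v (m - k))) \<partial>count_space UNIV) < \<infinity>" .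
qed simp

lemma Bc_diff_right:
  assumes "L > 0" "u 0 = 0" "v 0 = 0" "w 0 = 0" "Esq L 0 u < \<infinity>" "Esq L 0 v < \<infinity>" "Esq L 0 w < \<infinity>"
  shows "Bc L u (\<lambda>k. v k - w k) m = Bc L u v m - Bc L u w m"
proof -
  have "Bsum L u (\<lambda>k. v k - w k) m = Bsum L u v m - Bsum L u w m"
    unfolding Bsum_def
    by (subst Bochner_Integration.integral_diff[symmetric])
      (use assms in \<open>auto intro!: integrable_Bsum Bochner_Integration.integral_cong simp: vec_eq_iff algebra_simps\<close>)
  then show ?thesis unfolding Bc_def by (simp only: leray_simps) (simp add: vec_eq_iff algebra_simps)
qed

lemma Bc_diff_left:
  assumes "L > 0" "u 0 = 0" "v 0 = 0" "w 0 = 0" "Esq L 0 u < \<infinity>" "Esq L 0 v < \<infinity>" "Esq L 0 w < \<infinity>"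
  shows "Bc L (\<lambda>k. u k - v k) w m = Bc L u w m - Bc L v w m"
proof -
  have "Bsum L (\<lambda>k. u k - v k) w m = Bsum L u w m - Bsum L v w m"
    unfolding Bsum_def
    by (subst Bochner_Integration.integral_diff[symmetric])
      (use assms in \<open>auto intro!: integrable_Bsum Bochner_Integration.integral_cong simp: vec_eq_iff algebra_simps\<close>)
  then show ?thesis unfolding Bc_def by (simp only: leray_simps) (simp add: vec_eq_iff algebra_simps)
qed

lemma continuous_on_smult: "continuous_on UNIV (\<lambda>p :: complex \<times> (complex ^ 3). fst p *s snd p)"
  by (simp add: vector_scalar_mult_def continuous_intros)

lemma measurable_smult [measurable (raw)]:
  assumes [measurable]: "c \<in> borel_measurable M" "a \<in> borel_measurable M"
  shows "(\<lambda>t. c t *s (a t :: complex ^ 3)) \<in> borel_measurable M"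
proof -
  have "(\<lambda>t. (c t, a t)) \<in> borel_measurable M" by simp
  from borel_measurable_continuous_on[OF continuous_on_smult this] show ?thesis by simp
qed

lemma bounded_linear_zdot: "bounded_linear (zdot z)"
  by (rule bounded_linear_intro[where K = "norm z"]) (auto simp: norm_zdot mult.commute)

lemma bounded_linear_leray: "bounded_linear (leray z)"
proof (rule bounded_linear_intro[where K = 2])
  show "leray z (r *\<^sub>R a) = r *\<^sub>R leray z a" for r a
    unfolding leray_def zdot_simps by (simp add: vec_eq_iff scaleR_diff_right) (simp add: scaleR_conv_of_real)
  show "norm (leray z x) \<le> norm x * 2" for x
    using norm_leray[of z x] by (simp add: mult.commute)
qed simp

lemma measurable_Bc [measurable (raw)]:
  assumes [measurable]: "\<And>k. (\<lambda>t. u t k) \<in> borel_measurable M" "\<And>k. (\<lambda>t. v t k) \<in> borel_measurable M"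
  shows "(\<lambda>t. Bc L (u t) (v t) m) \<in> borel_measurable M"
proof -
  interpret sigma_finite_measure "count_space (UNIV :: (int ^ 3) set)"
    by (rule sigma_finite_measure_count_space)
  have z: "(\<lambda>t. zdot (freq L m) (u t k)) \<in> borel_measurable M" for k
    using borel_measurable_continuous_on[OF linear_continuous_on[OF bounded_linear_zdot], of "\<lambda>t. u t k" M] by auto
  have "(\<lambda>(x, y). zdot (freq L m) (u x y) *s v x (m - y)) \<in> borel_measurable (M \<Otimes>\<^sub>M count_space UNIV)"
    by (intro measurable_pair_count_space measurable_smult z assms)
  then have "(\<lambda>t. Bsum L (u t) (v t) m) \<in> borel_measurable M"
    unfolding Bsum_def by (rule borel_measurable_lebesgue_integral)
  from borel_measurable_continuous_on[OF linear_continuous_on[OF bounded_linear_leray] this]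
  show ?thesis unfolding Bc_def by measurable
qed


section \<open>The trilinear form on trigonometric polynomials\<close>

lemma integral_count_space_finite:
  fixes f :: "'a \<Rightarrow> 'b::{banach, second_countable_topology}"
  assumes "finite K" "\<And>k. k \<notin> K \<Longrightarrow> f k = 0"
  shows "(LINT k|count_space UNIV. f k) = (\<Sum>k\<in>K. f k)"
proof -
  have "finite {k\<in>UNIV. f k \<noteq> 0}" using assms by (auto intro: finite_subset[of _ K])
  then have "(LINT k|count_space UNIV. f k) = (\<Sum>k | k \<in> UNIV \<and> f k \<noteq> 0. f k)"
    by (rule lebesgue_integral_count_space_finite_support)
  also have "\<dots> = (\<Sum>k\<in>K. f k)" using assms by (intro sum.mono_neutral_left) auto
  finally show ?thesis .
qed

lemma LINT_lebesgue_on_eq: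
  fixes f :: "'a::euclidean_space \<Rightarrow> 'b::{banach, second_countable_topology}"
  assumes "f \<in> borel_measurable borel" "S \<in> sets borel"
  shows "(LINT x|lebesgue_on S. f x) = (LINT x|lborel. indicator S x *\<^sub>R f x)"
  using assms by (simp add: integral_restrict_space integral_completion)

lemma exp_integral_1d:
  assumes L: "L > 0" and w: "w = 2 * pi / L * of_int n"
  shows "(LINT x|lborel. indicator {0..L} x *\<^sub>R exp (\<i> * complex_of_real (x * w)))
    = (if w = 0 then complex_of_real L else 0)"
    and "integrable lborel (\<lambda>x. indicator {0..L} x *\<^sub>R exp (\<i> * complex_of_real (x * w)))"
proof -
  show "integrable lborel (\<lambda>x. indicator {0..L} x *\<^sub>R exp (\<i> * complex_of_real (x * w)))"
    by (rule borel_integrable_compact) (auto intro!: continuous_intros)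
  show "(LINT x|lborel. indicator {0..L} x *\<^sub>R exp (\<i> * complex_of_real (x * w)))
    = (if w = 0 then complex_of_real L else 0)"
  proof (cases "w = 0")
    case False
    define F where "F x = exp (\<i> * complex_of_real (x * w)) / (\<i> * complex_of_real w)" for x :: real
    have "(F has_vector_derivative exp (\<i> * complex_of_real (x * w))) (at x within {0..L})" for x
    proof -
      have "((\<lambda>z. exp (\<i> * (z * complex_of_real w)) / (\<i> * complex_of_real w)) has_field_derivative exp (\<i> * (complex_of_real x * complex_of_real w)))
          (at (complex_of_real x))"
        using False by (auto intro!: derivative_eq_intros simp: field_simps)
      from has_vector_derivative_real_field[OF this, of "{0..L}"] show ?thesis
        by (simp add: F_def[abs_def])
    qed
    then have "(LINT x|lborel. indicator {0..L} x *\<^sub>R exp (\<i> * complex_of_real (x * w))) = F L - F 0"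
      using L by (intro integral_FTC_atLeastAtMost) (auto intro!: continuous_intros)
    also have "F L = F 0"
    proof -
      have "L * w = 2 * of_int n * pi" using L by (simp add: w)
      then have "\<i> * complex_of_real (L * w) = (2 * of_int n * complex_of_real pi) * \<i>" by simp
      then have "exp (\<i> * complex_of_real (L * w)) = 1"
        using exp_integer_2pi[of "of_int n"] by (simp only:) simp
      then show ?thesis by (simp add: F_def)
    qed
    finally show ?thesis using False by simp
  qed (use L in \<open>simp add: scaleR_conv_of_real\<close>)
qed

text \<open>Orthogonality of the exponentials. The indicator of the cube and the exponential both
  factor over the coordinates, so the integral is a product of one-dimensional ones, and a single
  nonzero component of the frequency makes it vanish.\<close>

lemma exp_integral:
  assumes L: "L > 0"
  shows "(LINT x|lebesgue_on (cbox 0 (\<chi> i. L)). exp (\<i> * complex_of_real (x \<bullet> freq L k)))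
    = (if k = 0 then complex_of_real (L ^ 3) else 0)"
proof -
  define f where "f b t = indicator {0..L} t *\<^sub>R exp (\<i> * complex_of_real (t * (freq L k \<bullet> b)))" for b :: "real ^ 3" and t :: real
  interpret product_sigma_finite "\<lambda>b :: real ^ 3. lborel :: real measure" ..
  have w: "\<exists>n. freq L k \<bullet> b = 2 * pi / L * of_int n" if "b \<in> Basis" for b
    using that by (auto simp: Basis_vec_def inner_axis freq_def)
  have LB: "(\<chi> i. L) \<bullet> b = L" if "b \<in> Basis" for b :: "real ^ 3"
    using that by (auto simp: Basis_vec_def inner_axis)
  have prod: "indicator (cbox 0 (\<chi> i. L)) x *\<^sub>R exp (\<i> * complex_of_real (x \<bullet> freq L k)) = (\<Prod>b\<in>Basis. f b (x \<bullet> b))" for x :: "real ^ 3"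
  proof (cases "x \<in> cbox 0 (\<chi> i. L)")
    case True
    then have "f b (x \<bullet> b) = exp (\<i> * complex_of_real ((x \<bullet> b) * (freq L k \<bullet> b)))" if "b \<in> Basis" for b
      using that LB[OF that] by (auto simp: f_def mem_box)
    then have "(\<Prod>b\<in>Basis. f b (x \<bullet> b)) = exp (\<Sum>b\<in>Basis. \<i> * complex_of_real ((x \<bullet> b) * (freq L k \<bullet> b)))"
      by (simp add: exp_sum)
    also have "(\<Sum>b\<in>Basis. \<i> * complex_of_real ((x \<bullet> b) * (freq L k \<bullet> b))) = \<i> * complex_of_real (x \<bullet> freq L k)"
      by (subst euclidean_inner[of x]) (simp add: sum_distrib_left)
    finally show ?thesis using True by simp
  next
    case False
    then obtain b where b: "b \<in> Basis" "x \<bullet> b \<notin> {0..L}" using LB by (auto simp: mem_box)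
    then have "f b (x \<bullet> b) = 0" by (simp add: f_def)
    then have "(\<Prod>b\<in>Basis. f b (x \<bullet> b)) = 0" using b by (intro prod_zero) auto
    then show ?thesis using False by simp
  qed
  have meas [measurable]: "f b \<in> borel_measurable borel" for b
    unfolding f_def by measurable
  have "(LINT x|lebesgue_on (cbox 0 (\<chi> i. L)). exp (\<i> * complex_of_real (x \<bullet> freq L k)))
      = (LINT x|lborel. (\<Prod>b\<in>Basis. f b (x \<bullet> b)))"
    by (subst LINT_lebesgue_on_eq) (auto simp: prod)
  also have "\<dots> = (LINT x|(\<Pi>\<^sub>M b\<in>Basis. lborel). (\<Prod>b\<in>Basis. f b ((\<Sum>b\<in>Basis. x b *\<^sub>R b) \<bullet> b)))"
    by (subst lborel_eq, subst integral_distr) auto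
  also have "\<dots> = (LINT x|(\<Pi>\<^sub>M b\<in>Basis. lborel). (\<Prod>b\<in>Basis. f b (x b)))"
    by (intro Bochner_Integration.integral_cong refl prod.cong) (simp add: inner_sum_left_Basis)
  also have "\<dots> = (\<Prod>b\<in>Basis. (LINT t|lborel. f b t))"
  proof (rule product_integral_prod)
    fix b :: "real ^ 3" assume "b \<in> Basis"
    then obtain n where "freq L k \<bullet> b = 2 * pi / L * of_int n" using w by blast
    from exp_integral_1d(2)[OF L this] show "integrable lborel (f b)" by (simp add: f_def[abs_def])
  qed simp
  also have "\<dots> = (\<Prod>b\<in>Basis. if freq L k \<bullet> b = 0 then complex_of_real L else 0)"
  proof (rule prod.cong[OF refl])
    fix b :: "real ^ 3" assume "b \<in> Basis"
    then obtain n where "freq L k \<bullet> b = 2 * pi / L * of_int n" using w by blast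
    from exp_integral_1d(1)[OF L this] show "(LINT t|lborel. f b t) = (if freq L k \<bullet> b = 0 then complex_of_real L else 0)"
      by (simp add: f_def[abs_def])
  qed
  also have "\<dots> = (if k = 0 then complex_of_real (L ^ 3) else 0)"
  proof (cases "k = 0")
    case False
    then have "freq L k \<noteq> 0" using L freq_eq_0_iff by blast
    then obtain b where "b \<in> Basis" "freq L k \<bullet> b \<noteq> 0" by (auto simp: euclidean_eq_iff[of "freq L k"])
    then have "(\<Prod>b\<in>Basis. if freq L k \<bullet> b = 0 then complex_of_real L else 0) = 0" by (intro prod_zero) auto
    then show ?thesis using False by simp
  qed simp
  finally show ?thesis .
qed

definition trig_sum :: "real \<Rightarrow> (int ^ 3) set \<Rightarrow> (int ^ 3 \<Rightarrow> complex) \<Rightarrow> real ^ 3 \<Rightarrow> complex" where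
  "trig_sum L K c x = (\<Sum>k\<in>K. exp (\<i> * complex_of_real (x \<bullet> freq L k)) * c k)"

lemma trig_sum_real:
  assumes "finite K" "uminus ` K = K" "\<And>k. c (- k) = cnj (c k)"
  shows "complex_of_real (Re (trig_sum L K c x)) = trig_sum L K c x"
proof -
  have "cnj (trig_sum L K c x) = (\<Sum>k\<in>K. exp (\<i> * complex_of_real (x \<bullet> freq L (- k))) * c (- k))"
    unfolding trig_sum_def using assms(3) by (simp add: exp_cnj)
  also have "\<dots> = (\<Sum>k\<in>uminus ` K. exp (\<i> * complex_of_real (x \<bullet> freq L k)) * c k)"
    by (subst sum.reindex) (auto simp: inj_on_def)
  finally have "cnj (trig_sum L K c x) = trig_sum L K c x" using assms(2) by (simp add: trig_sum_def)
  then show ?thesis by (simp add: complex_eq_iff)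
qed

lemma trig_sum_product_integral:
  assumes L: "L > 0"
  shows "(LINT x|lebesgue_on (cbox 0 (\<chi> i. L)). trig_sum L K a x * trig_sum L K b x * trig_sum L K c x)
    = complex_of_real (L ^ 3) * (\<Sum>k\<in>K. \<Sum>l\<in>K. \<Sum>n\<in>K. if k + l + n = 0 then a k * b l * c n else 0)"
proof -
  let ?Q = "lebesgue_on (cbox 0 (\<chi> i. L)) :: (real ^ 3) measure"
  have int: "integrable ?Q (\<lambda>x. exp (\<i> * complex_of_real (x \<bullet> freq L k)))" for k
    by (rule continuous_imp_integrable) (auto intro!: continuous_intros)
  have "trig_sum L K a x * trig_sum L K b x * trig_sum L K c x
      = (\<Sum>k\<in>K. \<Sum>l\<in>K. \<Sum>n\<in>K. exp (\<i> * complex_of_real (x \<bullet> freq L (k + l + n))) * (a k * b l * c n))" for x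
  proof -
    define e where "e k = exp (\<i> * complex_of_real (x \<bullet> freq L k))" for k
    have "exp (\<i> * complex_of_real (x \<bullet> freq L (k + l + n))) * (a k * b l * c n) = (e k * a k) * (e l * b l) * (e n * c n)" for k l n
    proof -
      have "exp (\<i> * complex_of_real (x \<bullet> freq L (k + l + n))) = e k * e l * e n"
        by (simp add: e_def exp_add inner_add_right distrib_left)
      then show ?thesis by (simp only: ac_simps)
    qed
    then show ?thesis
      unfolding trig_sum_def e_def[symmetric]
      by (simp only: sum_distrib_left[symmetric] sum_distrib_right[symmetric])
  qed
  then have "(LINT x|?Q. trig_sum L K a x * trig_sum L K b x * trig_sum L K c x)
      = (LINT x|?Q. (\<Sum>k\<in>K. \<Sum>l\<in>K. \<Sum>n\<in>K. exp (\<i> * complex_of_real (x \<bullet> freq L (k + l + n))) * (a k * b l * c n)))"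
    by simp
  also have "\<dots> = (\<Sum>k\<in>K. \<Sum>l\<in>K. \<Sum>n\<in>K. (LINT x|?Q. exp (\<i> * complex_of_real (x \<bullet> freq L (k + l + n))) * (a k * b l * c n)))"
    by (subst Bochner_Integration.integral_sum, (intro Bochner_Integration.integrable_sum integrable_mult_left int))+ simp
  also have "\<dots> = (\<Sum>k\<in>K. \<Sum>l\<in>K. \<Sum>n\<in>K. (if k + l + n = 0 then complex_of_real (L ^ 3) else 0) * (a k * b l * c n))"
    by (simp only: integral_mult_left_zero exp_integral[OF L])
  also have "\<dots> = complex_of_real (L ^ 3) * (\<Sum>k\<in>K. \<Sum>l\<in>K. \<Sum>n\<in>K. if k + l + n = 0 then a k * b l * c n else 0)"
    by (auto simp: sum_distrib_left intro!: sum.cong)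
  finally show ?thesis .
qed

lemma Esq_finite_support:
  assumes "finite {k. u k \<noteq> 0}"
  shows "Esq L s u < \<infinity>"
  unfolding Esq_def using assms
  by (subst nn_integral_count_space'[of "{k. u k \<noteq> 0}"]) (auto simp: sum_Pinfty less_top)

lemma trig_polys_iff: "u \<in> trig_polys L \<longleftrightarrow> solen L u \<and> finite {k. u k \<noteq> 0}"
  using Esq_finite_support[of u L 0] by (auto simp: trig_polys_def Vspace_iff)

lemma trig_polysD:
  assumes "u \<in> trig_polys L"
  shows "solen L u" "finite {k. u k \<noteq> 0}"
  using assms by (auto simp: trig_polys_iff)

lemma field_of_eq:
  assumes "u \<in> trig_polys L" "finite K" "{k. u k \<noteq> 0} \<subseteq> K"
  shows "field_of L u x $ i = Re (trig_sum L K (\<lambda>k. u k $ i) x)"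
proof -
  have "(\<Sum>k | u k \<noteq> 0. exp (\<i> * complex_of_real (x \<bullet> freq L k)) * u k $ i) = trig_sum L K (\<lambda>k. u k $ i) x"
    unfolding trig_sum_def using assms by (intro sum.mono_neutral_left) auto
  then show ?thesis unfolding field_of_def by (simp only: vec_lambda_beta)
qed

lemma partial_deriv_trig_sum:
  "partial_deriv j (\<lambda>y. Re (trig_sum L K c y)) x = Re (trig_sum L K (\<lambda>k. \<i> * complex_of_real (freq L k $ j) * c k) x)"
proof -
  have "((\<lambda>y. Re (trig_sum L K c y)) has_derivative
      (\<lambda>h. Re (\<Sum>k\<in>K. exp (\<i> * complex_of_real (x \<bullet> freq L k)) * (\<i> * complex_of_real (h \<bullet> freq L k)) * c k))) (at x)"
    unfolding trig_sum_def
  proof (intro has_derivative_Re has_derivative_sum has_derivative_mult_left)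
    fix k
    have "((\<lambda>y. \<i> * complex_of_real (y \<bullet> freq L k)) has_derivative (\<lambda>h. \<i> * complex_of_real (h \<bullet> freq L k))) (at x)"
      by (intro bounded_linear_imp_has_derivative bounded_linear_const_mult
          bounded_linear_compose[OF bounded_linear_of_real] bounded_linear_inner_left)
    then have "((\<lambda>y. exp (\<i> * complex_of_real (y \<bullet> freq L k))) has_derivative
        (\<lambda>h. (\<i> * complex_of_real (h \<bullet> freq L k)) * exp (\<i> * complex_of_real (x \<bullet> freq L k)))) (at x)"
      using has_derivative_compose[OF _ DERIV_exp[unfolded has_field_derivative_def]] by (simp add: mult.commute)
    then show "((\<lambda>y. exp (\<i> * complex_of_real (y \<bullet> freq L k))) has_derivative
        (\<lambda>h. exp (\<i> * complex_of_real (x \<bullet> freq L k)) * (\<i> * complex_of_real (h \<bullet> freq L k)))) (at x)"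
      by (simp add: mult.commute)
  qed
  then have "frechet_derivative (\<lambda>y. Re (trig_sum L K c y)) (at x)
      = (\<lambda>h. Re (\<Sum>k\<in>K. exp (\<i> * complex_of_real (x \<bullet> freq L k)) * (\<i> * complex_of_real (h \<bullet> freq L k)) * c k))"
    by (rule frechet_derivative_at[symmetric])
  then show ?thesis
    by (simp add: partial_deriv_def trig_sum_def inner_axis' mult.assoc)
qed

text \<open>Integration leaves the triples of frequencies with k + l + n = 0. As p is
  divergence-free, the frequency l of the differentiated field can be replaced by -n, the negative
  of the frequency of r; this is how the derivative moves to the outside. Reality of r turns its
  coefficient at n = -m into a conjugate, which gives the pairing.\<close>

lemma b_trig_eq:
  assumes L: "L > 0" and p: "p \<in> trig_polys L" and q: "q \<in> trig_polys L" and r: "r \<in> trig_polys L"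
  shows "b_trig L p q r = pairing L (Bc L p q) r"
proof -
  define K where "K = {k. p k \<noteq> 0} \<union> {k. q k \<noteq> 0} \<union> {k. r k \<noteq> 0}"
  let ?Q = "lebesgue_on (cbox 0 (\<chi> i. L)) :: (real ^ 3) measure"
  have fin: "finite K" using trig_polysD(2)[OF p] trig_polysD(2)[OF q] trig_polysD(2)[OF r] by (simp add: K_def)
  have sub: "{k. p k \<noteq> 0} \<subseteq> K" "{k. q k \<noteq> 0} \<subseteq> K" "{k. r k \<noteq> 0} \<subseteq> K" by (auto simp: K_def)
  note solp = solenD[OF trig_polysD(1)[OF p]] and solq = solenD[OF trig_polysD(1)[OF q]] and solr = solenD[OF trig_polysD(1)[OF r]]
  have cj0: "cj a = 0 \<longleftrightarrow> a = 0" for a by (metis norm_cj norm_eq_zero)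
  have "- k \<in> K" if "k \<in> K" for k using that by (auto simp: K_def solp(2) solq(2) solr(2) cj0)
  then have neg: "uminus ` K = K" by (auto simp: image_iff) (metis minus_minus)
  have re: "c (- k) $ i = cnj (c k $ i)" if "c (- k) = cj (c k)" for c :: coeffs and k i
    using that by (simp add: cj_def)
  have ip: "complex_of_real (field_of L p x $ j) = trig_sum L K (\<lambda>k. p k $ j) x" for x j
    unfolding field_of_eq[OF p fin sub(1)] by (rule trig_sum_real[OF fin neg]) (rule re[of p, OF solp(2)])
  have ir: "complex_of_real (field_of L r x $ j) = trig_sum L K (\<lambda>k. r k $ j) x" for x j
    unfolding field_of_eq[OF r fin sub(3)] by (rule trig_sum_real[OF fin neg]) (rule re[of r, OF solr(2)])
  have iq: "complex_of_real (partial_deriv j (\<lambda>y. field_of L q y $ i) x)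
      = trig_sum L K (\<lambda>k. \<i> * complex_of_real (freq L k $ j) * q k $ i) x" for x i j
    unfolding field_of_eq[OF q fin sub(2)] partial_deriv_trig_sum
    by (rule trig_sum_real[OF fin neg]) (simp add: re[of q, OF solq(2)])
  have "complex_of_real (b_trig L p q r) = (\<Sum>i\<in>UNIV. \<Sum>j\<in>UNIV. complex_of_real (L ^ 3) *
      (\<Sum>k\<in>K. \<Sum>l\<in>K. \<Sum>n\<in>K. if k + l + n = 0 then p k $ j * (\<i> * complex_of_real (freq L l $ j) * q l $ i) * r n $ i else 0))"
    unfolding b_trig_def of_real_sum
  proof (intro sum.cong refl)
    fix i j
    have "complex_of_real (LINT x|?Q. field_of L p x $ j * partial_deriv j (\<lambda>y. field_of L q y $ i) x * field_of L r x $ i)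
      = (LINT x|?Q. complex_of_real (field_of L p x $ j * partial_deriv j (\<lambda>y. field_of L q y $ i) x * field_of L r x $ i))"
      by (rule integral_complex_of_real[symmetric])
    also have "\<dots> = (LINT x|?Q. trig_sum L K (\<lambda>k. p k $ j) x * trig_sum L K (\<lambda>k. \<i> * complex_of_real (freq L k $ j) * q k $ i) x * trig_sum L K (\<lambda>k. r k $ i) x)"
      by (simp only: of_real_mult ip ir iq)
    also have "\<dots> = complex_of_real (L ^ 3) *
      (\<Sum>k\<in>K. \<Sum>l\<in>K. \<Sum>n\<in>K. if k + l + n = 0 then p k $ j * (\<i> * complex_of_real (freq L l $ j) * q l $ i) * r n $ i else 0)"
      by (rule trig_sum_product_integral[OF L])
    finally show "complex_of_real (LINT x|?Q. field_of L p x $ j * partial_deriv j (\<lambda>y. field_of L q y $ i) x * field_of L r x $ i)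
      = complex_of_real (L ^ 3) *
      (\<Sum>k\<in>K. \<Sum>l\<in>K. \<Sum>n\<in>K. if k + l + n = 0 then p k $ j * (\<i> * complex_of_real (freq L l $ j) * q l $ i) * r n $ i else 0)" .
  qed
  also have "\<dots> = complex_of_real (L ^ 3) * (\<Sum>k\<in>K. \<Sum>l\<in>K. \<Sum>n\<in>K. \<Sum>i\<in>UNIV. \<Sum>j\<in>UNIV.
      if k + l + n = 0 then p k $ j * (\<i> * complex_of_real (freq L l $ j) * q l $ i) * r n $ i else 0)"
  proof -
    have sw: "(\<Sum>i\<in>UNIV. \<Sum>j\<in>UNIV. \<Sum>k\<in>K. \<Sum>l\<in>K. \<Sum>n\<in>K. g i j k l n) = (\<Sum>k\<in>K. \<Sum>l\<in>K. \<Sum>n\<in>K. \<Sum>i\<in>UNIV. \<Sum>j\<in>UNIV. g i j k l n)"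
      for g :: "3 \<Rightarrow> 3 \<Rightarrow> int ^ 3 \<Rightarrow> int ^ 3 \<Rightarrow> int ^ 3 \<Rightarrow> complex"
      by (simp only: sum.swap[of _ K "UNIV :: 3 set"])
    show ?thesis unfolding sw[symmetric] by (simp only: sum_distrib_left)
  qed
  also have "\<dots> = complex_of_real (L ^ 3) * (\<Sum>k\<in>K. \<Sum>l\<in>K. \<Sum>n\<in>K.
      if l = - n - k then \<i> * zdot (- freq L n) (p k) * (\<Sum>i\<in>UNIV. q l $ i * r n $ i) else 0)"
  proof -
    have "(\<Sum>i\<in>UNIV. \<Sum>j\<in>UNIV. if k + l + n = 0 then p k $ j * (\<i> * complex_of_real (freq L l $ j) * q l $ i) * r n $ i else 0)
      = (if l = - n - k then \<i> * zdot (- freq L n) (p k) * (\<Sum>i\<in>UNIV. q l $ i * r n $ i) else 0)" for k l n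
    proof (cases "k + l + n = 0")
      case True
      then have "(k + l + n) - n - k = - n - k" by simp
      then have l: "l = - n - k" by (simp add: algebra_simps)
      \<comment> \<open>Of -n - k only -n survives, because the coefficient of p at k is orthogonal
        to its own frequency.\<close>
      have z: "zdot (freq L l) (p k) = zdot (- freq L n) (p k)"
        unfolding l freq_simps zdot_simps using solp(3)[of k] by simp
      have "(\<Sum>i\<in>UNIV. \<Sum>j\<in>UNIV. p k $ j * (\<i> * complex_of_real (freq L l $ j) * q l $ i) * r n $ i)
        = \<i> * zdot (freq L l) (p k) * (\<Sum>i\<in>UNIV. q l $ i * r n $ i)"
      proof -
        have "p k $ j * (\<i> * complex_of_real (freq L l $ j) * q l $ i) * r n $ i
          = (\<i> * (complex_of_real (freq L l $ j) * p k $ j)) * (q l $ i * r n $ i)" for i j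
          by (simp only: ac_simps)
        then show ?thesis
          unfolding zdot_def by (simp only: sum_distrib_left[symmetric] sum_distrib_right[symmetric])
      qed
      then show ?thesis using True l z by simp
    next
      case False
      then have "l \<noteq> - n - k" by auto
      then show ?thesis using False by simp
    qed
    then show ?thesis by simp
  qed
  also have "\<dots> = complex_of_real (L ^ 3) * (\<Sum>n\<in>K. \<Sum>k\<in>K. \<i> * zdot (- freq L n) (p k) * (\<Sum>i\<in>UNIV. q (- n - k) $ i * r n $ i))"
  proof -
    have "(\<Sum>k\<in>K. \<Sum>l\<in>K. \<Sum>n\<in>K. if l = - n - k then \<i> * zdot (- freq L n) (p k) * (\<Sum>i\<in>UNIV. q l $ i * r n $ i) else 0)
      = (\<Sum>n\<in>K. \<Sum>k\<in>K. \<Sum>l\<in>K. if l = - n - k then \<i> * zdot (- freq L n) (p k) * (\<Sum>i\<in>UNIV. q l $ i * r n $ i) else 0)"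
      by (subst (2) sum.swap, subst sum.swap, rule refl)
    also have "\<dots> = (\<Sum>n\<in>K. \<Sum>k\<in>K. \<i> * zdot (- freq L n) (p k) * (\<Sum>i\<in>UNIV. q (- n - k) $ i * r n $ i))"
    proof (intro sum.cong refl)
      fix n k
      \<comment> \<open>If -n - k is outside K, the sum over l has no matching term, and the right
        side is 0 for the same reason: K contains the support of q.\<close>
      have "q (- n - k) = 0" if "- n - k \<notin> K" using that sub(2) by auto
      then show "(\<Sum>l\<in>K. if l = - n - k then \<i> * zdot (- freq L n) (p k) * (\<Sum>i\<in>UNIV. q l $ i * r n $ i) else 0)
        = \<i> * zdot (- freq L n) (p k) * (\<Sum>i\<in>UNIV. q (- n - k) $ i * r n $ i)"
        using fin by (simp add: sum.delta) 
    qed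
    finally show ?thesis by simp
  qed
  also have "\<dots> = complex_of_real (L ^ 3) * (\<Sum>m\<in>K. \<Sum>k\<in>K. \<i> * zdot (freq L m) (p k) * (\<Sum>i\<in>UNIV. q (m - k) $ i * cnj (r m $ i)))"
  proof -
    have "(\<Sum>n\<in>uminus ` K. \<Sum>k\<in>K. \<i> * zdot (- freq L n) (p k) * (\<Sum>i\<in>UNIV. q (- n - k) $ i * r n $ i))
      = (\<Sum>m\<in>K. \<Sum>k\<in>K. \<i> * zdot (freq L m) (p k) * (\<Sum>i\<in>UNIV. q (m - k) $ i * cnj (r m $ i)))"
      by (subst sum.reindex) (auto simp: inj_on_def re[of r, OF solr(2)])
    then show ?thesis unfolding neg by simp
  qed
  also have "\<dots> = complex_of_real (L ^ 3) * (\<Sum>m\<in>K. \<i> * (\<Sum>i\<in>UNIV. Bsum L p q m $ i * cnj (r m $ i)))"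
  proof -
    have "(\<Sum>k\<in>K. \<i> * zdot (freq L m) (p k) * (\<Sum>i\<in>UNIV. q (m - k) $ i * cnj (r m $ i)))
      = \<i> * (\<Sum>i\<in>UNIV. Bsum L p q m $ i * cnj (r m $ i))" for m
    proof -
      have "Bsum L p q m = (\<Sum>k\<in>K. zdot (freq L m) (p k) *s q (m - k))"
        unfolding Bsum_def
      proof (rule integral_count_space_finite[OF fin])
        fix k assume "k \<notin> K"
        then have "p k = 0" using sub(1) by blast
        then show "zdot (freq L m) (p k) *s q (m - k) = 0" by (simp only: zdot_simps) (simp add: vec_eq_iff)
      qed
      then have "(\<Sum>i\<in>UNIV. Bsum L p q m $ i * cnj (r m $ i))
        = (\<Sum>i\<in>UNIV. \<Sum>k\<in>K. zdot (freq L m) (p k) * (q (m - k) $ i * cnj (r m $ i)))"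
        by (simp add: sum_component sum_distrib_right mult.assoc)
      also have "\<dots> = (\<Sum>k\<in>K. \<Sum>i\<in>UNIV. zdot (freq L m) (p k) * (q (m - k) $ i * cnj (r m $ i)))"
        by (rule sum.swap)
      finally show ?thesis
        by (simp only: sum_distrib_left[symmetric] mult.assoc)
    qed
    then show ?thesis by simp
  qed
  finally have "b_trig L p q r = Re (complex_of_real (L ^ 3) * (\<Sum>m\<in>K. \<i> * (\<Sum>i\<in>UNIV. Bsum L p q m $ i * cnj (r m $ i))))"
    by (metis Re_complex_of_real)
  also have "\<dots> = L ^ 3 * (\<Sum>m\<in>K. Re (\<i> * (\<Sum>i\<in>UNIV. Bsum L p q m $ i * cnj (r m $ i))))"
    by (simp only: Re_sum[symmetric] scaleR_conv_of_real[symmetric] scaleR_complex.sel)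
  also have "\<dots> = L ^ 3 * (\<Sum>m\<in>K. Bc L p q m \<bullet> r m)"
  proof -
    have "Bc L p q m \<bullet> r m = Re (\<i> * (\<Sum>i\<in>UNIV. Bsum L p q m $ i * cnj (r m $ i)))" for m
      unfolding Bc_def using leray_inner[OF solr(3), of \<i> m "Bsum L p q m"] by (simp only: inner_cvec_smult)
    then show ?thesis by (simp only:)
  qed
  also have "\<dots> = pairing L (Bc L p q) r"
  proof -
    have "Bc L p q k \<bullet> r k = 0" if "k \<notin> K" for k
    proof -
      have "r k = 0" using that sub(3) by blast
      then show ?thesis by (simp only: inner_zero_right)
    qed
    then have "(LINT k|count_space UNIV. Bc L p q k \<bullet> r k) = (\<Sum>m\<in>K. Bc L p q m \<bullet> r m)"
      by (rule integral_count_space_finite[OF fin])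
    then show ?thesis by (simp only: pairing_eq)
  qed
  finally show ?thesis .
qed


section \<open>Extension of the trilinear form by continuity\<close>

lemma Vnorm_nonneg [simp]: "L > 0 \<Longrightarrow> Vnorm L s u \<ge> 0"
  by (simp add: Vnorm_eq)

lemma Esq_eq_Vnorm:
  assumes "L > 0" "Esq L s u < \<infinity>"
  shows "Esq L s u = ennreal ((Vnorm L s u)\<^sup>2 / L ^ 3)"
  using assms by (cases "Esq L s u") (auto simp: Vnorm_eq)

lemma Vnorm_add_le:
  assumes L: "L > 0" and u: "Esq L s u < \<infinity>" and v: "Esq L s v < \<infinity>"
  shows "Vnorm L s (\<lambda>k. u k + v k) \<le> 2 * (Vnorm L s u + Vnorm L s v)"
proof -
  have "2 * Esq L s u + 2 * Esq L s v < \<infinity>" using u v by (simp add: ennreal_mult_less_top)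
  then have fin: "Esq L s (\<lambda>k. u k + v k) < \<infinity>" using Esq_add le_less_trans by blast
  have "enn2real (Esq L s (\<lambda>k. u k + v k)) \<le> enn2real (2 * Esq L s u + 2 * Esq L s v)"
    using Esq_add u v by (intro enn2real_mono) (auto simp: ennreal_mult_less_top)
  also have "\<dots> = 2 * enn2real (Esq L s u) + 2 * enn2real (Esq L s v)"
    using u v by (subst enn2real_plus) (auto simp: ennreal_mult_less_top enn2real_mult)
  finally have "L ^ 3 * enn2real (Esq L s (\<lambda>k. u k + v k)) \<le> L ^ 3 * (2 * enn2real (Esq L s u) + 2 * enn2real (Esq L s v))"
    using L by (intro mult_left_mono) auto
  then have "(Vnorm L s (\<lambda>k. u k + v k))\<^sup>2 \<le> 2 * (Vnorm L s u)\<^sup>2 + 2 * (Vnorm L s v)\<^sup>2"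
    using L by (simp add: Vnorm_eq distrib_left mult.left_commute[of 2])
  also have "\<dots> \<le> (2 * (Vnorm L s u + Vnorm L s v))\<^sup>2"
  proof -
    have "2 * x\<^sup>2 + 2 * y\<^sup>2 \<le> (2 * (x + y))\<^sup>2" if "x \<ge> 0" "y \<ge> 0" for x y :: real
    proof -
      have "(2 * (x + y))\<^sup>2 = 2 * x\<^sup>2 + 2 * y\<^sup>2 + (2 * x\<^sup>2 + 2 * y\<^sup>2 + 8 * (x * y))"
        by (simp add: power2_eq_square algebra_simps)
      then show ?thesis using that by (simp add: add_nonneg_nonneg)
    qed
    then show ?thesis using Vnorm_nonneg[OF L] by blast
  qed
  finally show ?thesis by (rule power2_le_imp_le) (simp add: L)
qed

text \<open>Finiteness matters: \<open>enn2real\<close> sends infinity to 0, so \<open>Vdist\<close>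
  would report the distance 0 for a difference of infinite norm.\<close>

lemma tendsto_Vdist_iff:
  assumes L: "L > 0" and fin: "\<And>n. Esq L s (\<lambda>k. p n k - u k) < \<infinity>"
  shows "((\<lambda>n. Vdist L s (p n) u) \<longlongrightarrow> 0) F \<longleftrightarrow> ((\<lambda>n. Esq L s (\<lambda>k. p n k - u k)) \<longlongrightarrow> 0) F"
proof
  assume "((\<lambda>n. Esq L s (\<lambda>k. p n k - u k)) \<longlongrightarrow> 0) F"
  then have "((\<lambda>n. enn2real (Esq L s (\<lambda>k. p n k - u k))) \<longlongrightarrow> 0) F"
    using tendsto_enn2real[of "\<lambda>n. Esq L s (\<lambda>k. p n k - u k)" 0 F] by simp
  then have "((\<lambda>n. sqrt (L ^ 3 * enn2real (Esq L s (\<lambda>k. p n k - u k)))) \<longlongrightarrow> sqrt (L ^ 3 * 0)) F"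
    by (intro tendsto_real_sqrt tendsto_mult tendsto_const)
  then show "((\<lambda>n. Vdist L s (p n) u) \<longlongrightarrow> 0) F" by (simp add: Vdist_def Vnorm_eq)
next
  assume "((\<lambda>n. Vdist L s (p n) u) \<longlongrightarrow> 0) F"
  then have "((\<lambda>n. ennreal ((Vdist L s (p n) u)\<^sup>2 / L ^ 3)) \<longlongrightarrow> ennreal (0\<^sup>2 / L ^ 3)) F"
    using L by (intro tendsto_intros) auto
  then show "((\<lambda>n. Esq L s (\<lambda>k. p n k - u k)) \<longlongrightarrow> 0) F"
    using L fin by (simp add: Vdist_def Esq_eq_Vnorm[symmetric])
qed

text \<open>A cut-off by the modulus of the frequency is symmetric under k to -k, hence it keeps the
  field real; being a cut-off of whole coefficients, it keeps it divergence-free.\<close>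

definition trunc :: "real \<Rightarrow> nat \<Rightarrow> coeffs \<Rightarrow> coeffs" where
  "trunc L n u = (\<lambda>k. if norm (freq L k) \<le> real n then u k else 0)"

lemma finite_freq_le:
  assumes "L > 0"
  shows "finite {k. norm (freq L k) \<le> r}"
proof -
  define M where "M = \<lceil>r * L / (2 * pi)\<rceil>"
  have "finite (vec_lambda ` (PiE (UNIV :: 3 set) (\<lambda>_. {- M..M})))"
    by (intro finite_imageI finite_PiE) auto
  moreover have "{k. norm (freq L k) \<le> r} \<subseteq> vec_lambda ` (PiE (UNIV :: 3 set) (\<lambda>_. {- M..M}))"
  proof
    fix k assume k: "k \<in> {k. norm (freq L k) \<le> r}"
    have "\<bar>k $ i\<bar> \<le> M" for i
    proof -
      have "2 * pi / L * \<bar>real_of_int (k $ i)\<bar> \<le> r" using freq_ge_component[OF assms, of k i] k by simp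
      then have "\<bar>real_of_int (k $ i)\<bar> \<le> r * L / (2 * pi)" using assms by (simp add: field_simps)
      then have "real_of_int \<bar>k $ i\<bar> \<le> real_of_int M" unfolding M_def by linarith
      then show ?thesis by linarith
    qed
    then have "vec_nth k \<in> PiE UNIV (\<lambda>_. {- M..M})" by (auto simp: abs_le_iff) (metis minus_le_iff)
    then show "k \<in> vec_lambda ` (PiE (UNIV :: 3 set) (\<lambda>_. {- M..M}))" by (metis imageI vec_nth_inverse)
  qed
  ultimately show ?thesis by (rule finite_subset[rotated])
qed

lemma trunc_trig:
  assumes "L > 0" "solen L u"
  shows "trunc L n u \<in> trig_polys L"
proof -
  have sol: "solen L (trunc L n u)" using assms(2) by (simp add: solen_iff trunc_def)
  have fin: "finite {k. trunc L n u k \<noteq> 0}"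
    by (rule finite_subset[OF _ finite_freq_le[OF assms(1), of "real n"]]) (auto simp: trunc_def)
  show ?thesis using sol fin by (simp add: trig_polys_iff)
qed

lemma Esq_trunc_tendsto:
  assumes "Esq L s u < \<infinity>"
  shows "(\<lambda>n. Esq L s (\<lambda>k. trunc L n u k - u k)) \<longlonglongrightarrow> 0"
proof -
  have "(\<lambda>n. \<integral>\<^sup>+k. ennreal ((wt L s k * norm (trunc L n u k - u k))\<^sup>2) \<partial>count_space UNIV)
      \<longlonglongrightarrow> (\<integral>\<^sup>+k. 0 \<partial>count_space (UNIV :: (int ^ 3) set))"
  proof (rule nn_integral_dominated_convergence[where w = "\<lambda>k. ennreal ((wt L s k * norm (u k))\<^sup>2)"])
    show "(\<integral>\<^sup>+k. ennreal ((wt L s k * norm (u k))\<^sup>2) \<partial>count_space UNIV) < \<infinity>"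
      using assms by (simp add: Esq_def)
    show "AE k in count_space UNIV. (\<lambda>n. ennreal ((wt L s k * norm (trunc L n u k - u k))\<^sup>2)) \<longlonglongrightarrow> 0"
    proof (rule AE_I2)
      fix k
      have "eventually (\<lambda>n. norm (freq L k) \<le> real n) sequentially"
        using filterlim_real_sequentially by (auto simp: filterlim_at_top)
      then have "eventually (\<lambda>n. 0 = ennreal ((wt L s k * norm (trunc L n u k - u k))\<^sup>2)) sequentially"
        by eventually_elim (simp add: trunc_def)
      then show "(\<lambda>n. ennreal ((wt L s k * norm (trunc L n u k - u k))\<^sup>2)) \<longlonglongrightarrow> 0"
        by (rule Lim_transform_eventually[OF tendsto_const])
    qed
  qed (auto simp: trunc_def)
  then show ?thesis by (simp add: Esq_def)
qed

definition trilin :: "real \<Rightarrow> coeffs \<Rightarrow> coeffs \<Rightarrow> coeffs \<Rightarrow> real" where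
  "trilin L u v w = pairing L (Bc L u v) w"

lemma Bc_Esq_0:
  assumes "L > 0" "a > 1/2" "u \<in> Vspace L (1 + a)" "v \<in> Vspace L (1 + a)"
  shows "Esq L 0 (Bc L u v) < \<infinity>"
proof -
  have "Esq L (1 - 1) (Bc L u v) \<le> Bconst L (1 + a) 1 * (Esq L (1 + a) u * Esq L 1 v)"
    using assms by (intro Bc_bound) (auto simp: Vspace_iff solenD)
  also have "\<dots> < \<infinity>"
    using assms Bconst_finite[of L "1 + a" 1] Esq_finite_mono[of L 1 "1 + a" v]
    by (auto simp: ennreal_mult_less_top Vspace_iff)
  finally show ?thesis by simp
qed

lemma trilin_bound:
  assumes L: "L > 0" and a: "a > 1/2"
  obtains M where "M \<ge> 0" "\<And>u v w. u \<in> Vspace L (1 + a) \<Longrightarrow> v \<in> Vspace L (1 + a) \<Longrightarrow> w \<in> Vspace L (1 + a) \<Longrightarrow>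
     \<bar>trilin L u v w\<bar> \<le> M * Vnorm L (1 + a) u * Vnorm L (1 + a) v * Vnorm L (1 + a) w"
proof -
  obtain B where B: "Bconst L (1 + a) 1 = ennreal B" "B \<ge> 0"
    using Bconst_finite[OF L, of "1 + a" 1] a by (cases "Bconst L (1 + a) 1") auto
  \<comment> \<open>The numerator collects the squared volume from the pairing, the constant of
    \<open>Bc_bound\<close> at s = 1, and the embeddings for v and w. The denominator converts three
    values of \<open>Esq\<close> into squares of \<open>Vnorm\<close>.\<close>
  define K where "K = (L ^ 3)\<^sup>2 * (B * (wt_const L 1 (1 + a))\<^sup>2 * (wt_const L 0 (1 + a))\<^sup>2) / (L ^ 3) ^ 3"
  have K: "K \<ge> 0" using L B by (simp add: K_def)
  have "\<bar>trilin L u v w\<bar> \<le> sqrt K * Vnorm L (1 + a) u * Vnorm L (1 + a) v * Vnorm L (1 + a) w"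
    if u: "u \<in> Vspace L (1 + a)" and v: "v \<in> Vspace L (1 + a)" and w: "w \<in> Vspace L (1 + a)" for u v w
  proof -
    let ?E = "Esq L (1 + a)"
    have fin: "?E u < \<infinity>" "?E v < \<infinity>" "?E w < \<infinity>" using u v w by (auto simp: Vspace_iff)
    have "ennreal ((trilin L u v w)\<^sup>2) \<le> ennreal ((L ^ 3)\<^sup>2) * (Esq L 0 (Bc L u v) * Esq L 0 w)"
      using pairing_sq_le[where L = L and u = "Bc L u v" and v = w and s = 0] L by (simp add: trilin_def)
    also have "\<dots> \<le> ennreal ((L ^ 3)\<^sup>2) * ((Bconst L (1 + a) 1 * (?E u * Esq L 1 v)) * Esq L 0 w)"
      using Bc_bound[of L 1 "1 + a" u v] u v a L
      by (intro mult_left_mono mult_right_mono) (auto simp: Vspace_iff solenD)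
    also have "\<dots> \<le> ennreal ((L ^ 3)\<^sup>2) * ((ennreal B * (?E u * (ennreal ((wt_const L 1 (1 + a))\<^sup>2) * ?E v))) * (ennreal ((wt_const L 0 (1 + a))\<^sup>2) * ?E w))"
      unfolding B(1) using L a by (intro mult_left_mono mult_mono Esq_mono_exp) auto
    also have "\<dots> = ennreal (K * ((Vnorm L (1 + a) u)\<^sup>2 * (Vnorm L (1 + a) v)\<^sup>2 * (Vnorm L (1 + a) w)\<^sup>2))"
      unfolding fin[THEN Esq_eq_Vnorm[OF L]] using L B K
      by (simp add: K_def field_simps flip: ennreal_mult)
    finally have "(trilin L u v w)\<^sup>2 \<le> K * ((Vnorm L (1 + a) u)\<^sup>2 * (Vnorm L (1 + a) v)\<^sup>2 * (Vnorm L (1 + a) w)\<^sup>2)"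
      using K by (simp add: ennreal_le_iff)
    also have "\<dots> = (sqrt K * Vnorm L (1 + a) u * Vnorm L (1 + a) v * Vnorm L (1 + a) w)\<^sup>2"
      using K by (simp add: power_mult_distrib)
    finally have "\<bar>trilin L u v w\<bar>\<^sup>2 \<le> (sqrt K * Vnorm L (1 + a) u * Vnorm L (1 + a) v * Vnorm L (1 + a) w)\<^sup>2"
      by simp
    then show ?thesis by (rule power2_le_imp_le) (simp add: L K)
  qed
  then show ?thesis using that[of "sqrt K"] K by auto
qed

lemma Vspace_diff: "u \<in> Vspace L s \<Longrightarrow> v \<in> Vspace L s \<Longrightarrow> (\<lambda>k. u k - v k) \<in> Vspace L s"
  using Esq_diff[of L s u v] by (auto simp: Vspace_iff solen_diff ennreal_mult_less_top intro: le_less_trans)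

lemma pairing_diff_left:
  assumes "L > 0" "u 0 = 0" "v 0 = 0" "Esq L s u < \<infinity>" "Esq L s v < \<infinity>" "Esq L (- s) w < \<infinity>"
  shows "pairing L (\<lambda>k. u k - v k) w = pairing L u w - pairing L v w"
  using integrable_pairing[OF assms(1,2,4,6)] integrable_pairing[OF assms(1,3,5,6)]
  by (simp add: pairing_eq inner_diff_left right_diff_distrib)

lemma pairing_diff_right:
  assumes "L > 0" "u 0 = 0" "Esq L s u < \<infinity>" "Esq L (- s) v < \<infinity>" "Esq L (- s) w < \<infinity>"
  shows "pairing L u (\<lambda>k. v k - w k) = pairing L u v - pairing L u w"
  using integrable_pairing[OF assms(1,2,3,4)] integrable_pairing[OF assms(1,2,3,5)]
  by (simp add: pairing_eq inner_diff_right right_diff_distrib)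

lemma trilin_tendsto:
  assumes L: "L > 0" and a: "a > 1/2"
    and u: "u \<in> Vspace L (1 + a)" and v: "v \<in> Vspace L (1 + a)" and w: "w \<in> Vspace L (1 + a)"
    and p: "\<And>n. p n \<in> Vspace L (1 + a)" and q: "\<And>n. q n \<in> Vspace L (1 + a)" and r: "\<And>n. r n \<in> Vspace L (1 + a)"
    and lim: "(\<lambda>n. Vdist L (1 + a) (p n) u) \<longlonglongrightarrow> 0" "(\<lambda>n. Vdist L (1 + a) (q n) v) \<longlonglongrightarrow> 0"
      "(\<lambda>n. Vdist L (1 + a) (r n) w) \<longlonglongrightarrow> 0"
  shows "(\<lambda>n::nat. trilin L (p n) (q n) (r n)) \<longlonglongrightarrow> trilin L u v w"
proof -
  let ?N = "Vnorm L (1 + a)" and ?D = "Vdist L (1 + a)"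
  obtain M where M: "M \<ge> 0" "\<And>u v w. u \<in> Vspace L (1 + a) \<Longrightarrow> v \<in> Vspace L (1 + a) \<Longrightarrow> w \<in> Vspace L (1 + a) \<Longrightarrow>
     \<bar>trilin L u v w\<bar> \<le> M * ?N u * ?N v * ?N w" using trilin_bound[OF L a] by blast
  have V0: "x 0 = 0 \<and> Esq L 0 x < \<infinity> \<and> Esq L (1 + a) x < \<infinity>" if "x \<in> Vspace L (1 + a)" for x
    using that Esq_finite_mono[of L 0 "1 + a" x] L a by (auto simp: Vspace_iff solenD)
  have dl: "trilin L (\<lambda>k. x k - y k) z h = trilin L x z h - trilin L y z h"
    if "x \<in> Vspace L (1 + a)" "y \<in> Vspace L (1 + a)" "z \<in> Vspace L (1 + a)" "h \<in> Vspace L (1 + a)" for x y z h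
  proof -
    have "Bc L (\<lambda>k. x k - y k) z = (\<lambda>m. Bc L x z m - Bc L y z m)"
      by (rule ext, rule Bc_diff_left[OF L]) (use that V0 in auto)
    then show ?thesis unfolding trilin_def
      using pairing_diff_left[OF L, of "Bc L x z" "Bc L y z" 0 h] Bc_Esq_0[OF L a] V0 that by auto
  qed
  have dm: "trilin L x (\<lambda>k. y k - z k) h = trilin L x y h - trilin L x z h"
    if "x \<in> Vspace L (1 + a)" "y \<in> Vspace L (1 + a)" "z \<in> Vspace L (1 + a)" "h \<in> Vspace L (1 + a)" for x y z h
  proof -
    have "Bc L x (\<lambda>k. y k - z k) = (\<lambda>m. Bc L x y m - Bc L x z m)"
      by (rule ext, rule Bc_diff_right[OF L]) (use that V0 in auto)
    then show ?thesis unfolding trilin_def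
      using pairing_diff_left[OF L, of "Bc L x y" "Bc L x z" 0 h] Bc_Esq_0[OF L a] V0 that by auto
  qed
  have dr: "trilin L x y (\<lambda>k. z k - h k) = trilin L x y z - trilin L x y h"
    if "x \<in> Vspace L (1 + a)" "y \<in> Vspace L (1 + a)" "z \<in> Vspace L (1 + a)" "h \<in> Vspace L (1 + a)" for x y z h
    unfolding trilin_def
    using pairing_diff_right[OF L, of "Bc L x y" 0 z h] Bc_Esq_0[OF L a] V0 that by auto
  \<comment> \<open>One argument is exchanged at a time. The norms of \<open>q n\<close> and
    \<open>r n\<close> that occur on the way are replaced by twice the norm of the limit plus the
    distance to it, so that R tends to 0.\<close>
  define R where "R n = M * ?D (p n) u * (2 * (?N v + ?D (q n) v)) * (2 * (?N w + ?D (r n) w))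
      + M * ?N u * ?D (q n) v * (2 * (?N w + ?D (r n) w)) + M * ?N u * ?N v * ?D (r n) w" for n
  have bd: "?N (x n) \<le> 2 * (?N y + ?D (x n) y)" if "x n \<in> Vspace L (1 + a)" "y \<in> Vspace L (1 + a)" for x :: "nat \<Rightarrow> coeffs" and y n
    using Vnorm_add_le[OF L, of "1 + a" y "\<lambda>k. x n k - y k"] V0 Vspace_diff that unfolding Vdist_def by auto
  have le: "\<bar>trilin L (p n) (q n) (r n) - trilin L u v w\<bar> \<le> R n" for n
  proof -
    have "trilin L (p n) (q n) (r n) - trilin L u v w = trilin L (\<lambda>k. p n k - u k) (q n) (r n)
        + trilin L u (\<lambda>k. q n k - v k) (r n) + trilin L u v (\<lambda>k. r n k - w k)"
      using dl[OF p u q r] dm[OF u q v r] dr[OF u v r w] by simp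
    moreover have "\<bar>trilin L (\<lambda>k. p n k - u k) (q n) (r n)\<bar> \<le> M * ?D (p n) u * (2 * (?N v + ?D (q n) v)) * (2 * (?N w + ?D (r n) w))"
      by (rule order_trans[OF M(2)[OF Vspace_diff[OF p u] q r, folded Vdist_def]])
        (intro mult_mono bd q r v w order_refl mult_nonneg_nonneg add_nonneg_nonneg; simp add: L M Vdist_def)
    moreover have "\<bar>trilin L u (\<lambda>k. q n k - v k) (r n)\<bar> \<le> M * ?N u * ?D (q n) v * (2 * (?N w + ?D (r n) w))"
      by (rule order_trans[OF M(2)[OF u Vspace_diff[OF q v] r, folded Vdist_def]])
        (intro mult_mono bd q r v w order_refl mult_nonneg_nonneg add_nonneg_nonneg; simp add: L M Vdist_def)
    moreover have "\<bar>trilin L u v (\<lambda>k. r n k - w k)\<bar> \<le> M * ?N u * ?N v * ?D (r n) w"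
      using M(2)[OF u v Vspace_diff[OF r w]] by (simp add: Vdist_def)
    ultimately show ?thesis unfolding R_def by linarith
  qed
  have "R \<longlonglongrightarrow> M * 0 * (2 * (?N v + 0)) * (2 * (?N w + 0)) + M * ?N u * 0 * (2 * (?N w + 0)) + M * ?N u * ?N v * 0"
    unfolding R_def by (intro tendsto_intros lim)
  then have "R \<longlonglongrightarrow> 0" by simp
  then have "(\<lambda>n. trilin L (p n) (q n) (r n) - trilin L u v w) \<longlonglongrightarrow> 0"
    by (rule Lim_null_comparison[rotated]) (simp add: le)
  then show ?thesis by (rule LIM_zero_cancel)
qed

lemma trig_in_Vspace: "u \<in> trig_polys L \<Longrightarrow> u \<in> Vspace L s"
  using Esq_finite_support[of u L s] by (simp add: trig_polys_iff Vspace_iff)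

text \<open>Continuity of \<open>trilin\<close> shows that its value satisfies the description. For
  uniqueness at least one admissible triple of sequences must exist, since otherwise every c would
  qualify; the truncations provide it.\<close>

lemma b_form_eq:
  assumes L: "L > 0" and a: "a > 1/2"
    and u: "u \<in> Vspace L (1 + a)" and v: "v \<in> Vspace L (1 + a)" and w: "w \<in> Vspace L (1 + a)"
  shows "b_form L (1 + a) a (1 + a) u v w = pairing L (Bc L u v) w"
proof -
  have conv: "(\<lambda>n. b_trig L (p n) (q n) (r n)) \<longlonglongrightarrow> trilin L u v w"
    if "\<forall>n. p n \<in> trig_polys L \<and> q n \<in> trig_polys L \<and> r n \<in> trig_polys L"
      "(\<lambda>n. Vdist L (1 + a) (p n) u) \<longlonglongrightarrow> 0" "(\<lambda>n. Vdist L (1 + a) (q n) v) \<longlonglongrightarrow> 0"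
      "(\<lambda>n. Vdist L (1 + a) (r n) w) \<longlonglongrightarrow> 0" for p q r :: "nat \<Rightarrow> coeffs"
  proof -
    have "b_trig L (p n) (q n) (r n) = trilin L (p n) (q n) (r n)" for n
      unfolding trilin_def by (rule b_trig_eq[OF L]) (use that in auto)
    then show ?thesis
      using trilin_tendsto[OF L a u v w _ _ _ that(2-4)] that(1) trig_in_Vspace by auto
  qed
  have app: "(\<lambda>n. Vdist L (1 + a) (trunc L n x) x) \<longlonglongrightarrow> 0" if x: "x \<in> Vspace L (1 + a)" for x
  proof -
    have "trunc L n x \<in> Vspace L (1 + a)" for n
      using x trunc_trig[OF L, of x n] trig_in_Vspace by (simp add: Vspace_iff)
    from Vspace_diff[OF this x] have "Esq L (1 + a) (\<lambda>k. trunc L n x k - x k) < \<infinity>" for n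
      by (simp add: Vspace_iff)
    then show ?thesis
      using x by (subst tendsto_Vdist_iff[OF L]) (auto simp: Vspace_iff intro!: Esq_trunc_tendsto)
  qed
  have sol: "solen L u" "solen L v" "solen L w" using u v w by (auto simp: Vspace_iff)
  show ?thesis
    unfolding b_form_def add.commute[of a 1] trilin_def[symmetric]
  proof (rule the_equality)
    show "\<forall>p q r. (\<forall>n. p n \<in> trig_polys L \<and> q n \<in> trig_polys L \<and> r n \<in> trig_polys L) \<and>
       (\<lambda>n. Vdist L (1 + a) (p n) u) \<longlonglongrightarrow> 0 \<and> (\<lambda>n. Vdist L (1 + a) (q n) v) \<longlonglongrightarrow> 0 \<and>
       (\<lambda>n. Vdist L (1 + a) (r n) w) \<longlonglongrightarrow> 0 \<longrightarrow> (\<lambda>n. b_trig L (p n) (q n) (r n)) \<longlonglongrightarrow> trilin L u v w"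
      using conv by blast
    fix c
    assume c: "\<forall>p q r. (\<forall>n. p n \<in> trig_polys L \<and> q n \<in> trig_polys L \<and> r n \<in> trig_polys L) \<and>
       (\<lambda>n. Vdist L (1 + a) (p n) u) \<longlonglongrightarrow> 0 \<and> (\<lambda>n. Vdist L (1 + a) (q n) v) \<longlonglongrightarrow> 0 \<and>
       (\<lambda>n. Vdist L (1 + a) (r n) w) \<longlonglongrightarrow> 0 \<longrightarrow> (\<lambda>n. b_trig L (p n) (q n) (r n)) \<longlonglongrightarrow> c"
    have t: "\<forall>n. trunc L n u \<in> trig_polys L \<and> trunc L n v \<in> trig_polys L \<and> trunc L n w \<in> trig_polys L"
      using trunc_trig[OF L] sol by blast
    have "(\<lambda>n. b_trig L (trunc L n u) (trunc L n v) (trunc L n w)) \<longlonglongrightarrow> c"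
      using c[rule_format, of "\<lambda>n. trunc L n u" "\<lambda>n. trunc L n v" "\<lambda>n. trunc L n w"] t app[OF u] app[OF v] app[OF w] by blast
    then show "c = trilin L u v w"
      using conv[OF t app[OF u] app[OF v] app[OF w]] LIMSEQ_unique by blast
  qed
qed

section \<open>Single Fourier modes as test fields and the operator \<open>B_op\<close>\<close>

definition mode :: "int ^ 3 \<Rightarrow> complex ^ 3 \<Rightarrow> coeffs" where
  "mode m a = (\<lambda>k. if k = m then a else if k = - m then cj a else 0)"

lemma neg_ne: "m \<noteq> 0 \<Longrightarrow> - m \<noteq> (m :: int ^ 3)"
  by (auto simp: vec_eq_iff)

lemma mode_trig:
  assumes "m \<noteq> 0" "zdot (freq L m) a = 0"
  shows "mode m a \<in> trig_polys L"
proof -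
  have sol: "solen L (mode m a)"
    using assms neg_ne[OF assms(1)] unfolding solen_iff by (auto simp: mode_def)
  have fin: "finite {k. mode m a k \<noteq> 0}"
    by (rule finite_subset[of _ "{m, - m}"]) (auto simp: mode_def)
  show ?thesis using sol fin by (simp add: trig_polys_iff)
qed

lemma cj_inner: "cj a \<bullet> cj b = a \<bullet> b"
  by (simp add: inner_vec_def cj_def inner_complex_def)

text \<open>The factor 2 arises because a real field has to be supported on m and -m together, and
  both frequencies contribute the same amount.\<close>

lemma pairing_mode:
  assumes "solen L u" "m \<noteq> 0"
  shows "pairing L u (mode m a) = 2 * L ^ 3 * (u m \<bullet> a)"
proof -
  have "(LINT k|count_space UNIV. u k \<bullet> mode m a k) = (\<Sum>k\<in>{m, - m}. u k \<bullet> mode m a k)"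
    by (rule integral_count_space_finite) (auto simp: mode_def)
  also have "\<dots> = 2 * (u m \<bullet> a)"
    using neg_ne[OF assms(2)] solenD(2)[OF assms(1), of m] by (auto simp: mode_def cj_inner)
  finally show ?thesis by (simp add: pairing_eq)
qed

lemma B_op_eq:
  assumes L: "L > 0" and a: "a > 1/2"
    and u: "u \<in> Vspace L (1 + a)" and v: "v \<in> Vspace L (1 + a)"
  shows "B_op L (1 + a) a (1 + a) u v = Bc L u v"
  unfolding B_op_def
proof (rule the_equality)
  have sol: "solen L (Bc L u v)" using u v by (auto simp: Vspace_iff intro: solen_Bc)
  show "Bc L u v \<in> Vspace L (- (1 + a)) \<and> (\<forall>w\<in>Vspace L (1 + a). pairing L (Bc L u v) w = b_form L (1 + a) a (1 + a) u v w)"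
    using Bc_Esq_0[OF L a u v] sol b_form_eq[OF L a u v] Esq_finite_mono[of L "- (1 + a)" 0 "Bc L u v"] L a
    by (auto simp: Vspace_iff)
  fix z
  assume z: "z \<in> Vspace L (- (1 + a)) \<and> (\<forall>w\<in>Vspace L (1 + a). pairing L z w = b_form L (1 + a) a (1 + a) u v w)"
  then have solz: "solen L z" by (simp add: Vspace_iff)
  show "z = Bc L u v"
  proof
    fix m
    show "z m = Bc L u v m"
    proof (cases "m = 0")
      case False
      \<comment> \<open>The difference itself serves as amplitude of the test mode. It is orthogonal
        to the frequency of m, hence admissible, and testing with it gives |d|^2 = 0.\<close>
      define d where "d = z m - Bc L u v m"
      have "zdot (freq L m) d = 0" by (simp add: d_def solenD(3)[OF solz] solenD(3)[OF sol])
      then have t: "mode m d \<in> Vspace L (1 + a)" by (intro trig_in_Vspace mode_trig False)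
      have "pairing L z (mode m d) = pairing L (Bc L u v) (mode m d)"
        using z t b_form_eq[OF L a u v t] by auto
      then have "z m \<bullet> d = Bc L u v m \<bullet> d"
        using L by (simp add: pairing_mode[OF solz False] pairing_mode[OF sol False])
      then have "d \<bullet> d = 0" by (simp add: d_def inner_diff_left)
      then show ?thesis by (simp add: d_def)
    qed (simp add: solenD(1)[OF solz])
  qed
qed


section \<open>Primitives of integrable functions\<close>

text \<open>An absolutely continuous function is represented throughout as a constant plus
  \<open>prim g\<close> with g integrable. This form stands in for a derivative that exists almost
  everywhere only.\<close>

definition prim :: "(real \<Rightarrow> 'a::euclidean_space) \<Rightarrow> real \<Rightarrow> 'a" where
  "prim f t = (LINT r:{0..t}|lborel. f r)"

lemma prim_measurable [measurable (raw)]: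
  assumes [measurable]: "f \<in> borel_measurable borel"
  shows "prim f \<in> borel_measurable borel"
  unfolding prim_def set_lebesgue_integral_def indicator_def
  by (rule sigma_finite_measure.borel_measurable_lebesgue_integral[OF sigma_finite_lborel]) simp

lemma prim_0 [simp]: "prim f 0 = 0"
proof -
  have "AE r in lborel. indicator {0..0} r *\<^sub>R f r = 0"
    using AE_lborel_singleton[of "0::real"] by eventually_elim auto
  then show ?thesis
    unfolding prim_def set_lebesgue_integral_def by (rule integral_eq_zero_AE)
qed

lemma set_integrable_Icc_mono:
  fixes f :: "real \<Rightarrow> 'a::{banach, second_countable_topology}"
  shows "set_integrable lborel {a..T} f \<Longrightarrow> t \<le> T \<Longrightarrow> set_integrable lborel {a..t} f"
  by (erule set_integrable_subset) auto

lemma prim_add: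
  assumes "set_integrable lborel {0..t} f" "set_integrable lborel {0..t} g"
  shows "prim (\<lambda>r. f r + g r) t = prim f t + prim g t"
  unfolding prim_def using assms by (rule set_integral_add)

lemma prim_diff:
  assumes "set_integrable lborel {0..t} f" "set_integrable lborel {0..t} g"
  shows "prim (\<lambda>r. f r - g r) t = prim f t - prim g t"
  unfolding prim_def using assms by (rule set_integral_diff)

lemma prim_linear:
  assumes "bounded_linear h" "set_integrable lborel {0..t} f"
  shows "prim (\<lambda>r. h (f r)) t = h (prim f t)" "set_integrable lborel {0..t} (\<lambda>r. h (f r))"
proof -
  have *: "indicator {0..t} r *\<^sub>R h (f r) = h (indicator {0..t} r *\<^sub>R f r)" for r
    using assms(1) by (simp add: linear_simps)
  show "prim (\<lambda>r. h (f r)) t = h (prim f t)"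
    using integral_bounded_linear[OF assms(1) assms(2)[unfolded set_integrable_def]]
    by (simp add: prim_def set_lebesgue_integral_def *)
  show "set_integrable lborel {0..t} (\<lambda>r. h (f r))"
    using integrable_bounded_linear[OF assms(1) assms(2)[unfolded set_integrable_def]]
    by (simp add: set_integrable_def *)
qed

lemma prim_cong: "(\<And>r. r \<in> {0..t} \<Longrightarrow> f r = g r) \<Longrightarrow> prim f t = prim g t"
  unfolding prim_def by (rule set_lebesgue_integral_cong) auto

lemma prim_cong_AE:
  assumes "f \<in> borel_measurable borel" "g \<in> borel_measurable borel"
    "AE r in lborel. r \<in> {0..t} \<longrightarrow> f r = g r"
  shows "prim f t = prim g t"
  unfolding prim_def using assms by (intro set_lebesgue_integral_cong_AE) (auto simp: set_borel_measurable_def)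

lemma norm_prim_le:
  assumes "set_integrable lborel {0..t} f"
  shows "ennreal (norm (prim f t)) \<le> (\<integral>\<^sup>+r\<in>{0..t}. ennreal (norm (f r)) \<partial>lborel)"
proof -
  have "ennreal (norm (prim f t)) \<le> (\<integral>\<^sup>+r. ennreal (norm (indicator {0..t} r *\<^sub>R f r)) \<partial>lborel)"
    unfolding prim_def set_lebesgue_integral_def
    using assms by (intro integral_norm_bound_ennreal) (simp add: set_integrable_def)
  also have "\<dots> = (\<integral>\<^sup>+r\<in>{0..t}. ennreal (norm (f r)) \<partial>lborel)"
    by (intro nn_integral_cong) (auto simp: indicator_def)
  finally show ?thesis .
qed

lemma continuous_on_prim:
  assumes "set_integrable lborel {0..T} f"
  shows "continuous_on {0..T} (prim f)"
proof -
  have "prim f t = integral {0..t} f" if "t \<in> {0..T}" for t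
    unfolding prim_def using that
    by (intro set_borel_integral_eq_integral set_integrable_Icc_mono[OF assms]) auto
  moreover have "continuous_on {0..T} (\<lambda>t. integral {0..t} f)"
    by (intro indefinite_integral_continuous_1 set_borel_integral_eq_integral(1)[OF assms])
  ultimately show ?thesis by (auto intro: continuous_on_eq[where f = "\<lambda>t. integral {0..t} f"])
qed

lemma prim_diff_eq:
  assumes "set_integrable lborel {0..t} f" "0 \<le> s" "s \<le> t"
  shows "prim f t - prim f s = (LINT r:{s..t}|lborel. f r)"
proof -
  have i: "set_integrable lborel {0..s} f" "set_integrable lborel {s<..t} f"
    using assms by (auto elim!: set_integrable_subset)
  have "{0..t} = {0..s} \<union> {s<..t}" using assms by auto
  then have "prim f t = prim f s + (LINT r:{s<..t}|lborel. f r)"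
    unfolding prim_def using i by (simp only:) (rule set_integral_Un, auto)
  also have "(LINT r:{s<..t}|lborel. f r) = (LINT r:{s..t}|lborel. f r)"
    unfolding set_lebesgue_integral_def
  proof (rule Bochner_Integration.integral_cong_AE)
    show "(\<lambda>r. indicat_real {s<..t} r *\<^sub>R f r) \<in> borel_measurable lborel"
      using i(2) by (auto simp: set_integrable_def)
    have "set_integrable lborel {s..t} f" using assms by (auto elim!: set_integrable_subset)
    then show "(\<lambda>r. indicat_real {s..t} r *\<^sub>R f r) \<in> borel_measurable lborel"
      by (auto simp: set_integrable_def)
    show "AE r in lborel. indicat_real {s<..t} r *\<^sub>R f r = indicat_real {s..t} r *\<^sub>R f r"
      using AE_lborel_singleton[of s] by eventually_elim (auto simp: indicator_def)
  qed
  finally show ?thesis by simp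
qed

text \<open>The square \<open>[0, t]\<^sup>2\<close> is split along its diagonal and Fubini's theorem is applied to both halves.\<close>

lemma prim_bilinear:
  fixes h :: "'a::euclidean_space \<Rightarrow> 'b::euclidean_space \<Rightarrow> 'c::euclidean_space"
  assumes h: "bounded_bilinear h"
    and g: "set_integrable lborel {0..t} g" and k: "set_integrable lborel {0..t} k"
  shows "h (prim g t) (prim k t) = prim (\<lambda>r. h (g r) (prim k r) + h (prim g r) (k r)) t" (is ?eq)
    and "set_integrable lborel {0..t} (\<lambda>r. h (g r) (prim k r))" (is ?i1)
    and "set_integrable lborel {0..t} (\<lambda>r. h (prim g r) (k r))" (is ?i2)
proof -
  interpret h: bounded_bilinear h by (rule h)
  define G where "G r = indicator {0..t} r *\<^sub>R g r" for r
  define K where "K r = indicator {0..t} r *\<^sub>R k r" for r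
  have G: "integrable lborel G" and K: "integrable lborel K"
    using g k by (simp_all add: G_def[abs_def] K_def[abs_def] set_integrable_def)
  have [measurable]: "G \<in> borel_measurable borel" "K \<in> borel_measurable borel"
    using G K borel_measurable_integrable by force+
  define f where "f = (\<lambda>(r, s). h (G r) (K s))"
  have hc: "continuous_on UNIV (\<lambda>x. h (fst x) (snd x))"
    by (intro h.continuous_on continuous_intros)
  have f[measurable]: "f \<in> borel_measurable (lborel \<Otimes>\<^sub>M lborel)"
    unfolding f_def case_prod_beta'
    by (rule borel_measurable_continuous_Pair[OF _ _ hc]) measurable
  obtain C where C: "C \<ge> 0" "\<And>a b. norm (h a b) \<le> norm a * norm b * C"
    using h.nonneg_bounded by blast
  have fi: "integrable (lborel \<Otimes>\<^sub>M lborel) f"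
  proof (rule integrableI_bounded[OF f])
    have "(\<integral>\<^sup>+x. ennreal (norm (f x)) \<partial>(lborel \<Otimes>\<^sub>M lborel)) = (\<integral>\<^sup>+r. \<integral>\<^sup>+s. ennreal (norm (h (G r) (K s))) \<partial>lborel \<partial>lborel)"
      by (subst lborel.nn_integral_fst[symmetric], measurable) (simp add: f_def)
    also have "\<dots> \<le> (\<integral>\<^sup>+r. \<integral>\<^sup>+s. ennreal C * (ennreal (norm (G r)) * ennreal (norm (K s))) \<partial>lborel \<partial>lborel)"
    proof (intro nn_integral_mono)
      fix r s
      have "ennreal (norm (h (G r) (K s))) \<le> ennreal (C * (norm (G r) * norm (K s)))"
        using C(2) by (intro ennreal_leI) (simp add: mult.commute)
      then show "ennreal (norm (h (G r) (K s))) \<le> ennreal C * (ennreal (norm (G r)) * ennreal (norm (K s)))"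
        using C(1) by (simp add: ennreal_mult)
    qed
    also have "\<dots> = ennreal C * ((\<integral>\<^sup>+r. ennreal (norm (G r)) \<partial>lborel) * (\<integral>\<^sup>+s. ennreal (norm (K s)) \<partial>lborel))"
      by (simp add: nn_integral_cmult nn_integral_multc)
    also have "\<dots> < \<infinity>"
      using G K by (auto simp: integrable_iff_bounded ennreal_mult_less_top)
    finally show "(\<integral>\<^sup>+x. ennreal (norm (f x)) \<partial>(lborel \<Otimes>\<^sub>M lborel)) < \<infinity>" .
  qed
  define f1 where "f1 = (\<lambda>(r::real, s::real). indicator {..r} s *\<^sub>R f (r, s))"
  define f2 where "f2 = (\<lambda>(r::real, s::real). indicator {..<s} r *\<^sub>R f (r, s))"
  have f1: "integrable (lborel \<Otimes>\<^sub>M lborel) f1"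
  proof (rule Bochner_Integration.integrable_bound[OF fi])
    have "f1 = (\<lambda>x. if snd x \<le> fst x then f x else 0)" by (auto simp: f1_def)
    then show "f1 \<in> borel_measurable (lborel \<Otimes>\<^sub>M lborel)" by simp
  qed (auto simp: f1_def indicator_def)
  have f2: "integrable (lborel \<Otimes>\<^sub>M lborel) f2"
  proof (rule Bochner_Integration.integrable_bound[OF fi])
    have "f2 = (\<lambda>x. if fst x < snd x then f x else 0)" by (auto simp: f2_def)
    then show "f2 \<in> borel_measurable (lborel \<Otimes>\<^sub>M lborel)" by simp
  qed (auto simp: f2_def indicator_def)
  have Gr: "integrable lborel (\<lambda>r. indicator A r *\<^sub>R G r)" if "A \<in> sets borel" for A
    using integrable_mult_indicator[of A lborel, OF _ G] that by simp
  have Kr: "integrable lborel (\<lambda>r. indicator A r *\<^sub>R K r)" if "A \<in> sets borel" for A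
    using integrable_mult_indicator[of A lborel, OF _ K] that by simp
  have e1: "(LINT s|lborel. f1 (r, s)) = indicator {0..t} r *\<^sub>R h (g r) (prim k r)" for r
  proof -
    have "(LINT s|lborel. f1 (r, s)) = (LINT s|lborel. h (G r) (indicator {..r} s *\<^sub>R K s))"
      by (simp add: f1_def f_def h.scaleR_right)
    also have "\<dots> = h (G r) (LINT s|lborel. indicator {..r} s *\<^sub>R K s)"
      by (rule integral_bounded_linear[OF h.bounded_linear_right Kr]) simp
    also have "\<dots> = indicator {0..t} r *\<^sub>R h (g r) (prim k r)"
    proof (cases "r \<in> {0..t}")
      case True
      have "(LINT s|lborel. indicator {..r} s *\<^sub>R K s) = prim k r"
        unfolding prim_def set_lebesgue_integral_def
        by (intro Bochner_Integration.integral_cong refl) (use True in \<open>auto simp: K_def indicator_def\<close>)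
      then show ?thesis using True by (simp add: G_def)
    qed (simp add: G_def h.zero_left)
    finally show ?thesis .
  qed
  have e2: "(LINT r|lborel. f2 (r, s)) = indicator {0..t} s *\<^sub>R h (prim g s) (k s)" for s
  proof -
    have "(LINT r|lborel. f2 (r, s)) = (LINT r|lborel. h (indicator {..<s} r *\<^sub>R G r) (K s))"
      by (simp add: f2_def f_def h.scaleR_left)
    also have "\<dots> = h (LINT r|lborel. indicator {..<s} r *\<^sub>R G r) (K s)"
      by (rule integral_bounded_linear[OF h.bounded_linear_left Gr]) simp
    also have "\<dots> = indicator {0..t} s *\<^sub>R h (prim g s) (k s)"
    proof (cases "s \<in> {0..t}")
      case True
      have "(LINT r|lborel. indicator {..<s} r *\<^sub>R G r) = (LINT r|lborel. indicator {..s} r *\<^sub>R G r)"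
      proof (rule Bochner_Integration.integral_cong_AE)
        show "AE r in lborel. indicat_real {..<s} r *\<^sub>R G r = indicat_real {..s} r *\<^sub>R G r"
          using AE_lborel_singleton[of s] by eventually_elim (auto simp: indicator_def)
      qed auto
      also have "\<dots> = prim g s"
        unfolding prim_def set_lebesgue_integral_def
        by (intro Bochner_Integration.integral_cong refl) (use True in \<open>auto simp: G_def indicator_def\<close>)
      finally show ?thesis using True by (simp add: K_def)
    qed (simp add: K_def h.zero_right)
    finally show ?thesis .
  qed
  show i1: ?i1
    using lborel_pair.integrable_fst'[OF f1] unfolding e1 set_integrable_def .
  show i2: ?i2
    using lborel_pair.integrable_snd[of "\<lambda>r s. f2 (r, s)"] f2 unfolding e2 set_integrable_def by simp
  have "h (prim g t) (prim k t) = h (LINT r|lborel. G r) (LINT s|lborel. K s)"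
    by (simp add: prim_def set_lebesgue_integral_def G_def K_def)
  also have "\<dots> = (LINT r|lborel. h (G r) (LINT s|lborel. K s))"
    by (rule integral_bounded_linear[OF h.bounded_linear_left G, symmetric])
  also have "\<dots> = (LINT r|lborel. LINT s|lborel. f (r, s))"
    by (simp add: f_def integral_bounded_linear[OF h.bounded_linear_right K])
  also have "\<dots> = (LINT x|(lborel \<Otimes>\<^sub>M lborel). f x)"
    by (rule lborel_pair.integral_fst'[OF fi])
  also have "\<dots> = (LINT x|(lborel \<Otimes>\<^sub>M lborel). f1 x + f2 x)"
    by (intro Bochner_Integration.integral_cong refl) (auto simp: f1_def f2_def indicator_def)
  also have "\<dots> = (LINT x|(lborel \<Otimes>\<^sub>M lborel). f1 x) + (LINT x|(lborel \<Otimes>\<^sub>M lborel). f2 x)"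
    by (rule Bochner_Integration.integral_add[OF f1 f2])
  also have "(LINT x|(lborel \<Otimes>\<^sub>M lborel). f1 x) = prim (\<lambda>r. h (g r) (prim k r)) t"
    using lborel_pair.integral_fst'[OF f1] by (simp add: e1 prim_def set_lebesgue_integral_def)
  also have "(LINT x|(lborel \<Otimes>\<^sub>M lborel). f2 x) = prim (\<lambda>r. h (prim g r) (k r)) t"
    using lborel_pair.integral_snd[of "\<lambda>r s. f2 (r, s)"] f2 by (simp add: e2 prim_def set_lebesgue_integral_def)
  also have "prim (\<lambda>r. h (g r) (prim k r)) t + prim (\<lambda>r. h (prim g r) (k r)) t
      = prim (\<lambda>r. h (g r) (prim k r) + h (prim g r) (k r)) t"
    by (rule prim_add[OF i1 i2, symmetric])
  finally show ?eq .
qed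

text \<open>The product rule for absolutely continuous functions, from \<open>prim_bilinear\<close>
  by expanding the two constants. A general bilinear h covers scalar multiplication, inner products
  and real products at once.\<close>

lemma prim_by_parts:
  fixes h :: "'a::euclidean_space \<Rightarrow> 'b::euclidean_space \<Rightarrow> 'c::euclidean_space"
  assumes h: "bounded_bilinear h"
    and g: "set_integrable lborel {0..T} g" and k: "set_integrable lborel {0..T} k"
    and P: "\<And>r. r \<in> {0..T} \<Longrightarrow> P r = p0 + prim g r" and Q: "\<And>r. r \<in> {0..T} \<Longrightarrow> Q r = q0 + prim k r"
    and t: "t \<in> {0..T}"
  shows "h (P t) (Q t) = h p0 q0 + prim (\<lambda>r. h (g r) (Q r) + h (P r) (k r)) t"
    and "set_integrable lborel {0..t} (\<lambda>r. h (g r) (Q r))"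
    and "set_integrable lborel {0..t} (\<lambda>r. h (P r) (k r))"
proof -
  interpret h: bounded_bilinear h by (rule h)
  have g': "set_integrable lborel {0..t} g" and k': "set_integrable lborel {0..t} k"
    using set_integrable_Icc_mono[OF g] set_integrable_Icc_mono[OF k] t by auto
  note b = prim_bilinear[OF h g' k']
  note lg = prim_linear[OF h.bounded_linear_left[of q0] g'] and lk = prim_linear[OF h.bounded_linear_right[of p0] k']
  have eQ: "indicator {0..t} r *\<^sub>R h (g r) (Q r) = indicator {0..t} r *\<^sub>R (h (g r) q0 + h (g r) (prim k r))" for r
    using Q[of r] t by (auto simp: indicator_def h.add_right)
  have eP: "indicator {0..t} r *\<^sub>R h (P r) (k r) = indicator {0..t} r *\<^sub>R (h p0 (k r) + h (prim g r) (k r))" for r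
    using P[of r] t by (auto simp: indicator_def h.add_left)
  show i1: "set_integrable lborel {0..t} (\<lambda>r. h (g r) (Q r))"
    using set_integral_add(1)[OF lg(2) b(2)] unfolding set_integrable_def eQ .
  show i2: "set_integrable lborel {0..t} (\<lambda>r. h (P r) (k r))"
    using set_integral_add(1)[OF lk(2) b(3)] unfolding set_integrable_def eP .
  have p1: "prim (\<lambda>r. h (g r) (Q r)) t = h (prim g t) q0 + prim (\<lambda>r. h (g r) (prim k r)) t"
    unfolding lg(1)[symmetric] prim_add[OF lg(2) b(2), symmetric]
    by (rule prim_cong) (use Q t in \<open>auto simp: h.add_right\<close>)
  have p2: "prim (\<lambda>r. h (P r) (k r)) t = h p0 (prim k t) + prim (\<lambda>r. h (prim g r) (k r)) t"
    unfolding lk(1)[symmetric] prim_add[OF lk(2) b(3), symmetric]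
    by (rule prim_cong) (use P t in \<open>auto simp: h.add_left\<close>)
  have "h (P t) (Q t) = h p0 q0 + h p0 (prim k t) + h (prim g t) q0 + h (prim g t) (prim k t)"
    using P[OF t] Q[OF t] by (simp add: h.add_left h.add_right)
  also have "h (prim g t) (prim k t) = prim (\<lambda>r. h (g r) (prim k r)) t + prim (\<lambda>r. h (prim g r) (k r)) t"
    unfolding b(1) by (rule prim_add[OF b(2,3)])
  finally show "h (P t) (Q t) = h p0 q0 + prim (\<lambda>r. h (g r) (Q r) + h (P r) (k r)) t"
    unfolding prim_add[OF i1 i2] p1 p2 by simp
qed

lemma prim_deriv:
  fixes F :: "real \<Rightarrow> 'a::euclidean_space"
  assumes d: "\<And>r. (F has_vector_derivative F' r) (at r)" and c: "continuous_on UNIV F'" and t: "t \<ge> 0"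
  shows "F t = F 0 + prim F' t" "set_integrable lborel {0..t} F'"
proof -
  show "set_integrable lborel {0..t} F'"
    unfolding set_integrable_def by (rule borel_integrable_compact) (auto intro: continuous_on_subset[OF c])
  have "prim F' t = F t - F 0"
    unfolding prim_def set_lebesgue_integral_def
    using t by (intro integral_FTC_atLeastAtMost) (auto intro: continuous_on_subset[OF c] has_vector_derivative_at_within d)
  then show "F t = F 0 + prim F' t" by simp
qed

lemma prim_exp:
  fixes a :: real
  assumes "t \<ge> 0"
  shows "exp (a * t) = 1 + prim (\<lambda>r. a * exp (a * r)) t" "set_integrable lborel {0..t} (\<lambda>r. a * exp (a * r))"
proof -
  have d: "((\<lambda>t. exp (a * t)) has_vector_derivative a * exp (a * r)) (at r)" for r
    unfolding has_real_derivative_iff_has_vector_derivative[symmetric]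
    by (auto intro!: derivative_eq_intros)
  have c: "continuous_on UNIV (\<lambda>r. a * exp (a * r))" by (intro continuous_intros)
  show "exp (a * t) = 1 + prim (\<lambda>r. a * exp (a * r)) t" using prim_deriv(1)[OF d c assms] by simp
  show "set_integrable lborel {0..t} (\<lambda>r. a * exp (a * r))" using prim_deriv(2)[OF d c assms] .
qed

lemma set_integrable_mult_cont:
  fixes f :: "real \<Rightarrow> 'a::euclidean_space"
  assumes f: "set_integrable lborel {0..T} f" and c: "continuous_on {0..T} (c :: real \<Rightarrow> real)"
  shows "set_integrable lborel {0..T} (\<lambda>r. c r *\<^sub>R f r)"
proof -
  obtain C where C: "\<And>r. r \<in> {0..T} \<Longrightarrow> norm (c r) \<le> C"
    using compact_imp_bounded[OF compact_continuous_image[OF c compact_Icc]] unfolding bounded_iff by blast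
  have [measurable]: "(\<lambda>r. indicator {0..T} r *\<^sub>R c r) \<in> borel_measurable borel"
    using c by (intro borel_measurable_continuous_on_indicator) auto
  have [measurable]: "(\<lambda>r. indicator {0..T} r *\<^sub>R f r) \<in> borel_measurable lborel"
    using f unfolding set_integrable_def by (rule borel_measurable_integrable)
  show ?thesis unfolding set_integrable_def
  proof (rule Bochner_Integration.integrable_bound)
    show "integrable lborel (\<lambda>r. \<bar>C\<bar> *\<^sub>R (indicator {0..T} r *\<^sub>R f r))"
      using f unfolding set_integrable_def by (rule integrable_scaleR_right)
    have "(\<lambda>r. (indicator {0..T} r *\<^sub>R c r) *\<^sub>R (indicator {0..T} r *\<^sub>R f r)) \<in> borel_measurable lborel"
      by measurable
    moreover have "(indicator {0..T} r *\<^sub>R c r) *\<^sub>R (indicator {0..T} r *\<^sub>R f r) = indicator {0..T} r *\<^sub>R c r *\<^sub>R f r" for r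
      by (auto simp: indicator_def)
    ultimately show "(\<lambda>r. indicator {0..T} r *\<^sub>R c r *\<^sub>R f r) \<in> borel_measurable lborel" by (simp only:)
    show "AE r in lborel. norm (indicator {0..T} r *\<^sub>R c r *\<^sub>R f r) \<le> norm (\<bar>C\<bar> *\<^sub>R (indicator {0..T} r *\<^sub>R f r))"
      using C by (intro AE_I2) (fastforce simp: indicator_def intro: mult_right_mono)
  qed
qed

section \<open>A linear damped equation\<close>

text \<open>Variation of constants. F is merely integrable, so the formula is verified by the
  product rule for primitives, applied to the decaying exponential and the bracket.\<close>

lemma duhamel:
  fixes F :: "real \<Rightarrow> 'a::euclidean_space"
  assumes F: "set_integrable lborel {0..T} F"
    and c: "\<And>t. t \<in> {0..T} \<Longrightarrow> c t = exp (- l * t) *\<^sub>R (c0 + prim (\<lambda>r. exp (l * r) *\<^sub>R F r) t)"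
    and t: "t \<in> {0..T}"
  shows "c t = c0 + prim (\<lambda>r. F r - l *\<^sub>R c r) t"
proof -
  have T: "T \<ge> 0" using t by auto
  have eF: "set_integrable lborel {0..T} (\<lambda>r. exp (l * r) *\<^sub>R F r)"
    by (intro set_integrable_mult_cont F continuous_intros)
  have "exp (- l * t) *\<^sub>R (c0 + prim (\<lambda>r. exp (l * r) *\<^sub>R F r) t) = 1 *\<^sub>R c0
      + prim (\<lambda>r. (- l * exp (- l * r)) *\<^sub>R (c0 + prim (\<lambda>r. exp (l * r) *\<^sub>R F r) r) + exp (- l * r) *\<^sub>R (exp (l * r) *\<^sub>R F r)) t"
    by (rule prim_by_parts(1)[OF bounded_bilinear_scaleR prim_exp(2)[OF T, of "- l"] eF _ _ t]) (auto intro: prim_exp(1)[of _ "- l", simplified])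
  also have "\<dots> = c0 + prim (\<lambda>r. F r - l *\<^sub>R c r) t"
    using t by (intro arg_cong2[of _ _ _ _ "(+)"] prim_cong) (auto simp: c simp flip: exp_add)
  finally show ?thesis using c[OF t] by simp
qed

lemma set_integrable_continuous:
  fixes c :: "real \<Rightarrow> 'a::euclidean_space"
  assumes "continuous_on {0..T} c"
  shows "set_integrable lborel {0..T} c"
  unfolding set_integrable_def using assms by (intro borel_integrable_compact) auto

lemma damped_continuous:
  fixes c :: "real \<Rightarrow> 'a::euclidean_space"
  assumes "set_integrable lborel {0..T} (\<lambda>r. F r - l *\<^sub>R c r)"
    and "\<And>t. t \<in> {0..T} \<Longrightarrow> c t = c0 + prim (\<lambda>r. F r - l *\<^sub>R c r) t"
  shows "continuous_on {0..T} c"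
proof -
  have "continuous_on {0..T} (\<lambda>t. c0 + prim (\<lambda>r. F r - l *\<^sub>R c r) t)"
    by (intro continuous_intros continuous_on_prim assms)
  then show ?thesis by (rule continuous_on_eq) (simp add: assms(2))
qed

text \<open>The integrating factor exp (l r) is largest at r = t, so the bound does not depend on
  the damping l. It is meant for forces that are integrable but not square integrable in time, for
  which the energy inequality says nothing.\<close>

lemma damped_norm_le:
  fixes c :: "real \<Rightarrow> 'a::euclidean_space"
  assumes l: "l \<ge> 0" and i: "set_integrable lborel {0..T} (\<lambda>r. F r - l *\<^sub>R c r)"
    and c: "\<And>t. t \<in> {0..T} \<Longrightarrow> c t = prim (\<lambda>r. F r - l *\<^sub>R c r) t"
    and t: "t \<in> {0..T}"
  shows "ennreal (norm (c t)) \<le> (\<integral>\<^sup>+r\<in>{0..t}. ennreal (norm (F r)) \<partial>lborel)"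
proof -
  have T: "T \<ge> 0" using t by auto
  have "continuous_on {0..T} c" using damped_continuous[of T F l c 0] i c by simp
  then have ci: "set_integrable lborel {0..T} (\<lambda>r. l *\<^sub>R c r)"
    by (intro set_integrable_continuous continuous_intros)
  then have F: "set_integrable lborel {0..T} F" using set_integral_add(1)[OF i ci] by simp
  have eF: "set_integrable lborel {0..T} (\<lambda>r. exp (l * r) *\<^sub>R F r)"
    by (intro set_integrable_mult_cont F continuous_intros)
  have "exp (l * t) *\<^sub>R c t = 1 *\<^sub>R 0 + prim (\<lambda>r. (l * exp (l * r)) *\<^sub>R c r + exp (l * r) *\<^sub>R (F r - l *\<^sub>R c r)) t"
    by (rule prim_by_parts(1)[OF bounded_bilinear_scaleR prim_exp(2)[OF T, of l] i _ _ t]) (auto simp: c intro: prim_exp(1))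
  also have "\<dots> = prim (\<lambda>r. exp (l * r) *\<^sub>R F r) t"
    by (simp add: algebra_simps)
  finally have e: "exp (l * t) *\<^sub>R c t = prim (\<lambda>r. exp (l * r) *\<^sub>R F r) t" .
  have "ennreal (exp (l * t)) * ennreal (norm (c t)) = ennreal (norm (prim (\<lambda>r. exp (l * r) *\<^sub>R F r) t))"
    unfolding e[symmetric] by (simp add: ennreal_mult)
  also have "\<dots> \<le> (\<integral>\<^sup>+r\<in>{0..t}. ennreal (norm (exp (l * r) *\<^sub>R F r)) \<partial>lborel)"
    using t by (intro norm_prim_le set_integrable_Icc_mono[OF eF]) auto
  also have "\<dots> \<le> (\<integral>\<^sup>+r. ennreal (exp (l * t)) * ennreal (norm (indicator {0..t} r *\<^sub>R F r)) \<partial>lborel)"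
  proof (intro nn_integral_mono)
    fix r
    have "exp (l * r) \<le> exp (l * t)" if "r \<le> t" using that l by (simp add: mult_left_mono)
    then show "ennreal (norm (exp (l * r) *\<^sub>R F r)) * indicator {0..t} r \<le> ennreal (exp (l * t)) * ennreal (norm (indicator {0..t} r *\<^sub>R F r))"
      by (auto simp: indicator_def intro!: ennreal_leI mult_right_mono simp flip: ennreal_mult)
  qed
  also have "\<dots> = ennreal (exp (l * t)) * (\<integral>\<^sup>+r. ennreal (norm (indicator {0..t} r *\<^sub>R F r)) \<partial>lborel)"
  proof (rule nn_integral_cmult)
    have [measurable]: "(\<lambda>r. indicator {0..t} r *\<^sub>R F r) \<in> borel_measurable lborel"
      using set_integrable_Icc_mono[OF F, of t] t by (simp add: set_integrable_def)
    show "(\<lambda>r. ennreal (norm (indicat_real {0..t} r *\<^sub>R F r))) \<in> borel_measurable lborel"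
      by measurable
  qed
  also have "(\<integral>\<^sup>+r. ennreal (norm (indicator {0..t} r *\<^sub>R F r)) \<partial>lborel) = (\<integral>\<^sup>+r\<in>{0..t}. ennreal (norm (F r)) \<partial>lborel)"
    by (intro nn_integral_cong) (auto simp: indicator_def)
  finally show ?thesis
    by (simp add: ennreal_mult_le_mult_iff)
qed

text \<open>The derivative of |c|^2 is 2 F \<bullet> c - 2 l |c|^2; half of the damping absorbs the
  force and the other half stays on the left. The values are extended reals since |F|^2 need not be
  integrable.\<close>

lemma damped_energy:
  fixes c :: "real \<Rightarrow> 'a::euclidean_space"
  assumes l: "l > 0" and F: "set_integrable lborel {0..T} F" and i: "set_integrable lborel {0..T} (\<lambda>r. F r - l *\<^sub>R c r)"
    and c: "\<And>t. t \<in> {0..T} \<Longrightarrow> c t = c0 + prim (\<lambda>r. F r - l *\<^sub>R c r) t"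
    and t: "t \<in> {0..T}"
  shows "ennreal ((norm (c t))\<^sup>2) + ennreal l * (\<integral>\<^sup>+r\<in>{0..t}. ennreal ((norm (c r))\<^sup>2) \<partial>lborel)
    \<le> ennreal ((norm c0)\<^sup>2) + ennreal (1 / l) * (\<integral>\<^sup>+r\<in>{0..t}. ennreal ((norm (F r))\<^sup>2) \<partial>lborel)"
proof -
  define X where "X r = (F r - l *\<^sub>R c r) \<bullet> c r + c r \<bullet> (F r - l *\<^sub>R c r)" for r
  have cont: "continuous_on {0..T} c" by (rule damped_continuous[OF i c])
  have b1: "(norm (c t))\<^sup>2 = (norm c0)\<^sup>2 + prim X t"
    unfolding X_def using prim_by_parts(1)[OF bounded_bilinear_inner i i c c t] by (simp add: power2_norm_eq_inner)
  have Xi: "set_integrable lborel {0..t} X"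
    unfolding X_def by (intro set_integral_add(1) prim_by_parts(2,3)[OF bounded_bilinear_inner i i c c t])
  have ct: "continuous_on {0..t} c" using t by (intro continuous_on_subset[OF cont]) auto
  have ci: "set_integrable lborel {0..t} (\<lambda>r. l * (norm (c r))\<^sup>2)"
    using ct by (intro set_integrable_continuous continuous_intros)
  have Ft: "set_integrable lborel {0..t} F" using t by (intro set_integrable_Icc_mono[OF F]) auto
  have mF [measurable]: "(\<lambda>r. indicator {0..t} r *\<^sub>R F r) \<in> borel_measurable lborel"
    using Ft unfolding set_integrable_def by simp
  have pt: "X r + l * (norm (c r))\<^sup>2 \<le> 1 / l * (norm (F r))\<^sup>2" for r
  proof -
    \<comment> \<open>Expanding this square is Young's inequality with exactly the weights that
      leave l |c|^2 on the left and |F|^2 / l on the right.\<close>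
    have "0 \<le> (norm (F r - l *\<^sub>R c r))\<^sup>2" by simp
    then have "2 * l * (F r \<bullet> c r) \<le> (norm (F r))\<^sup>2 + l * l * (norm (c r))\<^sup>2"
      by (simp add: power2_norm_eq_inner inner_diff_left inner_diff_right inner_commute algebra_simps)
    then have "(2 * (F r \<bullet> c r) - l * (norm (c r))\<^sup>2) * l \<le> (norm (F r))\<^sup>2"
      by (simp add: algebra_simps)
    then have "2 * (F r \<bullet> c r) - l * (norm (c r))\<^sup>2 \<le> (norm (F r))\<^sup>2 / l"
      using l by (simp add: pos_le_divide_eq)
    moreover have "X r = 2 * (F r \<bullet> c r) - 2 * l * (norm (c r))\<^sup>2"
      by (simp add: X_def power2_norm_eq_inner inner_diff_left inner_diff_right inner_commute)
    ultimately show ?thesis by simp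
  qed
  have nc: "prim (\<lambda>r. l * (norm (c r))\<^sup>2) t \<ge> 0"
    unfolding prim_def set_lebesgue_integral_def using l by (intro integral_nonneg_AE) auto
  have e2: "ennreal (prim (\<lambda>r. l * (norm (c r))\<^sup>2) t) = ennreal l * (\<integral>\<^sup>+r\<in>{0..t}. ennreal ((norm (c r))\<^sup>2) \<partial>lborel)"
  proof -
    have "ennreal (prim (\<lambda>r. l * (norm (c r))\<^sup>2) t) = (\<integral>\<^sup>+r. ennreal (indicator {0..t} r *\<^sub>R (l * (norm (c r))\<^sup>2)) \<partial>lborel)"
      unfolding prim_def set_lebesgue_integral_def using l ci
      by (intro nn_integral_eq_integral[symmetric]) (auto simp: set_integrable_def)
    also have "\<dots> = (\<integral>\<^sup>+r. ennreal l * ennreal (indicator {0..t} r *\<^sub>R ((norm (c r))\<^sup>2)) \<partial>lborel)"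
      using l by (intro nn_integral_cong) (simp add: mult.left_commute flip: ennreal_mult)
    also have "\<dots> = ennreal l * (\<integral>\<^sup>+r. ennreal (indicator {0..t} r *\<^sub>R ((norm (c r))\<^sup>2)) \<partial>lborel)"
    proof (rule nn_integral_cmult)
      have [measurable]: "(\<lambda>r. indicator {0..t} r *\<^sub>R (norm (c r))\<^sup>2) \<in> borel_measurable borel"
        using ct by (intro borel_measurable_continuous_on_indicator) (auto intro!: continuous_intros)
      show "(\<lambda>r. ennreal (indicator {0..t} r *\<^sub>R (norm (c r))\<^sup>2)) \<in> borel_measurable lborel"
        by measurable
    qed
    also have "(\<integral>\<^sup>+r. ennreal (indicator {0..t} r *\<^sub>R ((norm (c r))\<^sup>2)) \<partial>lborel) = (\<integral>\<^sup>+r\<in>{0..t}. ennreal ((norm (c r))\<^sup>2) \<partial>lborel)"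
      by (intro nn_integral_cong) (auto simp: indicator_def)
    finally show ?thesis .
  qed
  have "ennreal ((norm (c t))\<^sup>2) + ennreal l * (\<integral>\<^sup>+r\<in>{0..t}. ennreal ((norm (c r))\<^sup>2) \<partial>lborel)
      = ennreal ((norm (c t))\<^sup>2 + prim (\<lambda>r. l * (norm (c r))\<^sup>2) t)"
    using nc by (simp add: e2[symmetric])
  also have "(norm (c t))\<^sup>2 + prim (\<lambda>r. l * (norm (c r))\<^sup>2) t = (norm c0)\<^sup>2 + prim (\<lambda>r. X r + l * (norm (c r))\<^sup>2) t"
    unfolding b1 prim_add[OF Xi ci] by simp
  also have "ennreal \<dots> \<le> ennreal ((norm c0)\<^sup>2) + ennreal (prim (\<lambda>r. X r + l * (norm (c r))\<^sup>2) t)"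
  proof -
    have "ennreal (x + y) \<le> ennreal x + ennreal y" if "x \<ge> 0" for x y
      using that by (cases "y \<ge> 0") (auto simp: ennreal_neg intro: ennreal_leI)
    then show ?thesis by simp
  qed
  \<comment> \<open>The integrand may be negative and \<open>ennreal\<close> cuts off its negative
    part, so the integral is first compared with that of the positive part.\<close>
  also have "ennreal (prim (\<lambda>r. X r + l * (norm (c r))\<^sup>2) t) \<le> (\<integral>\<^sup>+r. ennreal (indicator {0..t} r *\<^sub>R (X r + l * (norm (c r))\<^sup>2)) \<partial>lborel)"
  proof -
    have int: "integrable lborel (\<lambda>r. indicator {0..t} r *\<^sub>R (X r + l * (norm (c r))\<^sup>2))"
      using set_integral_add(1)[OF Xi ci] by (simp add: set_integrable_def)
    have "prim (\<lambda>r. X r + l * (norm (c r))\<^sup>2) t \<le> (LINT r|lborel. max 0 (indicator {0..t} r *\<^sub>R (X r + l * (norm (c r))\<^sup>2)))"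
      unfolding prim_def set_lebesgue_integral_def using int by (intro integral_mono) auto
    then have "ennreal (prim (\<lambda>r. X r + l * (norm (c r))\<^sup>2) t) \<le> ennreal (LINT r|lborel. max 0 (indicator {0..t} r *\<^sub>R (X r + l * (norm (c r))\<^sup>2)))"
      by (rule ennreal_leI)
    also have "\<dots> = (\<integral>\<^sup>+r. ennreal (max 0 (indicator {0..t} r *\<^sub>R (X r + l * (norm (c r))\<^sup>2))) \<partial>lborel)"
      using int by (intro nn_integral_eq_integral[symmetric]) auto
    also have "\<dots> = (\<integral>\<^sup>+r. ennreal (indicator {0..t} r *\<^sub>R (X r + l * (norm (c r))\<^sup>2)) \<partial>lborel)"
    proof -
      have mx: "ennreal (max 0 x) = ennreal x" for x
        by (cases "x \<ge> 0") (auto simp: ennreal_neg max_def)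
      show ?thesis by (intro nn_integral_cong mx)
    qed
    finally show ?thesis .
  qed
  also have "\<dots> \<le> (\<integral>\<^sup>+r. ennreal (1 / l) * (ennreal ((norm (F r))\<^sup>2) * indicator {0..t} r) \<partial>lborel)"
  proof (intro nn_integral_mono)
    fix r
    show "ennreal (indicator {0..t} r *\<^sub>R (X r + l * (norm (c r))\<^sup>2)) \<le> ennreal (1 / l) * (ennreal ((norm (F r))\<^sup>2) * indicator {0..t} r)"
      using ennreal_leI[OF pt[of r]] l by (auto simp: indicator_def simp flip: ennreal_mult)
  qed
  also have "\<dots> = ennreal (1 / l) * (\<integral>\<^sup>+r\<in>{0..t}. ennreal ((norm (F r))\<^sup>2) \<partial>lborel)"
  proof (rule nn_integral_cmult)
    have "(\<lambda>r. ennreal ((norm (indicator {0..t} r *\<^sub>R F r))\<^sup>2)) \<in> borel_measurable lborel"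
      by measurable
    moreover have "ennreal ((norm (indicator {0..t} r *\<^sub>R F r))\<^sup>2) = ennreal ((norm (F r))\<^sup>2) * indicator {0..t} r" for r
      by (auto simp: indicator_def)
    ultimately show "(\<lambda>r. ennreal ((norm (F r))\<^sup>2) * indicator {0..t} r) \<in> borel_measurable lborel" by (simp only:)
  qed
  finally show ?thesis by (simp add: add_left_mono)
qed


text \<open>The chain rule for powers of an absolutely continuous function, by induction with the
  product rule. It integrates the single terms of the exponential series in
  \<open>exp_weight\<close>.\<close>

lemma prim_power:
  fixes h :: "real \<Rightarrow> real"
  assumes h: "set_integrable lborel {0..T} h" and t: "t \<in> {0..T}"
  shows "prim (\<lambda>r. h r * prim h r ^ n) t = prim h t ^ Suc n / real (Suc n)"
    and "set_integrable lborel {0..T} (\<lambda>r. h r * prim h r ^ n)"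
proof -
  have i: "set_integrable lborel {0..T} (\<lambda>r. h r * prim h r ^ n)" for n
  proof -
    have "continuous_on {0..T} (\<lambda>r. prim h r ^ n)" by (intro continuous_intros continuous_on_prim h)
    from set_integrable_mult_cont[OF h this] show ?thesis by (simp add: mult.commute)
  qed
  show "set_integrable lborel {0..T} (\<lambda>r. h r * prim h r ^ n)" by (rule i)
  have "\<forall>t\<in>{0..T}. prim (\<lambda>r. h r * prim h r ^ n) t = prim h t ^ Suc n / real (Suc n)"
  proof (induction n)
    case (Suc n)
    show ?case
    proof
      fix t assume t: "t \<in> {0..T}"
      have it: "set_integrable lborel {0..t} (\<lambda>r. h r * prim h r ^ n)" for n
        using t by (intro set_integrable_Icc_mono[OF i]) auto
      have i1: "set_integrable lborel {0..T} (\<lambda>r. real (Suc n) * (h r * prim h r ^ n))"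
        by (rule set_integrable_mult_right) (rule i)
      have P: "prim h r ^ Suc n = 0 + prim (\<lambda>r. real (Suc n) * (h r * prim h r ^ n)) r" if "r \<in> {0..T}" for r
      proof -
        have "prim (\<lambda>r. real (Suc n) * (h r * prim h r ^ n)) r = real (Suc n) * prim (\<lambda>r. h r * prim h r ^ n) r"
          unfolding prim_def by (rule set_integral_mult_right)
        then show ?thesis using Suc that by simp
      qed
      have "prim h t ^ Suc n * prim h t = 0 * 0 + prim (\<lambda>r. real (Suc n) * (h r * prim h r ^ n) * prim h r + prim h r ^ Suc n * h r) t"
        by (rule prim_by_parts(1)[OF bounded_bilinear_mult i1 h P _ t]) auto
      also have "\<dots> = prim (\<lambda>r. real (Suc (Suc n)) * (h r * prim h r ^ Suc n)) t"
        by (simp add: algebra_simps)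
      also have "\<dots> = real (Suc (Suc n)) * prim (\<lambda>r. h r * prim h r ^ Suc n) t"
        unfolding prim_def by (rule set_integral_mult_right)
      finally have "prim h t ^ Suc (Suc n) = real (Suc (Suc n)) * prim (\<lambda>r. h r * prim h r ^ Suc n) t"
        by (simp add: mult.commute)
      then show "prim (\<lambda>r. h r * prim h r ^ Suc n) t = prim h t ^ Suc (Suc n) / real (Suc (Suc n))"
        by simp
    qed
  qed simp
  then show "prim (\<lambda>r. h r * prim h r ^ n) t = prim h t ^ Suc n / real (Suc n)" using t by blast
qed

lemma nn_integral_eq_prim:
  fixes f :: "real \<Rightarrow> real"
  assumes "set_integrable lborel {0..t} f" "\<And>r. r \<in> {0..t} \<Longrightarrow> f r \<ge> 0"
  shows "(\<integral>\<^sup>+r\<in>{0..t}. ennreal (f r) \<partial>lborel) = ennreal (prim f t)"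
proof -
  have "(\<integral>\<^sup>+r\<in>{0..t}. ennreal (f r) \<partial>lborel) = (\<integral>\<^sup>+r. ennreal (indicator {0..t} r *\<^sub>R f r) \<partial>lborel)"
    by (intro nn_integral_cong) (auto simp: indicator_def)
  also have "\<dots> = ennreal (prim f t)"
    unfolding prim_def set_lebesgue_integral_def using assms
    by (intro nn_integral_eq_integral) (auto simp: set_integrable_def indicator_def)
  finally show ?thesis .
qed

lemma prim_nonneg: "(\<And>r. r \<in> {0..t} \<Longrightarrow> f r \<ge> 0) \<Longrightarrow> prim f t \<ge> (0::real)"
  unfolding prim_def set_lebesgue_integral_def by (intro integral_nonneg_AE AE_I2) (auto simp: indicator_def)

text \<open>
  The weight \<open>exp (K H)\<close> with \<open>H' = h\<close> turns the Gronwall and Picard arguments into contractions;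
  the bound holds by expanding the exponential, since \<open>h\<close> is only integrable.
\<close>

lemma exp_weight:
  fixes h :: "real \<Rightarrow> real"
  assumes h: "set_integrable lborel {0..T} h" and pos: "\<And>r. h r \<ge> 0" and K: "K > 0" and t: "t \<in> {0..T}"
    and [measurable]: "h \<in> borel_measurable borel"
  shows "(\<integral>\<^sup>+r\<in>{0..t}. ennreal (h r * exp (K * prim h r)) \<partial>lborel) \<le> ennreal (exp (K * prim h t) / K)"
proof -
  have H: "prim h r \<ge> 0" for r by (rule prim_nonneg) (rule pos)
  let ?f = "\<lambda>n r. K ^ n / fact n * (h r * prim h r ^ n)"
  have f0: "?f n r \<ge> 0" for n r using K pos H by simp
  have sm: "ennreal (h r * exp (K * prim h r)) = (\<Sum>n. ennreal (?f n r))" for r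
  proof (rule suminf_ennreal_eq[symmetric])
    have "(\<lambda>n. h r * ((K * prim h r) ^ n /\<^sub>R fact n)) sums (h r * exp (K * prim h r))"
      by (intro sums_mult exp_converges)
    then show "(\<lambda>n. ?f n r) sums (h r * exp (K * prim h r))"
      by (simp add: power_mult_distrib divide_inverse ac_simps)
  qed (rule f0)
  have "(\<integral>\<^sup>+r\<in>{0..t}. ennreal (h r * exp (K * prim h r)) \<partial>lborel) = (\<integral>\<^sup>+r. (\<Sum>n. ennreal (?f n r) * indicator {0..t} r) \<partial>lborel)"
    unfolding sm by (intro nn_integral_cong) (simp add: ennreal_suminf_multc)
  also have "\<dots> = (\<Sum>n. \<integral>\<^sup>+r\<in>{0..t}. ennreal (?f n r) \<partial>lborel)"
    by (intro nn_integral_suminf) measurable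
  also have "\<dots> = (\<Sum>n. ennreal ((K * prim h t) ^ Suc n /\<^sub>R fact (Suc n) / K))"
  proof (intro suminf_cong)
    fix n
    have "set_integrable lborel {0..t} (\<lambda>r. h r * prim h r ^ n)"
      using t by (intro set_integrable_Icc_mono[OF prim_power(2)[OF h t]]) auto
    then have "(\<integral>\<^sup>+r\<in>{0..t}. ennreal (?f n r) \<partial>lborel) = ennreal (prim (?f n) t)"
      by (intro nn_integral_eq_prim f0 set_integrable_mult_right)
    also have "prim (?f n) t = K ^ n / fact n * (prim h t ^ Suc n / real (Suc n))"
      unfolding prim_power(1)[OF h t, symmetric] unfolding prim_def by (rule set_integral_mult_right)
    also have "\<dots> = (K * prim h t) ^ Suc n /\<^sub>R fact (Suc n) / K"
    proof -
      have "(K * prim h t) ^ Suc n /\<^sub>R fact (Suc n) / K = (K * (K ^ n * prim h t ^ Suc n)) / K / fact (Suc n)"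
        by (simp only: power_mult_distrib power_Suc[of K]) (simp add: divide_inverse ac_simps)
      also have "(K * (K ^ n * prim h t ^ Suc n)) / K = K ^ n * prim h t ^ Suc n" using K by simp
      finally show ?thesis by (simp add: fact_Suc mult.commute)
    qed
    finally show "(\<integral>\<^sup>+r\<in>{0..t}. ennreal (?f n r) \<partial>lborel) = ennreal ((K * prim h t) ^ Suc n /\<^sub>R fact (Suc n) / K)" .
  qed
  \<comment> \<open>Integration raised the power of each term by 1, so the sum is the exponential
    series without its first term.\<close>
  also have "\<dots> = ennreal ((exp (K * prim h t) - 1) / K)"
  proof (rule suminf_ennreal_eq)
    have "(\<lambda>n. (K * prim h t) ^ Suc n /\<^sub>R fact (Suc n)) sums (exp (K * prim h t) - 1)"
      using exp_converges[of "K * prim h t"] by (subst sums_Suc_iff) simp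
    then show "(\<lambda>n. (K * prim h t) ^ Suc n /\<^sub>R fact (Suc n) / K) sums ((exp (K * prim h t) - 1) / K)"
      by (rule sums_divide)
  qed (use K H in simp)
  also have "\<dots> \<le> ennreal (exp (K * prim h t) / K)"
    using K by (intro ennreal_leI divide_right_mono) auto
  finally show ?thesis .
qed

section \<open>The Stokes evolution with a right-hand side\<close>

text \<open>The integrated form of u' + \<nu> A u = F with u(0) = c0, mode by mode. Integrability of
  the right-hand side is part of the definition, because \<open>prim\<close> of a non-integrable
  function would silently be 0.\<close>

definition hsol :: "real \<Rightarrow> real \<Rightarrow> real \<Rightarrow> coeffs \<Rightarrow> (real \<Rightarrow> coeffs) \<Rightarrow> (real \<Rightarrow> coeffs) \<Rightarrow> bool" where
  "hsol L \<nu> T c0 F u \<longleftrightarrow> (\<forall>k. set_integrable lborel {0..T} (\<lambda>r. F r k) \<and>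
     set_integrable lborel {0..T} (\<lambda>r. F r k - (\<nu> * wt L 2 k) *\<^sub>R u r k) \<and>
     (\<forall>t\<in>{0..T}. u t k = c0 k + prim (\<lambda>r. F r k - (\<nu> * wt L 2 k) *\<^sub>R u r k) t))"

text \<open>Borel rather than Lebesgue measurability, and on the whole line: this suits product
  measures with the counting measure and survives the time shift by the delay.\<close>

definition cmodes :: "(real \<Rightarrow> coeffs) \<Rightarrow> bool" where
  "cmodes u \<longleftrightarrow> (\<forall>k. (\<lambda>t. u t k) \<in> borel_measurable borel)"

lemma cmodesD [measurable_dest]: "cmodes u \<Longrightarrow> (\<lambda>t. u t k) \<in> borel_measurable borel"
  by (simp add: cmodes_def)

lemma cmodes_diff: "cmodes u \<Longrightarrow> cmodes v \<Longrightarrow> cmodes (\<lambda>t k. u t k - v t k)"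
  unfolding cmodes_def by (auto intro: borel_measurable_diff)

lemma cmodes_Bc: "cmodes u \<Longrightarrow> cmodes v \<Longrightarrow> cmodes (\<lambda>t. Bc L (u t) (v t))"
  by (simp add: cmodes_def measurable_Bc)

lemma cmodes_Esq: "cmodes u \<Longrightarrow> (\<lambda>t. Esq L s (u t)) \<in> borel_measurable borel"
  by (intro Esq_measurable) (simp add: cmodes_def)

lemma Esq_AE_finite:
  assumes u: "cmodes u" and fin: "(\<integral>\<^sup>+r\<in>{a..b}. Esq L s (u r) \<partial>lborel) < \<infinity>"
  shows "AE r in lborel. r \<in> {a..b} \<longrightarrow> Esq L s (u r) < \<infinity>"
proof -
  have [measurable]: "(\<lambda>r. Esq L s (u r)) \<in> borel_measurable borel" by (rule cmodes_Esq[OF u])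
  have "AE r in lborel. Esq L s (u r) * indicator {a..b} r \<noteq> \<infinity>"
    using fin by (intro nn_integral_PInf_AE) auto
  then show ?thesis by eventually_elim (auto simp: less_top)
qed

lemma Vspace_AE:
  assumes "cmodes u" "\<And>r. solen L (u r)" "(\<integral>\<^sup>+r\<in>{a..b}. Esq L s (u r) \<partial>lborel) < \<infinity>"
  shows "AE r in lborel. r \<in> {a..b} \<longrightarrow> u r \<in> Vspace L s"
  using Esq_AE_finite[OF assms(1,3)] by eventually_elim (simp add: Vspace_iff assms(2))

text \<open>Tonelli's theorem in the form in which bounds on single modes become bounds in L_2(V^s),
  and conversely.\<close>

lemma Esq_integral_swap:
  assumes "cmodes u"
  shows "(\<integral>\<^sup>+r\<in>{0..t}. Esq L s (u r) \<partial>lborel)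
    = (\<integral>\<^sup>+k. ennreal ((wt L s k)\<^sup>2) * (\<integral>\<^sup>+r\<in>{0..t}. ennreal ((norm (u r k))\<^sup>2) \<partial>lborel) \<partial>count_space UNIV)"
proof -
  have [measurable]: "(\<lambda>t. u t k) \<in> borel_measurable borel" for k using assms by (rule cmodesD)
  have "(\<integral>\<^sup>+r\<in>{0..t}. Esq L s (u r) \<partial>lborel)
    = (\<integral>\<^sup>+r. \<integral>\<^sup>+k. ennreal ((wt L s k)\<^sup>2) * (ennreal ((norm (u r k))\<^sup>2) * indicator {0..t} r) \<partial>count_space UNIV \<partial>lborel)"
    unfolding Esq_def
    by (intro nn_integral_cong) (simp add: nn_integral_multc[symmetric] power_mult_distrib ennreal_mult mult.assoc)
  also have "\<dots> = (\<integral>\<^sup>+k. \<integral>\<^sup>+r. ennreal ((wt L s k)\<^sup>2) * (ennreal ((norm (u r k))\<^sup>2) * indicator {0..t} r) \<partial>lborel \<partial>count_space UNIV)"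
    by (rule nn_sum_swap) measurable
  also have "\<dots> = (\<integral>\<^sup>+k. ennreal ((wt L s k)\<^sup>2) * (\<integral>\<^sup>+r\<in>{0..t}. ennreal ((norm (u r k))\<^sup>2) \<partial>lborel) \<partial>count_space UNIV)"
    by (intro nn_integral_cong nn_integral_cmult) measurable
  finally show ?thesis .
qed

text \<open>\<open>damped_energy\<close> with damping \<nu> |\<zeta>|^2, multiplied by
  |\<zeta>|^(2a): the dissipation gains one order and the force loses one. The version for single
  modes is kept since it also provides the summable majorant for continuity in time.\<close>

lemma heat_energy_mode:
  assumes L: "L > 0" and nu: "\<nu> > 0" and s: "hsol L \<nu> T c0 F u" and t: "t \<in> {0..T}"
  shows "ennreal ((wt L a k)\<^sup>2 * (norm (u t k))\<^sup>2)
      + ennreal \<nu> * (ennreal ((wt L (a + 1) k)\<^sup>2) * (\<integral>\<^sup>+r\<in>{0..t}. ennreal ((norm (u r k))\<^sup>2) \<partial>lborel))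
    \<le> ennreal ((wt L a k)\<^sup>2 * (norm (c0 k))\<^sup>2)
      + ennreal (1 / \<nu>) * (ennreal ((wt L (a - 1) k)\<^sup>2) * (\<integral>\<^sup>+r\<in>{0..t}. ennreal ((norm (F r k))\<^sup>2) \<partial>lborel))"
proof (cases "k = 0")
  case False
  let ?W = "ennreal ((wt L a k)\<^sup>2)"
  let ?U = "\<integral>\<^sup>+r\<in>{0..t}. ennreal ((norm (u r k))\<^sup>2) \<partial>lborel" and ?F = "\<integral>\<^sup>+r\<in>{0..t}. ennreal ((norm (F r k))\<^sup>2) \<partial>lborel"
  have l: "\<nu> * wt L 2 k > 0" using nu wt_pos[OF L False] by simp
  have "ennreal ((norm (u t k))\<^sup>2) + ennreal (\<nu> * wt L 2 k) * ?U
      \<le> ennreal ((norm (c0 k))\<^sup>2) + ennreal (1 / (\<nu> * wt L 2 k)) * ?F"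
    using s t by (intro damped_energy[OF l]) (auto simp: hsol_def)
  then have "?W * (ennreal ((norm (u t k))\<^sup>2) + ennreal (\<nu> * wt L 2 k) * ?U)
      \<le> ?W * (ennreal ((norm (c0 k))\<^sup>2) + ennreal (1 / (\<nu> * wt L 2 k)) * ?F)"
    by (rule mult_left_mono) simp
  moreover have "?W * ennreal (\<nu> * wt L 2 k) = ennreal \<nu> * ennreal ((wt L (a + 1) k)\<^sup>2)"
  proof -
    have "(wt L a k)\<^sup>2 * (\<nu> * wt L 2 k) = \<nu> * (wt L (a + 1) k)\<^sup>2"
      by (simp add: wt_sq wt_mult distrib_left mult.left_commute)
    then show ?thesis using nu by (simp flip: ennreal_mult)
  qed
  moreover have "?W * ennreal (1 / (\<nu> * wt L 2 k)) = ennreal (1 / \<nu>) * ennreal ((wt L (a - 1) k)\<^sup>2)"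
  proof -
    have "(wt L a k)\<^sup>2 = wt L (2 * (a - 1)) k * wt L 2 k" by (simp add: wt_sq wt_mult)
    then have "(wt L a k)\<^sup>2 * (1 / (\<nu> * wt L 2 k)) = 1 / \<nu> * (wt L (a - 1) k)\<^sup>2"
      using wt_pos[OF L False, of 2] nu by (simp add: wt_sq[of L "a - 1"])
    then show ?thesis using nu by (simp flip: ennreal_mult)
  qed
  ultimately show ?thesis
    by (simp only: distrib_left mult.assoc[symmetric]) (simp add: ennreal_mult)
qed simp

lemma heat_energy:
  assumes L: "L > 0" and nu: "\<nu> > 0" and s: "hsol L \<nu> T c0 F u" and t: "t \<in> {0..T}"
    and u: "cmodes u" and F: "cmodes F"
  shows "Esq L a (u t) + ennreal \<nu> * (\<integral>\<^sup>+r\<in>{0..t}. Esq L (a + 1) (u r) \<partial>lborel)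
    \<le> Esq L a c0 + ennreal (1 / \<nu>) * (\<integral>\<^sup>+r\<in>{0..t}. Esq L (a - 1) (F r) \<partial>lborel)"
  using nn_integral_mono[OF heat_energy_mode[OF L nu s t, of a], of "count_space UNIV"]
  by (simp add: nn_integral_add nn_integral_cmult Esq_integral_swap[OF u] Esq_integral_swap[OF F])
    (simp add: Esq_def power_mult_distrib)

lemma L2_modes_integrable:
  fixes f :: "real \<Rightarrow> 'a::euclidean_space"
  assumes [measurable]: "f \<in> borel_measurable borel" and fin: "(\<integral>\<^sup>+r\<in>{0..T}. ennreal ((norm (f r))\<^sup>2) \<partial>lborel) < \<infinity>"
  shows "set_integrable lborel {0..T} f"
  unfolding set_integrable_def
proof (rule integrableI_bounded)
  have "(\<integral>\<^sup>+r. ennreal (norm (indicator {0..T} r *\<^sub>R f r)) \<partial>lborel)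
      \<le> (\<integral>\<^sup>+r. indicator {0..T} r + ennreal ((norm (f r))\<^sup>2) * indicator {0..T} r \<partial>lborel)"
  proof (intro nn_integral_mono)
    fix r
    have "norm (f r) \<le> 1 + (norm (f r))\<^sup>2"
      using sum_squares_bound[of 1 "norm (f r)"] norm_ge_zero[of "f r"] by (simp add: power2_eq_square del: norm_ge_zero)
    then show "ennreal (norm (indicator {0..T} r *\<^sub>R f r)) \<le> indicator {0..T} r + ennreal ((norm (f r))\<^sup>2) * indicator {0..T} r"
      using ennreal_leI by (fastforce simp: indicator_def)
  qed
  also have "\<dots> = emeasure lborel {0..T} + (\<integral>\<^sup>+r\<in>{0..T}. ennreal ((norm (f r))\<^sup>2) \<partial>lborel)"
    by (subst nn_integral_add) auto
  also have "\<dots> < \<infinity>" using fin by (simp add: emeasure_lborel_Icc_eq)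
  finally show "(\<integral>\<^sup>+r. ennreal (norm (indicator {0..T} r *\<^sub>R f r)) \<partial>lborel) < \<infinity>" .
qed measurable

lemma L2_modes:
  assumes L: "L > 0" and F: "cmodes F" and F0: "\<And>r. F r 0 = 0"
    and fin: "(\<integral>\<^sup>+r\<in>{0..T}. Esq L s (F r) \<partial>lborel) < \<infinity>"
  shows "set_integrable lborel {0..T} (\<lambda>r. F r k)" "(\<integral>\<^sup>+r\<in>{0..T}. ennreal ((norm (F r k))\<^sup>2) \<partial>lborel) < \<infinity>"
proof -
  have [measurable]: "(\<lambda>t. F t k) \<in> borel_measurable borel" for k using F by (rule cmodesD)
  show *: "(\<integral>\<^sup>+r\<in>{0..T}. ennreal ((norm (F r k))\<^sup>2) \<partial>lborel) < \<infinity>"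
  proof (cases "k = 0")
    case False
    have "ennreal ((wt L s k)\<^sup>2) * (\<integral>\<^sup>+r\<in>{0..T}. ennreal ((norm (F r k))\<^sup>2) \<partial>lborel) \<le> (\<integral>\<^sup>+r\<in>{0..T}. Esq L s (F r) \<partial>lborel)"
      unfolding Esq_integral_swap[OF F]
      by (rule nn_integral_ge_point[where p = "\<lambda>k. ennreal ((wt L s k)\<^sup>2) * (\<integral>\<^sup>+r\<in>{0..T}. ennreal ((norm (F r k))\<^sup>2) \<partial>lborel)"]) simp
    then have "ennreal ((wt L s k)\<^sup>2) * (\<integral>\<^sup>+r\<in>{0..T}. ennreal ((norm (F r k))\<^sup>2) \<partial>lborel) < \<infinity>"
      using fin by (rule le_less_trans)
    then show ?thesis using wt_pos[OF L False, of s] by (auto simp: ennreal_mult_less_top ennreal_eq_0_iff)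
  qed (simp add: F0)
  show "set_integrable lborel {0..T} (\<lambda>r. F r k)"
    by (rule L2_modes_integrable[OF _ *]) measurable
qed

definition heat :: "real \<Rightarrow> real \<Rightarrow> coeffs \<Rightarrow> (real \<Rightarrow> coeffs) \<Rightarrow> real \<Rightarrow> coeffs" where
  "heat L \<nu> c0 F t = (\<lambda>k. exp (- (\<nu> * wt L 2 k) * t) *\<^sub>R
     (c0 k + prim (\<lambda>r. exp (\<nu> * wt L 2 k * r) *\<^sub>R F r k) t))"

lemma heat_hsol:
  assumes F: "\<And>k. set_integrable lborel {0..T} (\<lambda>r. F r k)"
  shows "hsol L \<nu> T c0 F (heat L \<nu> c0 F)"
  unfolding hsol_def
proof (intro allI conjI ballI)
  fix k
  show "set_integrable lborel {0..T} (\<lambda>r. F r k)" by (rule F)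
  have i: "set_integrable lborel {0..T} (\<lambda>r. exp (\<nu> * wt L 2 k * r) *\<^sub>R F r k)"
    by (intro set_integrable_mult_cont F continuous_intros)
  have "continuous_on {0..T} (\<lambda>t. (\<nu> * wt L 2 k) *\<^sub>R heat L \<nu> c0 F t k)"
    unfolding heat_def by (intro continuous_intros continuous_on_prim i)
  then show "set_integrable lborel {0..T} (\<lambda>r. F r k - (\<nu> * wt L 2 k) *\<^sub>R heat L \<nu> c0 F r k)"
    by (intro set_integral_diff(1) F set_integrable_continuous)
  show "heat L \<nu> c0 F t k = c0 k + prim (\<lambda>r. F r k - (\<nu> * wt L 2 k) *\<^sub>R heat L \<nu> c0 F r k) t" if "t \<in> {0..T}" for t
    by (rule duhamel[OF F _ that]) (simp add: heat_def)
qed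

lemma cmodes_heat: "cmodes F \<Longrightarrow> cmodes (heat L \<nu> c0 F)"
  unfolding cmodes_def heat_def by (auto intro!: borel_measurable_scaleR borel_measurable_add prim_measurable)

text \<open>The constraints pass through the primitive because \<open>cj\<close> and
  \<open>zdot\<close> are bounded linear, which requires an integrable function. Integrability on
  the whole line gives them at every t, also outside [0, T].\<close>

lemma solen_heat:
  assumes c0: "solen L c0" and F: "\<And>r. solen L (F r)" and i: "\<And>k. integrable lborel (\<lambda>r. F r k)"
  shows "solen L (heat L \<nu> c0 F t)"
proof -
  have it: "set_integrable lborel {0..t} (\<lambda>r. exp (\<nu> * wt L 2 k * r) *\<^sub>R F r k)" for k
  proof (intro set_integrable_mult_cont continuous_intros)
    show "set_integrable lborel {0..t} (\<lambda>r. F r k)"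
      unfolding set_integrable_def using integrable_mult_indicator[OF _ i] by simp
  qed
  have "heat L \<nu> c0 F t (- k) = cj (heat L \<nu> c0 F t k)" for k
    using prim_linear(1)[OF bounded_linear_cj it[of k]]
    by (simp add: heat_def solenD(2)[OF c0] solenD(2)[OF F])
  moreover have "zdot (freq L k) (heat L \<nu> c0 F t k) = 0" for k
    using prim_linear(1)[OF bounded_linear_zdot[of "freq L k"] it[of k]]
    by (simp add: heat_def solenD(3)[OF c0] solenD(3)[OF F] prim_def)
  moreover have "heat L \<nu> c0 F t 0 = 0"
    by (simp add: heat_def solenD(1)[OF c0] solenD(1)[OF F] prim_def)
  ultimately show ?thesis by (simp add: solen_iff)
qed

lemma hsol_diff:
  assumes u: "hsol L \<nu> T c0 F u" and w: "hsol L \<nu> T d0 G w"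
  shows "hsol L \<nu> T (\<lambda>k. c0 k - d0 k) (\<lambda>r k. F r k - G r k) (\<lambda>t k. u t k - w t k)"
  unfolding hsol_def
proof (intro allI conjI ballI)
  fix k
  let ?l = "\<nu> * wt L 2 k"
  have e: "F r k - G r k - ?l *\<^sub>R (u r k - w r k) = (F r k - ?l *\<^sub>R u r k) - (G r k - ?l *\<^sub>R w r k)" for r
    by (simp add: algebra_simps)
  show "set_integrable lborel {0..T} (\<lambda>r. F r k - G r k)"
    using u w by (intro set_integral_diff(1)) (auto simp: hsol_def)
  have "set_integrable lborel {0..T} (\<lambda>r. F r k - ?l *\<^sub>R u r k)" "set_integrable lborel {0..T} (\<lambda>r. G r k - ?l *\<^sub>R w r k)"
    using u w by (auto simp: hsol_def)
  from set_integral_diff(1)[OF this] show "set_integrable lborel {0..T} (\<lambda>r. F r k - G r k - ?l *\<^sub>R (u r k - w r k))"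
    unfolding e .
  fix t assume t: "t \<in> {0..T}"
  have i: "set_integrable lborel {0..t} (\<lambda>r. F r k - ?l *\<^sub>R u r k)" "set_integrable lborel {0..t} (\<lambda>r. G r k - ?l *\<^sub>R w r k)"
  proof -
    have "set_integrable lborel {0..T} (\<lambda>r. F r k - ?l *\<^sub>R u r k)" "set_integrable lborel {0..T} (\<lambda>r. G r k - ?l *\<^sub>R w r k)"
      using u w unfolding hsol_def by blast+
    then show "set_integrable lborel {0..t} (\<lambda>r. F r k - ?l *\<^sub>R u r k)" "set_integrable lborel {0..t} (\<lambda>r. G r k - ?l *\<^sub>R w r k)"
      using t by (auto elim: set_integrable_Icc_mono)
  qed
  have "u t k = c0 k + prim (\<lambda>r. F r k - ?l *\<^sub>R u r k) t" "w t k = d0 k + prim (\<lambda>r. G r k - ?l *\<^sub>R w r k) t"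
    using u w t unfolding hsol_def by blast+
  then show "u t k - w t k = c0 k - d0 k + prim (\<lambda>r. F r k - G r k - ?l *\<^sub>R (u r k - w r k)) t"
    unfolding e prim_diff[OF i] by (simp only: add_diff_add)
qed

text \<open>The force may change on a null set of times, but u only outside the interval, because
  the integral equation holds at every t in it.\<close>

lemma hsol_cong_AE:
  assumes u: "hsol L \<nu> T c0 F u" and F: "cmodes F" and G: "cmodes G" and w: "cmodes w"
    and FG: "AE r in lborel. r \<in> {0..T} \<longrightarrow> F r = G r" and uw: "\<And>t. t \<in> {0..T} \<Longrightarrow> u t = w t" and um: "cmodes u"
  shows "hsol L \<nu> T c0 G w"
  unfolding hsol_def
proof (intro allI conjI ballI)
  fix k
  let ?l = "\<nu> * wt L 2 k"
  have [measurable]: "(\<lambda>t. F t k) \<in> borel_measurable borel" "(\<lambda>t. G t k) \<in> borel_measurable borel"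
     "(\<lambda>t. w t k) \<in> borel_measurable borel" "(\<lambda>t. u t k) \<in> borel_measurable borel" using F G w um by (auto intro: cmodesD)
  have F1: "set_integrable lborel {0..T} (\<lambda>r. F r k)" "set_integrable lborel {0..T} (\<lambda>r. F r k - ?l *\<^sub>R u r k)"
    using u by (auto simp: hsol_def)
  show "set_integrable lborel {0..T} (\<lambda>r. G r k)"
    using F1(1) unfolding set_integrable_def
    by (rule Bochner_Integration.integrable_cong_AE[THEN iffD1, rotated -1]) (use FG in \<open>auto elim!: AE_mp simp: indicator_def\<close>)
  show "set_integrable lborel {0..T} (\<lambda>r. G r k - ?l *\<^sub>R w r k)"
    using F1(2) unfolding set_integrable_def
    by (rule Bochner_Integration.integrable_cong_AE[THEN iffD1, rotated -1]) (use FG uw in \<open>auto elim!: AE_mp simp: indicator_def\<close>)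
  fix t assume t: "t \<in> {0..T}"
  have "prim (\<lambda>r. F r k - ?l *\<^sub>R u r k) t = prim (\<lambda>r. G r k - ?l *\<^sub>R w r k) t"
    by (rule prim_cong_AE) (use FG uw t in \<open>auto elim!: AE_mp\<close>)
  then show "w t k = c0 k + prim (\<lambda>r. G r k - ?l *\<^sub>R w r k) t"
    using u t uw by (auto simp: hsol_def)
qed


section \<open>The linear equation with a given drift\<close>

text \<open>The force f - B(v,u). Setting it to 0 outside [0, T] turns integrability on the interval
  into integrability on the line, as \<open>solen_heat\<close> requires.\<close>

definition NF :: "real \<Rightarrow> real \<Rightarrow> coeffs \<Rightarrow> (real \<Rightarrow> coeffs) \<Rightarrow> (real \<Rightarrow> coeffs) \<Rightarrow> real \<Rightarrow> coeffs" where
  "NF L T f v u r = (\<lambda>k. if r \<in> {0..T} then f k - Bc L (v r) (u r) k else 0)"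

lemma cmodes_NF: "cmodes v \<Longrightarrow> cmodes u \<Longrightarrow> cmodes (NF L T f v u)"
  unfolding cmodes_def
proof
  fix k assume "\<forall>k. (\<lambda>t. v t k) \<in> borel_measurable borel" "\<forall>k. (\<lambda>t. u t k) \<in> borel_measurable borel"
  then have [measurable]: "(\<lambda>r. Bc L (v r) (u r) k) \<in> borel_measurable borel" by (intro measurable_Bc) auto
  show "(\<lambda>t. NF L T f v u t k) \<in> borel_measurable borel" unfolding NF_def by measurable
qed

lemma solen_NF: "solen L f \<Longrightarrow> (\<And>r. solen L (v r)) \<Longrightarrow> (\<And>r. solen L (u r)) \<Longrightarrow> solen L (NF L T f v u r)"
  unfolding NF_def using solen_diff[OF _ solen_Bc, of L f "v r" "u r"] by (cases "r \<in> {0..T}") auto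

section \<open>Limits of Picard iterates\<close>

lemma geometric_convergent:
  fixes x :: "nat \<Rightarrow> 'a::banach"
  assumes "\<And>m n. norm (x (m + n) - x n) \<le> c / 2 ^ n"
  shows "convergent x"
proof (rule Cauchy_convergent, rule metric_CauchyI)
  fix e :: real assume e: "e > 0"
  have "(\<lambda>n. c / 2 ^ n) \<longlonglongrightarrow> 0"
    using LIMSEQ_divide_realpow_zero[of 2 c] by simp
  then obtain N where N: "c / 2 ^ N < e / 2"
    using e order_tendstoD(2)[of "\<lambda>n. c / 2 ^ n" 0 sequentially "e / 2"] by (auto simp: eventually_sequentially)
  show "\<exists>M. \<forall>m\<ge>M. \<forall>n\<ge>M. dist (x m) (x n) < e"
  proof (intro exI allI impI)
    fix m n assume "N \<le> m" "N \<le> n"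
    then have "norm (x m - x N) \<le> c / 2 ^ N" "norm (x n - x N) \<le> c / 2 ^ N"
      using assms[of "m - N" N] assms[of "n - N" N] by auto
    moreover have "norm (x m - x n) \<le> norm (x m - x N) + norm (x n - x N)"
      using norm_triangle_ineq4[of "x m - x N" "x n - x N"] by simp
    ultimately show "dist (x m) (x n) < e"
      unfolding dist_norm using N by linarith
  qed
qed

text \<open>Fatou's lemma for the counting measure: a limit taken mode by mode inherits norm bounds.
  This takes the place of completeness of V^s in the Picard iteration.\<close>

lemma Esq_liminf:
  assumes lim: "\<And>k. (\<lambda>m. x m k) \<longlonglongrightarrow> y k" and le: "\<And>m. Esq L s (x m) \<le> c"
  shows "Esq L s y \<le> c"
proof -
  have "(\<lambda>m. ennreal ((wt L s k * norm (x m k))\<^sup>2)) \<longlonglongrightarrow> ennreal ((wt L s k * norm (y k))\<^sup>2)" for k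
    by (intro tendsto_intros lim)
  from lim_imp_Liminf[OF sequentially_bot this]
  have "Esq L s y = (\<integral>\<^sup>+k. liminf (\<lambda>m. ennreal ((wt L s k * norm (x m k))\<^sup>2)) \<partial>count_space UNIV)"
    unfolding Esq_def by (simp only:)
  also have "\<dots> \<le> liminf (\<lambda>m. Esq L s (x m))"
    unfolding Esq_def by (rule nn_integral_liminf) simp
  also have "\<dots> \<le> c"
  proof -
    have "liminf (\<lambda>m. Esq L s (x m)) \<le> liminf (\<lambda>m. c)"
      by (rule Liminf_mono) (simp add: le)
    then show ?thesis by (simp add: Liminf_const)
  qed
  finally show ?thesis .
qed

section \<open>The contraction in the weighted norm, and the linear problem\<close>

locale drift =
  fixes L \<nu> \<alpha> T :: real and v :: "real \<Rightarrow> coeffs"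
  assumes L: "L > 0" and nu: "\<nu> > 0" and alpha: "\<alpha> > 1/2" and T: "T \<ge> 0"
    and v_modes: "cmodes v" and v_solen: "\<And>t. solen L (v t)"
    and v_fin: "(\<integral>\<^sup>+r\<in>{0..T}. Esq L (1 + \<alpha>) (v r) \<partial>lborel) < \<infinity>"
begin

definition hv :: "real \<Rightarrow> real" where "hv r = enn2real (Esq L (1 + \<alpha>) (v r))"
definition Br :: real where "Br = enn2real (Bconst L (1 + \<alpha>) \<alpha>)"
text \<open>Chosen to have Br / Kr \<le> \<nu> / 8. The summand 1 keeps it positive if
  \<open>Br\<close> is 0.\<close>

definition Kr :: real where "Kr = 8 * Br / \<nu> + 1"
definition rho :: "real \<Rightarrow> real" where "rho t = exp (Kr * prim hv t)"

lemma hv_nonneg: "hv r \<ge> 0"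
  by (simp add: hv_def)

lemma Br_nonneg: "Br \<ge> 0"
  by (simp add: Br_def)

lemma Kr_pos: "Kr > 0"
proof -
  have "8 * Br / \<nu> \<ge> 0" using Br_nonneg nu by simp
  then show ?thesis by (simp add: Kr_def)
qed

lemma v_Esq_measurable [measurable]: "(\<lambda>r. Esq L s (v r)) \<in> borel_measurable borel"
  by (rule cmodes_Esq[OF v_modes])

lemma hv_measurable [measurable]: "hv \<in> borel_measurable borel"
  unfolding hv_def[abs_def] by measurable

lemma rho_measurable [measurable]: "rho \<in> borel_measurable borel"
  unfolding rho_def[abs_def] by measurable

lemma hv_AE: "AE r in lborel. r \<in> {0..T} \<longrightarrow> Esq L (1 + \<alpha>) (v r) = ennreal (hv r)"
  using Esq_AE_finite[OF v_modes v_fin] by eventually_elim (auto simp: hv_def ennreal_enn2real_if)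

lemma hv_int: "set_integrable lborel {0..T} hv"
  unfolding set_integrable_def
proof (rule integrableI_bounded)
  have "(\<integral>\<^sup>+r. ennreal (norm (indicator {0..T} r *\<^sub>R hv r)) \<partial>lborel) \<le> (\<integral>\<^sup>+r\<in>{0..T}. Esq L (1 + \<alpha>) (v r) \<partial>lborel)"
    by (intro nn_integral_mono) (auto simp: indicator_def hv_def ennreal_enn2real_if)
  then show "(\<integral>\<^sup>+r. ennreal (norm (indicator {0..T} r *\<^sub>R hv r)) \<partial>lborel) < \<infinity>"
    using v_fin by (rule le_less_trans)
qed measurable

lemma rho_ge_1: "rho t \<ge> 1"
  using Kr_pos prim_nonneg[of t hv] hv_nonneg by (simp add: rho_def)

lemma rho_pos: "rho t > 0"
  by (simp add: rho_def)

lemma rho_bounded: "\<exists>R. \<forall>t\<in>{0..T}. rho t \<le> R"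
proof -
  have "continuous_on {0..T} rho" unfolding rho_def by (intro continuous_intros continuous_on_prim hv_int)
  then have "bounded (rho ` {0..T})" by (intro compact_imp_bounded compact_continuous_image) auto
  then obtain R where "\<forall>x\<in>rho ` {0..T}. norm x \<le> R" unfolding bounded_iff by blast
  then have "\<forall>t\<in>{0..T}. rho t \<le> R" by auto
  then show ?thesis ..
qed

lemma Bconst_eq: "Bconst L (1 + \<alpha>) \<alpha> = ennreal Br"
  using Bconst_finite[OF L, of "1 + \<alpha>" \<alpha>] alpha by (simp add: Br_def less_top)

lemma v_Esq0: "Esq L (1 + \<alpha>) (v r) = ennreal (hv r) \<Longrightarrow> Esq L 0 (v r) < \<infinity>"
  using Esq_finite_mono[OF L, of 0 "1 + \<alpha>" "v r"] alpha by simp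

text \<open>\<open>exp_weight\<close> trades the integral of \<open>hv * rho\<close> for
  \<open>rho / Kr\<close>. By the choice of \<open>Kr\<close> the drift term costs only the fraction
  \<nu> / 8, however large v is and without a restriction to short times.\<close>

lemma drift_integral_bound:
  assumes e: "cmodes e" "\<And>r. e r 0 = 0" and C: "C \<ge> 0" and t: "t \<in> {0..T}"
    and le: "\<And>r. r \<in> {0..T} \<Longrightarrow> Esq L \<alpha> (e r) \<le> ennreal (C * rho r)"
  shows "(\<integral>\<^sup>+r\<in>{0..t}. Esq L (\<alpha> - 1) (Bc L (v r) (e r)) \<partial>lborel) \<le> ennreal (\<nu> / 8 * C * rho t)"
proof -
  have "(\<integral>\<^sup>+r\<in>{0..t}. Esq L (\<alpha> - 1) (Bc L (v r) (e r)) \<partial>lborel)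
      \<le> (\<integral>\<^sup>+r. ennreal (Br * C) * (ennreal (hv r * rho r) * indicator {0..t} r) \<partial>lborel)"
  proof (rule nn_integral_mono_AE)
    show "AE r in lborel. Esq L (\<alpha> - 1) (Bc L (v r) (e r)) * indicator {0..t} r \<le> ennreal (Br * C) * (ennreal (hv r * rho r) * indicator {0..t} r)"
      using hv_AE
    proof eventually_elim
      case (elim r)
      show ?case
      proof (cases "r \<in> {0..t}")
        case True
        then have r: "r \<in> {0..T}" using t by auto
        have "Esq L (\<alpha> - 1) (Bc L (v r) (e r)) \<le> ennreal Br * (Esq L (1 + \<alpha>) (v r) * Esq L \<alpha> (e r))"
          unfolding Bconst_eq[symmetric] using alpha by (intro Bc_bound[OF L] e solenD(1)[OF v_solen]) auto
        also have "\<dots> \<le> ennreal Br * (ennreal (hv r) * ennreal (C * rho r))"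
          using elim r le[OF r] by (auto intro!: mult_left_mono)
        also have "\<dots> = ennreal (Br * C) * ennreal (hv r * rho r)"
          using Br_nonneg hv_nonneg C rho_pos[of r] by (simp add: ac_simps flip: ennreal_mult)
        finally show ?thesis using True by simp
      qed simp
    qed
  qed
  also have "\<dots> = ennreal (Br * C) * (\<integral>\<^sup>+r\<in>{0..t}. ennreal (hv r * rho r) \<partial>lborel)"
    by (rule nn_integral_cmult) measurable
  also have "\<dots> \<le> ennreal (Br * C) * ennreal (rho t / Kr)"
    unfolding rho_def by (intro mult_left_mono exp_weight[OF hv_int hv_nonneg Kr_pos t]) auto
  also have "\<dots> = ennreal (Br * C * (rho t / Kr))"
    using Br_nonneg C rho_pos[of t] Kr_pos by (simp flip: ennreal_mult)
  also have "\<dots> \<le> ennreal (\<nu> / 8 * C * rho t)"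
  proof (rule ennreal_leI)
    have "Br \<le> \<nu> / 8 * Kr" using nu by (simp add: Kr_def field_simps)
    then have "Br / Kr \<le> \<nu> / 8" using Kr_pos by (simp add: pos_divide_le_eq)
    then have "Br / Kr * (C * rho t) \<le> \<nu> / 8 * (C * rho t)"
      using C rho_pos[of t] by (intro mult_right_mono) auto
    then show "Br * C * (rho t / Kr) \<le> \<nu> / 8 * C * rho t" by simp
  qed
  finally show ?thesis .
qed

text \<open>Membership in the closed ball of squared radius C for the supremum norm in time with
  values in V^\<alpha>, weighted by 1 / \<open>rho\<close>.\<close>

definition good :: "real \<Rightarrow> (real \<Rightarrow> coeffs) \<Rightarrow> bool" where
  "good C w \<longleftrightarrow> cmodes w \<and> (\<forall>t. solen L (w t)) \<and> (\<forall>t\<in>{0..T}. Esq L \<alpha> (w t) \<le> ennreal (C * rho t))"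

lemma good_Esq0: "good C w \<Longrightarrow> t \<in> {0..T} \<Longrightarrow> Esq L 0 (w t) < \<infinity>"
  by (rule Esq_finite_mono[OF L, of 0 \<alpha>]) (use alpha in \<open>auto simp: good_def intro: le_less_trans[OF _ ennreal_less_top]\<close>)

lemma NF_integral_bound:
  assumes w: "good C w" and C: "C \<ge> 0" and t: "t \<in> {0..T}"
  shows "(\<integral>\<^sup>+r\<in>{0..t}. Esq L (\<alpha> - 1) (NF L T f v w r) \<partial>lborel) \<le> 2 * ennreal T * Esq L (\<alpha> - 1) f + ennreal (\<nu> / 4 * C * rho t)"
proof -
  have w': "cmodes w" "\<And>r. w r 0 = 0" using w by (auto simp: good_def solenD(1)[where L = L])
  have [measurable]: "(\<lambda>r. Esq L (\<alpha> - 1) (Bc L (v r) (w r))) \<in> borel_measurable borel"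
    by (intro cmodes_Esq cmodes_Bc v_modes w')
  have "(\<integral>\<^sup>+r\<in>{0..t}. Esq L (\<alpha> - 1) (NF L T f v w r) \<partial>lborel)
      \<le> (\<integral>\<^sup>+r. 2 * Esq L (\<alpha> - 1) f * indicator {0..t} r + 2 * (Esq L (\<alpha> - 1) (Bc L (v r) (w r)) * indicator {0..t} r) \<partial>lborel)"
  proof (intro nn_integral_mono)
    fix r
    show "Esq L (\<alpha> - 1) (NF L T f v w r) * indicator {0..t} r \<le>
        2 * Esq L (\<alpha> - 1) f * indicator {0..t} r + 2 * (Esq L (\<alpha> - 1) (Bc L (v r) (w r)) * indicator {0..t} r)"
      using Esq_diff[of L "\<alpha> - 1" f "Bc L (v r) (w r)"] t by (auto simp: indicator_def NF_def)
  qed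
  also have "\<dots> = 2 * Esq L (\<alpha> - 1) f * emeasure lborel {0..t} + 2 * (\<integral>\<^sup>+r\<in>{0..t}. Esq L (\<alpha> - 1) (Bc L (v r) (w r)) \<partial>lborel)"
    by (subst nn_integral_add) (auto simp: nn_integral_cmult nn_integral_cmult_indicator)
  also have "\<dots> \<le> 2 * Esq L (\<alpha> - 1) f * ennreal T + 2 * ennreal (\<nu> / 8 * C * rho t)"
    using t w C by (intro add_mono mult_left_mono drift_integral_bound[OF w' C t]) (auto simp: good_def intro: ennreal_leI)
  also have "2 * ennreal (\<nu> / 8 * C * rho t) = ennreal (\<nu> / 4 * C * rho t)"
  proof -
    have "2 * ennreal (\<nu> / 8 * C * rho t) = ennreal (2 * (\<nu> / 8 * C * rho t))"
      using nu C rho_pos[of t] by (subst ennreal_mult) auto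
    also have "2 * (\<nu> / 8 * C * rho t) = \<nu> / 4 * C * rho t" by simp
    finally show ?thesis .
  qed
  finally show ?thesis by (simp add: ac_simps)
qed

text \<open>The energy inequality with zero data gives the factor (1 / \<nu>) (\<nu> / 8), weakened
  to 1/4 so that the distance itself is halved. Only the norms of G are compared, since the
  difference of two forces is -B(v,e). In the existence proof e is a difference of two iterates, in
  the uniqueness proof it is d itself.\<close>

lemma contraction:
  assumes d: "hsol L \<nu> T (\<lambda>k. 0) G d" "cmodes d" "cmodes G" and e: "cmodes e" "\<And>r. e r 0 = 0" and C: "C \<ge> 0"
    and le: "\<And>r. r \<in> {0..T} \<Longrightarrow> Esq L \<alpha> (e r) \<le> ennreal (C * rho r)"
    and G: "AE r in lborel. r \<in> {0..T} \<longrightarrow> (\<forall>k. norm (G r k) = norm (Bc L (v r) (e r) k))"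
    and t: "t \<in> {0..T}"
  shows "Esq L \<alpha> (d t) \<le> ennreal (C / 4 * rho t)"
proof -
  have "Esq L \<alpha> (d t) \<le> Esq L \<alpha> (\<lambda>k. 0) + ennreal (1 / \<nu>) * (\<integral>\<^sup>+r\<in>{0..t}. Esq L (\<alpha> - 1) (G r) \<partial>lborel)"
    by (rule order_trans[OF _ heat_energy[OF L nu d(1) t d(2,3)]]) simp
  also have "(\<integral>\<^sup>+r\<in>{0..t}. Esq L (\<alpha> - 1) (G r) \<partial>lborel) = (\<integral>\<^sup>+r\<in>{0..t}. Esq L (\<alpha> - 1) (Bc L (v r) (e r)) \<partial>lborel)"
  proof (rule nn_integral_cong_AE)
    show "AE r in lborel. Esq L (\<alpha> - 1) (G r) * indicator {0..t} r = Esq L (\<alpha> - 1) (Bc L (v r) (e r)) * indicator {0..t} r"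
      using G by eventually_elim (use t in \<open>auto simp: indicator_def intro!: Esq_cong_norm\<close>)
  qed
  also have "ennreal (1 / \<nu>) * \<dots> \<le> ennreal (1 / \<nu>) * ennreal (\<nu> / 8 * C * rho t)"
    by (intro mult_left_mono drift_integral_bound[OF e C t le]) auto
  also have "\<dots> = ennreal (C / 8 * rho t)"
    using nu C rho_pos[of t] by (simp flip: ennreal_mult)
  also have "\<dots> \<le> ennreal (C / 4 * rho t)"
    using C rho_pos[of t] by (intro ennreal_leI mult_right_mono) auto
  finally show ?thesis by (simp add: add_left_mono)
qed

lemma NF_diff_AE:
  assumes u: "\<And>r. u r 0 = 0" "AE r in lborel. r \<in> {0..T} \<longrightarrow> Esq L 0 (u r) < \<infinity>"
    and w: "\<And>r. w r 0 = 0" "AE r in lborel. r \<in> {0..T} \<longrightarrow> Esq L 0 (w r) < \<infinity>"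
  shows "AE r in lborel. r \<in> {0..T} \<longrightarrow> (\<forall>k. norm (NF L T f v u r k - NF L T f v w r k) = norm (Bc L (v r) (\<lambda>k. u r k - w r k) k))"
  using hv_AE u(2) w(2)
proof eventually_elim
  case (elim r)
  show ?case
  proof (intro impI allI)
    fix k assume r: "r \<in> {0..T}"
    have "Bc L (v r) (\<lambda>k. u r k - w r k) k = Bc L (v r) (u r) k - Bc L (v r) (w r) k"
      using elim r by (intro Bc_diff_right[OF L] u w solenD(1)[OF v_solen] v_Esq0) auto
    then show "norm (NF L T f v u r k - NF L T f v w r k) = norm (Bc L (v r) (\<lambda>k. u r k - w r k) k)"
      using r by (simp add: NF_def norm_minus_commute)
  qed
qed

lemma linear_existence:
  assumes c0: "c0 \<in> Vspace L \<alpha>" and f: "f \<in> Vspace L (\<alpha> - 1)"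
  obtains u C where "cmodes u" "\<And>t. solen L (u t)" "hsol L \<nu> T c0 (NF L T f v u) u"
    "\<And>t. t \<in> {0..T} \<Longrightarrow> Esq L \<alpha> (u t) \<le> ennreal C"
    "(\<integral>\<^sup>+r\<in>{0..T}. Esq L (1 + \<alpha>) (u r) \<partial>lborel) < \<infinity>"
    "(\<integral>\<^sup>+r\<in>{0..T}. Esq L (\<alpha> - 1) (NF L T f v u r) \<partial>lborel) < \<infinity>"
proof -
  have sol: "solen L c0" "solen L f" and fin: "Esq L \<alpha> c0 < \<infinity>" "Esq L (\<alpha> - 1) f < \<infinity>"
    using c0 f by (auto simp: Vspace_iff)
  \<comment> \<open>The contribution of the data to the energy inequality; the term with f carries
    the 2 of \<open>NF_integral_bound\<close>.\<close>
  obtain A where A: "Esq L \<alpha> c0 + ennreal (1 / \<nu>) * (2 * ennreal T * Esq L (\<alpha> - 1) f) = ennreal A" "A \<ge> 0"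
    using fin by (cases "Esq L \<alpha> c0 + ennreal (1 / \<nu>) * (2 * ennreal T * Esq L (\<alpha> - 1) f)")
      (auto simp: ennreal_mult_eq_top_iff)
  define Phi where "Phi w = heat L \<nu> c0 (NF L T f v w)" for w
  have NFfin: "(\<integral>\<^sup>+r\<in>{0..T}. Esq L (\<alpha> - 1) (NF L T f v w r) \<partial>lborel) < \<infinity>" if "good C w" "C \<ge> 0" for C w
    using NF_integral_bound[OF that, of T f] T fin by (auto simp: ennreal_mult_less_top intro: le_less_trans)
  have NFsol: "cmodes (NF L T f v w)" "solen L (NF L T f v w r)" if "good C w" for C w r
    using that by (auto simp: good_def intro!: cmodes_NF solen_NF v_modes sol v_solen)
  have NFint: "set_integrable lborel {0..T} (\<lambda>r. NF L T f v w r k)" if "good C w" "C \<ge> 0" for C w k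
    using NFfin[OF that] by (intro L2_modes[OF L NFsol(1)[OF that(1)] solenD(1)[OF NFsol(2)[OF that(1)]]]) auto
  have Phi_hsol: "hsol L \<nu> T c0 (NF L T f v w) (Phi w)" if "good C w" "C \<ge> 0" for C w
    unfolding Phi_def by (intro heat_hsol NFint[OF that])
  have Phi_modes: "cmodes (Phi w)" if "good C w" for C w
    unfolding Phi_def by (intro cmodes_heat NFsol[OF that])
  have Phi_solen: "solen L (Phi w t)" if "good C w" "C \<ge> 0" for C w t
    unfolding Phi_def
  proof (rule solen_heat[OF sol(1) NFsol(2)[OF that(1)]])
    fix k
    have "indicator {0..T} r *\<^sub>R NF L T f v w r k = NF L T f v w r k" for r by (simp add: NF_def indicator_def)
    then show "integrable lborel (\<lambda>r. NF L T f v w r k)"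
      using NFint[OF that, of k] by (simp add: set_integrable_def)
  qed
  have Phi_good: "good (2 * A) (Phi w)" if w: "good (2 * A) w" for w
  proof -
    have A2: "2 * A \<ge> 0" using A by simp
    have "Esq L \<alpha> (Phi w t) \<le> ennreal (2 * A * rho t)" if t: "t \<in> {0..T}" for t
    proof -
      have "Esq L \<alpha> (Phi w t) \<le> Esq L \<alpha> c0 + ennreal (1 / \<nu>) * (\<integral>\<^sup>+r\<in>{0..t}. Esq L (\<alpha> - 1) (NF L T f v w r) \<partial>lborel)"
        by (rule order_trans[OF _ heat_energy[OF L nu Phi_hsol[OF w A2] t Phi_modes[OF w] NFsol(1)[OF w]]]) simp
      also have "\<dots> \<le> Esq L \<alpha> c0 + ennreal (1 / \<nu>) * (2 * ennreal T * Esq L (\<alpha> - 1) f + ennreal (\<nu> / 4 * (2 * A) * rho t))"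
        by (intro add_left_mono mult_left_mono NF_integral_bound[OF w A2 t]) simp
      also have "\<dots> = ennreal A + ennreal (1 / \<nu>) * ennreal (\<nu> / 4 * (2 * A) * rho t)"
        unfolding A(1)[symmetric] by (simp add: distrib_left add.assoc)
      also have "\<dots> = ennreal (A + A / 2 * rho t)"
        using nu A rho_pos[of t] by (simp flip: ennreal_mult)
      also have "\<dots> \<le> ennreal (2 * A * rho t)"
      proof (rule ennreal_leI)
        \<comment> \<open>In the ball of squared radius \<open>2 * A\<close> the drift contributes
          (1 / \<nu>) (\<nu> / 4) (2 A) rho = A / 2 * rho, where \<nu> / 4 is twice the \<nu> / 8 of
          the drift bound. The data part A is absorbed because the weight is at least 1.\<close>
        have "A * 1 \<le> A * rho t" using A rho_ge_1 by (intro mult_left_mono) auto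
        moreover have "A * rho t \<ge> 0" using A rho_pos[of t] by simp
        ultimately show "A + A / 2 * rho t \<le> 2 * A * rho t" by linarith
      qed
      finally show ?thesis .
    qed
    then show ?thesis using Phi_modes[OF w] Phi_solen[OF w A2] by (simp add: good_def)
  qed
  have Phi_contr: "Esq L \<alpha> (\<lambda>k. Phi w t k - Phi w' t k) \<le> ennreal (C / 4 * rho t)"
    if w: "good (2 * A) w" "good (2 * A) w'" and C: "C \<ge> 0" and t: "t \<in> {0..T}"
      and le: "\<And>r. r \<in> {0..T} \<Longrightarrow> Esq L \<alpha> (\<lambda>k. w r k - w' r k) \<le> ennreal (C * rho r)" for w w' C t
  proof (rule contraction[where e = "\<lambda>r k. w r k - w' r k", OF _ _ _ _ _ C le _ t])
    have A2: "2 * A \<ge> 0" using A by simp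
    show "hsol L \<nu> T (\<lambda>k. 0) (\<lambda>r k. NF L T f v w r k - NF L T f v w' r k) (\<lambda>t k. Phi w t k - Phi w' t k)"
      using hsol_diff[OF Phi_hsol[OF w(1) A2] Phi_hsol[OF w(2) A2]] by simp
    show "AE r in lborel. r \<in> {0..T} \<longrightarrow> (\<forall>k. norm (NF L T f v w r k - NF L T f v w' r k) = norm (Bc L (v r) (\<lambda>k. w r k - w' r k) k))"
      using w good_Esq0 by (intro NF_diff_AE AE_I2) (auto simp: good_def solenD(1)[where L = L])
  qed (use w in \<open>auto intro!: cmodes_diff Phi_modes NFsol simp: good_def solenD(1)[where L = L]\<close>)
  define W where "W n = (Phi ^^ n) (\<lambda>t k. 0)" for n
  have W0: "W 0 = (\<lambda>t k. 0)" and WS: "W (Suc n) = Phi (W n)" for n by (simp_all add: W_def)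
  have good_W: "good (2 * A) (W n)" for n
  proof (induction n)
    case 0
    then show ?case by (simp add: W0 good_def cmodes_def)
  qed (simp add: WS Phi_good)
  have W_diff: "\<forall>m. \<forall>t\<in>{0..T}. Esq L \<alpha> (\<lambda>k. W (m + n) t k - W n t k) \<le> ennreal (2 * A / 4 ^ n * rho t)" for n
  proof (induction n)
    case 0
    then show ?case using good_W by (auto simp: W0 good_def)
  next
    case (Suc n)
    show ?case
    proof (intro allI ballI)
      fix m t assume t: "t \<in> {0..T}"
      have "Esq L \<alpha> (\<lambda>k. Phi (W (m + n)) t k - Phi (W n) t k) \<le> ennreal (2 * A / 4 ^ n / 4 * rho t)"
        using Suc A by (intro Phi_contr good_W t) auto
      then show "Esq L \<alpha> (\<lambda>k. W (m + Suc n) t k - W (Suc n) t k) \<le> ennreal (2 * A / 4 ^ Suc n * rho t)"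
        by (simp add: WS)
    qed
  qed
  have conv: "convergent (\<lambda>n. W n t k)" if t: "t \<in> {0..T}" for t k
  proof (cases "k = 0")
    case True
    have "W n t 0 = 0" for n using good_W[of n] by (simp add: good_def solenD(1)[where L = L])
    then show ?thesis using True by (simp add: convergent_const)
  next
    case False
    have p: "wt L \<alpha> k > 0" using wt_pos[OF L False] .
    \<comment> \<open>The factor 1/4 holds for squared norms; for the norm of a single mode it
      becomes 1/2.\<close>
    show ?thesis
    proof (rule geometric_convergent[where c = "sqrt (2 * A * rho t) / wt L \<alpha> k"])
      fix m n
      have "ennreal ((wt L \<alpha> k * norm (W (m + n) t k - W n t k))\<^sup>2) \<le> ennreal (2 * A / 4 ^ n * rho t)"
        using order_trans[OF Esq_mode[of L \<alpha> k "\<lambda>k. W (m + n) t k - W n t k"]] W_diff t by blast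
      then have "(wt L \<alpha> k * norm (W (m + n) t k - W n t k))\<^sup>2 \<le> 2 * A / 4 ^ n * rho t"
        using A rho_pos[of t] by (subst (asm) ennreal_le_iff) auto
      also have "\<dots> = (sqrt (2 * A * rho t) / 2 ^ n)\<^sup>2"
        using A rho_pos[of t] by (simp add: power_divide power_mult[symmetric] mult.commute[of n] power_mult)
      finally have "wt L \<alpha> k * norm (W (m + n) t k - W n t k) \<le> sqrt (2 * A * rho t) / 2 ^ n"
        using A rho_pos[of t] by (intro power2_le_imp_le[of "wt L \<alpha> k * norm (W (m + n) t k - W n t k)"]) auto
      then show "norm (W (m + n) t k - W n t k) \<le> sqrt (2 * A * rho t) / wt L \<alpha> k / 2 ^ n"
        using p by (simp add: field_simps)
    qed
  qed
  \<comment> \<open>The indicator makes the sequence converge at every t, so that the limit is Borel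
    on the whole line and vanishes outside [0, T].\<close>
  define u where "u t k = lim (\<lambda>n. indicator {0..T} t *\<^sub>R W n t k)" for t k
  have lim: "(\<lambda>n. indicator {0..T} t *\<^sub>R W n t k) \<longlonglongrightarrow> u t k" for t k
  proof (cases "t \<in> {0..T}")
    case True
    then show ?thesis using conv[OF True, of k] by (simp add: u_def convergent_LIMSEQ_iff)
  qed (simp add: u_def)
  have lim': "(\<lambda>n. W n t k) \<longlonglongrightarrow> u t k" if "t \<in> {0..T}" for t k
    using lim[of t k] that by simp
  have um: "cmodes u"
    unfolding cmodes_def
  proof
    fix k
    have "(\<lambda>t. W n t k) \<in> borel_measurable borel" for n using good_W[of n] by (auto simp: good_def cmodes_def)
    then have "(\<lambda>t. indicator {0..T} t *\<^sub>R W n t k) \<in> borel_measurable borel" for n by measurable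
    then show "(\<lambda>t. u t k) \<in> borel_measurable borel"
      using lim by (rule borel_measurable_LIMSEQ_metric)
  qed
  have usol: "solen L (u t)" for t
    unfolding solen_iff
  proof (intro conjI allI)
    have Ws: "solen L (W n t)" for n using good_W[of n] by (simp add: good_def)
    show "u t 0 = 0" by (rule LIMSEQ_unique[OF lim]) (simp add: solenD(1)[OF Ws])
    show "u t (- k) = cj (u t k)" for k
    proof (rule LIMSEQ_unique[OF lim])
      have "(\<lambda>n. cj (indicator {0..T} t *\<^sub>R W n t k)) \<longlonglongrightarrow> cj (u t k)"
        by (rule bounded_linear.tendsto[OF bounded_linear_cj lim])
      then show "(\<lambda>n. indicator {0..T} t *\<^sub>R W n t (- k)) \<longlonglongrightarrow> cj (u t k)"
        by (simp add: solenD(2)[OF Ws])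
    qed
    show "zdot (freq L k) (u t k) = 0" for k
    proof (rule LIMSEQ_unique)
      show "(\<lambda>n. zdot (freq L k) (indicator {0..T} t *\<^sub>R W n t k)) \<longlonglongrightarrow> zdot (freq L k) (u t k)"
        by (rule bounded_linear.tendsto[OF bounded_linear_zdot lim])
    qed (simp add: solenD(3)[OF Ws])
  qed
  have u_diff: "Esq L \<alpha> (\<lambda>k. u t k - W n t k) \<le> ennreal (2 * A / 4 ^ n * rho t)" if t: "t \<in> {0..T}" for t n
  proof (rule Esq_liminf)
    show "(\<lambda>m. W (m + n) t k - W n t k) \<longlonglongrightarrow> u t k - W n t k" for k
      by (rule tendsto_diff[OF LIMSEQ_ignore_initial_segment[OF lim'[OF t]] tendsto_const])
  qed (use W_diff t in blast)
  have ugood: "good (2 * A) u"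
    using um usol u_diff[of _ 0] by (simp add: good_def W0)
  have A2: "2 * A \<ge> 0" using A by simp
  have fix_: "Phi u t = u t" if t: "t \<in> {0..T}" for t
  proof -
    have "Esq L \<alpha> (\<lambda>k. Phi u t k - u t k) \<le> ennreal (2 * A * rho t / 4 ^ n)" for n
    proof -
      \<comment> \<open>Both fields are compared with \<open>W (Suc n)\<close>, which is the image
        of \<open>W n\<close>: the first one by the contraction from \<open>u\<close> and
        \<open>W n\<close>, the second one by \<open>u_diff\<close>. Both bounds have the same power
        of 4.\<close>
      have "Esq L \<alpha> (\<lambda>k. Phi u t k - u t k) = Esq L \<alpha> (\<lambda>k. (Phi u t k - W (Suc n) t k) - (u t k - W (Suc n) t k))"
        by simp
      also have "\<dots> \<le> 2 * Esq L \<alpha> (\<lambda>k. Phi u t k - W (Suc n) t k) + 2 * Esq L \<alpha> (\<lambda>k. u t k - W (Suc n) t k)"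
        by (rule Esq_diff)
      also have "\<dots> \<le> 2 * ennreal (2 * A / 4 ^ n / 4 * rho t) + 2 * ennreal (2 * A / 4 ^ Suc n * rho t)"
        unfolding WS using A u_diff by (intro add_mono mult_left_mono Phi_contr ugood good_W t u_diff[of t "Suc n", unfolded WS]) auto
      also have "\<dots> = ennreal (2 * (2 * A / 4 ^ n / 4 * rho t) + 2 * (2 * A / 4 ^ Suc n * rho t))"
      proof -
        have "2 * ennreal x + 2 * ennreal y = ennreal (2 * x + 2 * y)" if "x \<ge> 0" "y \<ge> 0" for x y
          using that by (simp add: ennreal_mult)
        moreover have "2 * A / 4 ^ n / 4 * rho t \<ge> 0" "2 * A / 4 ^ Suc n * rho t \<ge> 0"
          using A rho_pos[of t] by simp_all
        ultimately show ?thesis by (simp only:)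
      qed
      also have "2 * (2 * A / 4 ^ n / 4 * rho t) + 2 * (2 * A / 4 ^ Suc n * rho t) = 2 * A * rho t / 4 ^ n"
        by (simp add: field_simps)
      finally show ?thesis .
    qed
    moreover have "(\<lambda>n. ennreal (2 * A * rho t / 4 ^ n)) \<longlonglongrightarrow> ennreal 0"
      by (intro tendsto_ennrealI LIMSEQ_divide_realpow_zero) simp
    ultimately have "Esq L \<alpha> (\<lambda>k. Phi u t k - u t k) \<le> 0"
      by (intro tendsto_lowerbound[where f = "\<lambda>n. ennreal (2 * A * rho t / 4 ^ n)"]) auto
    then have "(\<lambda>k. Phi u t k - u t k) = (\<lambda>k. 0)"
      using Esq_eq_0_iff[OF L, of "\<lambda>k. Phi u t k - u t k" \<alpha>] solenD(1)[OF usol] solenD(1)[OF Phi_solen[OF ugood A2]] by simp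
    then show ?thesis by (simp add: fun_eq_iff)
  qed
  have hs: "hsol L \<nu> T c0 (NF L T f v u) u"
    by (rule hsol_cong_AE[OF Phi_hsol[OF ugood A2] NFsol(1)[OF ugood] NFsol(1)[OF ugood] um _ fix_ Phi_modes[OF ugood]]) auto
  obtain R where R: "\<And>t. t \<in> {0..T} \<Longrightarrow> rho t \<le> R" using rho_bounded by blast
  have bd: "Esq L \<alpha> (u t) \<le> ennreal (2 * A * R)" if "t \<in> {0..T}" for t
    using ugood that R[OF that] A2 unfolding good_def by (meson ennreal_leI mult_left_mono order_trans)
  \<comment> \<open>The iteration only controls V^\<alpha>. The bound in L_2(V^(1+\<alpha>)) is read
    off from the dissipation term at the final time.\<close>
  have "Esq L \<alpha> (u T) + ennreal \<nu> * (\<integral>\<^sup>+r\<in>{0..T}. Esq L (\<alpha> + 1) (u r) \<partial>lborel)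
    \<le> Esq L \<alpha> c0 + ennreal (1 / \<nu>) * (\<integral>\<^sup>+r\<in>{0..T}. Esq L (\<alpha> - 1) (NF L T f v u r) \<partial>lborel)"
    using T by (intro heat_energy[OF L nu hs _ um NFsol(1)[OF ugood]]) auto
  also have "\<dots> < \<infinity>" using fin NFfin[OF ugood A2] by (simp add: ennreal_mult_less_top)
  finally have "(\<integral>\<^sup>+r\<in>{0..T}. Esq L (1 + \<alpha>) (u r) \<partial>lborel) < \<infinity>"
    using nu by (auto simp: ennreal_mult_less_top add.commute[of 1] ennreal_eq_0_iff)
  then show ?thesis
    using that um usol hs bd NFfin[OF ugood A2] by blast
qed

text \<open>\<open>contraction\<close> needs a supremum bound in V^\<alpha> to start from, and the
  hypotheses provide none. It is produced first: G is B(v,d) up to sign, with values in V^\<alpha>,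
  and after division by sqrt p it is square integrable in time. The modewise bound of
  \<open>damped_norm_le\<close> then sums to a finite M, and repeated contraction lets M shrink to
  0.\<close>

lemma linear_uniqueness:
  assumes u: "cmodes u" "\<And>t. solen L (u t)" "hsol L \<nu> T c0 (NF L T f v u) u"
      "(\<integral>\<^sup>+r\<in>{0..T}. Esq L (1 + \<alpha>) (u r) \<partial>lborel) < \<infinity>"
    and w: "cmodes w" "\<And>t. solen L (w t)" "hsol L \<nu> T c0 (NF L T f v w) w"
      "(\<integral>\<^sup>+r\<in>{0..T}. Esq L (1 + \<alpha>) (w r) \<partial>lborel) < \<infinity>"
    and t: "t \<in> {0..T}"
  shows "u t = w t"
proof -
  define d where "d r = (\<lambda>k. u r k - w r k)" for r
  define G where "G r = (\<lambda>k. NF L T f v u r k - NF L T f v w r k)" for r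
  have d: "cmodes d" "\<And>r. solen L (d r)" and Gm: "cmodes G"
    unfolding d_def G_def using u w by (auto intro!: cmodes_diff solen_diff cmodes_NF v_modes)
  have [measurable]: "(\<lambda>r. d r k) \<in> borel_measurable borel" "(\<lambda>r. G r k) \<in> borel_measurable borel" for k
    using d(1) Gm by (auto intro: cmodesD)
  have dsol: "hsol L \<nu> T (\<lambda>k. 0) G d"
    using hsol_diff[OF u(3) w(3)] by (simp add: d_def[abs_def] G_def[abs_def])
  have AEfin: "AE r in lborel. r \<in> {0..T} \<longrightarrow> Esq L 0 (x r) < \<infinity>"
    if "(\<integral>\<^sup>+r\<in>{0..T}. Esq L (1 + \<alpha>) (x r) \<partial>lborel) < \<infinity>" "cmodes x" for x
    using Esq_AE_finite[OF that(2,1)]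
    by eventually_elim (use Esq_finite_mono[OF L, of 0 "1 + \<alpha>" "x r" for r] alpha in auto)
  have G: "AE r in lborel. r \<in> {0..T} \<longrightarrow> (\<forall>k. norm (G r k) = norm (Bc L (v r) (d r) k))"
    unfolding G_def d_def using u w by (intro NF_diff_AE AEfin) (auto simp: solenD(1)[where L = L])
  \<comment> \<open>The summand 1 allows the division by sqrt p; the quotient \<open>hv / p\<close>
    stays below 1 while p itself remains integrable.\<close>
  define p where "p r = 1 + hv r" for r
  have p: "p r > 0" for r using hv_nonneg[of r] by (simp add: p_def)
  have [measurable]: "p \<in> borel_measurable borel" unfolding p_def[abs_def] by measurable
  define H where "H r = (\<lambda>k. (1 / sqrt (p r)) *\<^sub>R G r k)" for r
  have H: "cmodes H" unfolding cmodes_def H_def by (intro allI) measurable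
  have [measurable]: "(\<lambda>r. H r k) \<in> borel_measurable borel" for k using H by (rule cmodesD)
  define P where "P = (\<integral>\<^sup>+r\<in>{0..T}. ennreal (p r) \<partial>lborel)"
  have P: "P < \<infinity>"
  proof -
    have "set_integrable lborel {0..T} p"
      unfolding p_def[abs_def] by (intro set_integral_add(1) hv_int set_integrable_continuous continuous_intros)
    then have "P = ennreal (prim p T)"
      unfolding P_def by (rule nn_integral_eq_prim) (rule less_imp_le[OF p])
    then show ?thesis by simp
  qed
  define B2 where "B2 = Bconst L (1 + \<alpha>) (1 + \<alpha>)"
  have B2: "B2 < \<infinity>" unfolding B2_def using alpha by (intro Bconst_finite[OF L]) auto
  have HE: "(\<integral>\<^sup>+r\<in>{0..T}. Esq L \<alpha> (H r) \<partial>lborel) < \<infinity>"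
  proof -
    have [measurable]: "(\<lambda>r. Esq L (1 + \<alpha>) (u r)) \<in> borel_measurable borel" "(\<lambda>r. Esq L (1 + \<alpha>) (w r)) \<in> borel_measurable borel"
      using u(1) w(1) by (auto intro: cmodes_Esq)
    have "(\<integral>\<^sup>+r\<in>{0..T}. Esq L \<alpha> (H r) \<partial>lborel)
        \<le> (\<integral>\<^sup>+r. B2 * (2 * (Esq L (1 + \<alpha>) (u r) * indicator {0..T} r) + 2 * (Esq L (1 + \<alpha>) (w r) * indicator {0..T} r)) \<partial>lborel)"
    proof (rule nn_integral_mono_AE)
      show "AE r in lborel. Esq L \<alpha> (H r) * indicator {0..T} r
          \<le> B2 * (2 * (Esq L (1 + \<alpha>) (u r) * indicator {0..T} r) + 2 * (Esq L (1 + \<alpha>) (w r) * indicator {0..T} r))"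
        using hv_AE G
      proof eventually_elim
        case (elim r)
        show ?case
        proof (cases "r \<in> {0..T}")
          case True
          have "Esq L \<alpha> (H r) = ennreal (1 / p r) * Esq L (1 + \<alpha> - 1) (Bc L (v r) (d r))"
            using elim True p[of r] unfolding H_def Esq_scaleR
            by (simp add: power_divide) (metis Esq_cong_norm)
          also have "\<dots> \<le> ennreal (1 / p r) * (B2 * (Esq L (1 + \<alpha>) (v r) * Esq L (1 + \<alpha>) (d r)))"
            unfolding B2_def using alpha d(2) v_solen
            by (intro mult_left_mono Bc_bound[OF L]) (auto simp: solenD(1)[where L = L])
          also have "\<dots> = (ennreal (1 / p r) * ennreal (hv r)) * (B2 * Esq L (1 + \<alpha>) (d r))"
            using elim True by (simp add: ac_simps)
          also have "\<dots> \<le> 1 * (B2 * Esq L (1 + \<alpha>) (d r))"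
          proof (rule mult_right_mono)
            have "ennreal (1 / p r) * ennreal (hv r) = ennreal (1 / p r * hv r)"
              using p[of r] hv_nonneg by (intro ennreal_mult[symmetric]) auto
            also have "\<dots> \<le> ennreal 1" using p[of r] by (intro ennreal_leI) (simp add: p_def)
            finally show "ennreal (1 / p r) * ennreal (hv r) \<le> 1" by simp
          qed simp
          also have "\<dots> \<le> B2 * (2 * Esq L (1 + \<alpha>) (u r) + 2 * Esq L (1 + \<alpha>) (w r))"
            unfolding d_def by (simp add: mult_left_mono Esq_diff)
          finally show ?thesis using True by simp
        qed simp
      qed
    qed
    also have "\<dots> = B2 * (2 * (\<integral>\<^sup>+r\<in>{0..T}. Esq L (1 + \<alpha>) (u r) \<partial>lborel) + 2 * (\<integral>\<^sup>+r\<in>{0..T}. Esq L (1 + \<alpha>) (w r) \<partial>lborel))"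
      by (simp add: nn_integral_cmult nn_integral_add)
    also have "\<dots> < \<infinity>" using B2 u(4) w(4) by (simp add: ennreal_mult_less_top)
    finally show ?thesis .
  qed
  have bd: "Esq L \<alpha> (d t) \<le> P * (\<integral>\<^sup>+r\<in>{0..T}. Esq L \<alpha> (H r) \<partial>lborel)" if t: "t \<in> {0..T}" for t
  proof -
    have "ennreal ((wt L \<alpha> k * norm (d t k))\<^sup>2) \<le> P * (ennreal ((wt L \<alpha> k)\<^sup>2) * (\<integral>\<^sup>+r\<in>{0..T}. ennreal ((norm (H r k))\<^sup>2) \<partial>lborel))" for k
    proof -
      \<comment> \<open>The Cauchy-Schwarz inequality is applied in time for a fixed mode. Its first
        factor P is the same for all modes, so the squared bounds can be summed over k.\<close>
      have "ennreal (norm (d t k)) \<le> (\<integral>\<^sup>+r\<in>{0..t}. ennreal (norm (G r k)) \<partial>lborel)"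
        using dsol t nu by (intro damped_norm_le[where l = "\<nu> * wt L 2 k" and T = T]) (auto simp: hsol_def)
      also have "\<dots> \<le> (\<integral>\<^sup>+r. (ennreal (sqrt (p r)) * indicator {0..T} r) * (ennreal (norm (H r k)) * indicator {0..T} r) \<partial>lborel)"
      proof (intro nn_integral_mono)
        fix r
        have "ennreal (sqrt (p r)) * ennreal (norm (H r k)) = ennreal (norm (G r k))"
          using p[of r] by (subst ennreal_mult[symmetric]) (auto simp: H_def)
        then show "ennreal (norm (G r k)) * indicator {0..t} r \<le> (ennreal (sqrt (p r)) * indicator {0..T} r) * (ennreal (norm (H r k)) * indicator {0..T} r)"
          using t by (auto simp: indicator_def)
      qed
      finally have "(ennreal (norm (d t k)))\<^sup>2 \<le> (\<integral>\<^sup>+r. (ennreal (sqrt (p r)) * indicator {0..T} r) * (ennreal (norm (H r k)) * indicator {0..T} r) \<partial>lborel)\<^sup>2"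
        by (intro power_mono) auto
      also have "\<dots> \<le> (\<integral>\<^sup>+r. (ennreal (sqrt (p r)) * indicator {0..T} r)\<^sup>2 \<partial>lborel) * (\<integral>\<^sup>+r. (ennreal (norm (H r k)) * indicator {0..T} r)\<^sup>2 \<partial>lborel)"
        by (rule Cauchy_Schwarz_nn_integral) measurable
      also have "(\<integral>\<^sup>+r. (ennreal (sqrt (p r)) * indicator {0..T} r)\<^sup>2 \<partial>lborel) = P"
        unfolding P_def using p[THEN less_imp_le] by (intro nn_integral_cong) (auto simp: indicator_def ennreal_power)
      also have "(\<integral>\<^sup>+r. (ennreal (norm (H r k)) * indicator {0..T} r)\<^sup>2 \<partial>lborel) = (\<integral>\<^sup>+r\<in>{0..T}. ennreal ((norm (H r k))\<^sup>2) \<partial>lborel)"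
        by (intro nn_integral_cong) (auto simp: indicator_def ennreal_power)
      finally have "ennreal ((wt L \<alpha> k)\<^sup>2) * (ennreal (norm (d t k)))\<^sup>2 \<le> ennreal ((wt L \<alpha> k)\<^sup>2) * (P * (\<integral>\<^sup>+r\<in>{0..T}. ennreal ((norm (H r k))\<^sup>2) \<partial>lborel))"
        by (rule mult_left_mono) simp
      then show ?thesis by (simp add: power_mult_distrib ennreal_mult ennreal_power mult.left_commute)
    qed
    then have "Esq L \<alpha> (d t) \<le> (\<integral>\<^sup>+k. P * (ennreal ((wt L \<alpha> k)\<^sup>2) * (\<integral>\<^sup>+r\<in>{0..T}. ennreal ((norm (H r k))\<^sup>2) \<partial>lborel)) \<partial>count_space UNIV)"
      unfolding Esq_def by (intro nn_integral_mono)
    also have "\<dots> = P * (\<integral>\<^sup>+r\<in>{0..T}. Esq L \<alpha> (H r) \<partial>lborel)"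
      unfolding Esq_integral_swap[OF H] by (rule nn_integral_cmult) simp
    finally show ?thesis .
  qed
  obtain M where M: "P * (\<integral>\<^sup>+r\<in>{0..T}. Esq L \<alpha> (H r) \<partial>lborel) = ennreal M" "M \<ge> 0"
    using P HE by (cases "P * (\<integral>\<^sup>+r\<in>{0..T}. Esq L \<alpha> (H r) \<partial>lborel)") (auto simp: ennreal_mult_eq_top_iff)
  have it: "\<forall>t\<in>{0..T}. Esq L \<alpha> (d t) \<le> ennreal (M / 4 ^ n * rho t)" for n
  proof (induction n)
    case 0
    show ?case
    proof
      fix t assume t: "t \<in> {0..T}"
      have "ennreal M \<le> ennreal (M * rho t)" using M mult_left_mono[OF rho_ge_1[of t], of M] by (intro ennreal_leI) simp
      then show "Esq L \<alpha> (d t) \<le> ennreal (M / 4 ^ 0 * rho t)" using bd[OF t] M by simp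
    qed
  next
    case (Suc n)
    show ?case
    proof
      fix t assume t: "t \<in> {0..T}"
      \<comment> \<open>The difference is taken as its own argument of the drift term, so each
        application divides the constant by 4.\<close>
      have "Esq L \<alpha> (d t) \<le> ennreal (M / 4 ^ n / 4 * rho t)"
        using Suc M by (intro contraction[OF dsol d(1) Gm d(1) _ _ _ G t]) (auto simp: solenD[OF d(2)])
      then show "Esq L \<alpha> (d t) \<le> ennreal (M / 4 ^ Suc n * rho t)" by (simp add: mult.commute[of 4])
    qed
  qed
  have "(\<lambda>n. ennreal (M * rho t / 4 ^ n)) \<longlonglongrightarrow> ennreal 0"
    by (intro tendsto_ennrealI LIMSEQ_divide_realpow_zero) simp
  moreover have "Esq L \<alpha> (d t) \<le> ennreal (M * rho t / 4 ^ n)" for n using it[of n] t by simp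
  ultimately have "Esq L \<alpha> (d t) \<le> 0"
    by (intro tendsto_lowerbound[where f = "\<lambda>n. ennreal (M * rho t / 4 ^ n)"]) auto
  then have "d t = (\<lambda>k. 0)" using Esq_eq_0_iff[OF L, of "d t" \<alpha>] solenD(1)[OF d(2)] by simp
  then show ?thesis by (simp add: d_def fun_eq_iff)
qed

end


section \<open>Regularity in time and the weak formulation\<close>

lemma AE_lebesgue_on_iff:
  fixes S :: "'a::euclidean_space set"
  assumes "S \<in> sets borel"
  shows "(AE x in lebesgue_on S. P x) \<longleftrightarrow> (AE x in lborel. x \<in> S \<longrightarrow> P x)"
  using assms by (simp add: AE_restrict_space_iff AE_completion_iff)

text \<open>The integrands of the weak formulation involve arbitrary representatives and
  \<open>B_op\<close>, a definite description, and come without a measurability proof. Completeness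
  of Lebesgue measure transfers everything from a Borel function that agrees with them almost
  everywhere.\<close>

lemma LINT_AE_borel:
  fixes f g :: "real \<Rightarrow> real"
  assumes g: "g \<in> borel_measurable borel" and S: "S \<in> sets borel"
    and eq: "AE x in lborel. x \<in> S \<longrightarrow> f x = g x"
  shows "(LINT x|lebesgue_on S. f x) = (LINT x|lborel. indicator S x *\<^sub>R g x)"
    and "integrable (lebesgue_on S) f \<longleftrightarrow> set_integrable lborel S g"
proof -
  let ?g = "\<lambda>x. indicator S x *\<^sub>R g x" and ?f = "\<lambda>x. indicator S x *\<^sub>R f x"
  have bm: "?g \<in> borel_measurable borel"
    by (intro borel_measurable_scaleR borel_measurable_indicator g S)
  have gm: "?g \<in> borel_measurable lebesgue" by (rule measurable_completion) (use bm in simp)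
  have "AE x in lborel. ?g x = ?f x" "AE x in lborel. ?f x = ?g x"
    using eq by (eventually_elim, auto simp: indicator_def)+
  from this[THEN AE_completion] have ae: "AE x in lebesgue. ?g x = ?f x" and ae': "AE x in lebesgue. ?f x = ?g x" .
  have fm: "?f \<in> borel_measurable lebesgue" by (rule borel_measurable_AE[OF gm ae])
  have "(LINT x|lebesgue_on S. f x) = (LINT x|lebesgue. ?f x)"
    using S by (intro integral_restrict_space) auto
  also have "\<dots> = (LINT x|lebesgue. ?g x)"
    by (intro Bochner_Integration.integral_cong_AE fm gm ae')
  also have "\<dots> = (LINT x|lborel. ?g x)" using bm by (intro integral_completion) simp
  finally show "(LINT x|lebesgue_on S. f x) = (LINT x|lborel. indicator S x *\<^sub>R g x)" .
  have "integrable (lebesgue_on S) f \<longleftrightarrow> integrable lebesgue ?f"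
    using S by (intro integrable_restrict_space) auto
  also have "\<dots> \<longleftrightarrow> integrable lebesgue ?g"
    by (intro Bochner_Integration.integrable_cong_AE fm gm ae')
  also have "\<dots> \<longleftrightarrow> integrable lborel ?g" using bm by (intro integrable_completion) simp
  finally show "integrable (lebesgue_on S) f \<longleftrightarrow> set_integrable lborel S g" by (simp add: set_integrable_def)
qed

lemma LINT_prim:
  fixes g :: "real \<Rightarrow> real"
  assumes "g \<in> borel_measurable borel" "AE x in lborel. x \<in> {0..T} \<longrightarrow> f x = g x"
  shows "(LINT x|lebesgue_on {0..T}. f x) = prim g T"
  using LINT_AE_borel(1)[OF assms(1) _ assms(2)] by (simp add: prim_def set_lebesgue_integral_def)

lemma test_functionsD:
  assumes "\<psi> \<in> test_functions T"
  shows "(\<psi> has_vector_derivative deriv \<psi> r) (at r)" "continuous_on UNIV (deriv \<psi>)" "continuous_on UNIV \<psi>"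
    "\<psi> 0 = 0" "\<psi> T = 0"
proof -
  have d: "((deriv ^^ n) \<psi>) differentiable (at x)" for n x using assms by (simp add: test_functions_def)
  have 0: "\<psi> differentiable (at x)" for x using d[of 0 x] by simp
  show "(\<psi> has_vector_derivative deriv \<psi> r) (at r)"
    using 0[of r] unfolding has_real_derivative_iff_has_vector_derivative[symmetric]
    by (simp add: DERIV_deriv_iff_real_differentiable)
  show "continuous_on UNIV \<psi>" using 0 by (intro continuous_at_imp_continuous_on ballI differentiable_imp_continuous_within)
  have "deriv \<psi> differentiable (at x)" for x using d[of 1 x] by simp
  then show "continuous_on UNIV (deriv \<psi>)" by (intro continuous_at_imp_continuous_on ballI differentiable_imp_continuous_within)
  have "x \<in> {0<..<T}" if "\<psi> x \<noteq> 0" for x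
    using assms that closure_subset[of "{x. \<psi> x \<noteq> 0}"] by (auto simp: test_functions_def)
  then show "\<psi> 0 = 0" "\<psi> T = 0" by force+
qed

section \<open>Continuity and Hoelder continuity in time\<close>

lemma hsol_continuous:
  assumes "hsol L \<nu> T c0 F u"
  shows "continuous_on {0..T} (\<lambda>t. u t k)"
  by (rule damped_continuous[of T "\<lambda>r. F r k" "\<nu> * wt L 2 k" _ "c0 k"]) (use assms in \<open>auto simp: hsol_def\<close>)

text \<open>Dominated convergence over the modes. Every coefficient is continuous in time, and
  \<open>heat_energy_mode\<close> bounds all of them by a summable family \<open>A\<close> that does
  not depend on t.\<close>

lemma hsol_C_V:
  assumes L: "L > 0" and nu: "\<nu> > 0" and T: "T \<ge> 0" and h: "hsol L \<nu> T c0 F u" and F: "cmodes F"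
    and c0: "Esq L a c0 < \<infinity>" and Ffin: "(\<integral>\<^sup>+r\<in>{0..T}. Esq L (a - 1) (F r) \<partial>lborel) < \<infinity>"
    and sol: "\<And>t. solen L (u t)"
  shows "u \<in> C_V L a 0 T"
proof -
  define A where "A k = ennreal ((wt L a k)\<^sup>2 * (norm (c0 k))\<^sup>2)
      + ennreal (1 / \<nu>) * (ennreal ((wt L (a - 1) k)\<^sup>2) * (\<integral>\<^sup>+r\<in>{0..T}. ennreal ((norm (F r k))\<^sup>2) \<partial>lborel))" for k
  have A: "(\<integral>\<^sup>+k. A k \<partial>count_space UNIV) < \<infinity>"
  proof -
    have "(\<integral>\<^sup>+k. A k \<partial>count_space UNIV) = Esq L a c0 + ennreal (1 / \<nu>) * (\<integral>\<^sup>+r\<in>{0..T}. Esq L (a - 1) (F r) \<partial>lborel)"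
      unfolding A_def Esq_integral_swap[OF F]
      by (simp add: nn_integral_add nn_integral_cmult) (simp add: Esq_def power_mult_distrib)
    then show ?thesis using c0 Ffin by (simp add: ennreal_mult_less_top)
  qed
  have le: "ennreal ((wt L a k)\<^sup>2 * (norm (u t k))\<^sup>2) \<le> A k" if t: "t \<in> {0..T}" for t k
  proof -
    have "ennreal ((wt L a k)\<^sup>2 * (norm (u t k))\<^sup>2) \<le> ennreal ((wt L a k)\<^sup>2 * (norm (c0 k))\<^sup>2)
      + ennreal (1 / \<nu>) * (ennreal ((wt L (a - 1) k)\<^sup>2) * (\<integral>\<^sup>+r\<in>{0..t}. ennreal ((norm (F r k))\<^sup>2) \<partial>lborel))"
      by (rule order_trans[OF _ heat_energy_mode[OF L nu h t]]) simp
    also have "\<dots> \<le> A k"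
      unfolding A_def using t
      by (intro add_left_mono mult_left_mono nn_integral_mono) (auto simp: indicator_def)
    finally show ?thesis .
  qed
  have fin: "Esq L a (u t) < \<infinity>" if t: "t \<in> {0..T}" for t
    unfolding Esq_def power_mult_distrib by (rule le_less_trans[OF nn_integral_mono A]) (rule le[OF t])
  have lim: "((\<lambda>r. Vdist L a (u r) (u t)) \<longlongrightarrow> 0) (at t within {0..T})" if t: "t \<in> {0..T}" for t
    unfolding tendsto_at_iff_sequentially o_def
  proof (intro allI impI)
    fix X assume X: "\<forall>i. X i \<in> {0..T} - {t}" and Xt: "X \<longlonglongrightarrow> t"
    have XT: "X i \<in> {0..T}" for i using X by auto
    have pt: "ennreal ((wt L a k * norm (u (X i) k - u t k))\<^sup>2) \<le> 4 * A k" for i k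
    proof -
      have "(norm (u (X i) k - u t k))\<^sup>2 \<le> (norm (u (X i) k) + norm (u t k))\<^sup>2"
        by (intro power_mono norm_triangle_ineq4) simp
      also have "\<dots> \<le> 2 * (norm (u (X i) k))\<^sup>2 + 2 * (norm (u t k))\<^sup>2"
        using sum_squares_bound[of "norm (u (X i) k)" "norm (u t k)"] by (simp add: power2_sum)
      finally have "(wt L a k)\<^sup>2 * (norm (u (X i) k - u t k))\<^sup>2 \<le> (wt L a k)\<^sup>2 * (2 * (norm (u (X i) k))\<^sup>2 + 2 * (norm (u t k))\<^sup>2)"
        by (rule mult_left_mono) simp
      then have "ennreal ((wt L a k * norm (u (X i) k - u t k))\<^sup>2) \<le> ennreal (2 * ((wt L a k)\<^sup>2 * (norm (u (X i) k))\<^sup>2) + 2 * ((wt L a k)\<^sup>2 * (norm (u t k))\<^sup>2))"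
        by (intro ennreal_leI) (simp add: power_mult_distrib algebra_simps)
      also have "\<dots> = 2 * ennreal ((wt L a k)\<^sup>2 * (norm (u (X i) k))\<^sup>2) + 2 * ennreal ((wt L a k)\<^sup>2 * (norm (u t k))\<^sup>2)"
        by (simp add: ennreal_mult)
      also have "\<dots> \<le> 2 * A k + 2 * A k" by (intro add_mono mult_left_mono le XT t) auto
      also have "\<dots> = 4 * A k" by (simp flip: distrib_right)
      finally show ?thesis .
    qed
    have "(\<lambda>i. \<integral>\<^sup>+k. ennreal ((wt L a k * norm (u (X i) k - u t k))\<^sup>2) \<partial>count_space UNIV)
      \<longlonglongrightarrow> (\<integral>\<^sup>+k. 0 \<partial>count_space (UNIV :: (int ^ 3) set))"
    proof (rule nn_integral_dominated_convergence[where w = "\<lambda>k. 4 * A k"])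
      show "(\<integral>\<^sup>+k. 4 * A k \<partial>count_space UNIV) < \<infinity>" using A by (simp add: nn_integral_cmult ennreal_mult_less_top)
      show "AE k in count_space UNIV. (\<lambda>i. ennreal ((wt L a k * norm (u (X i) k - u t k))\<^sup>2)) \<longlonglongrightarrow> 0"
      proof (rule AE_I2)
        fix k
        have "(\<lambda>i. u (X i) k) \<longlonglongrightarrow> u t k"
          using continuous_on_tendsto_compose[OF hsol_continuous[OF h] Xt t] XT by simp
        then have "(\<lambda>i. ennreal ((wt L a k * norm (u (X i) k - u t k))\<^sup>2)) \<longlonglongrightarrow> ennreal ((wt L a k * norm (u t k - u t k))\<^sup>2)"
          by (intro tendsto_ennrealI tendsto_power tendsto_mult tendsto_norm tendsto_diff tendsto_const)
        then show "(\<lambda>i. ennreal ((wt L a k * norm (u (X i) k - u t k))\<^sup>2)) \<longlonglongrightarrow> 0" by simp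
      qed
    qed (use pt in auto)
    then have "(\<lambda>i. Esq L a (\<lambda>k. u (X i) k - u t k)) \<longlonglongrightarrow> 0" by (simp add: Esq_def)
    moreover have "Esq L a (\<lambda>k. u (X i) k - u t k) < \<infinity>" for i
      using Vspace_diff[of "u (X i)" L a "u t"] fin[OF XT] fin[OF t] sol by (simp add: Vspace_iff)
    ultimately show "(\<lambda>i. Vdist L a (u (X i)) (u t)) \<longlonglongrightarrow> 0"
      by (subst tendsto_Vdist_iff[OF L]) auto
  qed
  show ?thesis using fin sol lim by (simp add: C_V_def Vspace_iff)
qed

lemma C_V_mono:
  assumes L: "L > 0" and st: "s \<le> t" and u: "u \<in> C_V L t a b"
  shows "u \<in> C_V L s a b"
proof -
  have V: "u r \<in> Vspace L t" if "r \<in> {a..b}" for r using u that by (simp add: C_V_def)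
  have "Vdist L s (u r) (u q) \<le> wt_const L s t * Vdist L t (u r) (u q)" if "r \<in> {a..b}" "q \<in> {a..b}" for r q
  proof -
    have "(\<lambda>k. u r k - u q k) \<in> Vspace L t" using that by (intro Vspace_diff V)
    then have f: "Esq L t (\<lambda>k. u r k - u q k) < \<infinity>" by (simp add: Vspace_iff)
    have "enn2real (Esq L s (\<lambda>k. u r k - u q k)) \<le> enn2real (ennreal ((wt_const L s t)\<^sup>2) * Esq L t (\<lambda>k. u r k - u q k))"
      using f by (intro enn2real_mono Esq_mono_exp L st) (auto simp: ennreal_mult_less_top)
    then have "L ^ 3 * enn2real (Esq L s (\<lambda>k. u r k - u q k)) \<le> L ^ 3 * ((wt_const L s t)\<^sup>2 * enn2real (Esq L t (\<lambda>k. u r k - u q k)))"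
      using L by (intro mult_left_mono) (auto simp: enn2real_mult)
    then have "sqrt (L ^ 3 * enn2real (Esq L s (\<lambda>k. u r k - u q k))) \<le> sqrt ((wt_const L s t)\<^sup>2 * (L ^ 3 * enn2real (Esq L t (\<lambda>k. u r k - u q k))))"
      by (simp add: mult.left_commute)
    also have "\<dots> = wt_const L s t * sqrt (L ^ 3 * enn2real (Esq L t (\<lambda>k. u r k - u q k)))"
      by (simp only: real_sqrt_mult real_sqrt_abs) (simp add: wt_const_def)
    finally show ?thesis by (simp add: Vdist_def Vnorm_eq)
  qed
  note le = this
  have "((\<lambda>r. Vdist L s (u r) (u q)) \<longlongrightarrow> 0) (at q within {a..b})" if q: "q \<in> {a..b}" for q
  proof (rule tendsto_sandwich)
    show "\<forall>\<^sub>F r in at q within {a..b}. 0 \<le> Vdist L s (u r) (u q)" using L by (simp add: Vdist_def)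
    show "\<forall>\<^sub>F r in at q within {a..b}. Vdist L s (u r) (u q) \<le> wt_const L s t * Vdist L t (u r) (u q)"
      using le q by (auto simp: eventually_at_filter)
    have "((\<lambda>r. wt_const L s t * Vdist L t (u r) (u q)) \<longlongrightarrow> wt_const L s t * 0) (at q within {a..b})"
      using u q by (intro tendsto_mult tendsto_const) (simp add: C_V_def)
    then show "((\<lambda>r. wt_const L s t * Vdist L t (u r) (u q)) \<longlongrightarrow> 0) (at q within {a..b})" by simp
  qed simp
  then show ?thesis using V Vspace_mono[OF L st] by (simp add: C_V_def)
qed

definition hderiv :: "real \<Rightarrow> real \<Rightarrow> (real \<Rightarrow> coeffs) \<Rightarrow> (real \<Rightarrow> coeffs) \<Rightarrow> real \<Rightarrow> coeffs" where
  "hderiv L \<nu> F u r = (\<lambda>k. F r k - (\<nu> * wt L 2 k) *\<^sub>R u r k)"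

lemma Esq_stokes: "Esq L (a - 1) (\<lambda>k. (\<nu> * wt L 2 k) *\<^sub>R u k) = ennreal (\<nu>\<^sup>2) * Esq L (1 + a) u"
  unfolding Esq_def
proof (subst nn_integral_cmult[symmetric], simp, intro nn_integral_cong)
  fix k
  have "wt L (a - 1) k * wt L 2 k = wt L (1 + a) k" by (simp add: wt_mult add.commute)
  then have e: "wt L (a - 1) k * norm ((\<nu> * wt L 2 k) *\<^sub>R u k) = \<bar>\<nu>\<bar> * (wt L (1 + a) k * norm (u k))"
    by (simp add: abs_mult mult.commute[of "wt L 2 k"])
  show "ennreal ((wt L (a - 1) k * norm ((\<nu> * wt L 2 k) *\<^sub>R u k))\<^sup>2) = ennreal (\<nu>\<^sup>2) * ennreal ((wt L (1 + a) k * norm (u k))\<^sup>2)"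
    unfolding e by (simp add: power_mult_distrib ennreal_mult)
qed

lemma hderiv_fin:
  assumes F: "cmodes F" and u: "cmodes u" and Ffin: "(\<integral>\<^sup>+r\<in>{0..T}. Esq L (a - 1) (F r) \<partial>lborel) < \<infinity>"
    and ufin: "(\<integral>\<^sup>+r\<in>{0..T}. Esq L (1 + a) (u r) \<partial>lborel) < \<infinity>"
  shows "cmodes (hderiv L \<nu> F u)" "(\<integral>\<^sup>+r\<in>{0..T}. Esq L (a - 1) (hderiv L \<nu> F u r) \<partial>lborel) < \<infinity>"
proof -
  have [measurable]: "(\<lambda>t. F t k) \<in> borel_measurable borel" "(\<lambda>t. u t k) \<in> borel_measurable borel" for k
    using F u by (auto intro: cmodesD)
  show "cmodes (hderiv L \<nu> F u)" unfolding cmodes_def hderiv_def by (intro allI) measurable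
  have [measurable]: "(\<lambda>r. Esq L (a - 1) (F r)) \<in> borel_measurable borel" "(\<lambda>r. Esq L (1 + a) (u r)) \<in> borel_measurable borel"
    using F u by (auto intro: cmodes_Esq)
  have "(\<integral>\<^sup>+r\<in>{0..T}. Esq L (a - 1) (hderiv L \<nu> F u r) \<partial>lborel)
     \<le> (\<integral>\<^sup>+r. 2 * (Esq L (a - 1) (F r) * indicator {0..T} r) + 2 * (ennreal (\<nu>\<^sup>2) * (Esq L (1 + a) (u r) * indicator {0..T} r)) \<partial>lborel)"
  proof (intro nn_integral_mono)
    fix r
    show "Esq L (a - 1) (hderiv L \<nu> F u r) * indicator {0..T} r \<le> 2 * (Esq L (a - 1) (F r) * indicator {0..T} r) + 2 * (ennreal (\<nu>\<^sup>2) * (Esq L (1 + a) (u r) * indicator {0..T} r))"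
      using Esq_diff[of L "a - 1" "F r" "\<lambda>k. (\<nu> * wt L 2 k) *\<^sub>R u r k"] by (simp add: hderiv_def Esq_stokes indicator_def)
  qed
  also have "\<dots> = 2 * (\<integral>\<^sup>+r\<in>{0..T}. Esq L (a - 1) (F r) \<partial>lborel) + 2 * (ennreal (\<nu>\<^sup>2) * (\<integral>\<^sup>+r\<in>{0..T}. Esq L (1 + a) (u r) \<partial>lborel))"
    by (simp add: nn_integral_add nn_integral_cmult)
  also have "\<dots> < \<infinity>" using Ffin ufin by (simp add: ennreal_mult_less_top)
  finally show "(\<integral>\<^sup>+r\<in>{0..T}. Esq L (a - 1) (hderiv L \<nu> F u r) \<partial>lborel) < \<infinity>" .
qed

text \<open>The increment is the integral of the time derivative. The Cauchy-Schwarz inequality in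
  time gives its square the factor t - r, the origin of the Hoelder exponent 1/2.\<close>

lemma hsol_increment:
  assumes h: "hsol L \<nu> T c0 F u" and G: "cmodes (hderiv L \<nu> F u)" and r: "0 \<le> r" "r \<le> t" "t \<le> T"
  shows "Esq L a (\<lambda>k. u t k - u r k) \<le> ennreal (t - r) * (\<integral>\<^sup>+q\<in>{0..T}. Esq L a (hderiv L \<nu> F u q) \<partial>lborel)"
proof -
  let ?G = "hderiv L \<nu> F u"
  have [measurable]: "(\<lambda>q. ?G q k) \<in> borel_measurable borel" for k using G by (rule cmodesD)
  have mode: "ennreal ((wt L a k * norm (u t k - u r k))\<^sup>2) \<le> ennreal (t - r) * (ennreal ((wt L a k)\<^sup>2) * (\<integral>\<^sup>+q\<in>{0..T}. ennreal ((norm (?G q k))\<^sup>2) \<partial>lborel))" for k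
  proof -
    have Gi: "set_integrable lborel {0..T} (\<lambda>q. ?G q k)" and ue: "\<And>t. t \<in> {0..T} \<Longrightarrow> u t k = c0 k + prim (\<lambda>q. ?G q k) t"
      using h unfolding hsol_def hderiv_def by blast+
    have Gt: "set_integrable lborel {0..t} (\<lambda>q. ?G q k)" by (rule set_integrable_Icc_mono[OF Gi r(3)])
    have "u t k - u r k = prim (\<lambda>q. ?G q k) t - prim (\<lambda>q. ?G q k) r" using r by (simp add: ue)
    also have "\<dots> = (LINT q:{r..t}|lborel. ?G q k)" by (rule prim_diff_eq[OF Gt r(1,2)])
    finally have e: "u t k - u r k = (LINT q:{r..t}|lborel. ?G q k)" .
    have "set_integrable lborel {r..t} (\<lambda>q. ?G q k)"
      using set_integrable_subset[OF Gt, of "{r..t}"] r by auto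
    then have "ennreal (norm (u t k - u r k)) \<le> (\<integral>\<^sup>+q. ennreal (norm (indicator {r..t} q *\<^sub>R ?G q k)) \<partial>lborel)"
      unfolding e set_lebesgue_integral_def set_integrable_def by (rule integral_norm_bound_ennreal)
    also have "\<dots> = (\<integral>\<^sup>+q. indicator {r..t} q * (ennreal (norm (?G q k)) * indicator {r..t} q) \<partial>lborel)"
      by (intro nn_integral_cong) (auto simp: indicator_def)
    finally have "(ennreal (norm (u t k - u r k)))\<^sup>2 \<le> (\<integral>\<^sup>+q. indicator {r..t} q * (ennreal (norm (?G q k)) * indicator {r..t} q) \<partial>lborel)\<^sup>2"
      by (intro power_mono) auto
    also have "\<dots> \<le> (\<integral>\<^sup>+q. (indicator {r..t} q)\<^sup>2 \<partial>lborel) * (\<integral>\<^sup>+q. (ennreal (norm (?G q k)) * indicator {r..t} q)\<^sup>2 \<partial>lborel)"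
      by (rule Cauchy_Schwarz_nn_integral) measurable
    also have "(\<integral>\<^sup>+q. (indicator {r..t} q)\<^sup>2 \<partial>lborel) = (\<integral>\<^sup>+q. indicator {r..t} q \<partial>lborel)"
      by (intro nn_integral_cong) (auto simp: indicator_def)
    also have "\<dots> = ennreal (t - r)" using r by simp
    also have "(\<integral>\<^sup>+q. (ennreal (norm (?G q k)) * indicator {r..t} q)\<^sup>2 \<partial>lborel) \<le> (\<integral>\<^sup>+q\<in>{0..T}. ennreal ((norm (?G q k))\<^sup>2) \<partial>lborel)"
      using r by (intro nn_integral_mono) (auto simp: indicator_def ennreal_power)
    finally have "(ennreal (norm (u t k - u r k)))\<^sup>2 \<le> ennreal (t - r) * (\<integral>\<^sup>+q\<in>{0..T}. ennreal ((norm (?G q k))\<^sup>2) \<partial>lborel)"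
      by (simp add: mult_left_mono)
    then have "ennreal ((wt L a k)\<^sup>2) * (ennreal (norm (u t k - u r k)))\<^sup>2 \<le> ennreal ((wt L a k)\<^sup>2) * (ennreal (t - r) * (\<integral>\<^sup>+q\<in>{0..T}. ennreal ((norm (?G q k))\<^sup>2) \<partial>lborel))"
      by (rule mult_left_mono) simp
    then show ?thesis by (simp add: power_mult_distrib ennreal_mult ennreal_power mult.left_commute)
  qed
  have "Esq L a (\<lambda>k. u t k - u r k) \<le> (\<integral>\<^sup>+k. ennreal (t - r) * (ennreal ((wt L a k)\<^sup>2) * (\<integral>\<^sup>+q\<in>{0..T}. ennreal ((norm (?G q k))\<^sup>2) \<partial>lborel)) \<partial>count_space UNIV)"
    unfolding Esq_def by (intro nn_integral_mono mode)
  also have "\<dots> = ennreal (t - r) * (\<integral>\<^sup>+q\<in>{0..T}. Esq L a (?G q) \<partial>lborel)"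
    unfolding Esq_integral_swap[OF G] by (rule nn_integral_cmult) simp
  finally show ?thesis .
qed

text \<open>As s \<ge> 1 and a \<ge> 0, the space V^(a-1) embeds into V^(-s), so exponent 1/2 passes
  from the former to the latter. A smaller exponent costs the factor T^(1/2 - \<gamma>) on a bounded
  interval.\<close>

lemma hsol_Hoelder:
  assumes L: "L > 0" and T: "T \<ge> 0" and h: "hsol L \<nu> T c0 F u" and G: "cmodes (hderiv L \<nu> F u)"
    and Gfin: "(\<integral>\<^sup>+q\<in>{0..T}. Esq L (a - 1) (hderiv L \<nu> F u q) \<partial>lborel) < \<infinity>"
    and C: "u \<in> C_V L a 0 T" and g: "0 \<le> \<gamma>" "\<gamma> \<le> 1/2" and s: "s \<ge> 1" and a: "a \<ge> 0"
  shows "u \<in> Hoelder_V \<gamma> L (- s) 0 T"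
proof -
  let ?X = "ennreal ((wt_const L (- s) (a - 1))\<^sup>2) * (\<integral>\<^sup>+q\<in>{0..T}. Esq L (a - 1) (hderiv L \<nu> F u q) \<partial>lborel)"
  have "?X < \<infinity>" using Gfin by (simp add: ennreal_mult_less_top)
  then obtain K where K: "?X = ennreal K" "K \<ge> 0" by (cases ?X) auto
  define M where "M = sqrt (L ^ 3 * K) * T powr (1/2 - \<gamma>)"
  have b: "Vdist L (- s) (u t) (u r) \<le> M * \<bar>t - r\<bar> powr \<gamma>" if r: "0 \<le> r" "r \<le> t" "t \<le> T" for t r
  proof (cases "r = t")
    case True
    then show ?thesis using L K by (simp add: Vdist_def Vnorm_eq M_def)
  next
    case False
    have "Esq L (- s) (\<lambda>k. u t k - u r k) \<le> ennreal ((wt_const L (- s) (a - 1))\<^sup>2) * Esq L (a - 1) (\<lambda>k. u t k - u r k)"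
      using s a by (intro Esq_mono_exp L) auto
    also have "\<dots> \<le> ennreal ((wt_const L (- s) (a - 1))\<^sup>2) * (ennreal (t - r) * (\<integral>\<^sup>+q\<in>{0..T}. Esq L (a - 1) (hderiv L \<nu> F u q) \<partial>lborel))"
      by (intro mult_left_mono hsol_increment[OF h G r]) simp
    also have "\<dots> = ennreal ((t - r) * K)" using r K by (simp add: mult.left_commute ennreal_mult)
    finally have "enn2real (Esq L (- s) (\<lambda>k. u t k - u r k)) \<le> (t - r) * K"
      using r K by (intro enn2real_leI) auto
    then have "L ^ 3 * enn2real (Esq L (- s) (\<lambda>k. u t k - u r k)) \<le> L ^ 3 * ((t - r) * K)"
      using L by (intro mult_left_mono) auto
    then have "Vdist L (- s) (u t) (u r) \<le> sqrt (L ^ 3 * K * (t - r))"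
      unfolding Vdist_def Vnorm_eq by (intro real_sqrt_le_mono) (simp add: mult.assoc mult.commute[of K])
    also have "\<dots> = sqrt (L ^ 3 * K) * (t - r) powr (1/2)"
      using r by (simp add: real_sqrt_mult powr_half_sqrt)
    also have "(t - r) powr (1/2) = (t - r) powr (1/2 - \<gamma>) * (t - r) powr \<gamma>"
      by (simp flip: powr_add)
    also have "sqrt (L ^ 3 * K) * \<dots> \<le> sqrt (L ^ 3 * K) * (T powr (1/2 - \<gamma>) * (t - r) powr \<gamma>)"
      using r g L K by (intro mult_left_mono mult_right_mono powr_mono2) auto
    finally show ?thesis using r by (simp add: M_def mult.assoc)
  qed
  have "\<forall>t\<in>{0..T}. \<forall>r\<in>{0..T}. Vdist L (- s) (u t) (u r) \<le> M * \<bar>t - r\<bar> powr \<gamma>"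
  proof (intro ballI)
    fix t r assume tr: "t \<in> {0..T}" "r \<in> {0..T}"
    have sym: "Vdist L (- s) (u t) (u r) = Vdist L (- s) (u r) (u t)"
      by (simp add: Vdist_def Vnorm_eq Esq_commute[of L "- s" "u t"])
    show "Vdist L (- s) (u t) (u r) \<le> M * \<bar>t - r\<bar> powr \<gamma>"
      using b[of r t] b[of t r] tr sym by (cases "r \<le> t") (auto simp: abs_minus_commute)
  qed
  moreover have "u \<in> C_V L (- s) 0 T" using s a by (intro C_V_mono[OF L _ C]) auto
  ultimately show ?thesis unfolding Hoelder_V_def by blast
qed

section \<open>Time integrals of pairings and the weak identity\<close>

lemma pairing_measurable:
  assumes "cmodes X"
  shows "(\<lambda>r. pairing L (X r) w) \<in> borel_measurable borel"
proof -
  interpret C: sigma_finite_measure "count_space (UNIV :: (int ^ 3) set)" by (rule sigma_finite_measure_count_space)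
  have "(\<lambda>r. X r k \<bullet> w k) \<in> borel_measurable lborel" for k using cmodesD[OF assms, of k] by measurable
  then have "(\<lambda>(r, k). X r k \<bullet> w k) \<in> borel_measurable (lborel \<Otimes>\<^sub>M count_space UNIV)"
    by (rule measurable_pair_count_space)
  then have "(\<lambda>r. LINT k|count_space UNIV. X r k \<bullet> w k) \<in> borel_measurable lborel"
    by (rule C.borel_measurable_lebesgue_integral)
  then show ?thesis unfolding pairing_eq by simp
qed

text \<open>Fubini's theorem for time and modes; it reduces weak identities to a single mode.
  Absolute convergence uses S \<le> 1 + S^2 for the sum S of products of norms together with the
  duality bound for S^2, so on a bounded interval a square integrable V^s norm suffices.\<close>

lemma pairing_time_integral:
  assumes L: "L > 0" and T: "T \<ge> 0" and X: "cmodes X" "\<And>r. X r 0 = 0"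
    and fin: "(\<integral>\<^sup>+r\<in>{0..T}. Esq L s (X r) \<partial>lborel) < \<infinity>" and w: "Esq L (- s) w < \<infinity>"
    and psi: "continuous_on UNIV \<psi>"
  shows "set_integrable lborel {0..T} (\<lambda>r. pairing L (X r) w * \<psi> r)"
    and "(LINT r|lebesgue_on {0..T}. pairing L (X r) w * \<psi> r) = L ^ 3 * (LINT k|count_space UNIV. prim (\<lambda>r. \<psi> r *\<^sub>R X r k) T \<bullet> w k)"
proof -
  let ?C = "count_space (UNIV :: (int ^ 3) set)"
  interpret C: sigma_finite_measure ?C by (rule sigma_finite_measure_count_space)
  interpret P: pair_sigma_finite lborel ?C ..
  have [measurable]: "(\<lambda>r. X r k) \<in> borel_measurable borel" for k using X(1) by (rule cmodesD)
  have [measurable]: "\<psi> \<in> borel_measurable borel" by (rule borel_measurable_continuous_onI[OF psi])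
  note [measurable] = pairing_measurable[OF X(1)]
  obtain M where M: "\<And>r. r \<in> {0..T} \<Longrightarrow> norm (\<psi> r) \<le> M"
    using compact_imp_bounded[OF compact_continuous_image[OF continuous_on_subset[OF psi] compact_Icc], of 0 T] unfolding bounded_iff by blast
  define f where "f r k = (indicator {0..T} r * \<psi> r) * (X r k \<bullet> w k)" for r k
  have fm [measurable]: "(\<lambda>(r, k). f r k) \<in> borel_measurable (lborel \<Otimes>\<^sub>M ?C)"
    unfolding f_def by (rule measurable_pair_count_space) measurable
  have fi: "integrable (lborel \<Otimes>\<^sub>M ?C) (\<lambda>(r, k). f r k)"
  proof (rule integrableI_bounded[OF fm])
    have [measurable]: "(\<lambda>r. Esq L s (X r)) \<in> borel_measurable borel" by (rule cmodes_Esq[OF X(1)])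
    have in1: "(\<integral>\<^sup>+k. ennreal (norm (f r k)) \<partial>?C) \<le> ennreal \<bar>M\<bar> * (indicator {0..T} r + (Esq L s (X r) * indicator {0..T} r) * Esq L (- s) w)" for r
    proof (cases "r \<in> {0..T}")
      case True
      let ?S = "\<integral>\<^sup>+k. ennreal (norm (X r k) * norm (w k)) \<partial>?C"
      have "(\<integral>\<^sup>+k. ennreal (norm (f r k)) \<partial>?C) \<le> (\<integral>\<^sup>+k. ennreal \<bar>M\<bar> * ennreal (norm (X r k) * norm (w k)) \<partial>?C)"
      proof (intro nn_integral_mono)
        fix k
        have "norm (f r k) \<le> \<bar>M\<bar> * (norm (X r k) * norm (w k))"
          using True M[OF True] unfolding f_def norm_mult by (intro mult_mono) (auto simp: Cauchy_Schwarz_ineq2)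
        then show "ennreal (norm (f r k)) \<le> ennreal \<bar>M\<bar> * ennreal (norm (X r k) * norm (w k))"
          by (simp flip: ennreal_mult)
      qed
      also have "\<dots> = ennreal \<bar>M\<bar> * ?S" by (rule nn_integral_cmult) simp
      also have "?S \<le> 1 + ?S\<^sup>2"
      proof (cases ?S)
        case (real x)
        have "x \<le> 1 + x\<^sup>2" using sum_squares_bound[of 1 x] real by (simp add: power2_eq_square)
        then have "ennreal x \<le> ennreal (1 + x\<^sup>2)" by (rule ennreal_leI)
        then show ?thesis using real by (simp add: ennreal_power)
      qed (simp add: power2_eq_square ennreal_top_mult)
      also have "?S\<^sup>2 \<le> Esq L s (X r) * Esq L (- s) w" by (rule sum_norm_mult_sq_le[where u = "X r" and s = s, OF L X(2)])
      finally show ?thesis using True by (simp add: mult_left_mono add_left_mono)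
    qed (simp add: f_def)
    have "(\<integral>\<^sup>+x. ennreal (norm (case x of (r, k) \<Rightarrow> f r k)) \<partial>(lborel \<Otimes>\<^sub>M ?C)) = (\<integral>\<^sup>+r. \<integral>\<^sup>+k. ennreal (norm (f r k)) \<partial>?C \<partial>lborel)"
      by (subst C.nn_integral_fst[symmetric], measurable)
    also have "\<dots> \<le> (\<integral>\<^sup>+r. ennreal \<bar>M\<bar> * (indicator {0..T} r + (Esq L s (X r) * indicator {0..T} r) * Esq L (- s) w) \<partial>lborel)"
      by (intro nn_integral_mono in1)
    also have "\<dots> = ennreal \<bar>M\<bar> * (ennreal T + (\<integral>\<^sup>+r\<in>{0..T}. Esq L s (X r) \<partial>lborel) * Esq L (- s) w)"
      using T by (simp add: nn_integral_cmult nn_integral_add nn_integral_multc)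
    also have "\<dots> < \<infinity>" using fin w by (simp add: ennreal_mult_less_top)
    finally show "(\<integral>\<^sup>+x. ennreal (norm (case x of (r, k) \<Rightarrow> f r k)) \<partial>(lborel \<Otimes>\<^sub>M ?C)) < \<infinity>" .
  qed
  have e1: "(LINT k|?C. f r k) = indicator {0..T} r * \<psi> r * (LINT k|?C. X r k \<bullet> w k)" for r
    unfolding f_def by (rule integral_mult_right_zero)
  have i1: "integrable lborel (\<lambda>r. LINT k|?C. f r k)"
    using P.integrable_fst'[OF fi] by simp
  have p1: "indicator {0..T} r *\<^sub>R (pairing L (X r) w * \<psi> r) = L ^ 3 * (LINT k|?C. f r k)" for r
    unfolding e1 pairing_eq by simp
  show "set_integrable lborel {0..T} (\<lambda>r. pairing L (X r) w * \<psi> r)"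
    unfolding set_integrable_def p1 using i1 by (rule integrable_mult_right)
  have e2: "(LINT r|lborel. f r k) = prim (\<lambda>r. \<psi> r *\<^sub>R X r k) T \<bullet> w k" if "set_integrable lborel {0..T} (\<lambda>r. X r k)" for k
  proof -
    have "set_integrable lborel {0..T} (\<lambda>r. \<psi> r *\<^sub>R X r k)"
      by (intro set_integrable_mult_cont that continuous_on_subset[OF psi]) auto
    from prim_linear(1)[OF bounded_linear_inner_left this, of "w k"]
    show ?thesis by (simp add: prim_def set_lebesgue_integral_def f_def mult.assoc)
  qed
  have "(LINT r|lebesgue_on {0..T}. pairing L (X r) w * \<psi> r) = (LINT r|lborel. indicator {0..T} r *\<^sub>R (pairing L (X r) w * \<psi> r))"
    by (rule LINT_lebesgue_on_eq) auto
  also have "\<dots> = L ^ 3 * (LINT r|lborel. LINT k|?C. f r k)" unfolding p1 by (rule integral_mult_right_zero)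
  also have "(LINT r|lborel. LINT k|?C. f r k) = (LINT k|?C. LINT r|lborel. f r k)"
    by (rule P.Fubini_integral[OF fi, symmetric])
  also have "\<dots> = (LINT k|?C. prim (\<lambda>r. \<psi> r *\<^sub>R X r k) T \<bullet> w k)"
    using L2_modes(1)[OF L X fin] by (simp add: e2)
  finally show "(LINT r|lebesgue_on {0..T}. pairing L (X r) w * \<psi> r) = L ^ 3 * (LINT k|?C. prim (\<lambda>r. \<psi> r *\<^sub>R X r k) T \<bullet> w k)" .
qed

lemma hsol_distr_deriv:
  assumes L: "L > 0" and T: "T \<ge> 0" and h: "hsol L \<nu> T c0 F u" and u: "cmodes u" "\<And>r. solen L (u r)"
    and F: "cmodes F" "\<And>r. F r 0 = 0"
    and Ffin: "(\<integral>\<^sup>+r\<in>{0..T}. Esq L (a - 1) (F r) \<partial>lborel) < \<infinity>"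
    and ufin: "(\<integral>\<^sup>+r\<in>{0..T}. Esq L (1 + a) (u r) \<partial>lborel) < \<infinity>"
  shows "has_distr_deriv L (a - 1) T u (hderiv L \<nu> F u)"
  unfolding has_distr_deriv_def
proof (intro ballI)
  let ?G = "hderiv L \<nu> F u"
  fix w \<psi> assume w: "w \<in> Vspace L (- (a - 1))" and psi: "\<psi> \<in> test_functions T"
  note t = test_functionsD[OF psi]
  have wf: "Esq L (- (a - 1)) w < \<infinity>" using w by (simp add: Vspace_iff)
  have [measurable]: "(\<lambda>r. Esq L (1 + a) (u r)) \<in> borel_measurable borel" using u by (auto intro: cmodes_Esq)
  have uf: "(\<integral>\<^sup>+r\<in>{0..T}. Esq L (a - 1) (u r) \<partial>lborel) < \<infinity>"
  proof -
    have "(\<integral>\<^sup>+r\<in>{0..T}. Esq L (a - 1) (u r) \<partial>lborel) \<le> (\<integral>\<^sup>+r. ennreal ((wt_const L (a - 1) (1 + a))\<^sup>2) * (Esq L (1 + a) (u r) * indicator {0..T} r) \<partial>lborel)"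
      using Esq_mono_exp[OF L, of "a - 1" "1 + a"] by (intro nn_integral_mono) (auto simp: indicator_def)
    also have "\<dots> = ennreal ((wt_const L (a - 1) (1 + a))\<^sup>2) * (\<integral>\<^sup>+r\<in>{0..T}. Esq L (1 + a) (u r) \<partial>lborel)"
      by (rule nn_integral_cmult) measurable
    also have "\<dots> < \<infinity>" using ufin by (simp add: ennreal_mult_less_top)
    finally show ?thesis .
  qed
  \<comment> \<open>Integration by parts for one mode; both boundary terms contain a value of \<psi>
    at an end point and vanish.\<close>
  have parts: "prim (\<lambda>r. deriv \<psi> r *\<^sub>R u r k) T = - prim (\<lambda>r. \<psi> r *\<^sub>R ?G r k) T" for k
  proof -
    have Gi: "set_integrable lborel {0..T} (\<lambda>q. ?G q k)" and ue: "\<And>t. t \<in> {0..T} \<Longrightarrow> u t k = c0 k + prim (\<lambda>q. ?G q k) t"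
      using h unfolding hsol_def hderiv_def by blast+
    have TT: "T \<in> {0..T}" using T by simp
    have ps: "\<psi> r = 0 + prim (deriv \<psi>) r" if "r \<in> {0..T}" for r
      using prim_deriv(1)[OF t(1,2), of r] that t(4) by simp
    note b = prim_by_parts[OF bounded_bilinear_scaleR prim_deriv(2)[OF t(1,2) T] Gi ps ue TT]
    show ?thesis using b(1) t(5) prim_add[OF b(2,3)] by (simp add: add_eq_0_iff2)
  qed
  have "- (LINT r|lebesgue_on {0..T}. pairing L (u r) w * deriv \<psi> r) = - (L ^ 3 * (LINT k|count_space UNIV. prim (\<lambda>r. deriv \<psi> r *\<^sub>R u r k) T \<bullet> w k))"
    using pairing_time_integral(2)[OF L T u(1) solenD(1)[OF u(2)] uf wf t(2)] by simp
  also have "\<dots> = L ^ 3 * (LINT k|count_space UNIV. prim (\<lambda>r. \<psi> r *\<^sub>R ?G r k) T \<bullet> w k)"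
    unfolding parts by simp
  also have "\<dots> = (LINT r|lebesgue_on {0..T}. pairing L (?G r) w * \<psi> r)"
    by (rule pairing_time_integral(2)[OF L T hderiv_fin(1)[OF F(1) u(1) Ffin ufin] _ hderiv_fin(2)[OF F(1) u(1) Ffin ufin] wf t(3), symmetric])
      (simp add: hderiv_def F)
  finally show "- (LINT r|lebesgue_on {0..T}. pairing L (u r) w * deriv \<psi> r) = (LINT r|lebesgue_on {0..T}. pairing L (?G r) w * \<psi> r)" .
qed

lemma LINT_pairing_diff:
  assumes L: "L > 0" and T: "T \<ge> 0" and X: "cmodes X" "\<And>r. X r 0 = 0" "(\<integral>\<^sup>+r\<in>{0..T}. Esq L s (X r) \<partial>lborel) < \<infinity>"
    and Y: "cmodes Y" "\<And>r. Y r 0 = 0" "(\<integral>\<^sup>+r\<in>{0..T}. Esq L s (Y r) \<partial>lborel) < \<infinity>"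
    and w: "Esq L (- s) w < \<infinity>" and psi: "continuous_on UNIV \<psi>"
    and Z: "\<And>r. r \<in> {0..T} \<Longrightarrow> Z r = (\<lambda>k. X r k - Y r k)"
  shows "(LINT r|lebesgue_on {0..T}. pairing L (Z r) w * \<psi> r)
    = (LINT r|lebesgue_on {0..T}. pairing L (X r) w * \<psi> r) - (LINT r|lebesgue_on {0..T}. pairing L (Y r) w * \<psi> r)"
proof -
  note x = pairing_time_integral[OF L T X w psi] and y = pairing_time_integral[OF L T Y w psi]
  have [measurable]: "\<psi> \<in> borel_measurable borel" by (rule borel_measurable_continuous_onI[OF psi])
  note [measurable] = pairing_measurable[OF X(1)] pairing_measurable[OF Y(1)]
  have "(LINT r|lebesgue_on {0..T}. pairing L (Z r) w * \<psi> r) = prim (\<lambda>r. pairing L (X r) w * \<psi> r - pairing L (Y r) w * \<psi> r) T"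
  proof (rule LINT_prim)
    show "AE r in lborel. r \<in> {0..T} \<longrightarrow> pairing L (Z r) w * \<psi> r = pairing L (X r) w * \<psi> r - pairing L (Y r) w * \<psi> r"
      using Esq_AE_finite[OF X(1,3)] Esq_AE_finite[OF Y(1,3)]
    proof eventually_elim
      case (elim r)
      show ?case
      proof
        assume r: "r \<in> {0..T}"
        have "pairing L (\<lambda>k. X r k - Y r k) w = pairing L (X r) w - pairing L (Y r) w"
          using elim r by (intro pairing_diff_left[where u = "X r" and v = "Y r" and s = s, OF L X(2) Y(2)] w) auto
        then show "pairing L (Z r) w * \<psi> r = pairing L (X r) w * \<psi> r - pairing L (Y r) w * \<psi> r"
          by (simp add: Z[OF r] left_diff_distrib)
      qed
    qed
  qed measurable
  also have "\<dots> = prim (\<lambda>r. pairing L (X r) w * \<psi> r) T - prim (\<lambda>r. pairing L (Y r) w * \<psi> r) T"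
    by (rule prim_diff[OF x(1) y(1)])
  also have "prim (\<lambda>r. pairing L (X r) w * \<psi> r) T = (LINT r|lebesgue_on {0..T}. pairing L (X r) w * \<psi> r)"
    by (rule LINT_prim[symmetric]) auto
  also have "prim (\<lambda>r. pairing L (Y r) w * \<psi> r) T = (LINT r|lebesgue_on {0..T}. pairing L (Y r) w * \<psi> r)"
    by (rule LINT_prim[symmetric]) auto
  finally show ?thesis .
qed

lemma pairing_stokes:
  "pairing L (stokes_pow L (1/2) u) (stokes_pow L (1/2) w) = pairing L (\<lambda>k. wt L 2 k *\<^sub>R u k) w"
proof -
  have "stokes_pow L (1/2) u k \<bullet> stokes_pow L (1/2) w k = (wt L 2 k *\<^sub>R u k) \<bullet> w k" for k
    using wt_mult[of L 1 k 1] by (simp add: stokes_pow_def)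
  then show ?thesis by (simp add: pairing_eq)
qed

lemma pairing_scaleR: "pairing L (\<lambda>k. c *\<^sub>R u k) w = c * pairing L u w"
  by (simp add: pairing_eq)

text \<open>The distributional derivative is split into its three parts, which is possible because
  each of them is in L_2(V^(a-1)) by itself. The test space V^(a+1) embeds into the dual V^(1-a), as
  a \<ge> 0.\<close>

lemma weak_identity:
  assumes L: "L > 0" and T: "T \<ge> 0" and a: "a \<ge> 0" and f: "f \<in> Vspace L (a - 1)"
    and v: "cmodes v" "\<And>r. solen L (v r)" and u: "cmodes u" "\<And>r. solen L (u r)"
    and h: "hsol L \<nu> T c0 (NF L T f v u) u"
    and Ffin: "(\<integral>\<^sup>+r\<in>{0..T}. Esq L (a - 1) (NF L T f v u r) \<partial>lborel) < \<infinity>"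
    and ufin: "(\<integral>\<^sup>+r\<in>{0..T}. Esq L (1 + a) (u r) \<partial>lborel) < \<infinity>"
    and w: "w \<in> Vspace L (a + 1)" and psi: "\<psi> \<in> test_functions T"
  shows "- (LINT r|lebesgue_on {0..T}. pairing L (u r) w * deriv \<psi> r)
        + \<nu> * (LINT r|lebesgue_on {0..T}. pairing L (stokes_pow L (1/2) (u r)) (stokes_pow L (1/2) w) * \<psi> r)
        + (LINT r|lebesgue_on {0..T}. pairing L (Bc L (v r) (u r)) w * \<psi> r)
        = (LINT r|lebesgue_on {0..T}. pairing L f w * \<psi> r)"
proof -
  let ?F = "NF L T f v u"
  define S where "S r = (\<lambda>k. (\<nu> * wt L 2 k) *\<^sub>R u r k)" for r
  note c = test_functionsD(3)[OF psi]
  have f': "solen L f" "Esq L (a - 1) f < \<infinity>" using f by (auto simp: Vspace_iff)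
  have F: "cmodes ?F" "\<And>r. ?F r 0 = 0"
    by (rule cmodes_NF[OF v(1) u(1)]) (rule solenD(1)[OF solen_NF[OF f'(1) v(2) u(2)]])
  have w': "w \<in> Vspace L (- (a - 1))" using a by (intro Vspace_mono[OF L _ w]) auto
  then have wf: "Esq L (- (a - 1)) w < \<infinity>" by (simp add: Vspace_iff)
  have [measurable]: "(\<lambda>r. Esq L (1 + a) (u r)) \<in> borel_measurable borel" "(\<lambda>r. Esq L (a - 1) (?F r)) \<in> borel_measurable borel"
    using u F by (auto intro: cmodes_Esq)
  have S: "cmodes S" "\<And>r. S r 0 = 0" "(\<integral>\<^sup>+r\<in>{0..T}. Esq L (a - 1) (S r) \<partial>lborel) < \<infinity>"
  proof -
    have [measurable]: "(\<lambda>t. u t k) \<in> borel_measurable borel" for k using u(1) by (rule cmodesD)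
    show "cmodes S" unfolding cmodes_def S_def by (intro allI) measurable
    have "(\<integral>\<^sup>+r\<in>{0..T}. Esq L (a - 1) (S r) \<partial>lborel) = ennreal (\<nu>\<^sup>2) * (\<integral>\<^sup>+r\<in>{0..T}. Esq L (1 + a) (u r) \<partial>lborel)"
      unfolding S_def Esq_stokes by (subst nn_integral_cmult[symmetric]) (auto simp: mult.assoc)
    then show "(\<integral>\<^sup>+r\<in>{0..T}. Esq L (a - 1) (S r) \<partial>lborel) < \<infinity>" using ufin by (simp add: ennreal_mult_less_top)
  qed (simp add: S_def)
  have B: "cmodes (\<lambda>r. Bc L (v r) (u r))" by (rule cmodes_Bc[OF v(1) u(1)])
  \<comment> \<open>On [0, T] the nonlinear term is f minus the right-hand side \<open>NF\<close>,
    so its bound follows from those of the two.\<close>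
  have Bf: "(\<integral>\<^sup>+r\<in>{0..T}. Esq L (a - 1) (Bc L (v r) (u r)) \<partial>lborel) < \<infinity>"
  proof -
    have "(\<integral>\<^sup>+r\<in>{0..T}. Esq L (a - 1) (Bc L (v r) (u r)) \<partial>lborel)
        \<le> (\<integral>\<^sup>+r. 2 * Esq L (a - 1) f * indicator {0..T} r + 2 * (Esq L (a - 1) (?F r) * indicator {0..T} r) \<partial>lborel)"
    proof (intro nn_integral_mono)
      fix r
      show "Esq L (a - 1) (Bc L (v r) (u r)) * indicator {0..T} r \<le> 2 * Esq L (a - 1) f * indicator {0..T} r + 2 * (Esq L (a - 1) (?F r) * indicator {0..T} r)"
        using Esq_diff[of L "a - 1" f "?F r"] by (auto simp: indicator_def NF_def)
    qed
    also have "\<dots> = 2 * Esq L (a - 1) f * ennreal T + 2 * (\<integral>\<^sup>+r\<in>{0..T}. Esq L (a - 1) (?F r) \<partial>lborel)"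
      using T by (simp add: nn_integral_add nn_integral_cmult nn_integral_cmult_indicator)
    also have "\<dots> < \<infinity>" using f' Ffin by (simp add: ennreal_mult_less_top)
    finally show ?thesis .
  qed
  have cf: "cmodes (\<lambda>r. f)" by (simp add: cmodes_def)
  have ff: "(\<integral>\<^sup>+r\<in>{0..T}. Esq L (a - 1) f \<partial>lborel) < \<infinity>"
    using f' T by (simp add: nn_integral_cmult_indicator ennreal_mult_less_top)
  have "- (LINT r|lebesgue_on {0..T}. pairing L (u r) w * deriv \<psi> r) = (LINT r|lebesgue_on {0..T}. pairing L (hderiv L \<nu> ?F u r) w * \<psi> r)"
    using hsol_distr_deriv[OF L T h u F Ffin ufin] w' psi unfolding has_distr_deriv_def by blast
  also have "\<dots> = (LINT r|lebesgue_on {0..T}. pairing L (?F r) w * \<psi> r) - (LINT r|lebesgue_on {0..T}. pairing L (S r) w * \<psi> r)"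
    by (rule LINT_pairing_diff[OF L T F Ffin S wf c]) (simp add: hderiv_def S_def)
  also have "(LINT r|lebesgue_on {0..T}. pairing L (?F r) w * \<psi> r) = (LINT r|lebesgue_on {0..T}. pairing L f w * \<psi> r) - (LINT r|lebesgue_on {0..T}. pairing L (Bc L (v r) (u r)) w * \<psi> r)"
    by (rule LINT_pairing_diff[OF L T cf solenD(1)[OF f'(1)] ff B Bc_0 Bf wf c]) (simp add: NF_def)
  also have "(LINT r|lebesgue_on {0..T}. pairing L (S r) w * \<psi> r) = \<nu> * (LINT r|lebesgue_on {0..T}. pairing L (stokes_pow L (1/2) (u r)) (stokes_pow L (1/2) w) * \<psi> r)"
    unfolding pairing_stokes S_def scaleR_scaleR[symmetric] pairing_scaleR mult.assoc by simp
  finally show ?thesis by simp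
qed


section \<open>Strong measurability\<close>

lemma Vdist_mode_tendsto:
  assumes L: "L > 0" and p: "\<And>n. p n \<in> Vspace L s" and u: "u \<in> Vspace L s"
    and lim: "(\<lambda>n. Vdist L s (p n) u) \<longlonglongrightarrow> 0"
  shows "(\<lambda>n. p n k) \<longlonglongrightarrow> u k"
proof (cases "k = 0")
  case True
  then show ?thesis using p u by (simp add: Vspace_def)
next
  case False
  have fin: "Esq L s (\<lambda>k. p n k - u k) < \<infinity>" for n using Vspace_diff[OF p u] by (simp add: Vspace_iff)
  have le: "(wt L s k * norm (p n k - u k))\<^sup>2 \<le> (Vdist L s (p n) u)\<^sup>2 / L ^ 3" for n
  proof -
    have "ennreal ((wt L s k * norm (p n k - u k))\<^sup>2) \<le> ennreal ((Vdist L s (p n) u)\<^sup>2 / L ^ 3)"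
      using Esq_mode[of L s k "\<lambda>k. p n k - u k"] by (simp add: Vdist_def Esq_eq_Vnorm[OF L fin])
    then show ?thesis using L by (subst (asm) ennreal_le_iff) auto
  qed
  have z: "(0::real)\<^sup>2 / L ^ 3 = 0" by simp
  have "(\<lambda>n. (Vdist L s (p n) u)\<^sup>2 / L ^ 3) \<longlonglongrightarrow> 0\<^sup>2 / L ^ 3"
    using L by (intro tendsto_divide tendsto_power lim tendsto_const) auto
  then have yl: "(\<lambda>n. (Vdist L s (p n) u)\<^sup>2 / L ^ 3) \<longlonglongrightarrow> 0" by (simp only: z)
  have "(\<lambda>n. (wt L s k * norm (p n k - u k))\<^sup>2) \<longlonglongrightarrow> 0"
    by (rule tendsto_sandwich[OF always_eventually always_eventually tendsto_const yl]) (simp_all add: le)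
  then have "(\<lambda>n. sqrt ((wt L s k * norm (p n k - u k))\<^sup>2)) \<longlonglongrightarrow> sqrt 0" by (rule tendsto_real_sqrt)
  then have "(\<lambda>n. wt L s k * norm (p n k - u k)) \<longlonglongrightarrow> 0" by simp
  then have "(\<lambda>n. (wt L s k * norm (p n k - u k)) / wt L s k) \<longlonglongrightarrow> 0 / wt L s k"
    using wt_pos[OF L False, of s] by (intro tendsto_divide tendsto_const) auto
  then have "(\<lambda>n. norm (p n k - u k)) \<longlonglongrightarrow> 0" using wt_pos[OF L False, of s] by simp
  then have "(\<lambda>n. p n k - u k) \<longlonglongrightarrow> 0" by (rule tendsto_norm_zero_cancel)
  then show ?thesis by (rule LIM_zero_cancel)
qed

text \<open>Supplies the representative on which all later estimates work: Borel modes, and the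
  algebraic constraints and a finite norm at every time. Convergence in V^s implies convergence of
  each mode, so the modes are limits of simple functions.\<close>

lemma strongly_measurableE:
  assumes L: "L > 0" and u: "strongly_measurable L s a b u"
  obtains w where "cmodes w" "\<And>t. solen L (w t)" "\<And>t. Esq L s (w t) < \<infinity>"
    "AE t in lborel. t \<in> {a..b} \<longrightarrow> u t = w t"
proof -
  obtain g :: "nat \<Rightarrow> real \<Rightarrow> coeffs" where
    g: "\<And>n. simple_function (lebesgue_on {a..b}) (g n)" "\<And>n t. t \<in> {a..b} \<Longrightarrow> g n t \<in> Vspace L s"
    and ae: "AE t in lebesgue_on {a..b}. u t \<in> Vspace L s \<and> (\<lambda>n. Vdist L s (g n t) (u t)) \<longlonglongrightarrow> 0"
    using u unfolding strongly_measurable_def by blast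
  \<comment> \<open>The approximating functions are simple for Lebesgue measure only. One mode at a
    time they agree almost everywhere with Borel simple functions; there are countably many pairs of
    n and k, so the exceptional sets add up to a null set.\<close>
  have ex: "\<exists>h. simple_function lborel h \<and> (AE t in lborel. indicator {a..b} t *\<^sub>R g n t k = h t)" for n k
  proof -
    have "simple_function (lebesgue_on {a..b}) (\<lambda>t. g n t k)"
      using simple_function_compose[OF g(1), where g = "\<lambda>f. f k"] by (simp add: o_def)
    then have "simple_function lebesgue (\<lambda>t. indicator {a..b} t *\<^sub>R g n t k)"
      by (subst (asm) simple_function_restrict_space) auto
    then show ?thesis by (rule completion_ex_simple_function)
  qed
  define h where "h n k = (SOME h. simple_function lborel h \<and> (AE t in lborel. indicator {a..b} t *\<^sub>R g n t k = h t))" for n k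
  have h: "simple_function lborel (h n k)" "AE t in lborel. indicator {a..b} t *\<^sub>R g n t k = h n k t" for n k
    using someI_ex[OF ex[of n k]] unfolding h_def by blast+
  have "AE t in lborel. \<forall>n k. indicator {a..b} t *\<^sub>R g n t k = h n k t"
    using h(2) by (simp add: AE_all_countable)
  moreover have "AE t in lborel. t \<in> {a..b} \<longrightarrow> u t \<in> Vspace L s \<and> (\<lambda>n. Vdist L s (g n t) (u t)) \<longlonglongrightarrow> 0"
    using ae by (subst (asm) AE_lebesgue_on_iff) auto
  ultimately have "AE t in lborel. t \<in> {a..b} \<longrightarrow> u t \<in> Vspace L s \<and> (\<forall>k. (\<lambda>n. h n k t) \<longlonglongrightarrow> u t k)"
  proof eventually_elim
    case (elim t)
    show ?case
    proof
      assume t: "t \<in> {a..b}"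
      have "(\<lambda>n. g n t k) \<longlonglongrightarrow> u t k" for k
        by (rule Vdist_mode_tendsto[OF L g(2)[OF t]]) (use elim t in auto)
      moreover have "g n t k = h n k t" for n k using elim(1) t by (metis indicator_simps(1) scaleR_one)
      ultimately show "u t \<in> Vspace L s \<and> (\<forall>k. (\<lambda>n. h n k t) \<longlonglongrightarrow> u t k)" using elim t by simp
    qed
  qed
  then obtain N where N: "N \<in> null_sets lborel"
      "{t \<in> space lborel. \<not> (t \<in> {a..b} \<longrightarrow> u t \<in> Vspace L s \<and> (\<forall>k. (\<lambda>n. h n k t) \<longlonglongrightarrow> u t k))} \<subseteq> N"
    unfolding eventually_ae_filter by blast
  \<comment> \<open>A Borel null set absorbs all exceptional times. The zero field put there
    satisfies every constraint.\<close>
  define w where "w t k = (if t \<in> {a..b} - N then u t k else 0)" for t k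
  have good: "u t \<in> Vspace L s" "(\<lambda>n. h n k t) \<longlonglongrightarrow> u t k" if "t \<in> {a..b} - N" for t k
    using N(2) that by auto
  have "cmodes w"
    unfolding cmodes_def
  proof
    fix k
    have Nb: "N \<in> sets borel" using N(1) by auto
    have "h n k \<in> borel_measurable borel" for n using borel_measurable_simple_function[OF h(1)] by simp
    then have "(\<lambda>t. indicator ({a..b} - N) t *\<^sub>R h n k t) \<in> borel_measurable borel" for n
      using Nb by (intro borel_measurable_scaleR borel_measurable_indicator) auto
    moreover have "(\<lambda>n. indicator ({a..b} - N) t *\<^sub>R h n k t) \<longlonglongrightarrow> w t k" for t
      using good(2)[of t k] by (cases "t \<in> {a..b} - N") (auto simp: w_def)
    ultimately show "(\<lambda>t. w t k) \<in> borel_measurable borel" by (rule borel_measurable_LIMSEQ_metric)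
  qed
  moreover have w_cases: "w t = u t \<and> u t \<in> Vspace L s \<or> w t = (\<lambda>k. 0)" for t
    using good(1)[of t] by (cases "t \<in> {a..b} - N") (auto simp: w_def fun_eq_iff)
  moreover have "solen L (w t)" "Esq L s (w t) < \<infinity>" for t
    using w_cases[of t] by (auto simp: Vspace_iff)
  moreover have "AE t in lborel. t \<in> {a..b} \<longrightarrow> u t = w t"
    using AE_not_in[OF N(1)] by eventually_elim (auto simp: w_def fun_eq_iff)
  ultimately show ?thesis using that by blast
qed

lemma leray_id: "zdot z a = 0 \<Longrightarrow> leray z a = a"
  by (simp add: leray_def vec_eq_iff)

lemma simple_function_modes:
  assumes "finite K" "\<And>k. simple_function M (\<lambda>t. s t k)"
  shows "simple_function M (\<lambda>t k. if k \<in> K then s t k else (0 :: 'b::zero))"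
  using assms(1)
proof induction
  case (insert x K)
  have e: "(\<lambda>k. if k \<in> insert x K then s t k else 0) = (\<lambda>k. if k \<in> K then s t k else 0)(x := s t x)" for t
    by auto
  show ?case unfolding e
    using simple_function_compose2[OF insert.IH assms(2)[of x], where h = "\<lambda>f y. f(x := y)"] .
qed simp

text \<open>The converse passage. Simple approximations of the single modes are corrected to
  divergence-free real fields, cut off to finitely many frequencies, and shown to converge in V^s by
  dominated convergence over the modes.\<close>

lemma strongly_measurableI:
  assumes L: "L > 0" and w: "cmodes w" "\<And>t. solen L (w t)"
    and fin: "AE t in lborel. t \<in> {a..b} \<longrightarrow> Esq L s (w t) < \<infinity>"
    and eq: "AE t in lborel. t \<in> {a..b} \<longrightarrow> u t = w t"
  shows "strongly_measurable L s a b u"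
proof -
  let ?M = "lebesgue_on {a..b}"
  have "(\<lambda>t. w t k) \<in> borel_measurable ?M" for k
  proof -
    have "(\<lambda>t. w t k) \<in> borel_measurable lborel" using w(1) by (simp add: cmodes_def)
    then show ?thesis by (intro measurable_restrict_space1 measurable_completion)
  qed
  then have ex: "\<exists>F. (\<forall>i. simple_function ?M (F i)) \<and> (\<forall>t\<in>space ?M. (\<lambda>i. F i t) \<longlonglongrightarrow> w t k) \<and> (\<forall>i. \<forall>t\<in>space ?M. dist (F i t) 0 \<le> 2 * dist (w t k) 0)" for k
    by (rule borel_measurable_implies_sequence_metric[of "\<lambda>t. w t k" ?M 0])
  define F where "F k = (SOME F. (\<forall>i. simple_function ?M (F i)) \<and> (\<forall>t\<in>space ?M. (\<lambda>i. F i t) \<longlonglongrightarrow> w t k) \<and> (\<forall>i. \<forall>t\<in>space ?M. dist (F i t) 0 \<le> 2 * dist (w t k) 0))" for k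
  have F: "simple_function ?M (F k i)" "t \<in> {a..b} \<Longrightarrow> (\<lambda>i. F k i t) \<longlonglongrightarrow> w t k"
      "t \<in> {a..b} \<Longrightarrow> norm (F k i t) \<le> 2 * norm (w t k)" for k i t
    using someI_ex[OF ex[of k]] unfolding F_def[symmetric] by auto
  \<comment> \<open>An approximation of one mode need not be divergence-free, nor compatible with
    that of the opposite mode. The Leray projection and the average with the conjugate at -k repair
    both, and neither changes the limit.\<close>
  define q where "q n t k = (1 / 2) *\<^sub>R (leray (freq L k) (F k n t) + cj (leray (freq L k) (F (- k) n t)))" for n t k
  define K where "K n = {k. norm (freq L k) \<le> real n} - {0}" for n :: nat
  define g where "g n t k = (if k \<in> K n then q n t k else 0)" for n t k
  have finK: "finite (K n)" for n using finite_freq_le[OF L] by (simp add: K_def)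
  have simple: "simple_function ?M (g n)" for n
  proof -
    have "simple_function ?M (\<lambda>t. q n t k)" for k
      unfolding q_def
      using simple_function_compose2[OF F(1)[of k n] F(1)[of "- k" n], where h = "\<lambda>x y. (1 / 2) *\<^sub>R (leray (freq L k) x + cj (leray (freq L k) y))"] .
    from simple_function_modes[OF finK this] show ?thesis by (simp add: g_def[abs_def])
  qed
  have sol: "solen L (g n t)" for n t
    unfolding solen_iff
  proof (intro conjI allI)
    show "g n t 0 = 0" by (simp add: g_def K_def)
    show "g n t (- k) = cj (g n t k)" for k
      by (simp add: g_def q_def K_def add.commute)
    have "zdot (freq L k) (cj (leray (freq L k) x)) = 0" for k x by simp
    then show "zdot (freq L k) (g n t k) = 0" for k
      by (simp add: g_def q_def)
  qed
  have gV: "g n t \<in> Vspace L s" for n t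
  proof -
    have "finite {k. g n t k \<noteq> 0}" by (rule finite_subset[OF _ finK[of n]]) (auto simp: g_def)
    then have "Esq L s (g n t) < \<infinity>" by (rule Esq_finite_support)
    then show ?thesis using sol by (simp add: Vspace_iff)
  qed
  have conv: "(\<lambda>n. Vdist L s (g n t) (w t)) \<longlonglongrightarrow> 0" if t: "t \<in> {a..b}" and f: "Esq L s (w t) < \<infinity>" for t
  proof -
    have wV: "w t \<in> Vspace L s" using w(2) f by (simp add: Vspace_iff)
    have nw: "norm (w t (- k)) = norm (w t k)" for k using solenD(2)[OF w(2)] by simp
    have bd: "norm (g n t k) \<le> 4 * norm (w t k)" for n k
    proof -
      have "norm (q n t k) \<le> 1 / 2 * (2 * (2 * norm (w t k)) + 2 * (2 * norm (w t (- k))))"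
        unfolding q_def norm_scaleR
        by (intro mult_mono norm_triangle_le add_mono)
          (use F(3)[OF t, of k n] F(3)[OF t, of "- k" n] norm_leray[of "freq L k" "F k n t"] norm_leray[of "freq L k" "F (- k) n t"] in auto)
      then show ?thesis by (simp add: g_def nw)
    qed
    have "(\<lambda>n. \<integral>\<^sup>+k. ennreal ((wt L s k * norm (g n t k - w t k))\<^sup>2) \<partial>count_space UNIV)
        \<longlonglongrightarrow> (\<integral>\<^sup>+k. 0 \<partial>count_space (UNIV :: (int ^ 3) set))"
    \<comment> \<open>25 is the square of 4 + 1. The approximation is bounded by 4 |w|: a factor 2
      from the simple functions and a factor 2 from the Leray projection.\<close>
    proof (rule nn_integral_dominated_convergence[where w = "\<lambda>k. ennreal (25 * (wt L s k * norm (w t k))\<^sup>2)"])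
      have "(\<integral>\<^sup>+k. ennreal (25 * (wt L s k * norm (w t k))\<^sup>2) \<partial>count_space UNIV) = 25 * Esq L s (w t)"
        unfolding Esq_def by (simp add: ennreal_mult nn_integral_cmult)
      then show "(\<integral>\<^sup>+k. ennreal (25 * (wt L s k * norm (w t k))\<^sup>2) \<partial>count_space UNIV) < \<infinity>"
        using f by (simp add: ennreal_mult_less_top)
      show "AE k in count_space UNIV. ennreal ((wt L s k * norm (g n t k - w t k))\<^sup>2) \<le> ennreal (25 * (wt L s k * norm (w t k))\<^sup>2)" for n
      proof (intro AE_I2 ennreal_leI)
        fix k
        have "norm (g n t k - w t k) \<le> 5 * norm (w t k)"
          using bd[of n k] norm_triangle_ineq4[of "g n t k" "w t k"] by simp
        then have "(wt L s k * norm (g n t k - w t k))\<^sup>2 \<le> (wt L s k * (5 * norm (w t k)))\<^sup>2"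
          by (intro power_mono mult_left_mono) auto
        then show "(wt L s k * norm (g n t k - w t k))\<^sup>2 \<le> 25 * (wt L s k * norm (w t k))\<^sup>2"
          by (simp add: power_mult_distrib)
      qed
      show "AE k in count_space UNIV. (\<lambda>n. ennreal ((wt L s k * norm (g n t k - w t k))\<^sup>2)) \<longlonglongrightarrow> 0"
      proof (rule AE_I2)
        fix k :: "int ^ 3"
        have "(\<lambda>n. g n t k) \<longlonglongrightarrow> w t k"
        proof (cases "k = 0")
          case True
          then show ?thesis by (simp add: g_def K_def solenD(1)[OF w(2)])
        next
          case False
          have "(\<lambda>n. q n t k) \<longlonglongrightarrow> (1 / 2) *\<^sub>R (leray (freq L k) (w t k) + cj (leray (freq L k) (w t (- k))))"
            unfolding q_def
            by (intro tendsto_scaleR tendsto_add tendsto_const F(2)[OF t]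
                bounded_linear.tendsto[OF bounded_linear_leray] bounded_linear.tendsto[OF bounded_linear_cj])
          also have "(1 / 2) *\<^sub>R (leray (freq L k) (w t k) + cj (leray (freq L k) (w t (- k)))) = w t k"
          proof -
            have "leray (freq L k) (w t k) = w t k" by (rule leray_id) (rule solenD(3)[OF w(2)])
            then show ?thesis by (simp add: solenD(2)[OF w(2)] flip: scaleR_2)
          qed
          finally have "(\<lambda>n. q n t k) \<longlonglongrightarrow> w t k" .
          moreover have "eventually (\<lambda>n. norm (freq L k) \<le> real n) sequentially"
            using filterlim_real_sequentially by (auto simp: filterlim_at_top)
          then have "eventually (\<lambda>n. q n t k = g n t k) sequentially"
            by eventually_elim (simp add: g_def K_def False)
          ultimately show ?thesis by (rule Lim_transform_eventually)
        qed
        then have "(\<lambda>n. ennreal ((wt L s k * norm (g n t k - w t k))\<^sup>2)) \<longlonglongrightarrow> ennreal ((wt L s k * norm (w t k - w t k))\<^sup>2)"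
          by (intro tendsto_ennrealI tendsto_power tendsto_mult tendsto_norm tendsto_diff tendsto_const)
        then show "(\<lambda>n. ennreal ((wt L s k * norm (g n t k - w t k))\<^sup>2)) \<longlonglongrightarrow> 0" by simp
      qed
    qed auto
    then have "(\<lambda>n. Esq L s (\<lambda>k. g n t k - w t k)) \<longlonglongrightarrow> 0" by (simp add: Esq_def)
    moreover have "Esq L s (\<lambda>k. g n t k - w t k) < \<infinity>" for n
      using Vspace_diff[OF gV wV] by (simp add: Vspace_iff)
    ultimately show ?thesis by (subst tendsto_Vdist_iff[OF L]) auto
  qed
  have "AE t in lebesgue_on {a..b}. u t \<in> Vspace L s \<and> (\<lambda>n. Vdist L s (g n t) (u t)) \<longlonglongrightarrow> 0"
    unfolding AE_lebesgue_on_iff[OF borel_closed[OF closed_atLeastAtMost]]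
    using fin eq
  proof eventually_elim
    case (elim t)
    then show ?case using conv[of t] w(2)[of t] by (auto simp: Vspace_iff)
  qed
  then show ?thesis
    unfolding strongly_measurable_def using simple gV by blast
qed

lemma Vnorm_sq_nn:
  assumes L: "L > 0"
  shows "ennreal ((Vnorm L s u)\<^sup>2) \<le> ennreal (L ^ 3) * Esq L s u"
  using L by (cases "Esq L s u") (auto simp: Vnorm_eq ennreal_mult ennreal_mult_top)

lemma cmodes_Vnorm: "cmodes w \<Longrightarrow> (\<lambda>t. (Vnorm L s (w t))\<^sup>2) \<in> borel_measurable borel"
  unfolding Vnorm_eq using cmodes_Esq[of w L s] by measurable

lemma L2_VI:
  assumes L: "L > 0" and w: "cmodes w" "\<And>t. solen L (w t)"
    and fin: "(\<integral>\<^sup>+t\<in>{a..b}. Esq L s (w t) \<partial>lborel) < \<infinity>"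
    and eq: "AE t in lborel. t \<in> {a..b} \<longrightarrow> u t = w t"
  shows "u \<in> L2_V L s a b"
proof -
  have [measurable]: "(\<lambda>t. Esq L s (w t)) \<in> borel_measurable borel" by (rule cmodes_Esq[OF w(1)])
  from strongly_measurableI[OF L w Esq_AE_finite[OF w(1) fin] eq] have sm: "strongly_measurable L s a b u" .
  note [measurable] = cmodes_Vnorm[OF w(1), of L s]
  have "set_integrable lborel {a..b} (\<lambda>t. (Vnorm L s (w t))\<^sup>2)"
    unfolding set_integrable_def
  proof (rule integrableI_bounded)
    have "(\<integral>\<^sup>+t. ennreal (norm (indicator {a..b} t *\<^sub>R (Vnorm L s (w t))\<^sup>2)) \<partial>lborel)
        \<le> (\<integral>\<^sup>+t. ennreal (L ^ 3) * (Esq L s (w t) * indicator {a..b} t) \<partial>lborel)"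
      using Vnorm_sq_nn[OF L] by (intro nn_integral_mono) (auto simp: indicator_def)
    also have "\<dots> = ennreal (L ^ 3) * (\<integral>\<^sup>+t\<in>{a..b}. Esq L s (w t) \<partial>lborel)"
      by (rule nn_integral_cmult) measurable
    also have "\<dots> < \<infinity>" using fin by (simp add: ennreal_mult_less_top)
    finally show "(\<integral>\<^sup>+t. ennreal (norm (indicator {a..b} t *\<^sub>R (Vnorm L s (w t))\<^sup>2)) \<partial>lborel) < \<infinity>" .
  qed measurable
  moreover have "AE t in lborel. t \<in> {a..b} \<longrightarrow> (Vnorm L s (u t))\<^sup>2 = (Vnorm L s (w t))\<^sup>2"
    using eq by eventually_elim auto
  ultimately have "integrable (lebesgue_on {a..b}) (\<lambda>t. (Vnorm L s (u t))\<^sup>2)"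
    by (subst LINT_AE_borel(2)[OF cmodes_Vnorm[OF w(1)]]) auto
  then show ?thesis using sm by (simp add: L2_V_def)
qed

text \<open>Together with \<open>L2_VI\<close> this translates between the spaces of the statement
  and finite time integrals of \<open>Esq\<close> for Borel representatives.\<close>

lemma L2_VE:
  assumes L: "L > 0" and u: "u \<in> L2_V L s a b"
  obtains w where "cmodes w" "\<And>t. solen L (w t)" "(\<integral>\<^sup>+t\<in>{a..b}. Esq L s (w t) \<partial>lborel) < \<infinity>"
    "AE t in lborel. t \<in> {a..b} \<longrightarrow> u t = w t"
proof -
  have "strongly_measurable L s a b u" using u by (simp add: L2_V_def)
  from strongly_measurableE[OF L this] obtain w where w: "cmodes w" "\<And>t. solen L (w t)" "\<And>t. Esq L s (w t) < \<infinity>"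
    "AE t in lborel. t \<in> {a..b} \<longrightarrow> u t = w t" by blast
  have "AE t in lborel. t \<in> {a..b} \<longrightarrow> (Vnorm L s (u t))\<^sup>2 = (Vnorm L s (w t))\<^sup>2"
    using w(4) by eventually_elim auto
  then have "set_integrable lborel {a..b} (\<lambda>t. (Vnorm L s (w t))\<^sup>2)"
    using u LINT_AE_borel(2)[OF cmodes_Vnorm[OF w(1)], of "{a..b}"] by (auto simp: L2_V_def)
  then have i: "integrable lborel (\<lambda>t. (1 / L ^ 3) * (indicator {a..b} t *\<^sub>R (Vnorm L s (w t))\<^sup>2))"
    unfolding set_integrable_def by (rule integrable_mult_right)
  have "(\<integral>\<^sup>+t\<in>{a..b}. Esq L s (w t) \<partial>lborel) = (\<integral>\<^sup>+t. ennreal (norm ((1 / L ^ 3) * (indicator {a..b} t *\<^sub>R (Vnorm L s (w t))\<^sup>2))) \<partial>lborel)"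
    using L by (intro nn_integral_cong) (auto simp: Esq_eq_Vnorm[OF L w(3)] indicator_def)
  also have "\<dots> < \<infinity>" using i by (simp only: integrable_iff_bounded)
  finally show ?thesis using that w by blast
qed


section \<open>Test functions\<close>

text \<open>A family of functions supported in [0, 1] that is closed under differentiation: a
  polynomial and a power of x (1 - x) in front of the flat exponential. So all derivatives are
  reached by one lemma on first derivatives.\<close>

definition bump :: "real poly \<Rightarrow> nat \<Rightarrow> real \<Rightarrow> real" where
  "bump p n x = (if 0 < x \<and> x < 1 then poly p x / (x * (1 - x)) ^ n * exp (- 1 / (x * (1 - x))) else 0)"

text \<open>The numerator of the derivative over w^(n+2), where w = x (1 - x) and w' = 1 - 2 x. The
  three terms come from the polynomial, from the power of w, and from the exponential, whose
  derivative carries w' / w^2.\<close>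

definition bump_poly :: "nat \<Rightarrow> real poly \<Rightarrow> real poly" where
  "bump_poly n p = pderiv p * [:0, 1, -1:] ^ 2 - smult (real n) (p * [:1, -2:] * [:0, 1, -1:]) + p * [:1, -2:]"

lemma power_le_fact_exp:
  fixes z :: real
  assumes "z \<ge> 0"
  shows "z ^ m \<le> fact m * exp z"
proof -
  have s: "(\<lambda>n. z ^ n /\<^sub>R fact n) sums exp z" by (rule exp_converges)
  have "sum (\<lambda>n. z ^ n /\<^sub>R fact n) {m} \<le> (\<Sum>n. z ^ n /\<^sub>R fact n)"
    using assms s by (intro sum_le_suminf) (auto simp: sums_iff)
  then show ?thesis using s by (simp add: sums_iff field_simps)
qed

text \<open>A single term of the exponential series shows that exp (-1 / w) beats w^(n+2). The two
  surplus powers of w make the difference quotients at 0 and 1 tend to 0.\<close>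

lemma bump_quadratic_bound:
  obtains C where "\<And>y. \<bar>bump p n y\<bar> \<le> C * (y * (1 - y))\<^sup>2"
proof -
  have "compact (poly p ` {0..1})" by (intro compact_continuous_image continuous_intros) auto
  then obtain P where P: "\<And>y. y \<in> {0..1} \<Longrightarrow> \<bar>poly p y\<bar> \<le> P"
    using compact_imp_bounded[of "poly p ` {0..1}"] unfolding bounded_iff by fastforce
  have P0: "P \<ge> 0" using P[of 0] by auto
  have "\<bar>bump p n y\<bar> \<le> (P * fact (n + 2)) * (y * (1 - y))\<^sup>2" for y
  proof (cases "0 < y \<and> y < 1")
    case True
    define w where "w = y * (1 - y)"
    have w: "w > 0" using True by (simp add: w_def)
    have "(1 / w) ^ (n + 2) \<le> fact (n + 2) * exp (1 / w)" using w by (intro power_le_fact_exp) auto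
    then have "exp (- (1 / w)) * (1 / w) ^ (n + 2) \<le> exp (- (1 / w)) * (fact (n + 2) * exp (1 / w))"
      by (rule mult_left_mono) simp
    moreover have "exp (- (1 / w)) * (fact (n + 2) * exp (1 / w)) = fact (n + 2) * (exp (- (1 / w)) * exp (1 / w))"
      by (simp only: mult.left_commute)
    moreover have "exp (- (1 / w)) * exp (1 / w) = 1" by (simp flip: exp_add)
    moreover have "exp (- (1 / w)) * (1 / w) ^ (n + 2) = exp (- (1 / w)) / w ^ (n + 2)"
      by (simp only: power_one_over) simp
    ultimately have e: "exp (- (1 / w)) / w ^ (n + 2) \<le> fact (n + 2)" by (simp only: mult_1_right)
    have "\<bar>bump p n y\<bar> = \<bar>poly p y\<bar> * (exp (- (1 / w)) / w ^ n)"
      using True w by (simp add: bump_def w_def abs_mult)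
    also have "exp (- (1 / w)) / w ^ n = exp (- (1 / w)) / w ^ (n + 2) * w\<^sup>2"
      using w by (simp add: power_add power2_eq_square)
    also have "\<bar>poly p y\<bar> * (exp (- (1 / w)) / w ^ (n + 2) * w\<^sup>2) \<le> P * (fact (n + 2) * w\<^sup>2)"
      using P[of y] True e P0 w by (intro mult_mono mult_right_mono) auto
    finally show ?thesis by (simp add: w_def mult.assoc)
  next
    case False
    then have "bump p n y = 0" by (simp only: bump_def if_False)
    then show ?thesis using P0 by simp
  qed
  then show ?thesis using that by blast
qed

lemma bump_has_derivative: "(bump p n has_real_derivative bump (bump_poly n p) (n + 2) x) (at x)"
proof -
  consider "0 < x \<and> x < 1" | "x < 0 \<or> x > 1" | "x = 0 \<or> x = 1" by linarith
  then show ?thesis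
  proof cases
    case 1
    define w where "w = x * (1 - x)"
    have w: "w > 0" using 1 by (simp add: w_def)
    have "((\<lambda>x. poly p x / (x * (1 - x)) ^ n * exp (- 1 / (x * (1 - x)))) has_real_derivative
        ((poly (pderiv p) x * w ^ n - poly p x * (real n * (1 - 2 * x) * w ^ (n - 1))) / (w ^ n * w ^ n)) * exp (- 1 / w)
         + exp (- 1 / w) * ((1 - 2 * x) / w\<^sup>2) * (poly p x / w ^ n)) (at x)"
    proof -
      define W where "W x = x * (1 - x)" for x :: real
      have Wx: "W x = w" by (simp add: W_def w_def)
      have dW: "(W has_real_derivative (1 - 2 * x)) (at x)"
        unfolding W_def[abs_def] by (auto intro!: derivative_eq_intros)
      have dI: "((\<lambda>x. - 1 / W x) has_real_derivative (1 - 2 * x) / w\<^sup>2) (at x)"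
        using DERIV_divide[OF DERIV_const[of "- 1"] dW] w by (simp add: Wx power2_eq_square)
      have dp: "((\<lambda>x. W x ^ n) has_real_derivative real n * (1 - 2 * x) * w ^ (n - 1)) (at x)"
        using DERIV_power[OF dW, of n] by (simp add: Wx mult.assoc)
      have dq: "((\<lambda>x. poly p x / W x ^ n) has_real_derivative
          (poly (pderiv p) x * w ^ n - poly p x * (real n * (1 - 2 * x) * w ^ (n - 1))) / (w ^ n * w ^ n)) (at x)"
        using DERIV_divide[OF poly_DERIV[of p x] dp] w by (simp add: Wx)
      show ?thesis
        using DERIV_mult[OF dq DERIV_chain2[OF DERIV_exp dI]] unfolding Wx by (simp add: W_def)
    qed
    also have "((poly (pderiv p) x * w ^ n - poly p x * (real n * (1 - 2 * x) * w ^ (n - 1))) / (w ^ n * w ^ n)) * exp (- 1 / w)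
         + exp (- 1 / w) * ((1 - 2 * x) / w\<^sup>2) * (poly p x / w ^ n) = bump (bump_poly n p) (n + 2) x"
    proof -
      have pl: "poly [:0, 1, -1:] x = w" by (simp add: w_def algebra_simps)
      have "poly (bump_poly n p) x = poly (pderiv p) x * w\<^sup>2 - real n * (poly p x * (1 - 2 * x) * w) + poly p x * (1 - 2 * x)"
        unfolding bump_poly_def poly_add poly_diff poly_mult poly_power poly_smult pl by (simp add: mult.commute[of x])
      then have "bump (bump_poly n p) (n + 2) x = (poly (pderiv p) x * w\<^sup>2 - real n * (poly p x * (1 - 2 * x) * w) + poly p x * (1 - 2 * x)) / w ^ (n + 2) * exp (- 1 / w)"
        using 1 by (simp only: bump_def w_def if_True simp_thms)
      moreover have "(poly (pderiv p) x * w ^ n - poly p x * (real n * (1 - 2 * x) * w ^ (n - 1))) / (w ^ n * w ^ n)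
        = (poly (pderiv p) x * w\<^sup>2 - real n * (poly p x * (1 - 2 * x) * w)) / w ^ (n + 2)"
        using w by (cases n) (simp_all add: field_simps power2_eq_square power_add)
      moreover have "(1 - 2 * x) / w\<^sup>2 * (poly p x / w ^ n) = poly p x * (1 - 2 * x) / w ^ (n + 2)"
        using w by (simp add: power_add power2_eq_square field_simps)
      ultimately have
        "(poly (pderiv p) x * w ^ n - poly p x * (real n * (1 - 2 * x) * w ^ (n - 1))) / (w ^ n * w ^ n) * exp (- 1 / w)
         + ((1 - 2 * x) / w\<^sup>2 * (poly p x / w ^ n)) * exp (- 1 / w) = bump (bump_poly n p) (n + 2) x"
        by (simp only: add_divide_distrib distrib_right)
      then show ?thesis by (simp only: mult.assoc mult.commute mult.left_commute)
    qed
    finally show ?thesis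
    proof (rule has_field_derivative_transform_within_open)
      show "open {0<..<1::real}" by simp
    qed (use 1 in \<open>auto simp: bump_def\<close>)
  next
    case 2
    have "((\<lambda>x. 0) has_real_derivative 0) (at x)" by simp
    then have "(bump p n has_real_derivative 0) (at x)"
    proof (rule has_field_derivative_transform_within_open)
      show "open ({..<0} \<union> {1<..} :: real set)" by auto
    qed (use 2 in \<open>auto simp: bump_def\<close>)
    then show ?thesis using 2 by (auto simp: bump_def)
  next
    case 3
    \<comment> \<open>At the two end points neither formula holds on a neighbourhood; there the
      quadratic bound makes the difference quotient of order |h|.\<close>
    obtain C where C: "\<And>y. \<bar>bump p n y\<bar> \<le> C * (y * (1 - y))\<^sup>2" using bump_quadratic_bound by blast
    have z: "bump p n x = 0" "bump (bump_poly n p) (n + 2) x = 0" using 3 by (auto simp: bump_def)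
    have "((\<lambda>h. bump p n (x + h) / h) \<longlongrightarrow> 0) (at 0)"
    proof (rule Lim_null_comparison)
      show "\<forall>\<^sub>F h in at 0. norm (bump p n (x + h) / h) \<le> \<bar>C\<bar> * (\<bar>h\<bar> * (1 + \<bar>h\<bar>)\<^sup>2)"
      proof (rule eventually_at_filter[THEN iffD2], rule always_eventually, intro allI impI)
        fix h :: real assume h: "h \<noteq> 0"
        have "\<bar>(x + h) * (1 - (x + h))\<bar> \<le> \<bar>h\<bar> * (1 + \<bar>h\<bar>)"
        proof -
          have "\<bar>h\<bar> * \<bar>1 - h\<bar> \<le> \<bar>h\<bar> * (1 + \<bar>h\<bar>)" "\<bar>h\<bar> * \<bar>1 + h\<bar> \<le> \<bar>h\<bar> * (1 + \<bar>h\<bar>)"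
            by (auto intro!: mult_left_mono)
          then show ?thesis using 3 by (auto simp: abs_mult mult.commute)
        qed
        then have "((x + h) * (1 - (x + h)))\<^sup>2 \<le> (\<bar>h\<bar> * (1 + \<bar>h\<bar>))\<^sup>2"
          by (metis abs_ge_zero power2_abs power_mono)
        then have "\<bar>C\<bar> * ((x + h) * (1 - (x + h)))\<^sup>2 \<le> \<bar>C\<bar> * (\<bar>h\<bar> * (1 + \<bar>h\<bar>))\<^sup>2"
          by (rule mult_left_mono) simp
        moreover have "C * ((x + h) * (1 - (x + h)))\<^sup>2 \<le> \<bar>C\<bar> * ((x + h) * (1 - (x + h)))\<^sup>2"
          by (intro mult_right_mono) auto
        ultimately have "\<bar>bump p n (x + h)\<bar> \<le> \<bar>C\<bar> * (\<bar>h\<bar> * (1 + \<bar>h\<bar>))\<^sup>2"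
          using C[of "x + h"] by linarith
        also have "\<dots> = \<bar>C\<bar> * (\<bar>h\<bar> * (1 + \<bar>h\<bar>)\<^sup>2) * \<bar>h\<bar>"
          by (simp add: power2_eq_square)
        finally show "norm (bump p n (x + h) / h) \<le> \<bar>C\<bar> * (\<bar>h\<bar> * (1 + \<bar>h\<bar>)\<^sup>2)"
          using h by (simp add: pos_divide_le_eq)
      qed
      have "((\<lambda>h::real. \<bar>C\<bar> * (\<bar>h\<bar> * (1 + \<bar>h\<bar>)\<^sup>2)) \<longlongrightarrow> \<bar>C\<bar> * (\<bar>0\<bar> * (1 + \<bar>0\<bar>)\<^sup>2)) (at 0)"
        by (intro tendsto_intros)
      then show "((\<lambda>h::real. \<bar>C\<bar> * (\<bar>h\<bar> * (1 + \<bar>h\<bar>)\<^sup>2)) \<longlongrightarrow> 0) (at 0)" by simp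
    qed
    then show ?thesis unfolding DERIV_def z by simp
  qed
qed

lemma bump_continuous: "continuous_on UNIV (bump p n)"
  by (rule DERIV_continuous_on) (rule has_field_derivative_at_within[OF bump_has_derivative])

section \<open>Smooth steps and the lemma of du Bois-Reymond\<close>

lemma bump_antiderivative:
  obtains E c where "\<And>x. (E has_real_derivative bump 1 0 x) (at x)" "\<And>x. x \<le> 0 \<Longrightarrow> E x = 0" "\<And>x. x \<ge> 1 \<Longrightarrow> E x = c" "c > 0"
proof -
  have "\<exists>F. \<forall>x. - \<infinity> < ereal x \<longrightarrow> ereal x < \<infinity> \<longrightarrow> (F has_vector_derivative bump 1 0 x) (at x)"
    by (rule einterval_antiderivative) (auto intro: DERIV_isCont[OF bump_has_derivative])
  then obtain F where "\<And>x. (F has_vector_derivative bump 1 0 x) (at x)" by auto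
  then have F: "(F has_real_derivative bump 1 0 x) (at x)" for x
    by (simp add: has_real_derivative_iff_has_vector_derivative)
  define E where "E x = F x - F 0" for x
  have E: "(E has_real_derivative bump 1 0 x) (at x)" for x
    unfolding E_def[abs_def] using DERIV_diff[OF F DERIV_const] by simp
  have z: "bump 1 0 x = 0" if "x \<le> 0 \<or> x \<ge> 1" for x :: real using that by (auto simp: bump_def)
  have "\<exists>c. \<forall>x\<in>{..0}. E x = c"
  proof (rule has_field_derivative_zero_constant)
    fix x :: real assume "x \<in> {..0}"
    then show "(E has_real_derivative 0) (at x within {..0})" using E[of x] z[of x] by (auto intro: has_field_derivative_at_within)
  qed simp
  then obtain d where "\<forall>x\<in>{..0}. E x = d" by blast
  then have e: "E x = E 0" if "x \<le> 0" for x using that by simp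
  have E0: "E x = 0" if "x \<le> 0" for x using e[OF that] by (simp add: E_def)
  have "\<exists>c. \<forall>x\<in>{1..}. E x = c"
  proof (rule has_field_derivative_zero_constant)
    fix x :: real assume "x \<in> {1..}"
    then show "(E has_real_derivative 0) (at x within {1..})" using E[of x] z[of x] by (auto intro: has_field_derivative_at_within)
  qed simp
  then obtain d where "\<forall>x\<in>{1..}. E x = d" by blast
  then have E1: "E x = E 1" if "x \<ge> 1" for x using that by simp
  \<comment> \<open>The height of the step is positive, because the mean value theorem gives it as a
    value of the bump inside the interval.\<close>
  have "\<exists>\<xi>>0. \<xi> < 1 \<and> E 1 - E 0 = (1 - 0) * bump 1 0 \<xi>"
    by (rule MVT2) (auto intro: E)
  then have "E 1 > 0" using E0[of 0] by (auto simp: bump_def)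
  then show ?thesis using that[of E "E 1"] E E0 E1 by blast
qed

text \<open>A step up at a and a step down at b. The result has compact support although a single
  step has not, and its derivative is the difference of two equal bumps, which compares averages
  near a and near b.\<close>

lemma step_test_function:
  fixes E :: "real \<Rightarrow> real"
  assumes E: "\<And>x. (E has_real_derivative bump 1 0 x) (at x)" "\<And>x. x \<le> 0 \<Longrightarrow> E x = 0" "\<And>x. x \<ge> 1 \<Longrightarrow> E x = c"
    and e: "e > 0" and ab: "0 < a" "a \<le> b" "b + e < T"
  defines "\<psi> \<equiv> (\<lambda>x. E ((x - a) / e) - E ((x - b) / e))"
  shows "\<psi> \<in> test_functions T" "deriv \<psi> = (\<lambda>x. bump 1 0 ((x - a) / e) / e - bump 1 0 ((x - b) / e) / e)"
proof -
  have lin: "((\<lambda>x. (x - a) / e) has_real_derivative 1 / e) (at x)" for x a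
    using e by (auto intro!: derivative_eq_intros)
  have d0: "(\<psi> has_real_derivative bump 1 0 ((x - a) / e) / e - bump 1 0 ((x - b) / e) / e) (at x)" for x
    unfolding \<psi>_def using DERIV_diff[OF DERIV_chain2[OF E(1) lin[of a x]] DERIV_chain2[OF E(1) lin[of b x]]] by simp
  then show d: "deriv \<psi> = (\<lambda>x. bump 1 0 ((x - a) / e) / e - bump 1 0 ((x - b) / e) / e)"
    by (intro ext DERIV_imp_deriv)
  have d1: "((\<lambda>x. k * (bump p n ((x - a) / e) - bump p n ((x - b) / e))) has_real_derivative
      k / e * (bump (bump_poly n p) (n + 2) ((x - a) / e) - bump (bump_poly n p) (n + 2) ((x - b) / e))) (at x)" for k p n x
    using DERIV_cmult[OF DERIV_diff[OF DERIV_chain2[OF bump_has_derivative lin[of a x]] DERIV_chain2[OF bump_has_derivative lin[of b x]]], of k]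
    by (simp add: algebra_simps diff_divide_distrib)
  have it: "\<exists>k p m. (deriv ^^ Suc n) \<psi> = (\<lambda>x. k * (bump p m ((x - a) / e) - bump p m ((x - b) / e)))" for n
  proof (induction n)
    case 0
    have "(deriv ^^ Suc 0) \<psi> = (\<lambda>x. 1 / e * (bump 1 0 ((x - a) / e) - bump 1 0 ((x - b) / e)))"
      by (simp add: d diff_divide_distrib)
    then show ?case by blast
  next
    case (Suc n)
    then obtain k p m where "(deriv ^^ Suc n) \<psi> = (\<lambda>x. k * (bump p m ((x - a) / e) - bump p m ((x - b) / e)))" by blast
    then have "(deriv ^^ Suc (Suc n)) \<psi> = deriv (\<lambda>x. k * (bump p m ((x - a) / e) - bump p m ((x - b) / e)))" by simp
    also have "\<dots> = (\<lambda>x. k / e * (bump (bump_poly m p) (m + 2) ((x - a) / e) - bump (bump_poly m p) (m + 2) ((x - b) / e)))"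
      by (intro ext DERIV_imp_deriv d1)
    finally show ?case by blast
  qed
  have diff: "((deriv ^^ n) \<psi>) differentiable (at x)" for n x
  proof (cases n)
    case 0
    then show ?thesis using d0[of x] by (auto simp: real_differentiable_def)
  next
    case (Suc m)
    then obtain k p j where "(deriv ^^ n) \<psi> = (\<lambda>x. k * (bump p j ((x - a) / e) - bump p j ((x - b) / e)))" using it[of m] by blast
    then show ?thesis using d1[of k p j x] by (auto simp: real_differentiable_def)
  qed
  have "{x. \<psi> x \<noteq> 0} \<subseteq> {a..b + e}"
  proof
    fix x assume "x \<in> {x. \<psi> x \<noteq> 0}"
    then have nz: "\<psi> x \<noteq> 0" by simp
    have "x \<ge> a"
    proof (rule ccontr)
      assume "\<not> x \<ge> a"
      then have "(x - a) / e \<le> 0" "(x - b) / e \<le> 0" using ab e by (auto simp: divide_le_0_iff)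
      then show False using nz E(2) by (simp add: \<psi>_def)
    qed
    moreover have "x \<le> b + e"
    proof (rule ccontr)
      assume "\<not> x \<le> b + e"
      then have "(x - a) / e \<ge> 1" "(x - b) / e \<ge> 1" using ab e by (auto simp: le_divide_eq)
      then show False using nz E(3) by (simp add: \<psi>_def)
    qed
    ultimately show "x \<in> {a..b + e}" by simp
  qed
  then have "closure {x. \<psi> x \<noteq> 0} \<subseteq> {a..b + e}" by (intro closure_minimal) auto
  also have "\<dots> \<subseteq> {0<..<T}" using ab by auto
  finally show "\<psi> \<in> test_functions T" using diff by (simp add: test_functions_def)
qed

text \<open>Testing with a difference of steps shows that the averages of g against equal bumps at a
  and at b coincide. By continuity these averages approach g a and g b up to the common factor c, so
  g is constant on the open interval and hence on its closure.\<close>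

lemma du_Bois_Reymond:
  fixes g :: "real \<Rightarrow> real"
  assumes T: "T > 0" and g: "continuous_on {0..T} g"
    and test: "\<And>\<psi>. \<psi> \<in> test_functions T \<Longrightarrow> prim (\<lambda>r. deriv \<psi> r *\<^sub>R g r) T = 0"
    and t: "t \<in> {0..T}"
  shows "g t = g 0"
proof -
  obtain E c where E: "\<And>x. (E has_real_derivative bump 1 0 x) (at x)" "\<And>x. x \<le> 0 \<Longrightarrow> E x = 0" "\<And>x. x \<ge> 1 \<Longrightarrow> E x = c" "c > 0"
    using bump_antiderivative by blast
  define \<eta> where "\<eta> e a x = bump 1 0 ((x - a) / e) / e" for e a x :: real
  have \<eta>0: "\<eta> e a x \<ge> 0" if "e > 0" for e a x using that by (simp add: \<eta>_def bump_def)
  have \<eta>z: "\<eta> e a x = 0" if "e > 0" "x \<notin> {a..a + e}" for e a x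
  proof -
    have "\<not> (0 < (x - a) / e \<and> (x - a) / e < 1)" using that by (auto simp: zero_less_divide_iff divide_less_eq)
    then show ?thesis by (auto simp: \<eta>_def bump_def)
  qed
  have \<eta>c: "continuous_on A (\<eta> e a)" if "e > 0" for A e a
    unfolding \<eta>_def[abs_def] using that
    by (intro continuous_intros continuous_on_compose2[OF bump_continuous]) auto
  have \<eta>i: "prim (\<eta> e a) T = c" if e: "e > 0" "0 < a" "a + e < T" for e a
  proof -
    have "((\<lambda>x. E ((x - a) / e)) has_vector_derivative \<eta> e a x) (at x)" for x
    proof -
      have "((\<lambda>x. (x - a) / e) has_real_derivative 1 / e) (at x)" using e(1) by (auto intro!: derivative_eq_intros)
      from DERIV_chain2[OF E(1) this] show ?thesis
        by (simp add: \<eta>_def has_real_derivative_iff_has_vector_derivative)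
    qed
    from prim_deriv(1)[OF this \<eta>c[OF e(1)], of T] T have "E ((T - a) / e) = E ((0 - a) / e) + prim (\<eta> e a) T"
      by simp
    moreover have "(T - a) / e \<ge> 1" "(0 - a) / e \<le> 0" using e by (auto simp: le_divide_eq divide_le_0_iff)
    ultimately show ?thesis using E by simp
  qed
  have approx: "\<bar>prim (\<lambda>r. \<eta> e a r * g r) T - g a * c\<bar> \<le> d * c"
    if e: "e > 0" "0 < a" "a + e < T" and d: "\<And>x. x \<in> {a..a + e} \<Longrightarrow> \<bar>g x - g a\<bar> \<le> d" for e a d
  proof -
    have i1: "set_integrable lborel {0..T} (\<lambda>r. \<eta> e a r * g r)" "set_integrable lborel {0..T} (\<lambda>r. \<eta> e a r * g a)"
      by (intro set_integrable_continuous continuous_intros g \<eta>c e)+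
    have i2: "set_integrable lborel {0..T} (\<lambda>r. \<eta> e a r * \<bar>d\<bar>)"
      by (intro set_integrable_continuous continuous_intros g \<eta>c e)+
    have "g a * c = prim (\<lambda>r. \<eta> e a r * g a) T"
      unfolding \<eta>i[OF e, symmetric] prim_def by simp
    then have "prim (\<lambda>r. \<eta> e a r * g r) T - g a * c = prim (\<lambda>r. \<eta> e a r * g r - \<eta> e a r * g a) T"
      using prim_diff[OF i1] by simp
    also have "\<bar>\<dots>\<bar> \<le> prim (\<lambda>r. \<eta> e a r * \<bar>d\<bar>) T"
      unfolding prim_def set_lebesgue_integral_def
    proof (rule integral_abs_bound_integral)
      show "integrable lborel (\<lambda>r. indicat_real {0..T} r *\<^sub>R (\<eta> e a r * g r - \<eta> e a r * g a))"
        using set_integral_diff(1)[OF i1] by (simp add: set_integrable_def)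
      show "integrable lborel (\<lambda>r. indicat_real {0..T} r *\<^sub>R (\<eta> e a r * \<bar>d\<bar>))"
        using i2 by (simp add: set_integrable_def)
      fix r
      have "\<bar>\<eta> e a r * g r - \<eta> e a r * g a\<bar> = \<eta> e a r * \<bar>g r - g a\<bar>"
        using \<eta>0[OF e(1), of a r] by (simp add: abs_mult flip: right_diff_distrib)
      also have "\<dots> \<le> \<eta> e a r * \<bar>d\<bar>"
      proof (cases "r \<in> {a..a + e}")
        case True
        then show ?thesis using d[OF True] \<eta>0[OF e(1), of a r] by (intro mult_left_mono) auto
      qed (simp add: \<eta>z[OF e(1)])
      finally show "\<bar>indicat_real {0..T} r *\<^sub>R (\<eta> e a r * g r - \<eta> e a r * g a)\<bar> \<le> indicat_real {0..T} r *\<^sub>R (\<eta> e a r * \<bar>d\<bar>)"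
        by (simp add: indicator_def)
    qed
    also have "\<dots> = c * \<bar>d\<bar>" unfolding \<eta>i[OF e, symmetric] prim_def by simp
    also have "\<bar>d\<bar> = d" using d[of a] e by simp
    finally show ?thesis by (simp add: mult.commute)
  qed
  have eq: "g a = g b" if ab: "0 < a" "a \<le> b" "b < T" for a b
  proof (rule ccontr)
    assume ne: "g a \<noteq> g b"
    \<comment> \<open>A quarter of the gap: the two approximation errors together are at most half
      of it, which contradicts the equality of the averages.\<close>
    define d where "d = \<bar>g a - g b\<bar> / 4"
    have d: "d > 0" using ne by (simp add: d_def)
    have near: "\<exists>s>0. \<forall>x. \<bar>x - y\<bar> < s \<longrightarrow> x \<in> {0..T} \<longrightarrow> \<bar>g x - g y\<bar> \<le> d" if "y \<in> {0..T}" for y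
      using g d that unfolding continuous_on_iff dist_real_def by (meson less_imp_le)
    obtain s1 where s1: "s1 > 0" "\<And>x. \<bar>x - a\<bar> < s1 \<Longrightarrow> x \<in> {0..T} \<Longrightarrow> \<bar>g x - g a\<bar> \<le> d" using near[of a] ab by auto
    obtain s2 where s2: "s2 > 0" "\<And>x. \<bar>x - b\<bar> < s2 \<Longrightarrow> x \<in> {0..T} \<Longrightarrow> \<bar>g x - g b\<bar> \<le> d" using near[of b] ab by auto
    \<comment> \<open>The half makes all inequalities strict: e is smaller than both moduli of
      continuity, and the bump at b ends before T.\<close>
    define e where "e = min (min s1 s2) (T - b) / 2"
    have "e > 0" "2 * e \<le> s1" "2 * e \<le> s2" "2 * e \<le> T - b" using s1(1) s2(1) ab by (auto simp: e_def)
    then have e: "e > 0" "e < s1" "e < s2" "b + e < T" "a + e < T" using ab by linarith+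
    have A: "\<bar>prim (\<lambda>r. \<eta> e a r * g r) T - g a * c\<bar> \<le> d * c"
      using e ab s1(2) by (intro approx) auto
    have B: "\<bar>prim (\<lambda>r. \<eta> e b r * g r) T - g b * c\<bar> \<le> d * c"
      using e ab s2(2) by (intro approx) auto
    note ts = step_test_function[OF E(1-3) e(1) ab(1,2) e(4)]
    have i1: "set_integrable lborel {0..T} (\<lambda>r. \<eta> e a r * g r)" "set_integrable lborel {0..T} (\<lambda>r. \<eta> e b r * g r)"
      by (intro set_integrable_continuous continuous_intros g \<eta>c e)+
    have "prim (\<lambda>r. \<eta> e a r * g r - \<eta> e b r * g r) T = 0"
    proof -
      have "deriv (\<lambda>x. E ((x - a) / e) - E ((x - b) / e)) r = \<eta> e a r - \<eta> e b r" for r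
        using fun_cong[OF ts(2), of r] by (simp only: \<eta>_def)
      then show ?thesis using test[OF ts(1)] by (simp only: real_scaleR_def left_diff_distrib)
    qed
    then have "prim (\<lambda>r. \<eta> e a r * g r) T = prim (\<lambda>r. \<eta> e b r * g r) T" using prim_diff[OF i1] by simp
    then have "\<bar>g a * c - g b * c\<bar> \<le> 2 * (d * c)" using A B by linarith
    moreover have "\<bar>g a * c - g b * c\<bar> = 4 * (d * c)" using E(4) by (simp add: d_def abs_mult flip: left_diff_distrib)
    ultimately show False using d E(4) mult_pos_pos[OF d E(4)] by linarith
  qed
  have eq': "g x = g (T / 2)" if "x \<in> {0<..<T}" for x
    using eq[of x "T / 2"] eq[of "T / 2" x] that T by (cases "x \<le> T / 2") auto
  have "g x = g (T / 2)" if "x \<in> {0..T}" for x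
  proof -
    have cl: "closure {0<..<T} = {0..T}" using T by simp
    show ?thesis
      using continuous_constant_on_closure[of "{0<..<T}" g "g (T / 2)" x] g eq' that unfolding cl by blast
  qed
  from this[OF t] this[of 0] T show ?thesis by simp
qed


section \<open>The delay equation\<close>

lemma AE_shift:
  fixes m :: real
  assumes "AE x in lborel. P x"
  shows "AE r in lborel. P (r - m)"
proof -
  obtain N where N: "N \<in> null_sets lborel" "{x \<in> space lborel. \<not> P x} \<subseteq> N"
    using assms unfolding eventually_ae_filter by blast
  have "AE x in lborel. (- m + 1 * x) \<notin> N"
    by (rule AE_borel_affine[where P = "\<lambda>x. x \<notin> N"]) (use N in \<open>auto intro: AE_not_in\<close>)
  then show ?thesis by eventually_elim (use N(2) in auto)
qed

section \<open>Dependence on the past of the drift\<close>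

lemma hsol_mono:
  assumes "hsol L \<nu> T c0 F u" "t1 \<le> T"
  shows "hsol L \<nu> t1 c0 F u"
  unfolding hsol_def
proof (intro allI conjI)
  fix k
  have a: "set_integrable lborel {0..T} (\<lambda>r. F r k)" "set_integrable lborel {0..T} (\<lambda>r. F r k - (\<nu> * wt L 2 k) *\<^sub>R u r k)"
    "\<forall>t\<in>{0..T}. u t k = c0 k + prim (\<lambda>r. F r k - (\<nu> * wt L 2 k) *\<^sub>R u r k) t"
    using assms(1) unfolding hsol_def by blast+
  show "set_integrable lborel {0..t1} (\<lambda>r. F r k)" by (rule set_integrable_Icc_mono[OF a(1) assms(2)])
  show "set_integrable lborel {0..t1} (\<lambda>r. F r k - (\<nu> * wt L 2 k) *\<^sub>R u r k)" by (rule set_integrable_Icc_mono[OF a(2) assms(2)])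
  show "\<forall>t\<in>{0..t1}. u t k = c0 k + prim (\<lambda>r. F r k - (\<nu> * wt L 2 k) *\<^sub>R u r k) t" using a(3) assms(2) by auto
qed

lemma hsol_initial: "hsol L \<nu> T c0 F u \<Longrightarrow> T \<ge> 0 \<Longrightarrow> u 0 = c0"
  by (rule ext) (simp add: hsol_def)

lemma set_nn_integral_mono_set:
  "A \<subseteq> B \<Longrightarrow> (\<integral>\<^sup>+r\<in>A. g r \<partial>M) \<le> (\<integral>\<^sup>+r\<in>B. g r \<partial>M)"
  by (intro nn_integral_mono) (auto simp: indicator_def)

text \<open>A solution up to time t1 depends on the drift up to t1 only. Both solutions are
  restricted to [0, t1], where the two drifts may be identified, and
  \<open>linear_uniqueness\<close> applies. This is the induction step both for the construction and
  for the uniqueness of the delayed solution.\<close>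

lemma causal_uniqueness:
  assumes L: "L > 0" and nu: "\<nu> > 0" and alpha: "\<alpha> > 1/2" and t1: "0 \<le> t1" "t1 \<le> T"
    and v1: "cmodes v1" "\<And>r. solen L (v1 r)" "(\<integral>\<^sup>+r\<in>{0..T}. Esq L (1 + \<alpha>) (v1 r) \<partial>lborel) < \<infinity>"
    and v2: "cmodes v2" and eq: "AE r in lborel. r \<in> {0..t1} \<longrightarrow> v1 r = v2 r"
    and u: "cmodes u" "\<And>r. solen L (u r)" "(\<integral>\<^sup>+r\<in>{0..T}. Esq L (1 + \<alpha>) (u r) \<partial>lborel) < \<infinity>"
      "hsol L \<nu> T c0 (NF L T f v1 u) u"
    and w: "cmodes w" "\<And>r. solen L (w r)" "(\<integral>\<^sup>+r\<in>{0..T}. Esq L (1 + \<alpha>) (w r) \<partial>lborel) < \<infinity>"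
      "hsol L \<nu> T c0 (NF L T f v2 w) w"
    and t: "t \<in> {0..t1}"
  shows "u t = w t"
proof -
  have sub: "{0..t1} \<subseteq> {0..T}" using t1 by auto
  have fin: "(\<integral>\<^sup>+r\<in>{0..t1}. Esq L (1 + \<alpha>) (x r) \<partial>lborel) < \<infinity>"
    if "(\<integral>\<^sup>+r\<in>{0..T}. Esq L (1 + \<alpha>) (x r) \<partial>lborel) < \<infinity>" for x
    by (rule le_less_trans[OF set_nn_integral_mono_set[OF sub] that])
  interpret drift L \<nu> \<alpha> t1 v1
    by unfold_locales (use L nu alpha t1 v1 fin in auto)
  have hu: "hsol L \<nu> t1 c0 (NF L t1 f v1 u) u"
    by (rule hsol_cong_AE[OF hsol_mono[OF u(4) t1(2)] cmodes_NF[OF v1(1) u(1)] cmodes_NF[OF v1(1) u(1)] u(1) _ refl u(1)])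
      (use t1 in \<open>auto simp: NF_def\<close>)
  have ae: "AE r in lborel. r \<in> {0..t1} \<longrightarrow> NF L T f v2 w r = NF L t1 f v1 w r"
    using eq by eventually_elim (use t1 in \<open>auto simp: NF_def\<close>)
  have hw: "hsol L \<nu> t1 c0 (NF L t1 f v1 w) w"
    by (rule hsol_cong_AE[OF hsol_mono[OF w(4) t1(2)] cmodes_NF[OF v2 w(1)] cmodes_NF[OF v1(1) w(1)] w(1) ae refl w(1)])
  show ?thesis
    by (rule linear_uniqueness[OF u(1,2) hu fin[OF u(3)] w(1,2) hw fin[OF w(3)] t])
qed

text \<open>\<open>\<Phi>\<close> is a representative of the history with Borel modes; it need not
  equal the given function everywhere, but almost everywhere is all that the equation sees.\<close>

locale delay =
  fixes L \<nu> \<alpha> \<mu> T :: real and \<Phi> :: "real \<Rightarrow> coeffs" and u0 f :: coeffs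
  assumes L: "L > 0" and nu: "\<nu> > 0" and alpha: "\<alpha> > 1/2" and mu: "\<mu> > 0" and T: "T > 0"
    and Phi: "cmodes \<Phi>" "\<And>t. solen L (\<Phi> t)" "(\<integral>\<^sup>+r\<in>{- \<mu>..0}. Esq L (1 + \<alpha>) (\<Phi> r) \<partial>lborel) < \<infinity>"
    and u0: "u0 \<in> Vspace L \<alpha>" and f: "f \<in> Vspace L (\<alpha> - 1)"
begin

lemma cmodes_shift: "cmodes w \<Longrightarrow> cmodes (\<lambda>r. w (r - \<mu>))"
  unfolding cmodes_def
proof
  fix k assume "\<forall>k. (\<lambda>t. w t k) \<in> borel_measurable borel"
  then have [measurable]: "(\<lambda>t. w t k) \<in> borel_measurable borel" by blast
  have "(\<lambda>t. t - \<mu>) \<in> borel_measurable borel" by measurable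
  then show "(\<lambda>t. w (t - \<mu>) k) \<in> borel_measurable borel"
    by (rule measurable_compose) measurable
qed

lemma shift_fin:
  assumes w: "cmodes w" and fin: "(\<integral>\<^sup>+t\<in>{- \<mu>..T}. Esq L (1 + \<alpha>) (w t) \<partial>lborel) < \<infinity>"
  shows "(\<integral>\<^sup>+r\<in>{0..T}. Esq L (1 + \<alpha>) (w (r - \<mu>)) \<partial>lborel) < \<infinity>"
proof -
  have [measurable]: "(\<lambda>t. Esq L (1 + \<alpha>) (w t)) \<in> borel_measurable borel" by (rule cmodes_Esq[OF w])
  have "(\<integral>\<^sup>+t\<in>{- \<mu>..T}. Esq L (1 + \<alpha>) (w t) \<partial>lborel)
      = ennreal \<bar>1\<bar> * (\<integral>\<^sup>+r. Esq L (1 + \<alpha>) (w (- \<mu> + 1 * r)) * indicator {- \<mu>..T} (- \<mu> + 1 * r) \<partial>lborel)"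
    by (rule nn_integral_real_affine) auto
  then have "(\<integral>\<^sup>+r. Esq L (1 + \<alpha>) (w (r - \<mu>)) * indicator {- \<mu>..T} (r - \<mu>) \<partial>lborel) < \<infinity>"
    using fin by simp
  moreover have "(\<integral>\<^sup>+r\<in>{0..T}. Esq L (1 + \<alpha>) (w (r - \<mu>)) \<partial>lborel)
      \<le> (\<integral>\<^sup>+r. Esq L (1 + \<alpha>) (w (r - \<mu>)) * indicator {- \<mu>..T} (r - \<mu>) \<partial>lborel)"
    using mu by (intro nn_integral_mono) (auto simp: indicator_def)
  ultimately show ?thesis by (rule le_less_trans[rotated])
qed

text \<open>The history is prescribed on a half-open interval, so at time 0 the value is the one of
  z. Outside the time interval of the problem the zero field keeps the constraints.\<close>

definition hist :: "(real \<Rightarrow> coeffs) \<Rightarrow> real \<Rightarrow> coeffs" where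
  "hist z t = (if t \<in> {- \<mu>..<0} then \<Phi> t else if t \<in> {0..T} then z t else (\<lambda>k. 0))"

lemma cmodes_hist: "cmodes z \<Longrightarrow> cmodes (hist z)"
  unfolding cmodes_def
proof
  fix k assume "\<forall>k. (\<lambda>t. z t k) \<in> borel_measurable borel"
  then have [measurable]: "(\<lambda>t. z t k) \<in> borel_measurable borel" "(\<lambda>t. \<Phi> t k) \<in> borel_measurable borel"
    using Phi(1) by (auto simp: cmodes_def)
  have "(\<lambda>t. if t \<in> {- \<mu>..<0} then \<Phi> t k else if t \<in> {0..T} then z t k else 0) \<in> borel_measurable borel"
    by measurable
  moreover have "(\<lambda>t. if t \<in> {- \<mu>..<0} then \<Phi> t k else if t \<in> {0..T} then z t k else 0) = (\<lambda>t. hist z t k)"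
    by (auto simp: hist_def)
  ultimately show "(\<lambda>t. hist z t k) \<in> borel_measurable borel" by (simp only:)
qed

lemma solen_hist: "(\<And>t. solen L (z t)) \<Longrightarrow> solen L (hist z t)"
  using Phi(2) by (simp add: hist_def)

lemma hist_fin:
  assumes z: "cmodes z" and fin: "(\<integral>\<^sup>+t\<in>{0..T}. Esq L (1 + \<alpha>) (z t) \<partial>lborel) < \<infinity>"
  shows "(\<integral>\<^sup>+t\<in>{- \<mu>..T}. Esq L (1 + \<alpha>) (hist z t) \<partial>lborel) < \<infinity>"
proof -
  have [measurable]: "(\<lambda>t. Esq L (1 + \<alpha>) (z t)) \<in> borel_measurable borel" "(\<lambda>t. Esq L (1 + \<alpha>) (\<Phi> t)) \<in> borel_measurable borel"
    using z Phi(1) by (auto intro: cmodes_Esq)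
  have "(\<integral>\<^sup>+t\<in>{- \<mu>..T}. Esq L (1 + \<alpha>) (hist z t) \<partial>lborel)
      \<le> (\<integral>\<^sup>+t. Esq L (1 + \<alpha>) (\<Phi> t) * indicator {- \<mu>..0} t + Esq L (1 + \<alpha>) (z t) * indicator {0..T} t \<partial>lborel)"
    by (intro nn_integral_mono) (auto simp: indicator_def hist_def)
  also have "\<dots> = (\<integral>\<^sup>+t\<in>{- \<mu>..0}. Esq L (1 + \<alpha>) (\<Phi> t) \<partial>lborel) + (\<integral>\<^sup>+t\<in>{0..T}. Esq L (1 + \<alpha>) (z t) \<partial>lborel)"
    by (rule nn_integral_add) auto
  also have "\<dots> < \<infinity>" using Phi(3) fin by simp
  finally show ?thesis .
qed

definition step_sol :: "(real \<Rightarrow> coeffs) \<Rightarrow> (real \<Rightarrow> coeffs) \<Rightarrow> bool" where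
  "step_sol v z \<longleftrightarrow> cmodes z \<and> (\<forall>t. solen L (z t)) \<and> (\<integral>\<^sup>+t\<in>{0..T}. Esq L (1 + \<alpha>) (z t) \<partial>lborel) < \<infinity> \<and>
     hsol L \<nu> T u0 (NF L T f v z) z \<and> (\<integral>\<^sup>+r\<in>{0..T}. Esq L (\<alpha> - 1) (NF L T f v z r) \<partial>lborel) < \<infinity>"

definition hist_ok :: "(real \<Rightarrow> coeffs) \<Rightarrow> bool" where
  "hist_ok z \<longleftrightarrow> cmodes z \<and> (\<forall>t. solen L (z t)) \<and> (\<integral>\<^sup>+t\<in>{0..T}. Esq L (1 + \<alpha>) (z t) \<partial>lborel) < \<infinity>"

definition lag :: "(real \<Rightarrow> coeffs) \<Rightarrow> real \<Rightarrow> coeffs" where "lag z r = hist z (r - \<mu>)"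

lemma lag_ok:
  assumes "hist_ok z"
  shows "cmodes (lag z)" "solen L (lag z r)" "(\<integral>\<^sup>+r\<in>{0..T}. Esq L (1 + \<alpha>) (lag z r) \<partial>lborel) < \<infinity>"
  using assms cmodes_shift[OF cmodes_hist[of z]] solen_hist[of z] shift_fin[OF cmodes_hist hist_fin, of z]
  by (auto simp: hist_ok_def lag_def[abs_def])

lemma step_exists:
  assumes "hist_ok z"
  shows "\<exists>y. step_sol (lag z) y"
proof -
  interpret drift L \<nu> \<alpha> T "lag z"
    by unfold_locales (use L nu alpha T lag_ok[OF assms] in auto)
  show ?thesis
  proof (rule linear_existence[OF u0 f])
    fix u C
    assume "cmodes u" "\<And>t. solen L (u t)" "hsol L \<nu> T u0 (NF L T f (lag z) u) u"
      "(\<integral>\<^sup>+r\<in>{0..T}. Esq L (1 + \<alpha>) (u r) \<partial>lborel) < \<infinity>"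
      "(\<integral>\<^sup>+r\<in>{0..T}. Esq L (\<alpha> - 1) (NF L T f (lag z) u r) \<partial>lborel) < \<infinity>"
    then show "\<exists>y. step_sol (lag z) y" unfolding step_sol_def by blast
  qed
qed

text \<open>The delay intervals are handled by an iteration on all of [0, T]: each step solves the
  linear problem with the previous function, delayed, as drift. After n + 1 steps the result is
  final up to time (n + 1) \<mu>, so after finitely many steps it is its own predecessor, and pieces
  never have to be glued.\<close>

lemma delay_existence:
  obtains u where "cmodes u" "\<And>t. solen L (u t)" "\<And>t. t \<in> {- \<mu>..<0} \<Longrightarrow> u t = \<Phi> t"
    "(\<integral>\<^sup>+t\<in>{- \<mu>..T}. Esq L (1 + \<alpha>) (u t) \<partial>lborel) < \<infinity>"
    "hsol L \<nu> T u0 (NF L T f (\<lambda>r. u (r - \<mu>)) u) u"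
    "(\<integral>\<^sup>+r\<in>{0..T}. Esq L (\<alpha> - 1) (NF L T f (\<lambda>r. u (r - \<mu>)) u r) \<partial>lborel) < \<infinity>"
proof -
  define U where "U = rec_nat (\<lambda>t k. 0) (\<lambda>n z. SOME y. step_sol (lag z) y)"
  have U0: "U 0 = (\<lambda>t k. 0)" and US: "U (Suc n) = (SOME y. step_sol (lag (U n)) y)" for n by (simp_all add: U_def)
  have ok0: "hist_ok (U 0)" by (simp add: U0 hist_ok_def cmodes_def)
  have stp: "step_sol (lag (U n)) (U (Suc n))" if "hist_ok (U n)" for n
    unfolding US by (rule someI_ex[OF step_exists[OF that]])
  have ok: "hist_ok (U n)" for n
  proof (induction n)
    case (Suc n)
    then show ?case using stp[of n] by (simp add: step_sol_def hist_ok_def)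
  qed (rule ok0)
  note st = stp[OF ok]
  have agree: "\<forall>t\<in>{0..T}. t \<le> real (Suc n) * \<mu> \<longrightarrow> U (Suc n) t = U (Suc (Suc n)) t" for n
  proof (induction n)
    case 0
    show ?case
    proof (intro ballI impI)
      fix t assume t: "t \<in> {0..T}" "t \<le> real (Suc 0) * \<mu>"
      show "U (Suc 0) t = U (Suc (Suc 0)) t"
      proof (rule causal_uniqueness[OF L nu alpha, where ?t1.0 = "min T \<mu>" and T = T and ?v1.0 = "lag (U 0)" and ?v2.0 = "lag (U (Suc 0))"])
        \<comment> \<open>Before time \<mu> both drifts are the history. At r = \<mu> they may
          differ, since one takes the value of the start function and the other one the initial
          value, but this is a single point.\<close>
        show "AE r in lborel. r \<in> {0..min T \<mu>} \<longrightarrow> lag (U 0) r = lag (U (Suc 0)) r"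
          using AE_lborel_singleton[of \<mu>] by eventually_elim (auto simp: lag_def hist_def)
      qed (use t T mu st[of 0] st[of "Suc 0"] lag_ok[OF ok] in \<open>auto simp: step_sol_def\<close>)
    qed
  next
    case (Suc n)
    show ?case
    proof (intro ballI impI)
      fix t assume t: "t \<in> {0..T}" "t \<le> real (Suc (Suc n)) * \<mu>"
      let ?t1 = "min T (real (Suc (Suc n)) * \<mu>)"
      show "U (Suc (Suc n)) t = U (Suc (Suc (Suc n))) t"
      proof (rule causal_uniqueness[OF L nu alpha, where ?t1.0 = ?t1 and T = T and ?v1.0 = "lag (U (Suc n))" and ?v2.0 = "lag (U (Suc (Suc n)))"])
        have "lag (U (Suc n)) r = lag (U (Suc (Suc n))) r" if "r \<in> {0..?t1}" for r
        proof -
          \<comment> \<open>The delay moves r back into the range of the induction hypothesis;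
            negative times fall into the common history.\<close>
          have "r - \<mu> \<le> real (Suc n) * \<mu>" using that by (simp add: algebra_simps)
          then show ?thesis using Suc by (auto simp: lag_def hist_def)
        qed
        then show "AE r in lborel. r \<in> {0..?t1} \<longrightarrow> lag (U (Suc n)) r = lag (U (Suc (Suc n))) r" by auto
      qed (use t T mu st[of "Suc n"] st[of "Suc (Suc n)"] lag_ok[OF ok] in \<open>auto simp: step_sol_def\<close>)
    qed
  qed
  \<comment> \<open>For this n the agreement covers [0, T], so \<open>z\<close> coincides there with
    the function whose delay is its drift.\<close>
  obtain n where n: "T / \<mu> \<le> real n" using real_arch_simple by blast
  define z where "z = U (Suc (Suc n))"
  have Tn: "T \<le> real (Suc n) * \<mu>"
  proof -
    have "T \<le> real n * \<mu>" using n mu by (simp add: pos_divide_le_eq)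
    also have "\<dots> \<le> real (Suc n) * \<mu>" using mu by (intro mult_right_mono) auto
    finally show ?thesis .
  qed
  have zz: "U (Suc n) t = z t" if "t \<in> {0..T}" for t using agree[of n] that Tn by (auto simp: z_def)
  have lz: "lag (U (Suc n)) r = hist z (r - \<mu>)" for r
    using zz by (auto simp: lag_def hist_def)
  have z: "step_sol (lag (U (Suc n))) z" using st[of "Suc n"] by (simp add: z_def)
  have zc: "cmodes z" "\<And>t. solen L (z t)" "(\<integral>\<^sup>+t\<in>{0..T}. Esq L (1 + \<alpha>) (z t) \<partial>lborel) < \<infinity>"
    using z by (auto simp: step_sol_def)
  have NFeq: "NF L T f (lag (U (Suc n))) z r = NF L T f (\<lambda>r. hist z (r - \<mu>)) (hist z) r" for r
  proof (cases "r \<in> {0..T}")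
    case True
    then have "hist z r = z r" by (simp add: hist_def)
    then show ?thesis by (simp only: NF_def lz)
  qed (simp only: NF_def if_False)
  then have NFeq': "NF L T f (lag (U (Suc n))) z = NF L T f (\<lambda>r. hist z (r - \<mu>)) (hist z)" by (rule ext)
  have hm: "cmodes (NF L T f (\<lambda>r. hist z (r - \<mu>)) (hist z))"
    by (intro cmodes_NF cmodes_shift cmodes_hist zc)
  have hz: "hsol L \<nu> T u0 (NF L T f (\<lambda>r. hist z (r - \<mu>)) (hist z)) z"
    "(\<integral>\<^sup>+r\<in>{0..T}. Esq L (\<alpha> - 1) (NF L T f (\<lambda>r. hist z (r - \<mu>)) (hist z) r) \<partial>lborel) < \<infinity>"
    using z unfolding step_sol_def NFeq' by blast+
  have "hsol L \<nu> T u0 (NF L T f (\<lambda>r. hist z (r - \<mu>)) (hist z)) (hist z)"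
    by (rule hsol_cong_AE[OF hz(1) hm hm cmodes_hist[OF zc(1)] _ _ zc(1)]) (auto simp: hist_def)
  moreover have "hist z t = \<Phi> t" if "t \<in> {- \<mu>..<0}" for t using that by (simp only: hist_def if_True)
  ultimately show ?thesis
    using that[OF cmodes_hist[OF zc(1)] solen_hist[OF zc(2)] _ hist_fin[OF zc(1,3)] _ hz(2)] by blast
qed

end


text \<open>Of a weak solution and its drift only square integrability in time is known, so the
  product is no better than integrable in time. For a single mode this already suffices to write
  down the integral equation.\<close>

lemma Bc_mode_integrable:
  assumes L: "L > 0" and s: "s \<ge> 0" and v: "cmodes v" "\<And>r. v r 0 = 0" "(\<integral>\<^sup>+r\<in>{0..T}. Esq L s (v r) \<partial>lborel) < \<infinity>"
    and u: "cmodes u" "\<And>r. u r 0 = 0" "(\<integral>\<^sup>+r\<in>{0..T}. Esq L s (u r) \<partial>lborel) < \<infinity>"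
  shows "set_integrable lborel {0..T} (\<lambda>r. Bc L (v r) (u r) k)"
  unfolding set_integrable_def
proof (rule integrableI_bounded)
  have [measurable]: "(\<lambda>r. Bc L (v r) (u r) k) \<in> borel_measurable borel"
    using cmodes_Bc[OF v(1) u(1)] by (rule cmodesD)
  have [measurable]: "(\<lambda>r. Esq L s (v r)) \<in> borel_measurable borel" "(\<lambda>r. Esq L s (u r)) \<in> borel_measurable borel"
    using v u by (auto intro: cmodes_Esq)
  show "(\<lambda>r. indicator {0..T} r *\<^sub>R Bc L (v r) (u r) k) \<in> borel_measurable lborel" by measurable
  let ?c = "ennreal (2 * norm (freq L k)) * ennreal ((wt_const L 0 s)\<^sup>2)"
  have "(\<integral>\<^sup>+r. ennreal (norm (indicator {0..T} r *\<^sub>R Bc L (v r) (u r) k)) \<partial>lborel)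
      \<le> (\<integral>\<^sup>+r. ?c * (Esq L s (v r) * indicator {0..T} r + Esq L s (u r) * indicator {0..T} r) \<partial>lborel)"
  proof (intro nn_integral_mono)
    fix r
    have "ennreal (norm (Bc L (v r) (u r) k)) \<le> ennreal (2 * norm (freq L k)) * (Esq L 0 (v r) + Esq L 0 (u r))"
      by (rule Bc_mode_le[where u = "v r" and v = "u r", OF L v(2) u(2)])
    also have "\<dots> \<le> ennreal (2 * norm (freq L k)) * (ennreal ((wt_const L 0 s)\<^sup>2) * Esq L s (v r) + ennreal ((wt_const L 0 s)\<^sup>2) * Esq L s (u r))"
      by (intro mult_left_mono add_mono Esq_mono_exp L s) auto
    also have "\<dots> = ?c * (Esq L s (v r) + Esq L s (u r))" by (simp add: distrib_left mult.assoc)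
    finally show "ennreal (norm (indicator {0..T} r *\<^sub>R Bc L (v r) (u r) k))
        \<le> ?c * (Esq L s (v r) * indicator {0..T} r + Esq L s (u r) * indicator {0..T} r)"
      by (auto simp: indicator_def)
  qed
  also have "\<dots> = ?c * ((\<integral>\<^sup>+r\<in>{0..T}. Esq L s (v r) \<partial>lborel) + (\<integral>\<^sup>+r\<in>{0..T}. Esq L s (u r) \<partial>lborel))"
    by (simp add: nn_integral_cmult nn_integral_add)
  also have "\<dots> < \<infinity>" using v(3) u(3) by (simp add: ennreal_mult_less_top)
  finally show "(\<integral>\<^sup>+r. ennreal (norm (indicator {0..T} r *\<^sub>R Bc L (v r) (u r) k)) \<partial>lborel) < \<infinity>" .
qed

section \<open>From the weak formulation to the equation of each mode\<close>

lemma C_V_mode_continuous: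
  assumes L: "L > 0" and u: "u \<in> C_V L s a b"
  shows "continuous_on {a..b} (\<lambda>t. u t k)"
  unfolding continuous_on_def
proof
  fix t assume t: "t \<in> {a..b}"
  have V: "u r \<in> Vspace L s" if "r \<in> {a..b}" for r using u that by (simp add: C_V_def)
  have lim: "((\<lambda>r. Vdist L s (u r) (u t)) \<longlongrightarrow> 0) (at t within {a..b})" using u t by (simp add: C_V_def)
  show "((\<lambda>t. u t k) \<longlongrightarrow> u t k) (at t within {a..b})"
    unfolding tendsto_at_iff_sequentially o_def
  proof (intro allI impI)
    fix X assume X: "\<forall>i. X i \<in> {a..b} - {t}" "X \<longlonglongrightarrow> t"
    then have "(\<lambda>i. Vdist L s (u (X i)) (u t)) \<longlonglongrightarrow> 0"
      using lim unfolding tendsto_at_iff_sequentially o_def by blast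
    then show "(\<lambda>i. u (X i) k) \<longlonglongrightarrow> u t k"
      using X(1) by (intro Vdist_mode_tendsto[OF L V V[OF t]]) auto
  qed
qed

lemma prim_cmult: "prim (\<lambda>r. c * g r) t = c * prim g t" for c :: real
  unfolding prim_def by (rule set_integral_mult_right)

context delay
begin

text \<open>Test fields supported on one pair of frequencies turn the weak formulation into a scalar
  identity in time, and the lemma of du Bois-Reymond integrates it. The continuous representative
  may live in any V^\<sigma>: only the continuity of its modes and its value at 0 are used.\<close>

lemma weak_solution_hsol:
  assumes x: "cmodes x" "\<And>t. solen L (x t)" "(\<integral>\<^sup>+t\<in>{- \<mu>..T}. Esq L (1 + \<alpha>) (x t) \<partial>lborel) < \<infinity>"
    and wx: "AE t in lborel. t \<in> {- \<mu>..T} \<longrightarrow> w t = x t"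
    and u': "u' \<in> C_V L \<sigma> 0 T" "AE t in lborel. t \<in> {0..T} \<longrightarrow> u' t = w t" "u' 0 = u0"
    and weak: "\<And>v \<psi>. v \<in> Vspace L (\<alpha> + 1) \<Longrightarrow> \<psi> \<in> test_functions T \<Longrightarrow>
        - (LINT r|lebesgue_on {0..T}. pairing L (w r) v * deriv \<psi> r)
        + \<nu> * (LINT r|lebesgue_on {0..T}. pairing L (stokes_pow L (1/2) (w r)) (stokes_pow L (1/2) v) * \<psi> r)
        + (LINT r|lebesgue_on {0..T}. pairing L (B_op L (1 + \<alpha>) \<alpha> (1 + \<alpha>) (w (r - \<mu>)) (w r)) v * \<psi> r)
        = (LINT r|lebesgue_on {0..T}. pairing L f v * \<psi> r)"
  obtains y where "cmodes y" "\<And>t. solen L (y t)" "(\<integral>\<^sup>+t\<in>{0..T}. Esq L (1 + \<alpha>) (y t) \<partial>lborel) < \<infinity>"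
    "AE t in lborel. t \<in> {0..T} \<longrightarrow> y t = x t" "hsol L \<nu> T u0 (NF L T f (\<lambda>r. x (r - \<mu>)) y) y"
proof -
  define v where "v r = x (r - \<mu>)" for r
  \<comment> \<open>The continuous representative is used instead of w, because the integral
    equation is to hold at every time. Cutting it off to [0, T] makes the modes Borel on the
    line.\<close>
  define y where "y t = (\<lambda>k. indicator {0..T} t *\<^sub>R u' t k)" for t
  have u'V: "u' t \<in> Vspace L \<sigma>" if "t \<in> {0..T}" for t using u'(1) that by (simp add: C_V_def)
  have yu: "y t = u' t" if "t \<in> {0..T}" for t using that by (simp add: y_def)
  have y_modes: "cmodes y"
    unfolding cmodes_def y_def
  proof
    fix k
    show "(\<lambda>t. indicator {0..T} t *\<^sub>R u' t k) \<in> borel_measurable borel"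
      by (rule borel_measurable_continuous_on_indicator) (auto intro: C_V_mode_continuous[OF L u'(1)])
  qed
  have y_cont: "continuous_on {0..T} (\<lambda>t. y t k)" for k
    by (rule continuous_on_eq[OF C_V_mode_continuous[OF L u'(1)]]) (simp add: yu)
  have y_sol: "solen L (y t)" for t
  proof (cases "t \<in> {0..T}")
    case True
    then show ?thesis using u'V[of t] by (simp add: yu Vspace_iff)
  next
    case False
    then have "y t = (\<lambda>k. 0)" by (simp add: y_def)
    then show ?thesis by simp
  qed
  have v: "cmodes v" "\<And>r. solen L (v r)" "(\<integral>\<^sup>+r\<in>{0..T}. Esq L (1 + \<alpha>) (v r) \<partial>lborel) < \<infinity>"
    unfolding v_def using cmodes_shift[OF x(1)] x(2) shift_fin[OF x(1,3)] by auto
  have yx: "AE t in lborel. t \<in> {0..T} \<longrightarrow> y t = x t"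
    using u'(2) wx by eventually_elim (use mu in \<open>auto simp: yu\<close>)
  have wy: "AE t in lborel. t \<in> {0..T} \<longrightarrow> w t = y t"
    using u'(2) by eventually_elim (auto simp: yu)
  have wv: "AE r in lborel. r \<in> {0..T} \<longrightarrow> w (r - \<mu>) = v r"
    using AE_shift[OF wx, of \<mu>] by eventually_elim (use mu in \<open>auto simp: v_def\<close>)
  have y_fin: "(\<integral>\<^sup>+t\<in>{0..T}. Esq L (1 + \<alpha>) (y t) \<partial>lborel) < \<infinity>"
  proof -
    have "(\<integral>\<^sup>+t\<in>{0..T}. Esq L (1 + \<alpha>) (y t) \<partial>lborel) = (\<integral>\<^sup>+t\<in>{0..T}. Esq L (1 + \<alpha>) (x t) \<partial>lborel)"
    proof (rule nn_integral_cong_AE)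
      show "AE t in lborel. Esq L (1 + \<alpha>) (y t) * indicator {0..T} t = Esq L (1 + \<alpha>) (x t) * indicator {0..T} t"
        using yx by eventually_elim (auto simp: indicator_def)
    qed
    also have "\<dots> \<le> (\<integral>\<^sup>+t\<in>{- \<mu>..T}. Esq L (1 + \<alpha>) (x t) \<partial>lborel)"
      using mu by (intro set_nn_integral_mono_set) auto
    finally show ?thesis using x(3) by (rule le_less_trans)
  qed
  have y0: "y r 0 = 0" and v0: "v r 0 = 0" for r using y_sol v(2) by (auto simp: solenD(1)[where L = L])
  have BB: "AE r in lborel. r \<in> {0..T} \<longrightarrow> B_op L (1 + \<alpha>) \<alpha> (1 + \<alpha>) (w (r - \<mu>)) (w r) = Bc L (v r) (y r)"
    using wv wy Vspace_AE[OF v] Vspace_AE[OF y_modes y_sol y_fin]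
    by eventually_elim (use B_op_eq[OF L alpha] in auto)
  define F where "F = NF L T f v y"
  have Bint: "set_integrable lborel {0..T} (\<lambda>r. Bc L (v r) (y r) k)" for k
    by (rule Bc_mode_integrable[OF L _ v(1) v0 v(3) y_modes y0 y_fin]) (use alpha in simp)
  have Fint: "set_integrable lborel {0..T} (\<lambda>r. F r k)" for k
  proof -
    have "set_integrable lborel {0..T} (\<lambda>r. f k - Bc L (v r) (y r) k)"
      by (intro set_integral_diff(1) Bint set_integrable_continuous continuous_intros)
    moreover have "indicator {0..T} r *\<^sub>R (f k - Bc L (v r) (y r) k) = indicator {0..T} r *\<^sub>R F r k" for r
      by (simp add: F_def NF_def indicator_def)
    ultimately show ?thesis unfolding set_integrable_def by (simp only:)
  qed
  have F_modes: "cmodes F" unfolding F_def by (rule cmodes_NF[OF v(1) y_modes])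
  have f_sol: "solen L f" using f by (simp add: Vspace_iff)
  have F_sol: "solen L (F r)" for r unfolding F_def by (rule solen_NF[OF f_sol v(2) y_sol])
  have Gint: "set_integrable lborel {0..T} (\<lambda>r. F r k - (\<nu> * wt L 2 k) *\<^sub>R y r k)" for k
    by (intro set_integral_diff(1) Fint set_integrable_continuous continuous_intros y_cont)
  have eqn: "y t m = u0 m + prim (\<lambda>r. F r m - (\<nu> * wt L 2 m) *\<^sub>R y r m) t" if t: "t \<in> {0..T}" for t m
  proof (cases "m = 0")
    case True
    have "u0 0 = 0" using u0 by (simp add: Vspace_def)
    then show ?thesis using True y0 solenD(1)[OF F_sol] by (simp add: prim_def)
  next
    case False
    let ?l = "\<nu> * wt L 2 m"
    define I where "I t = prim (\<lambda>r. F r m - ?l *\<^sub>R y r m) t" for t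
    have Gt: "set_integrable lborel {0..t} (\<lambda>r. F r m - ?l *\<^sub>R y r m)"
      using t by (intro set_integrable_Icc_mono[OF Gint]) auto
    \<comment> \<open>Only amplitudes orthogonal to the frequency of m give divergence-free test
      fields, so at first the equation is known against such a alone.\<close>
    have key: "(y t m - I t) \<bullet> a = u0 m \<bullet> a" if a: "zdot (freq L m) a = 0" for a
    proof -
      have [measurable]: "(\<lambda>r. y r m) \<in> borel_measurable borel" "(\<lambda>r. Bc L (v r) (y r) m) \<in> borel_measurable borel"
        using cmodesD[OF y_modes] cmodesD[OF cmodes_Bc[OF v(1) y_modes]] by auto
      have lin: "bounded_linear (\<lambda>z. z \<bullet> a)" by (rule bounded_linear_inner_left)
      have Ga: "set_integrable lborel {0..T} (\<lambda>r. (F r m - ?l *\<^sub>R y r m) \<bullet> a)"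
        by (rule prim_linear(2)[OF lin Gint])
      have Ia: "prim (\<lambda>r. (F r m - ?l *\<^sub>R y r m) \<bullet> a) s = I s \<bullet> a" if "s \<in> {0..T}" for s
        unfolding I_def using that by (intro prim_linear(1)[OF lin] set_integrable_Icc_mono[OF Gint]) auto
      \<comment> \<open>The defect of the integral equation against a. The weak formulation says
        that its distributional derivative vanishes, and its value at 0 is that of the initial
        datum.\<close>
      define g where "g s = y s m \<bullet> a - prim (\<lambda>r. (F r m - ?l *\<^sub>R y r m) \<bullet> a) s" for s
      have gc: "continuous_on {0..T} g"
        unfolding g_def by (intro continuous_intros y_cont continuous_on_prim Ga)
      have "g t = g 0"
      proof (rule du_Bois_Reymond[OF T gc _ t])
        fix \<psi> assume psi: "\<psi> \<in> test_functions T"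
        note tf = test_functionsD[OF psi]
        have [measurable]: "\<psi> \<in> borel_measurable borel" "deriv \<psi> \<in> borel_measurable borel"
          using tf(2,3) by (auto intro: borel_measurable_continuous_onI)
        have cT: "continuous_on {0..T} \<psi>" "continuous_on {0..T} (deriv \<psi>)"
          using tf(2,3) by (auto intro: continuous_on_subset)
        \<comment> \<open>The common factor that \<open>pairing_mode\<close> produces in all four
          terms; it is divided out below.\<close>
        define K where "K = 2 * L ^ 3"
        have K: "K > 0" using L by (simp add: K_def)
        have mV: "mode m a \<in> Vspace L (\<alpha> + 1)" by (intro trig_in_Vspace mode_trig False a)
        have t1: "(LINT r|lebesgue_on {0..T}. pairing L (w r) (mode m a) * deriv \<psi> r) = prim (\<lambda>r. K * ((y r m \<bullet> a) * deriv \<psi> r)) T"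
        proof (rule LINT_prim)
          show "AE r in lborel. r \<in> {0..T} \<longrightarrow> pairing L (w r) (mode m a) * deriv \<psi> r = K * ((y r m \<bullet> a) * deriv \<psi> r)"
            using wy by eventually_elim (auto simp: pairing_mode[OF y_sol False] K_def)
        qed measurable
        have t2: "(LINT r|lebesgue_on {0..T}. pairing L (stokes_pow L (1/2) (w r)) (stokes_pow L (1/2) (mode m a)) * \<psi> r)
            = prim (\<lambda>r. K * (wt L 2 m * ((y r m \<bullet> a) * \<psi> r))) T"
        proof (rule LINT_prim)
          have p2: "pairing L (\<lambda>k. wt L 2 k *\<^sub>R y r k) (mode m a) = K * (wt L 2 m * (y r m \<bullet> a))" for r
            using pairing_mode[OF solen_scaleR[OF y_sol, of "wt L 2"] False] by (simp add: K_def)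
          show "AE r in lborel. r \<in> {0..T} \<longrightarrow> pairing L (stokes_pow L (1/2) (w r)) (stokes_pow L (1/2) (mode m a)) * \<psi> r
              = K * (wt L 2 m * ((y r m \<bullet> a) * \<psi> r))"
            unfolding pairing_stokes using wy by eventually_elim (auto simp: p2)
        qed measurable
        have t3: "(LINT r|lebesgue_on {0..T}. pairing L (B_op L (1 + \<alpha>) \<alpha> (1 + \<alpha>) (w (r - \<mu>)) (w r)) (mode m a) * \<psi> r)
            = prim (\<lambda>r. K * ((Bc L (v r) (y r) m \<bullet> a) * \<psi> r)) T"
        proof (rule LINT_prim)
          show "AE r in lborel. r \<in> {0..T} \<longrightarrow> pairing L (B_op L (1 + \<alpha>) \<alpha> (1 + \<alpha>) (w (r - \<mu>)) (w r)) (mode m a) * \<psi> r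
              = K * ((Bc L (v r) (y r) m \<bullet> a) * \<psi> r)"
            using BB by eventually_elim (auto simp: pairing_mode[OF solen_Bc[OF v(2) y_sol] False] K_def)
        qed measurable
        have t4: "(LINT r|lebesgue_on {0..T}. pairing L f (mode m a) * \<psi> r) = prim (\<lambda>r. K * ((f m \<bullet> a) * \<psi> r)) T"
          by (rule LINT_prim) (auto simp: pairing_mode[OF f_sol False] K_def)
        define A1 where "A1 = prim (\<lambda>r. (y r m \<bullet> a) * deriv \<psi> r) T"
        define A2 where "A2 = prim (\<lambda>r. (y r m \<bullet> a) * \<psi> r) T"
        define A3 where "A3 = prim (\<lambda>r. (Bc L (v r) (y r) m \<bullet> a) * \<psi> r) T"
        define A4 where "A4 = prim (\<lambda>r. (f m \<bullet> a) * \<psi> r) T"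
        have "K * (- A1 + ?l * A2 + A3 - A4) = 0"
          using weak[OF mV psi] unfolding t1 t2 t3 t4 prim_cmult[of K] prim_cmult[of "wt L 2 m"] A1_def[symmetric] A2_def[symmetric] A3_def[symmetric] A4_def[symmetric]
          by (simp add: algebra_simps)
        then have A: "A1 = ?l * A2 + A3 - A4" using K by simp
        have i2: "set_integrable lborel {0..T} (\<lambda>r. ?l * ((y r m \<bullet> a) * \<psi> r))"
          by (intro set_integrable_continuous continuous_intros y_cont cT)
        have i3: "set_integrable lborel {0..T} (\<lambda>r. (Bc L (v r) (y r) m \<bullet> a) * \<psi> r)"
          using set_integrable_mult_cont[OF prim_linear(2)[OF lin Bint[of m]] cT(1)] by (simp add: mult.commute)
        have i4: "set_integrable lborel {0..T} (\<lambda>r. (f m \<bullet> a) * \<psi> r)"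
          by (intro set_integrable_continuous continuous_intros cT)
        have "prim (\<lambda>r. \<psi> r * ((F r m - ?l *\<^sub>R y r m) \<bullet> a)) T
            = prim (\<lambda>r. (f m \<bullet> a) * \<psi> r - (Bc L (v r) (y r) m \<bullet> a) * \<psi> r - ?l * ((y r m \<bullet> a) * \<psi> r)) T"
          by (rule prim_cong) (simp add: F_def NF_def inner_diff_left algebra_simps)
        also have "\<dots> = A4 - A3 - ?l * A2"
          unfolding prim_diff[OF set_integral_diff(1)[OF i4 i3] i2] prim_diff[OF i4 i3] prim_cmult[of ?l] A2_def A3_def A4_def ..
        finally have B: "prim (\<lambda>r. \<psi> r * ((F r m - ?l *\<^sub>R y r m) \<bullet> a)) T = - A1" using A by simp
        have ps: "\<psi> r = 0 + prim (deriv \<psi>) r" if "r \<in> {0..T}" for r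
          using prim_deriv(1)[OF tf(1,2), of r] that tf(4) by simp
        have TT: "T \<in> {0..T}" using T by simp
        have T0: "T \<ge> 0" using T by simp
        let ?J = "\<lambda>s. prim (\<lambda>r. (F r m - ?l *\<^sub>R y r m) \<bullet> a) s"
        note bp = prim_by_parts[OF bounded_bilinear_mult prim_deriv(2)[OF tf(1,2) T0] Ga ps _ TT, of ?J 0]
        have "prim (\<lambda>r. deriv \<psi> r * ?J r) T = A1"
          using bp(1) prim_add[OF bp(2,3)] tf(5) B by simp
        moreover have "prim (\<lambda>r. deriv \<psi> r *\<^sub>R g r) T = prim (\<lambda>r. (y r m \<bullet> a) * deriv \<psi> r - deriv \<psi> r * ?J r) T"
          by (rule prim_cong) (simp add: g_def algebra_simps)
        moreover have "\<dots> = A1 - prim (\<lambda>r. deriv \<psi> r * ?J r) T"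
          unfolding A1_def
          by (rule prim_diff) (intro set_integrable_continuous continuous_intros y_cont cT continuous_on_prim Ga)+
        ultimately show "prim (\<lambda>r. deriv \<psi> r *\<^sub>R g r) T = 0" by simp
      qed
      moreover have "y 0 m = u0 m" using T u'(3) by (simp add: yu)
      ultimately show ?thesis using Ia[OF t] by (simp add: g_def inner_diff_left)
    qed
    \<comment> \<open>The residual is itself orthogonal to the frequency of m, hence an admissible
      amplitude; testing with it makes its norm 0.\<close>
    define d where "d = y t m - I t - u0 m"
    have zI: "zdot (freq L m) (I t) = 0"
    proof -
      have "zdot (freq L m) (I t) = prim (\<lambda>r. zdot (freq L m) (F r m - ?l *\<^sub>R y r m)) t"
        unfolding I_def by (rule prim_linear(1)[OF bounded_linear_zdot Gt, symmetric])
      then show ?thesis by (simp add: solenD(3)[OF F_sol] solenD(3)[OF y_sol] prim_def)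
    qed
    have "solen L u0" using u0 by (simp add: Vspace_iff)
    then have "zdot (freq L m) d = 0"
      using zI by (simp add: d_def solenD(3)[OF y_sol] solenD(3)[of L u0])
    from key[OF this] have "d \<bullet> d = 0" by (simp add: d_def inner_diff_left)
    then have "d = 0" by simp
    then show ?thesis by (simp add: d_def I_def algebra_simps)
  qed
  have "hsol L \<nu> T u0 (NF L T f (\<lambda>r. x (r - \<mu>)) y) y"
    using Fint Gint eqn unfolding hsol_def F_def v_def[abs_def] by blast
  then show ?thesis using that y_modes y_sol y_fin yx by blast
qed

end


section \<open>Existence, uniqueness and regularity for the delay equation\<close>

theorem theorem4p2:
  fixes L \<mu> T \<nu> \<alpha> :: real
    and \<phi> :: "real \<Rightarrow> coeffs"
    and u0 f :: coeffs
  assumes "L > 0" and "\<mu> > 0" and "T > 0" and "\<nu> > 0" and "\<alpha> > 1/2"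
    and "\<phi> \<in> L2_V L (1 + \<alpha>) (- \<mu>) 0"
    and "u0 \<in> Vspace L \<alpha>"
    and "f \<in> Vspace L (\<alpha> - 1)"
  shows "\<exists>u. weak_solution L \<nu> \<alpha> \<mu> T \<phi> u0 f u \<and>
           (\<forall>w. weak_solution L \<nu> \<alpha> \<mu> T \<phi> u0 f w \<longrightarrow>
                (AE t in lebesgue_on {- \<mu>..T}. w t = u t)) \<and>
           u \<in> C_V L \<alpha> 0 T \<and>
           (\<forall>\<gamma> s. 0 \<le> \<gamma> \<and> \<gamma> \<le> 1/2 \<and> s \<ge> 1 \<longrightarrow>
                u \<in> Linf_V L \<alpha> 0 T \<and>
                u \<in> Hoelder_V \<gamma> L (- s) 0 T \<and>
                (\<exists>g \<in> L2_V L (\<alpha> - 1) 0 T. has_distr_deriv L (\<alpha> - 1) T u g))"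
proof -
  note L = assms(1) and mu = assms(2) and T = assms(3) and nu = assms(4) and alpha = assms(5)
  obtain \<Phi> where hst: "cmodes \<Phi>" "\<And>t. solen L (\<Phi> t)" "(\<integral>\<^sup>+t\<in>{- \<mu>..0}. Esq L (1 + \<alpha>) (\<Phi> t) \<partial>lborel) < \<infinity>"
    "AE t in lborel. t \<in> {- \<mu>..0} \<longrightarrow> \<phi> t = \<Phi> t"
    using L2_VE[OF L assms(6)] by blast
  interpret delay L \<nu> \<alpha> \<mu> T \<Phi> u0 f
    by unfold_locales (use assms hst in auto)
  obtain u where um: "cmodes u" and us: "\<And>t. solen L (u t)" and uP: "\<And>t. t \<in> {- \<mu>..<0} \<Longrightarrow> u t = \<Phi> t"
    and uf: "(\<integral>\<^sup>+t\<in>{- \<mu>..T}. Esq L (1 + \<alpha>) (u t) \<partial>lborel) < \<infinity>"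
    and uh: "hsol L \<nu> T u0 (NF L T f (\<lambda>r. u (r - \<mu>)) u) u"
    and uN: "(\<integral>\<^sup>+r\<in>{0..T}. Esq L (\<alpha> - 1) (NF L T f (\<lambda>r. u (r - \<mu>)) u r) \<partial>lborel) < \<infinity>"
    using delay_existence by blast
  define v where "v r = u (r - \<mu>)" for r
  define F where "F = NF L T f v u"
  have vc: "cmodes v" "\<And>r. solen L (v r)" "(\<integral>\<^sup>+r\<in>{0..T}. Esq L (1 + \<alpha>) (v r) \<partial>lborel) < \<infinity>"
    unfolding v_def using cmodes_shift[OF um] us shift_fin[OF um uf] by auto
  have vv: "(\<lambda>r. u (r - \<mu>)) = v" by (simp add: v_def[abs_def])
  have h: "hsol L \<nu> T u0 F u" and Ff: "(\<integral>\<^sup>+r\<in>{0..T}. Esq L (\<alpha> - 1) (F r) \<partial>lborel) < \<infinity>"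
    using uh uN by (simp_all add: F_def vv)
  have T0: "T \<ge> 0" using T by simp
  have sub: "{0..T} \<subseteq> {- \<mu>..T}" using mu by auto
  have uf0: "(\<integral>\<^sup>+t\<in>{0..T}. Esq L (1 + \<alpha>) (u t) \<partial>lborel) < \<infinity>"
    by (rule le_less_trans[OF set_nn_integral_mono_set[OF sub] uf])
  have u0V: "solen L u0" "Esq L \<alpha> u0 < \<infinity>" and fV: "solen L f" using u0 f by (auto simp: Vspace_iff)
  have F: "cmodes F" "\<And>r. F r 0 = 0"
    unfolding F_def by (rule cmodes_NF[OF vc(1) um]) (rule solenD(1)[OF solen_NF[OF fV vc(2) us]])
  have uC: "u \<in> C_V L \<alpha> 0 T"
    by (rule hsol_C_V[OF L nu T0 h F(1) u0V(2) Ff us])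
  define G where "G = hderiv L \<nu> F u"
  have G: "cmodes G" "(\<integral>\<^sup>+r\<in>{0..T}. Esq L (\<alpha> - 1) (G r) \<partial>lborel) < \<infinity>"
    unfolding G_def using hderiv_fin[OF F(1) um Ff uf0] by auto
  have weak: "weak_solution L \<nu> \<alpha> \<mu> T \<phi> u0 f u"
    unfolding weak_solution_def
  proof (intro conjI ballI)
    show "u \<in> L2_V L (1 + \<alpha>) (- \<mu>) T" by (rule L2_VI[OF L um us uf]) simp
    show "\<exists>u' \<sigma>. u' \<in> C_V L \<sigma> 0 T \<and> (AE t in lebesgue_on {0..T}. u' t = u t) \<and> u' 0 = u0"
      using uC hsol_initial[OF h T0] by (intro exI[of _ u] exI[of _ \<alpha>]) auto
    show "AE t in lebesgue_on {- \<mu>..<0}. u t = \<phi> t"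
      unfolding AE_lebesgue_on_iff[OF atLeastLessThan_borel]
      using hst(4) by eventually_elim (auto simp: uP)
    fix w \<psi> assume w: "w \<in> Vspace L (\<alpha> + 1)" and psi: "\<psi> \<in> test_functions T"
    have [measurable]: "\<psi> \<in> borel_measurable borel"
      by (rule borel_measurable_continuous_onI[OF test_functionsD(3)[OF psi]])
    have Bf: "(\<lambda>r. pairing L (Bc L (v r) (u r)) w * \<psi> r) \<in> borel_measurable borel"
    proof -
      have [measurable]: "(\<lambda>r. pairing L (Bc L (v r) (u r)) w) \<in> borel_measurable borel"
        by (rule pairing_measurable[OF cmodes_Bc[OF vc(1) um]])
      show ?thesis by measurable
    qed
    \<comment> \<open>\<open>B_op\<close> is identified with the Fourier series only at times when
      both arguments are in V^(1+\<alpha>), which is almost every time.\<close>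
    have "AE r in lborel. r \<in> {0..T} \<longrightarrow> B_op L (1 + \<alpha>) \<alpha> (1 + \<alpha>) (u (r - \<mu>)) (u r) = Bc L (v r) (u r)"
      using Vspace_AE[OF vc] Vspace_AE[OF um us uf0]
      by eventually_elim (use B_op_eq[OF L alpha] in \<open>auto simp: v_def\<close>)
    then have ae: "AE r in lborel. r \<in> {0..T} \<longrightarrow> pairing L (B_op L (1 + \<alpha>) \<alpha> (1 + \<alpha>) (u (r - \<mu>)) (u r)) w * \<psi> r = pairing L (Bc L (v r) (u r)) w * \<psi> r"
      by eventually_elim auto
    have "(LINT r|lebesgue_on {0..T}. pairing L (B_op L (1 + \<alpha>) \<alpha> (1 + \<alpha>) (u (r - \<mu>)) (u r)) w * \<psi> r)
        = (LINT r|lebesgue_on {0..T}. pairing L (Bc L (v r) (u r)) w * \<psi> r)"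
      unfolding LINT_prim[OF Bf ae] by (rule LINT_prim[OF Bf, symmetric]) simp
    then show "- (LINT r|lebesgue_on {0..T}. pairing L (u r) w * deriv \<psi> r)
        + \<nu> * (LINT r|lebesgue_on {0..T}. pairing L (stokes_pow L (1/2) (u r)) (stokes_pow L (1/2) w) * \<psi> r)
        + (LINT r|lebesgue_on {0..T}. pairing L (B_op L (1 + \<alpha>) \<alpha> (1 + \<alpha>) (u (r - \<mu>)) (u r)) w * \<psi> r)
        = (LINT r|lebesgue_on {0..T}. pairing L f w * \<psi> r)"
      using weak_identity[OF L T0 _ f vc(1,2) um us h[unfolded F_def] Ff[unfolded F_def] uf0 w psi] alpha by simp
  qed
  have unique: "AE t in lebesgue_on {- \<mu>..T}. w t = u t" if w: "weak_solution L \<nu> \<alpha> \<mu> T \<phi> u0 f w" for w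
  proof -
    have wL2: "w \<in> L2_V L (1 + \<alpha>) (- \<mu>) T" using w unfolding weak_solution_def by (elim conjE)
    obtain x where x: "cmodes x" "\<And>t. solen L (x t)" "(\<integral>\<^sup>+t\<in>{- \<mu>..T}. Esq L (1 + \<alpha>) (x t) \<partial>lborel) < \<infinity>"
      "AE t in lborel. t \<in> {- \<mu>..T} \<longrightarrow> w t = x t"
      using L2_VE[OF L wL2] by blast
    obtain u' \<sigma> where u': "u' \<in> C_V L \<sigma> 0 T" "AE t in lebesgue_on {0..T}. u' t = w t" "u' 0 = u0"
      using w unfolding weak_solution_def by blast
    have ae': "AE t in lborel. t \<in> {0..T} \<longrightarrow> u' t = w t"
      using u'(2) by (subst (asm) AE_lebesgue_on_iff) auto
    have wP: "AE t in lborel. t \<in> {- \<mu>..<0} \<longrightarrow> w t = \<phi> t"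
      using w unfolding weak_solution_def by (subst (asm) AE_lebesgue_on_iff[OF atLeastLessThan_borel]) blast
    have weakw: "- (LINT r|lebesgue_on {0..T}. pairing L (w r) v * deriv \<psi> r)
        + \<nu> * (LINT r|lebesgue_on {0..T}. pairing L (stokes_pow L (1/2) (w r)) (stokes_pow L (1/2) v) * \<psi> r)
        + (LINT r|lebesgue_on {0..T}. pairing L (B_op L (1 + \<alpha>) \<alpha> (1 + \<alpha>) (w (r - \<mu>)) (w r)) v * \<psi> r)
        = (LINT r|lebesgue_on {0..T}. pairing L f v * \<psi> r)"
      if "v \<in> Vspace L (\<alpha> + 1)" "\<psi> \<in> test_functions T" for v \<psi>
      using w that unfolding weak_solution_def by blast
    obtain y where y: "cmodes y" "\<And>t. solen L (y t)" "(\<integral>\<^sup>+t\<in>{0..T}. Esq L (1 + \<alpha>) (y t) \<partial>lborel) < \<infinity>"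
      and yx: "AE t in lborel. t \<in> {0..T} \<longrightarrow> y t = x t" and yh: "hsol L \<nu> T u0 (NF L T f (\<lambda>r. x (r - \<mu>)) y) y"
      using weak_solution_hsol[OF x u'(1) ae' u'(3) weakw] by blast
    have past: "AE t in lborel. t \<in> {- \<mu>..<0} \<longrightarrow> u t = x t"
      using x(4) wP hst(4) by eventually_elim (use T in \<open>auto simp: uP\<close>)
    have agree: "\<forall>t\<in>{0..T}. t \<le> real n * \<mu> \<longrightarrow> u t = y t" for n
    proof (induction n)
      case 0
      \<comment> \<open>For n = 0 the only time left is t = 0, where both functions take the initial
        value.\<close>
      show ?case using hsol_initial[OF h T0] hsol_initial[OF yh T0] by auto
    next
      case (Suc n)
      show ?case
      proof (intro ballI impI)
        fix t assume t: "t \<in> {0..T}" "t \<le> real (Suc n) * \<mu>"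
        let ?t1 = "min T (real (Suc n) * \<mu>)"
        \<comment> \<open>Up to time n \<mu>, history included, u agrees almost everywhere with x.
          Shifted by the delay, this identifies the two drifts up to (n + 1) \<mu>.\<close>
        have eq: "AE t in lborel. t \<in> {- \<mu>..T} \<and> t \<le> real n * \<mu> \<longrightarrow> u t = x t"
          using past yx by eventually_elim (use Suc in \<open>auto simp: not_le\<close>)
        have "AE r in lborel. r \<in> {0..?t1} \<longrightarrow> v r = x (r - \<mu>)"
          using AE_shift[OF eq, of \<mu>] by eventually_elim (use mu in \<open>auto simp: v_def algebra_simps\<close>)
        then show "u t = y t"
          by (rule causal_uniqueness[OF L nu alpha _ _ vc cmodes_shift[OF x(1)] _ um us uf0 h[unfolded F_def] y yh, rotated 2])
            (use t T mu in auto)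
      qed
    qed
    obtain n where n: "T / \<mu> \<le> real n" using real_arch_simple by blast
    then have "T \<le> real n * \<mu>" using mu by (simp add: pos_divide_le_eq)
    then have uy: "u t = y t" if "t \<in> {0..T}" for t using agree[of n] that by auto
    have "AE t in lborel. t \<in> {- \<mu>..T} \<longrightarrow> w t = u t"
      using x(4) past yx by eventually_elim (use uy in \<open>fastforce simp: not_le\<close>)
    then show ?thesis by (subst AE_lebesgue_on_iff) auto
  qed
  have uLinf: "u \<in> Linf_V L \<alpha> 0 T"
  proof -
    have V: "u t \<in> Vspace L \<alpha>" if "t \<in> {0..T}" for t using uC that by (simp add: C_V_def)
    have sm: "strongly_measurable L \<alpha> 0 T u"
      by (rule strongly_measurableI[OF L um us]) (use V in \<open>auto simp: Vspace_iff\<close>)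
    let ?E = "Esq L \<alpha> u0 + ennreal (1 / \<nu>) * (\<integral>\<^sup>+r\<in>{0..T}. Esq L (\<alpha> - 1) (F r) \<partial>lborel)"
    have E: "?E < \<infinity>" using u0V(2) Ff by (simp add: ennreal_mult_less_top)
    have "Vnorm L \<alpha> (u t) \<le> sqrt (L ^ 3 * enn2real ?E)" if t: "t \<in> {0..T}" for t
    proof -
      have "Esq L \<alpha> (u t) \<le> Esq L \<alpha> u0 + ennreal (1 / \<nu>) * (\<integral>\<^sup>+r\<in>{0..t}. Esq L (\<alpha> - 1) (F r) \<partial>lborel)"
        by (rule order_trans[OF _ heat_energy[OF L nu h t um F(1)]]) simp
      also have "\<dots> \<le> ?E" using t by (intro add_left_mono mult_left_mono set_nn_integral_mono_set) auto
      finally have "enn2real (Esq L \<alpha> (u t)) \<le> enn2real ?E" using E by (intro enn2real_mono) auto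
      then show ?thesis unfolding Vnorm_eq using L by (intro real_sqrt_le_mono mult_left_mono) auto
    qed
    then have "AE t in lebesgue_on {0..T}. Vnorm L \<alpha> (u t) \<le> sqrt (L ^ 3 * enn2real ?E)" by (intro AE_I2) simp
    then show ?thesis using sm unfolding Linf_V_def by blast
  qed
  have uH: "u \<in> Hoelder_V \<gamma> L (- s) 0 T" if "0 \<le> \<gamma>" "\<gamma> \<le> 1/2" "s \<ge> 1" for \<gamma> s
    using alpha by (intro hsol_Hoelder[OF L T0 h G(1)[unfolded G_def] G(2)[unfolded G_def] uC that]) simp
  \<comment> \<open>The witness is F - \<nu> A u. Since u is in L_2(V^(1+\<alpha>)), the Stokes term
    lies in L_2(V^(\<alpha>-1)), the space of the force.\<close>
  have uD: "\<exists>g \<in> L2_V L (\<alpha> - 1) 0 T. has_distr_deriv L (\<alpha> - 1) T u g"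
  proof
    show "has_distr_deriv L (\<alpha> - 1) T u G"
      unfolding G_def by (rule hsol_distr_deriv[OF L T0 h um us F Ff uf0])
    have Gs: "solen L (G r)" for r
      unfolding G_def hderiv_def F_def
      by (intro solen_diff solen_NF fV vc(2) us solen_scaleR) simp
    show "G \<in> L2_V L (\<alpha> - 1) 0 T" by (rule L2_VI[OF L G(1) Gs G(2)]) simp
  qed
  show ?thesis using weak unique uC uLinf uH uD by blast
qed


end
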